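(* Let $\Gamma_1,\Gamma_2$ be subgroups of $SL_2(\mathbb R)$ commensurable with $SL_2(\mathbb Z)$. Let $F(\tau_1,\tau_2)$ be a modular form (of two variables) of weight $(1,1)$ on $\Gamma_1\times\Gamma_2$ (with some character $\chi$), and let $x(\tau_1,\tau_2)$ and $y(\tau_1,\tau_2)$ be non-constant modular functions (of two variables) on $\Gamma_1\times\Gamma_2$. For each function $t\in\{F,x,y\}$ put $$G_{t,1}=\frac{D_{q_1}t}{t}=\frac{1}{2\pi i}\frac{\partial t}{t\,\partial\tau_1},\qquad G_{t,2}=\frac{D_{q_2}t}{t}=\frac{1}{2\pi i}\frac{\partial t}{t\,\partial\tau_2}.$$ Put $N:=G_{x,1}^2G_{y,2}^2-G_{y,1}^2G_{x,2}^2$ and $$a_0=\frac{2G_{y,1}G_{y,2}}{G_{x,1}G_{y,2}+G_{y,1}G_{x,2}},\qquad b_0=\frac{2G_{x,1}G_{x,2}}{G_{x,1}G_{y,2}+G_{y,1}G_{x,2}},$$ $$a_1=\frac{G_{y,2}^2(D_{q_1}G_{x,1}-2G_{F,1}G_{x,1})-G_{y,1}^2(D_{q_2}G_{x,2}-2G_{F,2}G_{x,2})}{N},$$ $$b_1=\frac{-G_{x,2}^2(D_{q_1}G_{x,1}-2G_{F,1}G_{x,1})+G_{x,1}^2(D_{q_2}G_{x,2}-2G_{F,2}G_{x,2})}{N},$$ $$a_2=\frac{G_{y,2}^2(D_{q_1}G_{y,1}-2G_{F,1}G_{y,1})-G_{y,1}^2(D_{q_2}G_{y,2}-2G_{F,2}G_{y,2})}{N},$$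 $$b_2=\frac{-G_{x,2}^2(D_{q_1}G_{y,1}-2G_{F,1}G_{y,1})+G_{x,1}^2(D_{q_2}G_{y,2}-2G_{F,2}G_{y,2})}{N},$$ $$a_3=-\frac{G_{y,2}^2(D_{q_1}G_{F,1}-G_{F,1}^2)-G_{y,1}^2(D_{q_2}G_{F,2}-G_{F,2}^2)}{N},$$ $$b_3=-\frac{-G_{x,2}^2(D_{q_1}G_{F,1}-G_{F,1}^2)+G_{x,1}^2(D_{q_2}G_{F,2}-G_{F,2}^2)}{N}.$$ Then $a_i,b_i$ are algebraic functions of $x$ and $y$, and $F$, regarded as a function of $x$ and $y$, satisfies the system of partial differential equations $$D_x^2F+a_0D_xD_yF+a_1D_xF+a_2D_yF+a_3F=0,\qquad D_y^2F+b_0D_xD_yF+b_1D_xF+b_2D_yF+b_3F=0.$$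
   Context: $\mathbb H=\{\tau:\Im\tau>0\}$ and $\mathbb H^*=\mathbb H\cup\mathbb Q\cup\{\infty\}$. For subgroups $\Gamma_1,\Gamma_2\subset SL_2(\mathbb R)$ commensurable with $SL_2(\mathbb Z)$, a modular form (of two variables) of weight $(k_1,k_2)$ on $\Gamma_1\times\Gamma_2$ with character $\chi$ is a function $F$ meromorphic on $\mathbb H^*\times\mathbb H^*$ such that $F(\gamma_1\tau_1,\gamma_2\tau_2)=\chi(\gamma_1,\gamma_2)(c_1\tau_1+d_1)^{k_1}(c_2\tau_2+d_2)^{k_2}F(\tau_1,\tau_2)$ for all $\gamma_j=\begin{pmatrix}a_j&b_j\\c_j&d_j\end{pmatrix}\in\Gamma_j$. A modular function (of two variables) is a modular form of weight $(0,0)$ with trivial character. Notation: $q_j=e^{2\pi i\tau_j}$, and for a variable $t$, $D_t=t\,\partial/\partial t$ (so $D_{q_j}=\frac{1}{2\pi i}\partial/\partial\tau_j$). *)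

theory Defs
  imports "HOL-Analysis.Analysis" "HOL-Algebra.Coset" "HOL-Computational_Algebra.Polynomial"
begin

definition SL2R :: "(real^2^2) monoid" where
  "SL2R = \<lparr>carrier = {A. det A = 1}, monoid.mult = (**), one = mat 1\<rparr>"

definition SL2Z :: "(real^2^2) set" where
  "SL2Z = {A. det A = 1 \<and> (\<forall>i j. A $ i $ j \<in> \<int>)}"

definition commensurable :: "('a, 'b) monoid_scheme \<Rightarrow> 'a set \<Rightarrow> 'a set \<Rightarrow> bool" where
  "commensurable G H K \<longleftrightarrow>
     finite (rcosets\<^bsub>G\<lparr>carrier := H\<rparr>\<^esub> (H \<inter> K)) \<and> finite (rcosets\<^bsub>G\<lparr>carrier := K\<rparr>\<^esub> (H \<inter> K))"

lemma group_SL2R: "group SL2R"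
proof (rule groupI)
  fix A assume "A \<in> carrier SL2R"
  then have A: "det A = 1" by (simp add: SL2R_def)
  then have "invertible A" by (simp add: invertible_det_nz)
  then obtain B where B: "B ** A = mat 1" by (auto simp: invertible_def)
  have "det B * det A = 1" using B by (metis det_I det_mul)
  then show "\<exists>B\<in>carrier SL2R. B \<otimes>\<^bsub>SL2R\<^esub> A = \<one>\<^bsub>SL2R\<^esub>"
    using B A by (auto simp: SL2R_def)
qed (auto simp: SL2R_def det_mul matrix_mul_assoc)

definition act :: "real^2^2 \<Rightarrow> complex \<Rightarrow> complex" where
  "act A = moebius (of_real (A$1$1)) (of_real (A$1$2)) (of_real (A$2$1)) (of_real (A$2$2))"

definition autfac :: "real^2^2 \<Rightarrow> complex \<Rightarrow> complex" where
  "autfac A t = of_real (A$2$1) * t + of_real (A$2$2)"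

text \<open>Complex Frechet differentiability; only used for open \<open>S\<close>.\<close>

definition holomorphic2_on :: "(complex \<times> complex \<Rightarrow> complex) \<Rightarrow> (complex \<times> complex) set \<Rightarrow> bool" where
  "holomorphic2_on f S \<longleftrightarrow>
     (\<forall>z\<in>S. \<exists>A B. (f has_derivative (\<lambda>w. A * fst w + B * snd w)) (at z within S))"

definition HH :: "(complex \<times> complex) set" where
  "HH = {t. Im (fst t) > 0 \<and> Im (snd t) > 0}"

text \<open>
  A meromorphic function is represented by a total function whose values on the (nowhere dense)
  set of poles, points of indeterminacy and removable singularities are arbitrary. Its values are
  only meaningful at the points of \<open>hol_points\<close>.
\<close>

definition hol_points :: "(complex \<times> complex \<Rightarrow> complex) \<Rightarrow> (complex \<times> complex) set" where
  "hol_points f = {t. \<exists>U. open U \<and> t \<in> U \<and> U \<subseteq> HH \<and> holomorphic2_on f U}"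

text \<open>
  Near the point \<open>p\<close> of the local parameter space, \<open>f\<close> is the pullback under the local
  parameters \<open>\<phi>\<close> of a quotient \<open>g / h\<close> of holomorphic functions; as \<open>V\<close> is connected,
  \<open>h\<close> vanishes identically on no nonempty open subset of \<open>V\<close>.
\<close>

definition merom_near ::
  "(complex \<times> complex \<Rightarrow> complex) \<Rightarrow> (complex \<times> complex \<Rightarrow> complex \<times> complex) \<Rightarrow>
   complex \<times> complex \<Rightarrow> bool" where
  "merom_near f \<phi> p \<longleftrightarrow>
     (\<exists>V g h. open V \<and> connected V \<and> p \<in> V \<and> holomorphic2_on g V \<and> holomorphic2_on h V \<and>
        (\<exists>z\<in>V. h z \<noteq> 0) \<and>
        (\<forall>t\<in>HH. \<phi> t \<in> V \<and> h (\<phi> t) \<noteq> 0 \<longrightarrow> f t = g (\<phi> t) / h (\<phi> t)))"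

definition qexp :: "complex \<Rightarrow> complex" where
  "qexp z = exp (2 * of_real pi * \<i> * z)"

definition slash ::
  "int \<Rightarrow> int \<Rightarrow> real^2^2 \<Rightarrow> real^2^2 \<Rightarrow> (complex \<times> complex \<Rightarrow> complex) \<Rightarrow>
   complex \<times> complex \<Rightarrow> complex" where
  "slash k1 k2 A B F = (\<lambda>(t1, t2).
     autfac A t1 powi (- k1) * autfac B t2 powi (- k2) * F (act A t1, act B t2))"

text \<open>
  Every cusp in \<open>\<rat> \<union> {\<infinity>}\<close> is the image of \<open>\<infinity>\<close> under some matrix of \<open>SL2Z\<close>. There, the weighted
  pullback of \<open>F\<close> is required to be meromorphic in the local parameter \<open>qexp (t / h)\<close>, up to an
  exponential factor \<open>qexp (r * t)\<close>, which is needed because translations may act through a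
  nontrivial (possibly infinite order) character. For trivial character and weight \<open>0\<close> this
  factor can be absorbed into a suitable local parameter.
\<close>

definition meromorphic_HH_star :: "int \<Rightarrow> int \<Rightarrow> (complex \<times> complex \<Rightarrow> complex) \<Rightarrow> bool" where
  "meromorphic_HH_star k1 k2 F \<longleftrightarrow>
     (\<forall>p\<in>HH. merom_near F (\<lambda>t. t) p) \<and>
     (\<forall>s B. Im s > 0 \<longrightarrow> B \<in> SL2Z \<longrightarrow> (\<exists>(h::real) r. h > 0 \<and>
        merom_near (\<lambda>(t1, t2). qexp (- r * t2) * slash k1 k2 (mat 1) B F (t1, t2))
          (\<lambda>(t1, t2). (t1, qexp (t2 / of_real h))) (s, 0))) \<and>
     (\<forall>s A. Im s > 0 \<longrightarrow> A \<in> SL2Z \<longrightarrow> (\<exists>(h::real) r. h > 0 \<and>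
        merom_near (\<lambda>(t1, t2). qexp (- r * t1) * slash k1 k2 A (mat 1) F (t1, t2))
          (\<lambda>(t1, t2). (qexp (t1 / of_real h), t2)) (0, s))) \<and>
     (\<forall>A\<in>SL2Z. \<forall>B\<in>SL2Z. \<exists>(h1::real) (h2::real) r1 r2. h1 > 0 \<and> h2 > 0 \<and>
        merom_near (\<lambda>(t1, t2). qexp (- r1 * t1 - r2 * t2) * slash k1 k2 A B F (t1, t2))
          (\<lambda>(t1, t2). (qexp (t1 / of_real h1), qexp (t2 / of_real h2))) (0, 0))"

definition character_on :: "(real^2^2) set \<Rightarrow> (real^2^2) set \<Rightarrow> (real^2^2 \<Rightarrow> real^2^2 \<Rightarrow> complex) \<Rightarrow> bool"
  where "character_on \<Gamma>1 \<Gamma>2 ch \<longleftrightarrow>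
     (\<forall>A\<in>\<Gamma>1. \<forall>B\<in>\<Gamma>2. ch A B \<noteq> 0) \<and>
     (\<forall>A\<in>\<Gamma>1. \<forall>A'\<in>\<Gamma>1. \<forall>B\<in>\<Gamma>2. \<forall>B'\<in>\<Gamma>2. ch (A ** A') (B ** B') = ch A B * ch A' B')"

text \<open>
  The transformation law is an identity of meromorphic functions, so it is required at the points
  where both sides are holomorphic.
\<close>

definition modular_form2 ::
  "(real^2^2) set \<Rightarrow> (real^2^2) set \<Rightarrow> int \<Rightarrow> int \<Rightarrow> (real^2^2 \<Rightarrow> real^2^2 \<Rightarrow> complex) \<Rightarrow>
   (complex \<times> complex \<Rightarrow> complex) \<Rightarrow> bool" where
  "modular_form2 \<Gamma>1 \<Gamma>2 k1 k2 ch F \<longleftrightarrow>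
     character_on \<Gamma>1 \<Gamma>2 ch \<and> meromorphic_HH_star k1 k2 F \<and>
     (\<forall>A\<in>\<Gamma>1. \<forall>B\<in>\<Gamma>2. \<forall>t1 t2.
        (t1, t2) \<in> hol_points F \<longrightarrow> (act A t1, act B t2) \<in> hol_points F \<longrightarrow>
        F (act A t1, act B t2) =
          ch A B * autfac A t1 powi k1 * autfac B t2 powi k2 * F (t1, t2))"

definition modular_function2 ::
  "(real^2^2) set \<Rightarrow> (real^2^2) set \<Rightarrow> (complex \<times> complex \<Rightarrow> complex) \<Rightarrow> bool" where
  "modular_function2 \<Gamma>1 \<Gamma>2 f \<longleftrightarrow> modular_form2 \<Gamma>1 \<Gamma>2 0 0 (\<lambda>_ _. 1) f"

definition nonconstant :: "(complex \<times> complex \<Rightarrow> complex) \<Rightarrow> bool" where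
  "nonconstant f \<longleftrightarrow> \<not> (\<exists>c. \<forall>t\<in>hol_points f. f t = c)"

definition Dq1 :: "(complex \<times> complex \<Rightarrow> complex) \<Rightarrow> complex \<times> complex \<Rightarrow> complex" where
  "Dq1 f = (\<lambda>(t1, t2). 1 / (2 * of_real pi * \<i>) * deriv (\<lambda>s. f (s, t2)) t1)"

definition Dq2 :: "(complex \<times> complex \<Rightarrow> complex) \<Rightarrow> complex \<times> complex \<Rightarrow> complex" where
  "Dq2 f = (\<lambda>(t1, t2). 1 / (2 * of_real pi * \<i>) * deriv (\<lambda>s. f (t1, s)) t2)"

definition G1 :: "(complex \<times> complex \<Rightarrow> complex) \<Rightarrow> complex \<times> complex \<Rightarrow> complex" where
  "G1 f t = Dq1 f t / f t"

definition G2 :: "(complex \<times> complex \<Rightarrow> complex) \<Rightarrow> complex \<times> complex \<Rightarrow> complex" where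
  "G2 f t = Dq2 f t / f t"

definition Dx :: "(complex \<times> complex \<Rightarrow> complex) \<Rightarrow> complex \<times> complex \<Rightarrow> complex" where
  "Dx \<Phi> = (\<lambda>(u, v). u * deriv (\<lambda>s. \<Phi> (s, v)) u)"

definition Dy :: "(complex \<times> complex \<Rightarrow> complex) \<Rightarrow> complex \<times> complex \<Rightarrow> complex" where
  "Dy \<Phi> = (\<lambda>(u, v). v * deriv (\<lambda>s. \<Phi> (u, s)) v)"

context
  fixes F x y :: "complex \<times> complex \<Rightarrow> complex"
begin

definition coeff_N :: "complex \<times> complex \<Rightarrow> complex" where
  "coeff_N t = (G1 x t)^2 * (G2 y t)^2 - (G1 y t)^2 * (G2 x t)^2"

definition coeff_a0 :: "complex \<times> complex \<Rightarrow> complex" where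
  "coeff_a0 t = 2 * G1 y t * G2 y t / (G1 x t * G2 y t + G1 y t * G2 x t)"

definition coeff_b0 :: "complex \<times> complex \<Rightarrow> complex" where
  "coeff_b0 t = 2 * G1 x t * G2 x t / (G1 x t * G2 y t + G1 y t * G2 x t)"

definition coeff_a1 :: "complex \<times> complex \<Rightarrow> complex" where
  "coeff_a1 t =
     ((G2 y t)^2 * (Dq1 (G1 x) t - 2 * G1 F t * G1 x t)
      - (G1 y t)^2 * (Dq2 (G2 x) t - 2 * G2 F t * G2 x t)) / coeff_N t"

definition coeff_b1 :: "complex \<times> complex \<Rightarrow> complex" where
  "coeff_b1 t =
     (- ((G2 x t)^2) * (Dq1 (G1 x) t - 2 * G1 F t * G1 x t)
      + (G1 x t)^2 * (Dq2 (G2 x) t - 2 * G2 F t * G2 x t)) / coeff_N t"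

definition coeff_a2 :: "complex \<times> complex \<Rightarrow> complex" where
  "coeff_a2 t =
     ((G2 y t)^2 * (Dq1 (G1 y) t - 2 * G1 F t * G1 y t)
      - (G1 y t)^2 * (Dq2 (G2 y) t - 2 * G2 F t * G2 y t)) / coeff_N t"

definition coeff_b2 :: "complex \<times> complex \<Rightarrow> complex" where
  "coeff_b2 t =
     (- ((G2 x t)^2) * (Dq1 (G1 y) t - 2 * G1 F t * G1 y t)
      + (G1 x t)^2 * (Dq2 (G2 y) t - 2 * G2 F t * G2 y t)) / coeff_N t"

definition coeff_a3 :: "complex \<times> complex \<Rightarrow> complex" where
  "coeff_a3 t =
     - (((G2 y t)^2 * (Dq1 (G1 F) t - (G1 F t)^2)
         - (G1 y t)^2 * (Dq2 (G2 F) t - (G2 F t)^2)) / coeff_N t)"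

definition coeff_b3 :: "complex \<times> complex \<Rightarrow> complex" where
  "coeff_b3 t =
     - ((- ((G2 x t)^2) * (Dq1 (G1 F) t - (G1 F t)^2)
         + (G1 x t)^2 * (Dq2 (G2 F) t - (G2 F t)^2)) / coeff_N t)"

text \<open>
  The points where all the expressions above are defined. The condition on \<open>coeff_N\<close> also gives
  nonvanishing of the denominator of \<open>coeff_a0\<close> and \<open>coeff_b0\<close>, and of the Jacobian of \<open>(x, y)\<close>.
\<close>

definition regular_domain :: "(complex \<times> complex) set" where
  "regular_domain = {t \<in> hol_points F \<inter> hol_points x \<inter> hol_points y.
     F t \<noteq> 0 \<and> x t \<noteq> 0 \<and> y t \<noteq> 0 \<and> coeff_N t \<noteq> 0}"

end

text \<open>
  A polynomial \<open>P\<close> in \<open>T\<close> with coefficients in \<open>\<complex>[X][Y]\<close> (\<open>X\<close> the innermost variable),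
  specialised at \<open>X = u\<close>, \<open>Y = v\<close>.
\<close>

definition specialise :: "complex \<Rightarrow> complex \<Rightarrow> complex poly poly poly \<Rightarrow> complex poly" where
  "specialise u v = map_poly (\<lambda>c. poly (poly c [:v:]) u)"

text \<open>
  The density condition says that \<open>P (x, y, T)\<close> is nonzero as a polynomial in \<open>T\<close> over the field
  generated by the functions \<open>x\<close> and \<open>y\<close>, on every part of \<open>S\<close>.
\<close>

definition algebraic_function_of ::
  "(complex \<times> complex) set \<Rightarrow> (complex \<times> complex \<Rightarrow> complex) \<Rightarrow> (complex \<times> complex \<Rightarrow> complex) \<Rightarrow>
   (complex \<times> complex \<Rightarrow> complex) \<Rightarrow> bool" where
  "algebraic_function_of S x y a \<longleftrightarrow>
     (\<exists>P. (\<forall>t\<in>S. poly (specialise (x t) (y t) P) (a t) = 0) \<and>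
          S \<subseteq> closure {t\<in>S. specialise (x t) (y t) P \<noteq> 0})"

end

theory Submission
  imports Defs "HOL-Complex_Analysis.Complex_Analysis"
begin

text \<open>
  Locally \<open>F = \<Phi> (x, y)\<close>, and the chain rule for the second derivative in each of the two variables
  gives a linear relation between \<open>Dx (Dx \<Phi>)\<close>, \<open>Dx (Dy \<Phi>)\<close>, \<open>Dy (Dy \<Phi>)\<close>, \<open>Dx \<Phi>\<close>, \<open>Dy \<Phi>\<close> and \<open>\<Phi>\<close>.
  Eliminating \<open>Dy (Dy \<Phi>)\<close> or \<open>Dx (Dx \<Phi>)\<close> between the two relations yields the system.

  For the algebraicity of a coefficient \<open>a\<close> no compactification is used. In \<open>a\<close> the character and
  the nonmodular terms of the derivatives cancel, so on a generic slice (one variable fixed) \<open>x\<close>, \<open>y\<close>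
  and \<open>a\<close> are modular functions of one variable, meromorphic at the cusps. A Schwarz lemma in the
  \<open>q\<close>-disc gives \<open>\<delta>\<close> such that a polynomial in \<open>x\<close>, \<open>y\<close>, \<open>a\<close> of degree at most \<open>n\<close> in each of them, with
  more than \<open>n * \<delta>\<close> zeros in a fixed box, vanishes on the slice. As \<open>\<delta>\<close> can be taken uniform for
  uncountably many slices in either direction, a polynomial vanishing on a suitable grid, which
  exists by counting coefficients, is a relation between \<open>x\<close>, \<open>y\<close> and \<open>a\<close>.
\<close>

section \<open>Holomorphic functions of two variables\<close>

text \<open>Weight one is what makes the coefficients modular: in \<open>D G - 2 * G F * G\<close>
  for \<open>x\<close> and \<open>y\<close>, and in \<open>D (G F) - (G F)^2\<close>, the
  inhomogeneous terms of the transformation law carry a factor \<open>k - 1\<close>, where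
  \<open>k\<close> is the weight of \<open>F\<close>. Two obstacles shape the proof of algebraicity.
  Meromorphy is given only locally, by quotients in two variables, so a slice may lie inside a polar
  or zero set. Such slices are countable: a denominator that vanishes along a slice vanishes at one
  chosen point of it, and countably many neighbourhoods suffice. Moreover the number of zeros
  allowed on a slice depends on the slice; but it is \<open>n\<close> times a natural number, and
  one natural number serves uncountably many slices. That the bound is linear in \<open>n\<close> in
  both directions is decisive: a grid imposes about \<open>\<delta>1 * \<delta>2 * n^2\<close>
  conditions on \<open>(n + 1)^3\<close> coefficients. That the relation found is not degenerate
  over the field of \<open>x\<close> and \<open>y\<close> follows from
  \<open>coeff_N \<noteq> 0\<close>, which makes \<open>(x, y)\<close> locally
  biholomorphic.\<close>

definition pd1 :: "(complex \<times> complex \<Rightarrow> complex) \<Rightarrow> complex \<times> complex \<Rightarrow> complex" where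
  "pd1 f = (\<lambda>(t1, t2). deriv (\<lambda>s. f (s, t2)) t1)"

definition pd2 :: "(complex \<times> complex \<Rightarrow> complex) \<Rightarrow> complex \<times> complex \<Rightarrow> complex" where
  "pd2 f = (\<lambda>(t1, t2). deriv (\<lambda>s. f (t1, s)) t2)"

lemma Dq1_eq: "Dq1 f t = pd1 f t / (2 * of_real pi * \<i>)"
  by (simp add: Dq1_def pd1_def split: prod.splits)

lemma Dq2_eq: "Dq2 f t = pd2 f t / (2 * of_real pi * \<i>)"
  by (simp add: Dq2_def pd2_def split: prod.splits)

lemma holomorphic2_on_subset:
  assumes "holomorphic2_on f S" "T \<subseteq> S"
  shows "holomorphic2_on f T"
  unfolding holomorphic2_on_def
proof
  fix z assume "z \<in> T"
  then obtain A B where "(f has_derivative (\<lambda>w. A * fst w + B * snd w)) (at z within S)"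
    using assms unfolding holomorphic2_on_def by blast
  then show "\<exists>A B. (f has_derivative (\<lambda>w. A * fst w + B * snd w)) (at z within T)"
    using has_derivative_subset[OF _ assms(2)] by blast
qed

lemma holomorphic2_on_open:
  assumes "open S"
  shows "holomorphic2_on f S \<longleftrightarrow>
     (\<forall>z\<in>S. \<exists>A B. (f has_derivative (\<lambda>w. A * fst w + B * snd w)) (at z))"
proof -
  have "at z within S = at z" if "z \<in> S" for z
    using that assms by (rule at_within_open)
  then show ?thesis unfolding holomorphic2_on_def by (simp cong: ball_cong)
qed

lemma holomorphic2_onI:
  assumes "open S"
    and "\<And>a b. (a, b) \<in> S \<Longrightarrow> (f has_derivative (\<lambda>w. A a b * fst w + B a b * snd w)) (at (a, b))"
  shows "holomorphic2_on f S"
  unfolding holomorphic2_on_open[OF assms(1)]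
proof
  fix z assume "z \<in> S"
  then have "(f has_derivative (\<lambda>w. A (fst z) (snd z) * fst w + B (fst z) (snd z) * snd w)) (at z)"
    using assms(2)[of "fst z" "snd z"] by simp
  then show "\<exists>A B. (f has_derivative (\<lambda>w. A * fst w + B * snd w)) (at z)" by blast
qed

lemma holomorphic2_on_Union:
  assumes "\<And>z. z \<in> S \<Longrightarrow> \<exists>U. open U \<and> z \<in> U \<and> holomorphic2_on f U"
  shows "holomorphic2_on f S"
proof -
  have "\<exists>A B. (f has_derivative (\<lambda>w. A * fst w + B * snd w)) (at z within S)" if "z \<in> S" for z
  proof -
    have "\<exists>U. open U \<and> z \<in> U \<and> holomorphic2_on f U" using that by (rule assms)
    then obtain U where "open U" "z \<in> U" "holomorphic2_on f U" by blast
    then obtain A B where "(f has_derivative (\<lambda>w. A * fst w + B * snd w)) (at z)"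
      using holomorphic2_on_open[of U f] by blast
    then show ?thesis using has_derivative_at_withinI by blast
  qed
  then show ?thesis unfolding holomorphic2_on_def by blast
qed

lemma holomorphic2_on_partials:
  assumes "holomorphic2_on f S" "open S" "(a, b) \<in> S"
  shows "(f has_derivative (\<lambda>w. pd1 f (a, b) * fst w + pd2 f (a, b) * snd w)) (at (a, b))"
    and "((\<lambda>s. f (s, b)) has_field_derivative pd1 f (a, b)) (at a)"
    and "((\<lambda>s. f (a, s)) has_field_derivative pd2 f (a, b)) (at b)"
proof -
  obtain A B where AB: "(f has_derivative (\<lambda>w. A * fst w + B * snd w)) (at (a, b))"
    using assms holomorphic2_on_open by blast
  have "((\<lambda>s. f (s, b)) has_derivative (\<lambda>w. A * fst (w, 0::complex) + B * snd (w, 0::complex))) (at a)"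
    by (rule has_derivative_compose[of "\<lambda>s. (s, b)", OF _ AB]) (auto intro!: derivative_eq_intros)
  then have 1: "((\<lambda>s. f (s, b)) has_field_derivative A) (at a)"
    by (simp add: has_field_derivative_def)
  have "((\<lambda>s. f (a, s)) has_derivative (\<lambda>w. A * fst (0::complex, w) + B * snd (0::complex, w))) (at b)"
    by (rule has_derivative_compose[of "\<lambda>s. (a, s)", OF _ AB]) (auto intro!: derivative_eq_intros)
  then have 2: "((\<lambda>s. f (a, s)) has_field_derivative B) (at b)"
    by (simp add: has_field_derivative_def)
  have A: "A = pd1 f (a, b)" using 1 by (simp add: pd1_def DERIV_imp_deriv)
  have B: "B = pd2 f (a, b)" using 2 by (simp add: pd2_def DERIV_imp_deriv)
  show "((\<lambda>s. f (s, b)) has_field_derivative pd1 f (a, b)) (at a)" using 1 A by simp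
  show "((\<lambda>s. f (a, s)) has_field_derivative pd2 f (a, b)) (at b)" using 2 B by simp
  show "(f has_derivative (\<lambda>w. pd1 f (a, b) * fst w + pd2 f (a, b) * snd w)) (at (a, b))"
    using AB A B by simp
qed

lemma pd_eqI:
  assumes "(f has_derivative (\<lambda>w. A * fst w + B * snd w)) (at (a, b))"
  shows "pd1 f (a, b) = A" "pd2 f (a, b) = B"
proof -
  have "((\<lambda>s. f (s, b)) has_derivative (\<lambda>w. A * fst (w, 0::complex) + B * snd (w, 0::complex))) (at a)"
    by (rule has_derivative_compose[of "\<lambda>s. (s, b)", OF _ assms]) (auto intro!: derivative_eq_intros)
  then show "pd1 f (a, b) = A"
    by (simp add: has_field_derivative_def[symmetric] pd1_def DERIV_imp_deriv)
  have "((\<lambda>s. f (a, s)) has_derivative (\<lambda>w. A * fst (0::complex, w) + B * snd (0::complex, w))) (at b)"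
    by (rule has_derivative_compose[of "\<lambda>s. (a, s)", OF _ assms]) (auto intro!: derivative_eq_intros)
  then show "pd2 f (a, b) = B"
    by (simp add: has_field_derivative_def[symmetric] pd2_def DERIV_imp_deriv)
qed

lemma holomorphic2_on_imp_continuous_on: "holomorphic2_on f S \<Longrightarrow> continuous_on S f"
  unfolding holomorphic2_on_def continuous_on_eq_continuous_within
  using has_derivative_continuous by blast

section \<open>Slices, bidiscs, and Cauchy integrals with parameters\<close>

lemma open_slice1: "open S \<Longrightarrow> open {a. (a, b) \<in> S}"
  and open_slice2: "open S \<Longrightarrow> open {b. (a, b) \<in> S}"
  using open_vimage[of S "\<lambda>a. (a, b)"] open_vimage[of S "\<lambda>b. (a, b)"]
  by (simp_all add: vimage_def continuous_on_Pair)

lemma holomorphic_slice1: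
  "holomorphic2_on f S \<Longrightarrow> open S \<Longrightarrow> (\<lambda>s. f (s, b)) holomorphic_on {a. (a, b) \<in> S}"
  using holomorphic2_on_partials(2) holomorphic_on_open[OF open_slice1] by blast

lemma holomorphic_slice2:
  "holomorphic2_on f S \<Longrightarrow> open S \<Longrightarrow> (\<lambda>s. f (a, s)) holomorphic_on {b. (a, b) \<in> S}"
  using holomorphic2_on_partials(3) holomorphic_on_open[OF open_slice2] by blast

lemma open_prod_ball:
  fixes S :: "(complex \<times> complex) set"
  assumes "open S" "(a, b) \<in> S"
  obtains r where "r > 0" "cball a r \<times> cball b r \<subseteq> S"
proof -
  obtain A B where AB: "open A" "open B" "a \<in> A" "b \<in> B" "A \<times> B \<subseteq> S"
    using assms by (rule open_prod_elim) auto
  obtain r1 where r1: "r1 > 0" "cball a r1 \<subseteq> A" using AB open_contains_cball by blast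
  obtain r2 where r2: "r2 > 0" "cball b r2 \<subseteq> B" using AB open_contains_cball by blast
  have "cball a (min r1 r2) \<times> cball b (min r1 r2) \<subseteq> S"
    using r1 r2 AB by fastforce
  with r1 r2 show ?thesis using that[of "min r1 r2"] by auto
qed

text \<open>Osgood's form of holomorphy. Joint continuity is built in so that Cauchy integrals over
  a circle can be treated as parameter integrals; differentiability refers to full neighbourhoods,
  so the notion restricts to the closed bidiscs on whose boundary the circles lie.\<close>

definition separately_holomorphic :: "(complex \<times> complex \<Rightarrow> complex) \<Rightarrow> (complex \<times> complex) set \<Rightarrow> bool" where
  "separately_holomorphic f S \<longleftrightarrow> continuous_on S f \<and>
     (\<forall>(a, b)\<in>S. (\<lambda>s. f (s, b)) field_differentiable (at a) \<and> (\<lambda>s. f (a, s)) field_differentiable (at b))"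

lemma separately_holomorphic_subset:
  "separately_holomorphic f S \<Longrightarrow> T \<subseteq> S \<Longrightarrow> separately_holomorphic f T"
  unfolding separately_holomorphic_def by (auto intro: continuous_on_subset)

lemma separately_holomorphic_swap:
  assumes "separately_holomorphic f S"
  shows "separately_holomorphic (f \<circ> prod.swap) (prod.swap ` S)"
proof -
  have "continuous_on (prod.swap ` S) (f \<circ> prod.swap)"
    using assms unfolding separately_holomorphic_def
    by (intro continuous_on_compose continuous_on_swap) (auto simp: image_image)
  then show ?thesis using assms unfolding separately_holomorphic_def by (auto simp: o_def)
qed

text \<open>Cauchy's formula for the first derivative, written over the fixed interval
  \<open>cbox 0 1\<close>. The circle is centred at \<open>a0\<close> and not at \<open>a\<close>,
  so that both \<open>a\<close> and \<open>b\<close> enter the integrand as parameters.\<close>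

lemma pd1_circle_integral:
  assumes f: "separately_holomorphic f (cball a0 r \<times> cball b0 r)" and "r > 0"
    and "a \<in> ball a0 r" "b \<in> cball b0 r"
  shows "pd1 f (a, b) = integral (cbox 0 1)
    (\<lambda>x. f (circlepath a0 r x, b) / (circlepath a0 r x - a)^2 * (of_real r * exp (2 * of_real pi * \<i> * x)))"
proof -
  let ?g = "\<lambda>s. f (s, b)"
  have fc: "continuous_on (cball a0 r \<times> cball b0 r) f"
    using f by (simp add: separately_holomorphic_def)
  have fd: "?g field_differentiable (at s)" if "s \<in> cball a0 r" for s
    using f that assms(4) unfolding separately_holomorphic_def by blast
  have c: "continuous_on (cball a0 r) ?g"
    by (rule continuous_on_compose2[OF fc]) (use assms(4) in \<open>auto intro!: continuous_intros\<close>)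
  have h: "?g holomorphic_on ball a0 r"
    unfolding holomorphic_on_def using fd by (simp add: field_differentiable_at_within)
  have D: "(?g has_field_derivative (1 / (2 * of_real pi * \<i>) * contour_integral (circlepath a0 r) (\<lambda>u. ?g u / (u - a)^2))) (at a)"
    by (rule Cauchy_derivative_integral_circlepath(2)[OF c h assms(3)])
  have "contour_integral (circlepath a0 r) (\<lambda>u. ?g u / (u - a)^2)
     = integral {0..1} (\<lambda>x. ?g (circlepath a0 r x) / (circlepath a0 r x - a)^2 *
         (2 * pi * \<i> * r * exp (2 * of_real pi * \<i> * x)))"
    unfolding contour_integral_integral vector_derivative_circlepath by simp
  also have "\<dots> = (2 * of_real pi * \<i>) * integral {0..1} (\<lambda>x. ?g (circlepath a0 r x) / (circlepath a0 r x - a)^2 *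
         (r * exp (2 * of_real pi * \<i> * x)))"
    unfolding integral_mult_right[symmetric] by (rule arg_cong[where f = "integral _"]) (simp add: mult_ac)
  finally show ?thesis using DERIV_imp_deriv[OF D] by (simp add: pd1_def)
qed

text \<open>The integrand is jointly continuous because no point of the open ball lies on the
  circle, and a continuous integrand over a compact interval has a continuous integral.\<close>

lemma continuous_on_pd1_local:
  assumes f: "separately_holomorphic f (cball a0 r \<times> cball b0 r)" and "r > 0"
  shows "continuous_on (ball a0 r \<times> cball b0 r) (pd1 f)"
proof -
  let ?U = "ball a0 r \<times> cball b0 r"
  let ?F = "\<lambda>z x. f (circlepath a0 r x, snd z) / (circlepath a0 r x - fst z)^2 * (of_real r * exp (2 * of_real pi * \<i> * of_real x))"
  have sph: "circlepath a0 r x \<in> sphere a0 r" for x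
    using \<open>r > 0\<close> by (simp add: circlepath_def part_circlepath_def dist_norm norm_mult)
  have nz: "circlepath a0 r x \<noteq> a" if "a \<in> ball a0 r" for a x
    using sph[of x] that by auto
  have "continuous_on (?U \<times> cbox 0 1) (\<lambda>w. f (circlepath a0 r (snd w), snd (fst w)))"
  proof (rule continuous_on_compose2[of "cball a0 r \<times> cball b0 r" f])
    show "continuous_on (cball a0 r \<times> cball b0 r) f" using f unfolding separately_holomorphic_def by auto
    show "continuous_on (?U \<times> cbox 0 1) (\<lambda>w. (circlepath a0 r (snd w), snd (fst w)))"
      unfolding circlepath by (intro continuous_intros)
    show "(\<lambda>w. (circlepath a0 r (snd w), snd (fst w))) ` (?U \<times> cbox 0 1) \<subseteq> cball a0 r \<times> cball b0 r"
      using sph by auto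
  qed
  moreover have "continuous_on (?U \<times> cbox 0 1) (\<lambda>w. circlepath a0 r (snd w))"
    unfolding circlepath by (intro continuous_intros)
  ultimately have "continuous_on (?U \<times> cbox 0 1) (\<lambda>w. ?F (fst w) (snd w))"
    using nz by (intro continuous_intros) auto
  then have "continuous_on (?U \<times> cbox 0 1) (\<lambda>(z, x). ?F z x)"
    by (simp add: case_prod_unfold)
  then have "continuous_on ?U (\<lambda>z. integral (cbox 0 1) (?F z))"
    by (rule integral_continuous_on_param)
  moreover have "integral (cbox 0 1) (?F z) = pd1 f z" if "z \<in> ?U" for z
    using pd1_circle_integral[OF f \<open>r > 0\<close>, of "fst z" "snd z"] that by auto
  ultimately show ?thesis
    by (simp only: cong: continuous_on_cong)
qed

lemma continuous_on_pd1:
  assumes f: "separately_holomorphic f S" and "open S"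
  shows "continuous_on S (pd1 f)"
proof -
  have "isCont (pd1 f) z" if z: "z \<in> S" for z
  proof -
    obtain a b where ab: "z = (a, b)" by force
    obtain r where r: "r > 0" "cball a r \<times> cball b r \<subseteq> S"
      using open_prod_ball[OF \<open>open S\<close>] z ab by blast
    have "continuous_on (ball a r \<times> cball b r) (pd1 f)"
      using continuous_on_pd1_local[OF separately_holomorphic_subset[OF f r(2)] r(1)] .
    then have "continuous_on (ball a r \<times> ball b r) (pd1 f)"
      by (rule continuous_on_subset) auto
    then show ?thesis using r(1) ab
      by (subst (asm) continuous_on_eq_continuous_at) (auto intro: open_Times)
  qed
  then show ?thesis using \<open>open S\<close> by (simp add: continuous_on_eq_continuous_at)
qed

lemma pd2_swap: "pd2 f = pd1 (f \<circ> prod.swap) \<circ> prod.swap"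
  and pd1_swap: "pd1 f = pd2 (f \<circ> prod.swap) \<circ> prod.swap"
  by (auto simp: pd1_def pd2_def fun_eq_iff)

lemma open_swap: "open S \<Longrightarrow> open (prod.swap ` S :: ('a::topological_space \<times> 'b::topological_space) set)"
proof -
  assume "open S"
  have "prod.swap ` S = prod.swap -` S" by force
  then show ?thesis using \<open>open S\<close> by (simp add: open_vimage continuous_on_swap)
qed

lemma continuous_on_pd2:
  assumes f: "separately_holomorphic f S" and "open S"
  shows "continuous_on S (pd2 f)"
proof -
  have "continuous_on (prod.swap ` S) (pd1 (f \<circ> prod.swap))"
    by (rule continuous_on_pd1[OF separately_holomorphic_swap[OF f] open_swap[OF \<open>open S\<close>]])
  then show ?thesis unfolding pd2_swap[of f]
    by (rule continuous_on_compose[OF continuous_on_swap])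
qed

text \<open>Osgood's lemma. A partial derivative at the point in one variable and a continuous
  partial derivative in the other give a total derivative; the continuity of \<open>pd2 f\<close>
  comes from its Cauchy integral.\<close>

lemma separately_holomorphic_imp_holomorphic2:
  assumes f: "separately_holomorphic f S" and "open S"
  shows "holomorphic2_on f S"
proof -
  have "\<exists>A B. (f has_derivative (\<lambda>w. A * fst w + B * snd w)) (at z)" if z: "z \<in> S" for z
  proof -
    obtain a b where ab: "z = (a, b)" by force
    obtain r where r: "r > 0" "cball a r \<times> cball b r \<subseteq> S"
      using open_prod_ball[OF \<open>open S\<close>] z ab by blast
    let ?X = "ball a r" and ?Y = "ball b r"
    have op: "open (?X \<times> ?Y)" by (simp add: open_Times)
    have sub: "?X \<times> ?Y \<subseteq> S" by (rule order_trans[OF Sigma_mono r(2)]) auto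
    have d1: "((\<lambda>s. f (s, b)) has_field_derivative pd1 f (a, b)) (at a)"
      using f z ab unfolding separately_holomorphic_def pd1_def
      by (auto simp: DERIV_deriv_iff_field_differentiable)
    have d2: "((\<lambda>s. f (u, s)) has_field_derivative pd2 f (u, v)) (at v)" if "(u, v) \<in> S" for u v
      using f that unfolding separately_holomorphic_def pd2_def
      by (auto simp: DERIV_deriv_iff_field_differentiable)
    have "((\<lambda>(x, y). f (x, y)) has_derivative
        (\<lambda>(tx, ty). pd1 f (a, b) * tx + blinfun_mult_right (pd2 f (a, b)) ty)) (at (a, b) within ?X \<times> ?Y)"
    proof (rule has_derivative_partialsI[where fy = "\<lambda>u v. blinfun_mult_right (pd2 f (u, v))"])
      show "((\<lambda>x. f (x, b)) has_derivative (*) (pd1 f (a, b))) (at a within ball a r)"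
        using d1 by (simp add: has_field_derivative_def has_derivative_at_withinI)
      show "((\<lambda>y. f (x, y)) has_derivative blinfun_apply (blinfun_mult_right (pd2 f (x, y)))) (at y within ball b r)"
        if "x \<in> ball a r" "y \<in> ball b r" for x y
      proof -
        have "(x, y) \<in> S" using sub that by blast
        from has_field_derivative_at_within[OF d2[OF this]] show ?thesis
          by (simp add: has_field_derivative_def mult_commute_abs)
      qed
      have "isCont (pd2 f) (a, b)"
        using continuous_on_pd2[OF f \<open>open S\<close>] z ab \<open>open S\<close> by (simp add: continuous_on_eq_continuous_at)
      then have "isCont (\<lambda>z. blinfun_mult_right (pd2 f z)) (a, b)"
        by (intro bounded_linear.isCont[OF bounded_linear_blinfun_mult_right])
      then show "continuous (at (a, b) within ball a r \<times> ball b r) (\<lambda>(x, y). blinfun_mult_right (pd2 f (x, y)))"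
        by (simp add: case_prod_unfold continuous_at_imp_continuous_at_within)
    qed (use r in auto)
    then have "(f has_derivative (\<lambda>w. pd1 f (a, b) * fst w + pd2 f (a, b) * snd w)) (at (a, b))"
      using r(1) by (subst (asm) at_within_open[OF _ op]) (auto simp: case_prod_unfold mult_commute_abs)
    then show ?thesis using ab by blast
  qed
  then show ?thesis by (simp add: holomorphic2_on_open[OF \<open>open S\<close>])
qed

lemma holomorphic2_imp_separately:
  assumes "holomorphic2_on f S" "open S"
  shows "separately_holomorphic f S"
proof -
  have "(\<lambda>s. f (s, b)) field_differentiable (at a)" "(\<lambda>s. f (a, s)) field_differentiable (at b)"
    if "(a, b) \<in> S" for a b
    unfolding field_differentiable_def using holomorphic2_on_partials(2,3)[OF assms that] by blast+
  then show ?thesis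
    unfolding separately_holomorphic_def using holomorphic2_on_imp_continuous_on[OF assms(1)] by blast
qed

text \<open>Differentiation under the integral sign in Cauchy's formula. The result is again a
  Cauchy integral, now of \<open>pd2 f\<close>, and this explicit form is what identifies the mixed
  derivatives later.\<close>

lemma pd1_has_derivative2:
  assumes f: "holomorphic2_on f S" and "open S" and "r > 0" "cball a r \<times> cball b r \<subseteq> S"
  shows "((\<lambda>v. pd1 f (a, v)) has_field_derivative
     integral (cbox 0 1) (\<lambda>x. pd2 f (circlepath a r x, b) / (circlepath a r x - a)^2
       * (of_real r * exp (2 * of_real pi * \<i> * x)))) (at b)"
proof -
  have r: "r > 0" "cball a r \<times> cball b r \<subseteq> S" by fact+
  have sh: "separately_holomorphic f S" by (rule holomorphic2_imp_separately[OF assms(1,2)])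
  let ?U = "ball b r"
  let ?K = "\<lambda>x. (of_real r * exp (2 * of_real pi * \<i> * of_real x)) / (circlepath a r x - a)^2"
  have sph: "circlepath a r x \<in> sphere a r" for x
    using \<open>r > 0\<close> by (simp add: circlepath_def part_circlepath_def dist_norm norm_mult)
  have nz: "circlepath a r x - a \<noteq> 0" for x
    using sph[of x] r(1) by auto
  have cp: "continuous_on A (circlepath a r)" for A
    unfolding circlepath by (intro continuous_intros)
  have inS: "(circlepath a r x, v) \<in> S" if "v \<in> ?U" for x v
    using sph[of x] that by (intro subsetD[OF r(2)]) auto
  have hol: "((\<lambda>v. integral (cbox 0 1) (\<lambda>x. f (circlepath a r x, v) * ?K x)) has_field_derivative
      integral (cbox 0 1) (\<lambda>x. pd2 f (circlepath a r x, b) * ?K x)) (at b within ?U)"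
  proof (rule leibniz_rule_field_derivative[where fx = "\<lambda>v x. pd2 f (circlepath a r x, v) * ?K x"])
    show "((\<lambda>v. f (circlepath a r x, v) * ?K x) has_field_derivative pd2 f (circlepath a r x, v) * ?K x)
        (at v within ?U)" if "v \<in> ?U" for v x
      by (rule DERIV_cmult_right[OF has_field_derivative_at_within[OF
            holomorphic2_on_partials(3)[OF f \<open>open S\<close> inS[OF that]]]])
    show "(\<lambda>x. f (circlepath a r x, v) * ?K x) integrable_on cbox 0 1" if "v \<in> ?U" for v
    proof (rule integrable_continuous)
      have "continuous_on (cbox 0 1) (\<lambda>x. f (circlepath a r x, v))"
        using inS[OF that] by (intro continuous_on_compose2[OF holomorphic2_on_imp_continuous_on[OF f]] continuous_intros cp) auto
      then show "continuous_on (cbox 0 1) (\<lambda>x. f (circlepath a r x, v) * ?K x)"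
        using nz by (intro continuous_intros cp) auto
    qed
    have "continuous_on (?U \<times> cbox 0 1) (\<lambda>w. pd2 f (circlepath a r (snd w), fst w))"
      using inS by (intro continuous_on_compose2[OF continuous_on_pd2[OF sh \<open>open S\<close>]] continuous_intros continuous_on_compose2[OF cp]) auto
    moreover have "continuous_on (?U \<times> cbox 0 1) (\<lambda>w. circlepath a r (snd w))"
      by (intro continuous_intros continuous_on_compose2[OF cp]) auto
    ultimately have "continuous_on (?U \<times> cbox 0 1) (\<lambda>w. pd2 f (circlepath a r (snd w), fst w) * ?K (snd w))"
      using nz by (intro continuous_intros) auto
    then show "continuous_on (?U \<times> cbox 0 1) (\<lambda>(v, x). pd2 f (circlepath a r x, v) * ?K x)"
      by (simp add: case_prod_unfold)
  qed (use r(1) in auto)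
  have eq: "pd1 f (a, v) = integral (cbox 0 1) (\<lambda>x. f (circlepath a r x, v) * ?K x)" if "v \<in> ?U" for v
    using pd1_circle_integral[OF separately_holomorphic_subset[OF sh r(2)] r(1), of a v] that r(1)
    by simp
  have "((\<lambda>v. integral (cbox 0 1) (\<lambda>x. f (circlepath a r x, v) * ?K x)) has_field_derivative
      integral (cbox 0 1) (\<lambda>x. pd2 f (circlepath a r x, b) * ?K x)) (at b)"
    using hol unfolding at_within_open[OF centre_in_ball[THEN iffD2, OF r(1)] open_ball] .
  then have "((\<lambda>v. pd1 f (a, v)) has_field_derivative
      integral (cbox 0 1) (\<lambda>x. pd2 f (circlepath a r x, b) * ?K x)) (at b)"
    by (rule has_field_derivative_transform_within_open[of _ _ _ ?U]) (use r(1) eq in auto)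
  then show ?thesis by (simp add: field_simps)
qed

lemma holomorphic2_on_pd1:
  assumes f: "holomorphic2_on f S" and "open S"
  shows "holomorphic2_on (pd1 f) S"
proof -
  have sh: "separately_holomorphic f S" by (rule holomorphic2_imp_separately[OF assms])
  have 1: "(\<lambda>s. pd1 f (s, b)) field_differentiable (at a)" if "(a, b) \<in> S" for a b
  proof -
    have "deriv (\<lambda>s. f (s, b)) holomorphic_on {a. (a, b) \<in> S}"
      by (intro holomorphic_deriv holomorphic_slice1 open_slice1 assms)
    then show ?thesis using that open_slice1[OF \<open>open S\<close>]
      by (auto simp: pd1_def holomorphic_on_imp_differentiable_at)
  qed
  have 2: "(\<lambda>s. pd1 f (a, s)) field_differentiable (at b)" if "(a, b) \<in> S" for a b
  proof -
    obtain r where r: "r > 0" "cball a r \<times> cball b r \<subseteq> S"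
      using open_prod_ball[OF \<open>open S\<close> \<open>(a, b) \<in> S\<close>] by blast
    show ?thesis
      unfolding field_differentiable_def
      by (rule exI, rule pd1_has_derivative2[OF f \<open>open S\<close> r])
  qed
  have "separately_holomorphic (pd1 f) S"
    unfolding separately_holomorphic_def using continuous_on_pd1[OF sh \<open>open S\<close>] 1 2 by auto
  then show ?thesis by (rule separately_holomorphic_imp_holomorphic2[OF _ \<open>open S\<close>])
qed

lemma holomorphic2_on_swap:
  assumes "holomorphic2_on f S" "open S"
  shows "holomorphic2_on (f \<circ> prod.swap) (prod.swap ` S)"
  by (rule separately_holomorphic_imp_holomorphic2[OF separately_holomorphic_swap[OF
        holomorphic2_imp_separately[OF assms]] open_swap[OF assms(2)]])

lemma holomorphic2_on_pd2:
  assumes f: "holomorphic2_on f S" and "open S"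
  shows "holomorphic2_on (pd2 f) S"
proof -
  have "holomorphic2_on (pd1 (f \<circ> prod.swap) \<circ> prod.swap) (prod.swap ` prod.swap ` S)"
    by (rule holomorphic2_on_swap[OF holomorphic2_on_pd1[OF holomorphic2_on_swap[OF assms]]]) (intro open_swap assms)+
  moreover have "prod.swap ` prod.swap ` S = S" by (simp add: image_image)
  ultimately show ?thesis by (simp only: pd2_swap[of f])
qed

text \<open>Both sides are the same circle integral: the left by differentiating Cauchy's formula
  for \<open>f\<close>, the right by Cauchy's formula for \<open>pd2 f\<close>.\<close>

lemma pd_commute:
  assumes f: "holomorphic2_on f S" and "open S" and "(a, b) \<in> S"
  shows "pd2 (pd1 f) (a, b) = pd1 (pd2 f) (a, b)"
proof -
  obtain r where r: "r > 0" "cball a r \<times> cball b r \<subseteq> S"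
    using open_prod_ball[OF assms(2,3)] by blast
  have sh: "separately_holomorphic (pd2 f) (cball a r \<times> cball b r)"
    by (rule separately_holomorphic_subset[OF holomorphic2_imp_separately[OF holomorphic2_on_pd2[OF f]] r(2)])
       (rule assms(2))+
  show ?thesis
    using DERIV_imp_deriv[OF pd1_has_derivative2[OF f \<open>open S\<close> r]] pd1_circle_integral[OF sh r(1), of a b] r(1)
    unfolding pd2_def[of "pd1 f"] by simp
qed

section \<open>Closure rules and chain rules\<close>

lemma holomorphic2_on_cong:
  assumes "holomorphic2_on f S" "open S" "\<And>z. z \<in> S \<Longrightarrow> f z = g z"
  shows "holomorphic2_on g S"
  unfolding holomorphic2_on_open[OF assms(2)]
proof
  fix z assume z: "z \<in> S"
  then obtain A B where "(f has_derivative (\<lambda>w. A * fst w + B * snd w)) (at z)"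
    using assms(1) holomorphic2_on_open[OF assms(2), of f] by blast
  then have "(g has_derivative (\<lambda>w. A * fst w + B * snd w)) (at z)"
    by (rule has_derivative_transform_within_open[OF _ assms(2) z]) (rule assms(3))
  then show "\<exists>A B. (g has_derivative (\<lambda>w. A * fst w + B * snd w)) (at z)" by blast
qed

lemma pd_cong:
  assumes "open U" "(a, b) \<in> U" "\<And>z. z \<in> U \<Longrightarrow> f z = g z"
  shows "pd1 f (a, b) = pd1 g (a, b)" "pd2 f (a, b) = pd2 g (a, b)"
proof -
  have "eventually (\<lambda>s. (s, b) \<in> U) (nhds a)"
    using eventually_nhds_in_open[OF open_slice1[OF assms(1)], of a b] assms(2) by simp
  then have "eventually (\<lambda>s. f (s, b) = g (s, b)) (nhds a)"
    by eventually_elim (rule assms(3))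
  then show "pd1 f (a, b) = pd1 g (a, b)"
    unfolding pd1_def by (simp add: deriv_cong_ev)
  have "eventually (\<lambda>s. (a, s) \<in> U) (nhds b)"
    using eventually_nhds_in_open[OF open_slice2[OF assms(1)], of b a] assms(2) by simp
  then have "eventually (\<lambda>s. f (a, s) = g (a, s)) (nhds b)"
    by eventually_elim (rule assms(3))
  then show "pd2 f (a, b) = pd2 g (a, b)"
    unfolding pd2_def by (simp add: deriv_cong_ev)
qed

lemma holomorphic2_on_const: "holomorphic2_on (\<lambda>_. c) S"
proof -
  have "\<exists>A B. ((\<lambda>_. c) has_derivative (\<lambda>w. A * fst w + B * snd w)) (at z within S)" for z
    by (intro exI[of _ 0]) simp
  then show ?thesis unfolding holomorphic2_on_def by blast
qed

lemma holomorphic2_on_fst: "holomorphic2_on fst S"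
  and holomorphic2_on_snd: "holomorphic2_on snd S"
proof -
  have "\<exists>A B. (fst has_derivative (\<lambda>w. A * fst w + B * snd w)) (at z within S)" for z :: "complex \<times> complex"
    by (rule exI[of _ 1], rule exI[of _ 0]) (auto intro!: derivative_eq_intros)
  then show "holomorphic2_on fst S" unfolding holomorphic2_on_def by blast
  have "\<exists>A B. (snd has_derivative (\<lambda>w. A * fst w + B * snd w)) (at z within S)" for z :: "complex \<times> complex"
    by (rule exI[of _ 0], rule exI[of _ 1]) (auto intro!: derivative_eq_intros)
  then show "holomorphic2_on snd S" unfolding holomorphic2_on_def by blast
qed

lemma holomorphic2_on_compose1:
  assumes f: "holomorphic2_on f S" and g: "g holomorphic_on T" and "open S" "open T" "f ` S \<subseteq> T"
  shows "holomorphic2_on (\<lambda>z. g (f z)) S"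
    and "(a, b) \<in> S \<Longrightarrow> pd1 (\<lambda>z. g (f z)) (a, b) = deriv g (f (a, b)) * pd1 f (a, b)"
    and "(a, b) \<in> S \<Longrightarrow> pd2 (\<lambda>z. g (f z)) (a, b) = deriv g (f (a, b)) * pd2 f (a, b)"
proof -
  have D: "((\<lambda>z. g (f z)) has_derivative
      (\<lambda>w. (deriv g (f (a, b)) * pd1 f (a, b)) * fst w + (deriv g (f (a, b)) * pd2 f (a, b)) * snd w)) (at (a, b))"
    if ab: "(a, b) \<in> S" for a b
  proof -
    have "(g has_field_derivative deriv g (f (a, b))) (at (f (a, b)))"
      using holomorphic_derivI[OF g \<open>open T\<close>] assms(5) ab by blast
    then have "((\<lambda>z. g (f z)) has_derivative
      (\<lambda>w. deriv g (f (a, b)) * (pd1 f (a, b) * fst w + pd2 f (a, b) * snd w))) (at (a, b))"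
      unfolding has_field_derivative_def
      by (rule has_derivative_compose[OF holomorphic2_on_partials(1)[OF f \<open>open S\<close> ab]])
    then show ?thesis by (simp add: algebra_simps)
  qed
  show "holomorphic2_on (\<lambda>z. g (f z)) S"
    by (rule holomorphic2_onI[OF \<open>open S\<close>]) (rule D)
  show "pd1 (\<lambda>z. g (f z)) (a, b) = deriv g (f (a, b)) * pd1 f (a, b)" if "(a, b) \<in> S"
    using pd_eqI(1)[OF D[OF that]] .
  show "pd2 (\<lambda>z. g (f z)) (a, b) = deriv g (f (a, b)) * pd2 f (a, b)" if "(a, b) \<in> S"
    using pd_eqI(2)[OF D[OF that]] .
qed

lemma holomorphic2_on_compose2:
  assumes u: "holomorphic2_on u S" and v: "holomorphic2_on v S" and f: "holomorphic2_on f T"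
    and "open S" "open T" "\<And>z. z \<in> S \<Longrightarrow> (u z, v z) \<in> T"
  shows "holomorphic2_on (\<lambda>z. f (u z, v z)) S"
    and "z \<in> S \<Longrightarrow> pd1 (\<lambda>z. f (u z, v z)) z = pd1 f (u z, v z) * pd1 u z + pd2 f (u z, v z) * pd1 v z"
    and "z \<in> S \<Longrightarrow> pd2 (\<lambda>z. f (u z, v z)) z = pd1 f (u z, v z) * pd2 u z + pd2 f (u z, v z) * pd2 v z"
proof -
  have D: "((\<lambda>z. f (u z, v z)) has_derivative
      (\<lambda>w. (pd1 f (u z, v z) * pd1 u z + pd2 f (u z, v z) * pd1 v z) * fst w
         + (pd1 f (u z, v z) * pd2 u z + pd2 f (u z, v z) * pd2 v z) * snd w)) (at z)"
    if z: "z \<in> S" for z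
  proof -
    obtain a b where ab: "z = (a, b)" by force
    have uv: "((\<lambda>z. (u z, v z)) has_derivative
       (\<lambda>w. (pd1 u z * fst w + pd2 u z * snd w, pd1 v z * fst w + pd2 v z * snd w))) (at z)"
      using holomorphic2_on_partials(1)[OF u \<open>open S\<close>, of a b] holomorphic2_on_partials(1)[OF v \<open>open S\<close>, of a b]
        z ab by (intro has_derivative_Pair) auto
    have "(f has_derivative (\<lambda>w. pd1 f (u z, v z) * fst w + pd2 f (u z, v z) * snd w)) (at (u z, v z))"
      by (rule holomorphic2_on_partials(1)[OF f \<open>open T\<close> assms(6)[OF z]])
    from has_derivative_compose[OF uv this] show ?thesis by (simp add: algebra_simps)
  qed
  show "holomorphic2_on (\<lambda>z. f (u z, v z)) S"
    unfolding holomorphic2_on_open[OF \<open>open S\<close>] using D by blast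
  show "pd1 (\<lambda>z. f (u z, v z)) z = pd1 f (u z, v z) * pd1 u z + pd2 f (u z, v z) * pd1 v z" if "z \<in> S"
    using pd_eqI(1)[of _ _ _ "fst z" "snd z"] D[OF that] by simp
  show "pd2 (\<lambda>z. f (u z, v z)) z = pd1 f (u z, v z) * pd2 u z + pd2 f (u z, v z) * pd2 v z" if "z \<in> S"
    using pd_eqI(2)[of _ _ _ "fst z" "snd z"] D[OF that] by simp
qed

lemma holomorphic2_on_add:
  assumes f: "holomorphic2_on f S" and g: "holomorphic2_on g S" and "open S"
  shows "holomorphic2_on (\<lambda>z. f z + g z) S"
    and "(a, b) \<in> S \<Longrightarrow> pd1 (\<lambda>z. f z + g z) (a, b) = pd1 f (a, b) + pd1 g (a, b)"
    and "(a, b) \<in> S \<Longrightarrow> pd2 (\<lambda>z. f z + g z) (a, b) = pd2 f (a, b) + pd2 g (a, b)"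
proof -
  have D: "((\<lambda>z. f z + g z) has_derivative
      (\<lambda>w. (pd1 f (a, b) + pd1 g (a, b)) * fst w + (pd2 f (a, b) + pd2 g (a, b)) * snd w)) (at (a, b))"
    if ab: "(a, b) \<in> S" for a b
    using has_derivative_add[OF holomorphic2_on_partials(1)[OF f \<open>open S\<close> ab] holomorphic2_on_partials(1)[OF g \<open>open S\<close> ab]]
    by (simp add: algebra_simps)
  show "holomorphic2_on (\<lambda>z. f z + g z) S"
    by (rule holomorphic2_onI[OF \<open>open S\<close>]) (rule D)
  show "(a, b) \<in> S \<Longrightarrow> pd1 (\<lambda>z. f z + g z) (a, b) = pd1 f (a, b) + pd1 g (a, b)"
    using pd_eqI(1)[OF D] .
  show "(a, b) \<in> S \<Longrightarrow> pd2 (\<lambda>z. f z + g z) (a, b) = pd2 f (a, b) + pd2 g (a, b)"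
    using pd_eqI(2)[OF D] .
qed

lemma holomorphic2_on_mult:
  assumes f: "holomorphic2_on f S" and g: "holomorphic2_on g S" and "open S"
  shows "holomorphic2_on (\<lambda>z. f z * g z) S"
    and "(a, b) \<in> S \<Longrightarrow> pd1 (\<lambda>z. f z * g z) (a, b) = f (a, b) * pd1 g (a, b) + pd1 f (a, b) * g (a, b)"
    and "(a, b) \<in> S \<Longrightarrow> pd2 (\<lambda>z. f z * g z) (a, b) = f (a, b) * pd2 g (a, b) + pd2 f (a, b) * g (a, b)"
proof -
  have D: "((\<lambda>z. f z * g z) has_derivative
      (\<lambda>w. (f (a, b) * pd1 g (a, b) + pd1 f (a, b) * g (a, b)) * fst w
         + (f (a, b) * pd2 g (a, b) + pd2 f (a, b) * g (a, b)) * snd w)) (at (a, b))"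
    if ab: "(a, b) \<in> S" for a b
    using has_derivative_mult[OF holomorphic2_on_partials(1)[OF f \<open>open S\<close> ab] holomorphic2_on_partials(1)[OF g \<open>open S\<close> ab]]
    by (simp add: algebra_simps)
  show "holomorphic2_on (\<lambda>z. f z * g z) S"
    by (rule holomorphic2_onI[OF \<open>open S\<close>]) (rule D)
  show "(a, b) \<in> S \<Longrightarrow> pd1 (\<lambda>z. f z * g z) (a, b) = f (a, b) * pd1 g (a, b) + pd1 f (a, b) * g (a, b)"
    using pd_eqI(1)[OF D] .
  show "(a, b) \<in> S \<Longrightarrow> pd2 (\<lambda>z. f z * g z) (a, b) = f (a, b) * pd2 g (a, b) + pd2 f (a, b) * g (a, b)"
    using pd_eqI(2)[OF D] .
qed

lemma holomorphic2_on_uminus: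
  "holomorphic2_on f S \<Longrightarrow> open S \<Longrightarrow> holomorphic2_on (\<lambda>z. - f z) S"
  using holomorphic2_on_mult(1)[OF holomorphic2_on_const[of "-1"]] by simp

lemma holomorphic2_on_diff:
  "holomorphic2_on f S \<Longrightarrow> holomorphic2_on g S \<Longrightarrow> open S \<Longrightarrow> holomorphic2_on (\<lambda>z. f z - g z) S"
  using holomorphic2_on_add(1)[of f S "\<lambda>z. - g z"] holomorphic2_on_uminus by simp

lemma holomorphic2_on_power:
  "holomorphic2_on f S \<Longrightarrow> open S \<Longrightarrow> holomorphic2_on (\<lambda>z. f z ^ n) S"
  by (induction n) (simp_all add: holomorphic2_on_const holomorphic2_on_mult(1))

lemma holomorphic2_on_divide:
  assumes f: "holomorphic2_on f S" and g: "holomorphic2_on g S" and "open S"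
    and nz: "\<And>z. z \<in> S \<Longrightarrow> g z \<noteq> 0"
  shows "holomorphic2_on (\<lambda>z. f z / g z) S"
    and "(a, b) \<in> S \<Longrightarrow> pd1 (\<lambda>z. f z / g z) (a, b) =
      (pd1 f (a, b) * g (a, b) - f (a, b) * pd1 g (a, b)) / (g (a, b))\<^sup>2"
    and "(a, b) \<in> S \<Longrightarrow> pd2 (\<lambda>z. f z / g z) (a, b) =
      (pd2 f (a, b) * g (a, b) - f (a, b) * pd2 g (a, b)) / (g (a, b))\<^sup>2"
proof -
  have D: "((\<lambda>z. f z / g z) has_derivative
      (\<lambda>w. (pd1 f (a, b) * g (a, b) - f (a, b) * pd1 g (a, b)) / (g (a, b))\<^sup>2 * fst w
         + (pd2 f (a, b) * g (a, b) - f (a, b) * pd2 g (a, b)) / (g (a, b))\<^sup>2 * snd w)) (at (a, b))"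
    if ab: "(a, b) \<in> S" for a b
    using has_derivative_divide[OF holomorphic2_on_partials(1)[OF f \<open>open S\<close> ab] holomorphic2_on_partials(1)[OF g \<open>open S\<close> ab] nz[OF ab]]
    by (rule back_subst[where P = "\<lambda>d. (_ has_derivative d) _"])
       (use nz[OF ab] in \<open>auto simp: fun_eq_iff field_simps power2_eq_square\<close>)
  show "holomorphic2_on (\<lambda>z. f z / g z) S"
    by (rule holomorphic2_onI[OF \<open>open S\<close>]) (rule D)
  show "(a, b) \<in> S \<Longrightarrow> pd1 (\<lambda>z. f z / g z) (a, b) =
      (pd1 f (a, b) * g (a, b) - f (a, b) * pd1 g (a, b)) / (g (a, b))\<^sup>2"
    using pd_eqI(1)[OF D] .
  show "(a, b) \<in> S \<Longrightarrow> pd2 (\<lambda>z. f z / g z) (a, b) =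
      (pd2 f (a, b) * g (a, b) - f (a, b) * pd2 g (a, b)) / (g (a, b))\<^sup>2"
    using pd_eqI(2)[OF D] .
qed

section \<open>The differential equations\<close>

text \<open>The derivative of the inverse supplied by the inverse function theorem is the inverse of
  a complex 2 by 2 matrix, hence complex linear, so both components of the inverse are
  holomorphic.\<close>

lemma holomorphic2_local_inverse:
  assumes x: "holomorphic2_on x S" and y: "holomorphic2_on y S" and S: "open S" "t0 \<in> S"
    and J: "\<And>t. t \<in> S \<Longrightarrow> pd1 x t * pd2 y t - pd2 x t * pd1 y t \<noteq> 0"
  obtains U V g where "open U" "t0 \<in> U" "U \<subseteq> S" "open V" "homeomorphism U V (\<lambda>t. (x t, y t)) g"
    "holomorphic2_on (\<lambda>z. fst (g z)) V" "holomorphic2_on (\<lambda>z. snd (g z)) V"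
proof -
  define f where "f = (\<lambda>t. (x t, y t))"
  define L where "L = (\<lambda>a b c d (w :: complex \<times> complex). (a * fst w + b * snd w, c * fst w + d * snd w))"
  have bl: "bounded_linear (L a b c d)" for a b c d
    unfolding L_def
    by (intro bounded_linear_Pair bounded_linear_add bounded_linear_const_mult bounded_linear_fst bounded_linear_snd)
  define D where "D = (\<lambda>t. Blinfun (L (pd1 x t) (pd2 x t) (pd1 y t) (pd2 y t)))"
  have D: "blinfun_apply (D t) = L (pd1 x t) (pd2 x t) (pd1 y t) (pd2 y t)" for t
    unfolding D_def by (rule bounded_linear_Blinfun_apply[OF bl])
  define j where "j = (\<lambda>t. pd1 x t * pd2 y t - pd2 x t * pd1 y t)"
  \<comment> \<open>The adjugate of the Jacobian matrix divided by its determinant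
    \<open>j t\<close>.\<close>
  define I where "I = (\<lambda>t. L (pd2 y t / j t) (- pd2 x t / j t) (- pd1 y t / j t) (pd1 x t / j t))"
  have DI: "L (pd1 x t) (pd2 x t) (pd1 y t) (pd2 y t) (I t w) = w"
    and ID: "I t (L (pd1 x t) (pd2 x t) (pd1 y t) (pd2 y t) w) = w" if "t \<in> S" for t w
  proof -
    have nz: "j t \<noteq> 0" using J[OF that] by (simp add: j_def)
    have 1: "(p * (d / j t * u + - q / j t * v) + q * (- c / j t * u + p / j t * v)) = u"
         "(c * (d / j t * u + - q / j t * v) + d * (- c / j t * u + p / j t * v)) = v"
         "(d / j t * (p * u + q * v) + - q / j t * (c * u + d * v)) = u"
         "(- c / j t * (p * u + q * v) + p / j t * (c * u + d * v)) = v"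
      if "j t = p * d - q * c" for p q c d u v
      using nz that by (simp_all add: divide_simps) (simp_all add: algebra_simps)
    note 2 = 1[of "pd1 x t" "pd2 y t" "pd2 x t" "pd1 y t" "fst w" "snd w", OF j_def[THEN fun_cong]]
    show "L (pd1 x t) (pd2 x t) (pd1 y t) (pd2 y t) (I t w) = w"
      unfolding I_def L_def fst_conv snd_conv 2 by simp
    show "I t (L (pd1 x t) (pd2 x t) (pd1 y t) (pd2 y t) w) = w"
      unfolding I_def L_def fst_conv snd_conv 2 by simp
  qed
  have der: "(f has_derivative blinfun_apply (D t)) (at t)" if "t \<in> S" for t
    unfolding f_def D L_def
    using holomorphic2_on_partials(1)[OF x S(1), of "fst t" "snd t"]
      holomorphic2_on_partials(1)[OF y S(1), of "fst t" "snd t"] that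
    by (intro has_derivative_Pair) auto
  have cont: "continuous_on S D"
  proof (rule continuous_on_blinfun_componentwise)
    note c = holomorphic2_on_imp_continuous_on[OF holomorphic2_on_pd1[OF x S(1)]]
      holomorphic2_on_imp_continuous_on[OF holomorphic2_on_pd2[OF x S(1)]]
      holomorphic2_on_imp_continuous_on[OF holomorphic2_on_pd1[OF y S(1)]]
      holomorphic2_on_imp_continuous_on[OF holomorphic2_on_pd2[OF y S(1)]]
    show "continuous_on S (\<lambda>t. blinfun_apply (D t) i)" for i
      unfolding D L_def by (intro continuous_intros c)
  qed
  have inv: "Blinfun (I t0) o\<^sub>L D t0 = id_blinfun"
  proof (rule blinfun_eqI)
    fix w show "blinfun_apply (Blinfun (I t0) o\<^sub>L D t0) w = blinfun_apply id_blinfun w"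
      using ID[OF S(2)] by (simp add: D I_def bounded_linear_Blinfun_apply[OF bl])
  qed
  show ?thesis
  proof (rule inverse_function_theorem[OF S(1) der cont S(2) inv])
  fix U V g g'
  assume *: "open U" "U \<subseteq> S" "t0 \<in> U" "open V" "f t0 \<in> V" "homeomorphism U V f g"
    and g': "\<And>z. z \<in> V \<Longrightarrow> (g has_derivative (g' z)) (at z)"
    and inv': "\<And>z. z \<in> V \<Longrightarrow> g' z = inv_into UNIV (blinfun_apply (D (g z)))"
  have gS: "g z \<in> S" if "z \<in> V" for z
    using *(2,6) that unfolding homeomorphism_def by blast
  have gI: "(g has_derivative I (g z)) (at z)" if "z \<in> V" for z
  proof -
    have "inv_into UNIV (blinfun_apply (D (g z))) = I (g z)"
      unfolding D by (rule inv_equality) (use DI ID gS[OF that] in auto)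
    then show ?thesis using g'[OF that] inv'[OF that] by simp
  qed
  have f1: "((\<lambda>z. fst (g z)) has_derivative (\<lambda>w. (pd2 y (g z) / j (g z)) * fst w + (- pd2 x (g z) / j (g z)) * snd w)) (at z)"
    if "z \<in> V" for z
    using has_derivative_fst[OF gI[OF that]] by (simp only: I_def L_def fst_conv)
  have f2: "((\<lambda>z. snd (g z)) has_derivative (\<lambda>w. (- pd1 y (g z) / j (g z)) * fst w + (pd1 x (g z) / j (g z)) * snd w)) (at z)"
    if "z \<in> V" for z
    using has_derivative_snd[OF gI[OF that]] by (simp only: I_def L_def snd_conv)
  have "holomorphic2_on (\<lambda>z. fst (g z)) V"
    by (rule holomorphic2_onI[OF *(4)]) (erule f1)
  moreover have "holomorphic2_on (\<lambda>z. snd (g z)) V"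
    by (rule holomorphic2_onI[OF *(4)]) (erule f2)
  ultimately show ?thesis
    using that[of U V g] *(1-4) *(6)[unfolded f_def] by simp
  qed
qed

section \<open>Logarithmic derivatives, Euler derivatives and the regular domain\<close>

lemma open_hol_points: "open (hol_points f)"
  and hol_points_subset: "hol_points f \<subseteq> HH"
  and holomorphic2_on_hol_points: "holomorphic2_on f (hol_points f)"
proof -
  show "open (hol_points f)"
    unfolding open_subopen[of "hol_points f"]
  proof
    fix t assume "t \<in> hol_points f"
    then obtain U where U: "open U" "t \<in> U" "U \<subseteq> HH" "holomorphic2_on f U"
      unfolding hol_points_def by auto
    then have "U \<subseteq> hol_points f" unfolding hol_points_def by auto
    with U show "\<exists>T. open T \<and> t \<in> T \<and> T \<subseteq> hol_points f" by auto
  qed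
  show "hol_points f \<subseteq> HH" unfolding hol_points_def by blast
  show "holomorphic2_on f (hol_points f)"
    by (rule holomorphic2_on_Union) (auto simp: hol_points_def)
qed

lemma holomorphic2_on_Dq:
  assumes "holomorphic2_on f S" "open S"
  shows "holomorphic2_on (Dq1 f) S" "holomorphic2_on (Dq2 f) S"
proof -
  have eq: "Dq1 f = (\<lambda>t. pd1 f t / (2 * of_real pi * \<i>))" "Dq2 f = (\<lambda>t. pd2 f t / (2 * of_real pi * \<i>))"
    by (simp_all add: fun_eq_iff Dq1_eq Dq2_eq)
  show "holomorphic2_on (Dq1 f) S" "holomorphic2_on (Dq2 f) S"
    unfolding eq
    by (rule holomorphic2_on_divide(1)[OF holomorphic2_on_pd1[OF assms] holomorphic2_on_const assms(2)], simp)
       (rule holomorphic2_on_divide(1)[OF holomorphic2_on_pd2[OF assms] holomorphic2_on_const assms(2)], simp)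
qed

lemma holomorphic2_on_G:
  assumes "holomorphic2_on f S" "open S" "\<And>t. t \<in> S \<Longrightarrow> f t \<noteq> 0"
  shows "holomorphic2_on (G1 f) S" "holomorphic2_on (G2 f) S"
proof -
  have eq: "G1 f = (\<lambda>t. Dq1 f t / f t)" "G2 f = (\<lambda>t. Dq2 f t / f t)"
    by (simp_all add: fun_eq_iff G1_def G2_def)
  show "holomorphic2_on (G1 f) S" "holomorphic2_on (G2 f) S"
    unfolding eq
    by (rule holomorphic2_on_divide(1)[OF holomorphic2_on_Dq(1)[OF assms(1,2)] assms(1,2,3)], assumption)
       (rule holomorphic2_on_divide(1)[OF holomorphic2_on_Dq(2)[OF assms(1,2)] assms(1,2,3)], assumption)
qed

lemma Dq_mult:
  assumes "holomorphic2_on f S" "holomorphic2_on g S" "open S" "t \<in> S"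
  shows "Dq1 (\<lambda>t. f t * g t) t = f t * Dq1 g t + Dq1 f t * g t"
    and "Dq2 (\<lambda>t. f t * g t) t = f t * Dq2 g t + Dq2 f t * g t"
  using holomorphic2_on_mult(2,3)[OF assms(1-3), of "fst t" "snd t"] assms(4)
  by (simp_all add: Dq1_eq Dq2_eq add_divide_distrib)

lemma Dq_add:
  assumes "holomorphic2_on f S" "holomorphic2_on g S" "open S" "t \<in> S"
  shows "Dq1 (\<lambda>t. f t + g t) t = Dq1 f t + Dq1 g t"
    and "Dq2 (\<lambda>t. f t + g t) t = Dq2 f t + Dq2 g t"
  using holomorphic2_on_add(2,3)[OF assms(1-3), of "fst t" "snd t"] assms(4)
  by (simp_all add: Dq1_eq Dq2_eq add_divide_distrib)

lemma Dq_cong: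
  assumes "open U" "t \<in> U" "\<And>z. z \<in> U \<Longrightarrow> f z = g z"
  shows "Dq1 f t = Dq1 g t" "Dq2 f t = Dq2 g t"
  using pd_cong[OF assms(1) _ assms(3), of "fst t" "snd t"] assms(2) by (simp_all add: Dq1_eq Dq2_eq)

lemma Dx_eq: "Dx \<Phi> w = fst w * pd1 \<Phi> w"
  and Dy_eq: "Dy \<Phi> w = snd w * pd2 \<Phi> w"
  by (simp_all add: Dx_def Dy_def pd1_def pd2_def split: prod.splits)

lemma holomorphic2_on_Dxy:
  assumes "holomorphic2_on \<Phi> V" "open V"
  shows "holomorphic2_on (Dx \<Phi>) V" "holomorphic2_on (Dy \<Phi>) V"
proof -
  have eq: "Dx \<Phi> = (\<lambda>w. fst w * pd1 \<Phi> w)" "Dy \<Phi> = (\<lambda>w. snd w * pd2 \<Phi> w)"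
    by (simp_all add: fun_eq_iff Dx_eq Dy_eq)
  show "holomorphic2_on (Dx \<Phi>) V" "holomorphic2_on (Dy \<Phi>) V"
    unfolding eq
    by (rule holomorphic2_on_mult(1)[OF holomorphic2_on_fst holomorphic2_on_pd1[OF assms] assms(2)])
       (rule holomorphic2_on_mult(1)[OF holomorphic2_on_snd holomorphic2_on_pd2[OF assms] assms(2)])
qed

lemma Dx_Dy_commute:
  assumes "holomorphic2_on \<Phi> V" "open V" "w \<in> V"
  shows "Dy (Dx \<Phi>) w = Dx (Dy \<Phi>) w"
proof -
  obtain u v where w: "w = (u, v)" by force
  have eq: "Dx \<Phi> = (\<lambda>w. fst w * pd1 \<Phi> w)" "Dy \<Phi> = (\<lambda>w. snd w * pd2 \<Phi> w)"
    by (simp_all add: fun_eq_iff Dx_eq Dy_eq)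
  have fst: "pd2 fst (u, v) = (0::complex)" and snd: "pd1 snd (u, v) = (0::complex)"
    by (simp_all add: pd1_def pd2_def)
  have "pd2 (Dx \<Phi>) (u, v) = u * pd2 (pd1 \<Phi>) (u, v)"
    using holomorphic2_on_mult(3)[OF holomorphic2_on_fst holomorphic2_on_pd1[OF assms(1,2)] assms(2), of u v]
      assms(3) w fst eq by simp
  moreover have "pd1 (Dy \<Phi>) (u, v) = v * pd1 (pd2 \<Phi>) (u, v)"
    using holomorphic2_on_mult(2)[OF holomorphic2_on_snd holomorphic2_on_pd2[OF assms(1,2)] assms(2), of u v]
      assms(3) w snd eq by simp
  moreover have "pd2 (pd1 \<Phi>) (u, v) = pd1 (pd2 \<Phi>) (u, v)"
    using pd_commute[OF assms(1,2)] assms(3) w by simp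
  ultimately show ?thesis unfolding Dx_eq Dy_eq w by simp
qed

lemma Dq_compose:
  assumes "holomorphic2_on x U" "holomorphic2_on y U" "holomorphic2_on \<Psi> V" "open U" "open V"
    and "\<And>t. t \<in> U \<Longrightarrow> (x t, y t) \<in> V" "t \<in> U" "x t \<noteq> 0" "y t \<noteq> 0"
  shows "Dq1 (\<lambda>t. \<Psi> (x t, y t)) t = Dx \<Psi> (x t, y t) * G1 x t + Dy \<Psi> (x t, y t) * G1 y t"
    and "Dq2 (\<lambda>t. \<Psi> (x t, y t)) t = Dx \<Psi> (x t, y t) * G2 x t + Dy \<Psi> (x t, y t) * G2 y t"
proof -
  have c: "pd1 (\<lambda>t. \<Psi> (x t, y t)) t = pd1 \<Psi> (x t, y t) * pd1 x t + pd2 \<Psi> (x t, y t) * pd1 y t"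
    "pd2 (\<lambda>t. \<Psi> (x t, y t)) t = pd1 \<Psi> (x t, y t) * pd2 x t + pd2 \<Psi> (x t, y t) * pd2 y t"
    by (rule holomorphic2_on_compose2(2,3)[OF assms(1-3) \<open>open U\<close> \<open>open V\<close> assms(6) \<open>t \<in> U\<close>]; assumption)+
  show "Dq1 (\<lambda>t. \<Psi> (x t, y t)) t = Dx \<Psi> (x t, y t) * G1 x t + Dy \<Psi> (x t, y t) * G1 y t"
    unfolding Dq1_eq G1_def Dx_eq Dy_eq c(1) using assms(8,9) by (simp add: field_simps)
  show "Dq2 (\<lambda>t. \<Psi> (x t, y t)) t = Dx \<Psi> (x t, y t) * G2 x t + Dy \<Psi> (x t, y t) * G2 y t"
    unfolding Dq2_eq G2_def Dx_eq Dy_eq c(2) using assms(8,9) by (simp add: field_simps)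
qed

lemma open_regular_domain: "open (regular_domain F x y)"
  and regular_domain_subset:
    "regular_domain F x y \<subseteq> hol_points F" "regular_domain F x y \<subseteq> hol_points x" "regular_domain F x y \<subseteq> hol_points y"
    "regular_domain F x y \<subseteq> HH"
proof -
  define W where "W = {t \<in> hol_points F \<inter> hol_points x \<inter> hol_points y. F t \<noteq> 0 \<and> x t \<noteq> 0 \<and> y t \<noteq> 0}"
  let ?W0 = "hol_points F \<inter> hol_points x \<inter> hol_points y"
  have c: "continuous_on ?W0 F" "continuous_on ?W0 x" "continuous_on ?W0 y"
    by (auto intro: continuous_on_subset[OF holomorphic2_on_imp_continuous_on[OF holomorphic2_on_hol_points]])
  have "continuous_on ?W0 (\<lambda>t. F t * x t * y t)" by (intro continuous_intros c)
  moreover have "open ?W0" by (intro open_Int open_hol_points)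
  ultimately have "open (?W0 \<inter> (\<lambda>t. F t * x t * y t) -` (- {0}))"
    by (intro continuous_open_preimage) auto
  moreover have "?W0 \<inter> (\<lambda>t. F t * x t * y t) -` (- {0}) = W" unfolding W_def by auto
  ultimately have W: "open W" by simp
  have h: "holomorphic2_on x W" "holomorphic2_on y W"
    by (auto intro!: holomorphic2_on_subset[OF holomorphic2_on_hol_points] simp: W_def)
  have g: "continuous_on W (G1 x)" "continuous_on W (G2 x)" "continuous_on W (G1 y)" "continuous_on W (G2 y)"
    by (rule holomorphic2_on_imp_continuous_on, rule holomorphic2_on_G; use h W in \<open>auto simp: W_def\<close>)+
  have "continuous_on W (coeff_N x y)"
    unfolding coeff_N_def[abs_def] by (intro continuous_intros g)
  then have "open (W \<inter> coeff_N x y -` (- {0}))"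
    by (intro continuous_open_preimage W) auto
  moreover have "W \<inter> coeff_N x y -` (- {0}) = regular_domain F x y"
    unfolding W_def regular_domain_def by auto
  ultimately show "open (regular_domain F x y)" by simp
  show "regular_domain F x y \<subseteq> hol_points F" "regular_domain F x y \<subseteq> hol_points x" "regular_domain F x y \<subseteq> hol_points y"
    "regular_domain F x y \<subseteq> HH"
    using hol_points_subset[of F] unfolding regular_domain_def by auto
qed

lemma regular_domain_holomorphic:
  "holomorphic2_on F (regular_domain F x y)" "holomorphic2_on x (regular_domain F x y)"
  "holomorphic2_on y (regular_domain F x y)"
  by (rule holomorphic2_on_subset[OF holomorphic2_on_hol_points regular_domain_subset(1)]
      holomorphic2_on_subset[OF holomorphic2_on_hol_points regular_domain_subset(2)]
      holomorphic2_on_subset[OF holomorphic2_on_hol_points regular_domain_subset(3)])+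

lemma regular_domainD:
  assumes "t \<in> regular_domain F x y"
  shows "F t \<noteq> 0" "x t \<noteq> 0" "y t \<noteq> 0" "coeff_N x y t \<noteq> 0"
  using assms by (auto simp: regular_domain_def)

text \<open>\<open>coeff_N\<close> is a difference of two squares, and its factor
  \<open>G1 x * G2 y - G1 y * G2 x\<close> is the Jacobian of \<open>(x, y)\<close> divided by
  \<open>(2 * pi * i)^2 * x * y\<close>.\<close>

lemma regular_domain_Jacobian:
  assumes "t \<in> regular_domain F x y"
  shows "pd1 x t * pd2 y t - pd2 x t * pd1 y t \<noteq> 0"
proof
  assume 0: "pd1 x t * pd2 y t - pd2 x t * pd1 y t = 0"
  have "G1 x t * G2 y t - G1 y t * G2 x t =
      (pd1 x t * pd2 y t - pd2 x t * pd1 y t) / ((2 * of_real pi * \<i>)^2 * x t * y t)"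
    unfolding G1_def G2_def Dq1_eq Dq2_eq by (simp add: power2_eq_square diff_divide_distrib mult_ac)
  then have *: "G1 x t * G2 y t = G1 y t * G2 x t" using 0 by simp
  have "coeff_N x y t = (G1 x t * G2 y t)^2 - (G1 y t * G2 x t)^2"
    by (simp add: coeff_N_def power_mult_distrib)
  then show False using * regular_domainD(4)[OF assms] by simp
qed

text \<open>Cramer's rule for the unknowns \<open>A\<close> and \<open>C\<close>, with determinant
  \<open>N\<close>. The coefficient of \<open>B\<close> has a shorter denominator since
  \<open>p * s - r * q\<close> divides both its numerator and \<open>N\<close>.\<close>

lemma linear_system_solution:
  fixes p q r s A B C P Q F X1 X2 Y1 Y2 Z1 Z2 :: complex
  assumes e1: "p^2 * A + 2 * p * r * B + r^2 * C + X1 * P + Y1 * Q = Z1 * F"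
    and e2: "q^2 * A + 2 * q * s * B + s^2 * C + X2 * P + Y2 * Q = Z2 * F"
    and N: "N = p^2 * s^2 - r^2 * q^2" "N \<noteq> 0"
  shows "A + 2 * r * s / (p * s + r * q) * B + (s^2 * X1 - r^2 * X2) / N * P
     + (s^2 * Y1 - r^2 * Y2) / N * Q + - ((s^2 * Z1 - r^2 * Z2) / N) * F = 0"
    and "C + 2 * p * q / (p * s + r * q) * B + (- (q^2) * X1 + p^2 * X2) / N * P
     + (- (q^2) * Y1 + p^2 * Y2) / N * Q + - ((- (q^2) * Z1 + p^2 * Z2) / N) * F = 0"
proof -
  have Nf: "N = (p * s + r * q) * (p * s - r * q)" using N(1) by (simp add: algebra_simps power2_eq_square)
  then have nz: "p * s + r * q \<noteq> 0" "p * s - r * q \<noteq> 0" using N(2) by auto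
  have frac: "A + m / N * B + u / N * P + v / N * Q + - (w / N) * F = (N * A + m * B + u * P + v * Q - w * F) / N"
    for A m u v w using N(2) by (simp add: field_simps)
  have a0: "2 * r * s / (p * s + r * q) = 2 * r * s * (p * s - r * q) / N"
    and b0: "2 * p * q / (p * s + r * q) = 2 * p * q * (p * s - r * q) / N"
    using nz by (simp_all add: Nf)
  have "N * A + 2 * r * s * (p * s - r * q) * B + (s^2 * X1 - r^2 * X2) * P
     + (s^2 * Y1 - r^2 * Y2) * Q - (s^2 * Z1 - r^2 * Z2) * F
    = s^2 * ((p^2 * A + 2 * p * r * B + r^2 * C + X1 * P + Y1 * Q) - Z1 * F)
      - r^2 * ((q^2 * A + 2 * q * s * B + s^2 * C + X2 * P + Y2 * Q) - Z2 * F)"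
    unfolding N(1) by (simp add: algebra_simps power2_eq_square)
  then have 1: "N * A + 2 * r * s * (p * s - r * q) * B + (s^2 * X1 - r^2 * X2) * P
     + (s^2 * Y1 - r^2 * Y2) * Q - (s^2 * Z1 - r^2 * Z2) * F = 0"
    unfolding e1 e2 by simp
  have "N * C + 2 * p * q * (p * s - r * q) * B + (- (q^2) * X1 + p^2 * X2) * P
     + (- (q^2) * Y1 + p^2 * Y2) * Q - (- (q^2) * Z1 + p^2 * Z2) * F
    = p^2 * ((q^2 * A + 2 * q * s * B + s^2 * C + X2 * P + Y2 * Q) - Z2 * F)
      - q^2 * ((p^2 * A + 2 * p * r * B + r^2 * C + X1 * P + Y1 * Q) - Z1 * F)"
    unfolding N(1) by (simp add: algebra_simps power2_eq_square)
  then have 2: "N * C + 2 * p * q * (p * s - r * q) * B + (- (q^2) * X1 + p^2 * X2) * P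
     + (- (q^2) * Y1 + p^2 * Y2) * Q - (- (q^2) * Z1 + p^2 * Z2) * F = 0"
    unfolding e1 e2 by simp
  have "A + 2 * r * s / (p * s + r * q) * B + (s^2 * X1 - r^2 * X2) / N * P
     + (s^2 * Y1 - r^2 * Y2) / N * Q + - ((s^2 * Z1 - r^2 * Z2) / N) * F
    = (N * A + 2 * r * s * (p * s - r * q) * B + (s^2 * X1 - r^2 * X2) * P
     + (s^2 * Y1 - r^2 * Y2) * Q - (s^2 * Z1 - r^2 * Z2) * F) / N"
    unfolding a0 by (rule frac)
  then show "A + 2 * r * s / (p * s + r * q) * B + (s^2 * X1 - r^2 * X2) / N * P
     + (s^2 * Y1 - r^2 * Y2) / N * Q + - ((s^2 * Z1 - r^2 * Z2) / N) * F = 0" using 1 by simp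
  have "C + 2 * p * q / (p * s + r * q) * B + (- (q^2) * X1 + p^2 * X2) / N * P
     + (- (q^2) * Y1 + p^2 * Y2) / N * Q + - ((- (q^2) * Z1 + p^2 * Z2) / N) * F
    = (N * C + 2 * p * q * (p * s - r * q) * B + (- (q^2) * X1 + p^2 * X2) * P
     + (- (q^2) * Y1 + p^2 * Y2) * Q - (- (q^2) * Z1 + p^2 * Z2) * F) / N"
    unfolding b0 by (rule frac)
  then show "C + 2 * p * q / (p * s + r * q) * B + (- (q^2) * X1 + p^2 * X2) / N * P
     + (- (q^2) * Y1 + p^2 * Y2) / N * Q + - ((- (q^2) * Z1 + p^2 * Z2) / N) * F = 0" using 2 by simp
qed

text \<open>The first-order chain rule is kept in the form
  \<open>F * G F = Dx \<Phi> * G x + Dy \<Phi> * G y\<close> and differentiated once more in the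
  same variable; equality of mixed derivatives merges the two cross terms.\<close>

lemma second_derivative_identity:
  assumes hF: "holomorphic2_on F U" and hx: "holomorphic2_on x U" and hy: "holomorphic2_on y U"
    and hP: "holomorphic2_on \<Phi> V" and op: "open U" "open V"
    and nz: "\<And>t. t \<in> U \<Longrightarrow> F t \<noteq> 0" "\<And>t. t \<in> U \<Longrightarrow> x t \<noteq> 0" "\<And>t. t \<in> U \<Longrightarrow> y t \<noteq> 0"
    and UV: "\<And>t. t \<in> U \<Longrightarrow> (x t, y t) \<in> V" and FP: "\<And>t. t \<in> U \<Longrightarrow> F t = \<Phi> (x t, y t)"
    and t: "t \<in> U"
  shows "(G1 x t)^2 * Dx (Dx \<Phi>) (x t, y t) + 2 * G1 x t * G1 y t * Dx (Dy \<Phi>) (x t, y t)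
      + (G1 y t)^2 * Dy (Dy \<Phi>) (x t, y t) + (Dq1 (G1 x) t - 2 * G1 F t * G1 x t) * Dx \<Phi> (x t, y t)
      + (Dq1 (G1 y) t - 2 * G1 F t * G1 y t) * Dy \<Phi> (x t, y t)
      = (Dq1 (G1 F) t - (G1 F t)^2) * \<Phi> (x t, y t)"
    and "(G2 x t)^2 * Dx (Dx \<Phi>) (x t, y t) + 2 * G2 x t * G2 y t * Dx (Dy \<Phi>) (x t, y t)
      + (G2 y t)^2 * Dy (Dy \<Phi>) (x t, y t) + (Dq2 (G2 x) t - 2 * G2 F t * G2 x t) * Dx \<Phi> (x t, y t)
      + (Dq2 (G2 y) t - 2 * G2 F t * G2 y t) * Dy \<Phi> (x t, y t)
      = (Dq2 (G2 F) t - (G2 F t)^2) * \<Phi> (x t, y t)"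
proof -
  let ?P = "\<lambda>t. Dx \<Phi> (x t, y t)" and ?Q = "\<lambda>t. Dy \<Phi> (x t, y t)"
  have hG: "holomorphic2_on (G1 F) U" "holomorphic2_on (G2 F) U" "holomorphic2_on (G1 x) U"
    "holomorphic2_on (G2 x) U" "holomorphic2_on (G1 y) U" "holomorphic2_on (G2 y) U"
    by (rule holomorphic2_on_G[OF hF op(1) nz(1)] holomorphic2_on_G[OF hx op(1) nz(2)]
        holomorphic2_on_G[OF hy op(1) nz(3)]; assumption)+
  note hD = holomorphic2_on_Dxy[OF hP op(2)]
  have hPQ: "holomorphic2_on ?P U" "holomorphic2_on ?Q U"
    by (rule holomorphic2_on_compose2(1)[OF hx hy hD(1) op UV] holomorphic2_on_compose2(1)[OF hx hy hD(2) op UV]; assumption)+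
  have F1: "F t * G1 F t = ?P t * G1 x t + ?Q t * G1 y t"
    and F2: "F t * G2 F t = ?P t * G2 x t + ?Q t * G2 y t" if "t \<in> U" for t
  proof -
    have "Dq1 F t = Dq1 (\<lambda>t. \<Phi> (x t, y t)) t" "Dq2 F t = Dq2 (\<lambda>t. \<Phi> (x t, y t)) t"
      by (rule Dq_cong[OF op(1) that FP], assumption)+
    then show "F t * G1 F t = ?P t * G1 x t + ?Q t * G1 y t" "F t * G2 F t = ?P t * G2 x t + ?Q t * G2 y t"
      using Dq_compose[OF hx hy hP op UV that nz(2,3)[OF that]] nz(1)[OF that] by (simp_all add: G1_def G2_def)
  qed
  have cP: "Dq1 ?P t = Dx (Dx \<Phi>) (x t, y t) * G1 x t + Dy (Dx \<Phi>) (x t, y t) * G1 y t"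
      "Dq2 ?P t = Dx (Dx \<Phi>) (x t, y t) * G2 x t + Dy (Dx \<Phi>) (x t, y t) * G2 y t"
    by (rule Dq_compose[OF hx hy hD(1) op UV t nz(2,3)[OF t]]; assumption)+
  have cQ: "Dq1 ?Q t = Dx (Dy \<Phi>) (x t, y t) * G1 x t + Dy (Dy \<Phi>) (x t, y t) * G1 y t"
      "Dq2 ?Q t = Dx (Dy \<Phi>) (x t, y t) * G2 x t + Dy (Dy \<Phi>) (x t, y t) * G2 y t"
    by (rule Dq_compose[OF hx hy hD(2) op UV t nz(2,3)[OF t]]; assumption)+
  have comm: "Dy (Dx \<Phi>) (x t, y t) = Dx (Dy \<Phi>) (x t, y t)"
    by (rule Dx_Dy_commute[OF hP op(2) UV[OF t]])
  have DF: "Dq1 F t = F t * G1 F t" "Dq2 F t = F t * G2 F t"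
    using nz(1)[OF t] by (simp_all add: G1_def G2_def)
  have l1: "Dq1 (\<lambda>t. ?P t * G1 x t + ?Q t * G1 y t) t =
      (?P t * Dq1 (G1 x) t + Dq1 ?P t * G1 x t) + (?Q t * Dq1 (G1 y) t + Dq1 ?Q t * G1 y t)"
    by (subst Dq_add(1)[OF holomorphic2_on_mult(1)[OF hPQ(1) hG(3) op(1)] holomorphic2_on_mult(1)[OF hPQ(2) hG(5) op(1)] op(1) t])
       (simp only: Dq_mult(1)[OF hPQ(1) hG(3) op(1) t] Dq_mult(1)[OF hPQ(2) hG(5) op(1) t])
  have l2: "Dq2 (\<lambda>t. ?P t * G2 x t + ?Q t * G2 y t) t =
      (?P t * Dq2 (G2 x) t + Dq2 ?P t * G2 x t) + (?Q t * Dq2 (G2 y) t + Dq2 ?Q t * G2 y t)"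
    by (subst Dq_add(2)[OF holomorphic2_on_mult(1)[OF hPQ(1) hG(4) op(1)] holomorphic2_on_mult(1)[OF hPQ(2) hG(6) op(1)] op(1) t])
       (simp only: Dq_mult(2)[OF hPQ(1) hG(4) op(1) t] Dq_mult(2)[OF hPQ(2) hG(6) op(1) t])
  have "Dq1 (\<lambda>t. F t * G1 F t) t = Dq1 (\<lambda>t. ?P t * G1 x t + ?Q t * G1 y t) t"
    by (rule Dq_cong[OF op(1) t F1])
  then have e1: "F t * Dq1 (G1 F) t + F t * G1 F t * G1 F t =
     (?P t * Dq1 (G1 x) t + (Dx (Dx \<Phi>) (x t, y t) * G1 x t + Dx (Dy \<Phi>) (x t, y t) * G1 y t) * G1 x t)
     + (?Q t * Dq1 (G1 y) t + (Dx (Dy \<Phi>) (x t, y t) * G1 x t + Dy (Dy \<Phi>) (x t, y t) * G1 y t) * G1 y t)"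
    unfolding Dq_mult(1)[OF hF hG(1) op(1) t] l1 cP cQ comm DF .
  have "Dq2 (\<lambda>t. F t * G2 F t) t = Dq2 (\<lambda>t. ?P t * G2 x t + ?Q t * G2 y t) t"
    by (rule Dq_cong[OF op(1) t F2])
  then have e2: "F t * Dq2 (G2 F) t + F t * G2 F t * G2 F t =
     (?P t * Dq2 (G2 x) t + (Dx (Dx \<Phi>) (x t, y t) * G2 x t + Dx (Dy \<Phi>) (x t, y t) * G2 y t) * G2 x t)
     + (?Q t * Dq2 (G2 y) t + (Dx (Dy \<Phi>) (x t, y t) * G2 x t + Dy (Dy \<Phi>) (x t, y t) * G2 y t) * G2 y t)"
    unfolding Dq_mult(2)[OF hF hG(2) op(1) t] l2 cP cQ comm DF .
  \<comment> \<open>Subtracting \<open>2 * k\<close> times the first-order relation turns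
    \<open>Z + k^2\<close> into \<open>Z - k^2\<close>. The elimination does not force this
    normalisation; it is the one whose second-order expressions transform without extra terms in
    weight one.\<close>
  have *: "g^2 * A + 2 * g * h * B + h^2 * C + (X - 2 * k * g) * P + (Y - 2 * k * h) * Q = (Z - k^2) * f"
    if "f * Z + f * k * k = (P * X + (A * g + B * h) * g) + (Q * Y + (B * g + C * h) * h)"
      and "f * k = P * g + Q * h" for A B C X Y Z P Q f g h k :: complex
  proof -
    have "f * k * k = P * g * k + Q * h * k" using arg_cong[OF that(2), of "\<lambda>z. z * k"] by (simp add: algebra_simps)
    then show ?thesis using that(1) by (simp add: algebra_simps power2_eq_square)
  qed
  show "(G1 x t)^2 * Dx (Dx \<Phi>) (x t, y t) + 2 * G1 x t * G1 y t * Dx (Dy \<Phi>) (x t, y t)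
      + (G1 y t)^2 * Dy (Dy \<Phi>) (x t, y t) + (Dq1 (G1 x) t - 2 * G1 F t * G1 x t) * Dx \<Phi> (x t, y t)
      + (Dq1 (G1 y) t - 2 * G1 F t * G1 y t) * Dy \<Phi> (x t, y t)
      = (Dq1 (G1 F) t - (G1 F t)^2) * \<Phi> (x t, y t)"
    unfolding FP[OF t, symmetric] by (rule *[OF e1 F1[OF t]])
  show "(G2 x t)^2 * Dx (Dx \<Phi>) (x t, y t) + 2 * G2 x t * G2 y t * Dx (Dy \<Phi>) (x t, y t)
      + (G2 y t)^2 * Dy (Dy \<Phi>) (x t, y t) + (Dq2 (G2 x) t - 2 * G2 F t * G2 x t) * Dx \<Phi> (x t, y t)
      + (Dq2 (G2 y) t - 2 * G2 F t * G2 y t) * Dy \<Phi> (x t, y t)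
      = (Dq2 (G2 F) t - (G2 F t)^2) * \<Phi> (x t, y t)"
    unfolding FP[OF t, symmetric] by (rule *[OF e2 F2[OF t]])
qed

lemma local_differential_system:
  assumes "t0 \<in> regular_domain F x y"
  shows "\<exists>U \<Phi>. open U \<and> t0 \<in> U \<and> U \<subseteq> regular_domain F x y \<and>
            inj_on (\<lambda>t. (x t, y t)) U \<and> open ((\<lambda>t. (x t, y t)) ` U) \<and>
            holomorphic2_on \<Phi> ((\<lambda>t. (x t, y t)) ` U) \<and>
            (\<forall>t\<in>U. F t = \<Phi> (x t, y t)) \<and>
            (\<forall>t\<in>U.
               Dx (Dx \<Phi>) (x t, y t) + coeff_a0 x y t * Dx (Dy \<Phi>) (x t, y t)
                 + coeff_a1 F x y t * Dx \<Phi> (x t, y t) + coeff_a2 F x y t * Dy \<Phi> (x t, y t)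
                 + coeff_a3 F x y t * \<Phi> (x t, y t) = 0 \<and>
               Dy (Dy \<Phi>) (x t, y t) + coeff_b0 x y t * Dx (Dy \<Phi>) (x t, y t)
                 + coeff_b1 F x y t * Dx \<Phi> (x t, y t) + coeff_b2 F x y t * Dy \<Phi> (x t, y t)
                 + coeff_b3 F x y t * \<Phi> (x t, y t) = 0)"
proof -
  let ?S = "regular_domain F x y"
  obtain U V g where U: "open U" "t0 \<in> U" "U \<subseteq> ?S" and V: "open V"
    and h: "homeomorphism U V (\<lambda>t. (x t, y t)) g"
    and g: "holomorphic2_on (\<lambda>z. fst (g z)) V" "holomorphic2_on (\<lambda>z. snd (g z)) V"
    by (rule holomorphic2_local_inverse[OF regular_domain_holomorphic(2,3) open_regular_domain assms regular_domain_Jacobian])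
  have im: "(\<lambda>t. (x t, y t)) ` U = V" and inj: "inj_on (\<lambda>t. (x t, y t)) U"
    using h unfolding homeomorphism_def by (auto intro: inj_on_inverseI)
  have gU: "g z \<in> U" if "z \<in> V" for z using h that unfolding homeomorphism_def by blast
  have gt: "g (x t, y t) = t" if "t \<in> U" for t using h that unfolding homeomorphism_def by blast
  define \<Phi> where "\<Phi> = (\<lambda>z. F (fst (g z), snd (g z)))"
  note sub = holomorphic2_on_subset[OF _ U(3)]
  note hol = sub[OF regular_domain_holomorphic(1)] sub[OF regular_domain_holomorphic(2)] sub[OF regular_domain_holomorphic(3)]
  have P: "holomorphic2_on \<Phi> V"
    unfolding \<Phi>_def by (rule holomorphic2_on_compose2(1)[OF g hol(1) V U(1)]) (simp add: gU)
  have FP: "F t = \<Phi> (x t, y t)" if "t \<in> U" for t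
    using gt[OF that] by (simp add: \<Phi>_def)
  have UV: "(x t, y t) \<in> V" if "t \<in> U" for t using im that by blast
  have nz: "F t \<noteq> 0" "x t \<noteq> 0" "y t \<noteq> 0" "coeff_N x y t \<noteq> 0" if "t \<in> U" for t
    using regular_domainD[of t F x y] that U(3) by auto
  have pde: "Dx (Dx \<Phi>) (x t, y t) + coeff_a0 x y t * Dx (Dy \<Phi>) (x t, y t)
                 + coeff_a1 F x y t * Dx \<Phi> (x t, y t) + coeff_a2 F x y t * Dy \<Phi> (x t, y t)
                 + coeff_a3 F x y t * \<Phi> (x t, y t) = 0 \<and>
               Dy (Dy \<Phi>) (x t, y t) + coeff_b0 x y t * Dx (Dy \<Phi>) (x t, y t)
                 + coeff_b1 F x y t * Dx \<Phi> (x t, y t) + coeff_b2 F x y t * Dy \<Phi> (x t, y t)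
                 + coeff_b3 F x y t * \<Phi> (x t, y t) = 0" if t: "t \<in> U" for t
    unfolding coeff_a0_def coeff_a1_def coeff_a2_def coeff_a3_def coeff_b0_def coeff_b1_def coeff_b2_def coeff_b3_def
    using linear_system_solution[OF second_derivative_identity[OF hol P U(1) V nz(1,2,3) UV FP t] coeff_N_def nz(4)[OF t]]
    by blast
  show ?thesis
    unfolding im
    using U inj V P FP pde by (intro exI[of _ U] exI[of _ \<Phi>] conjI ballI) (fact | simp only: im)+
qed

section \<open>Counting zeros in a disc\<close>

text \<open>The degree is bounded by \<open>n\<close> in each variable separately: there are
  \<open>(n + 1)^3\<close> coefficients, and the power \<open>3 * n\<close> of a common denominator
  clears all poles.\<close>

definition eval3 :: "nat \<Rightarrow> (nat \<Rightarrow> nat \<Rightarrow> nat \<Rightarrow> complex) \<Rightarrow> complex \<Rightarrow> complex \<Rightarrow> complex \<Rightarrow> complex" where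
  "eval3 n c u v w = (\<Sum>i\<le>n. \<Sum>j\<le>n. \<Sum>k\<le>n. c i j k * u ^ i * v ^ j * w ^ k)"

text \<open>Isolated zeros are mostly used in this weaker form, since countability survives
  countable unions over matrices, cusps and slices.\<close>

lemma meromorphic_zeros_countable:
  assumes "f meromorphic_on S" "open S" "connected S" "\<not> (\<forall>\<^sub>\<approx>z\<in>S. f z = 0)"
  shows "countable {z \<in> S. f z = 0}"
proof -
  have "\<forall>\<^sub>\<approx>z\<in>S. f z \<noteq> 0"
    using meromorphic_imp_constant_or_avoid[OF assms(1-3), of 0] assms(4) by blast
  then have "countable (S \<inter> {z. \<not> f z \<noteq> 0})"
    by (intro sparse_imp_countable assms(2)) (simp add: eventually_cosparse)
  then show ?thesis by (simp add: Int_def)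
qed

lemma holomorphic_zeros_countable:
  assumes f: "f holomorphic_on S" and S: "open S" "connected S" and a: "a \<in> S" "f a \<noteq> 0"
  shows "countable {z \<in> S. f z = 0}"
proof (rule meromorphic_zeros_countable[OF _ S])
  show "f meromorphic_on S"
    using f S(1) by (simp add: analytic_on_open analytic_on_imp_meromorphic_on)
  show "\<not> (\<forall>\<^sub>\<approx>z\<in>S. f z = 0)"
  proof
    assume "\<forall>\<^sub>\<approx>z\<in>S. f z = 0"
    then have "eventually (\<lambda>z. f z = 0) (at a)" using a(1) eventually_cosparse_imp_eventually_at by blast
    then have "f \<midarrow>a\<rightarrow> 0" by (rule tendsto_eventually)
    moreover have "f \<midarrow>a\<rightarrow> f a"
      using f S(1) a(1) by (metis continuous_on_eq_continuous_at holomorphic_on_imp_continuous_on isContD)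
    ultimately show False using a(2) LIM_unique by blast
  qed
qed

lemma holomorphic_maximum_disc:
  assumes "G holomorphic_on ball 0 r1" "0 < R" "R < r1" "\<And>q. cmod q = R \<Longrightarrow> cmod (G q) \<le> M" "cmod q \<le> R"
  shows "cmod (G q) \<le> M"
proof (rule maximum_modulus_frontier[where S = "cball 0 R" and f = G and \<xi> = q])
  show "G holomorphic_on interior (cball 0 R)"
    using assms by (intro holomorphic_on_subset[OF assms(1)]) auto
  have "continuous_on (cball 0 R) G"
    using assms(3) by (intro holomorphic_on_imp_continuous_on holomorphic_on_subset[OF assms(1)]) auto
  then show "continuous_on (closure (cball 0 R)) G" by simp
  show "cmod (G z) \<le> M" if "z \<in> frontier (cball 0 R)" for z
    using that by (intro assms(4)) (simp add: frontier_cball)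
  show "bounded (cball 0 R :: complex set)" by simp
  show "q \<in> cball 0 R" using assms(5) by simp
qed

text \<open>The identity \<open>|R^2 - cnj z * q|^2 - R^2 * |q - z|^2 = (R^2 - |q|^2) * (R^2 -
  |z|^2)\<close> bounds the defect of the Blaschke factor from below. Comparing it with
  \<open>|R^2 - cnj z * q| \<le> R^2 + \<rho>^2\<close> gives a constant that depends on
  \<open>R\<close> and \<open>\<rho>\<close> only.\<close>

lemma Blaschke_factor_bound:
  assumes "0 < R" "cmod q \<le> \<rho>" "cmod z \<le> \<rho>" "\<rho> < R"
  shows "cmod ((q - z) * of_real R) \<le> sqrt (1 - ((R\<^sup>2 - \<rho>\<^sup>2) / (R\<^sup>2 + \<rho>\<^sup>2))\<^sup>2) * cmod (of_real (R\<^sup>2) - cnj z * q)"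
proof -
  let ?D = "of_real (R\<^sup>2) - cnj z * q"
  have \<rho>: "0 \<le> \<rho>" using assms(2) norm_ge_zero order_trans by blast
  have sq: "\<rho>\<^sup>2 < R\<^sup>2" "(cmod q)\<^sup>2 \<le> \<rho>\<^sup>2" "(cmod z)\<^sup>2 \<le> \<rho>\<^sup>2"
    using assms \<rho> by (simp_all add: power_strict_mono power_mono)
  have id: "(cmod ?D)\<^sup>2 - (cmod ((q - z) * of_real R))\<^sup>2 = (R\<^sup>2 - (cmod q)\<^sup>2) * (R\<^sup>2 - (cmod z)\<^sup>2)"
    unfolding cmod_power2 by (simp add: algebra_simps power2_eq_square)
  have "cmod ?D \<le> R\<^sup>2 + cmod z * cmod q"
    using norm_triangle_ineq4[of "of_real (R\<^sup>2)" "cnj z * q"] by (simp add: norm_mult norm_power)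
  also have "cmod z * cmod q \<le> \<rho>\<^sup>2"
    using assms \<rho> by (simp add: power2_eq_square mult_mono)
  finally have D: "cmod ?D \<le> R\<^sup>2 + \<rho>\<^sup>2" by simp
  have pos: "R\<^sup>2 + \<rho>\<^sup>2 > 0" using assms(1) by (simp add: add_pos_nonneg)
  have "((R\<^sup>2 - \<rho>\<^sup>2) / (R\<^sup>2 + \<rho>\<^sup>2))\<^sup>2 * (cmod ?D)\<^sup>2 \<le> ((R\<^sup>2 - \<rho>\<^sup>2) / (R\<^sup>2 + \<rho>\<^sup>2))\<^sup>2 * (R\<^sup>2 + \<rho>\<^sup>2)\<^sup>2"
    using D by (intro mult_left_mono power_mono) auto
  also have "\<dots> = (R\<^sup>2 - \<rho>\<^sup>2) * (R\<^sup>2 - \<rho>\<^sup>2)"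
    using pos by (simp add: power_divide power2_eq_square)
  also have "\<dots> \<le> (R\<^sup>2 - (cmod q)\<^sup>2) * (R\<^sup>2 - (cmod z)\<^sup>2)"
    using sq by (intro mult_mono) auto
  finally have "(cmod ((q - z) * of_real R))\<^sup>2 \<le> (1 - ((R\<^sup>2 - \<rho>\<^sup>2) / (R\<^sup>2 + \<rho>\<^sup>2))\<^sup>2) * (cmod ?D)\<^sup>2"
    using id by (simp add: algebra_simps)
  then have "sqrt ((cmod ((q - z) * of_real R))\<^sup>2) \<le> sqrt ((1 - ((R\<^sup>2 - \<rho>\<^sup>2) / (R\<^sup>2 + \<rho>\<^sup>2))\<^sup>2) * (cmod ?D)\<^sup>2)"
    by (rule real_sqrt_le_mono)
  then show ?thesis by (simp add: real_sqrt_mult)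
qed

text \<open>Each zero is divided out by its Blaschke factor, which has modulus one on the circle of
  radius \<open>R\<close>: the bound \<open>M\<close> there survives, and every zero contributes one
  factor to the estimate inside.\<close>

lemma Schwarz_many_zeros:
  assumes R: "0 < R" "R < r1" and \<rho>: "0 \<le> \<rho>" "\<rho> < R"
    and Z: "finite Z" "Z \<subseteq> cball 0 \<rho>"
    and G: "G holomorphic_on ball 0 r1" "\<And>z. z \<in> Z \<Longrightarrow> G z = 0"
      "\<And>q. cmod q = R \<Longrightarrow> cmod (G q) \<le> M"
    and q: "cmod q \<le> \<rho>"
  shows "cmod (G q) \<le> sqrt (1 - ((R\<^sup>2 - \<rho>\<^sup>2) / (R\<^sup>2 + \<rho>\<^sup>2))\<^sup>2) ^ card Z * M"
  using Z G
proof (induction Z arbitrary: G rule: finite_induct)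
  case empty
  then show ?case using holomorphic_maximum_disc[OF empty(2) R, of M q] q \<rho> by simp
next
  case (insert z Z)
  define \<kappa> where "\<kappa> = sqrt (1 - ((R\<^sup>2 - \<rho>\<^sup>2) / (R\<^sup>2 + \<rho>\<^sup>2))\<^sup>2)"
  have z: "cmod z \<le> \<rho>" "z \<in> ball 0 r1" using insert.prems(1) \<rho> R by auto
  define g where "g = (\<lambda>w. if w = z then deriv G z else (G w - G z) / (w - z))"
  have g: "g holomorphic_on ball 0 r1"
    unfolding g_def by (rule pole_lemma_open[OF insert.prems(2)]) simp
  have Gz: "G z = 0" using insert.prems(3) by simp
  have Gg: "G w = (w - z) * g w" for w by (auto simp: g_def Gz)
  \<comment> \<open>\<open>G\<close> divided by the Blaschke factor of \<open>z\<close>. The zero of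
    \<open>G\<close> cancels the pole, and \<open>|R^2 - cnj z * w| = R * |w - z|\<close> on the
    circle.\<close>
  define G' where "G' = (\<lambda>w. g w * ((of_real (R\<^sup>2) - cnj z * w) / of_real R))"
  have hG': "G' holomorphic_on ball 0 r1"
    unfolding G'_def using R by (intro holomorphic_intros g) auto
  have bd: "cmod (G' w) \<le> M" if w: "cmod w = R" for w
  proof -
    have "w * cnj w = of_real (R\<^sup>2)" using w by (metis complex_norm_square of_real_power)
    then have "of_real (R\<^sup>2) - cnj z * w = w * cnj (w - z)" by (simp add: algebra_simps)
    then have "cmod (of_real (R\<^sup>2) - cnj z * w) = R * cmod (w - z)"
      using w by (metis complex_mod_cnj norm_mult)
    then have "cmod (G' w) = cmod (g w) * cmod (w - z)"
      using R by (simp add: G'_def norm_mult norm_divide)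
    also have "\<dots> = cmod (G w)" by (simp add: Gg norm_mult)
    finally show ?thesis using insert.prems(4)[OF w] by simp
  qed
  have zero: "G' w = 0" if "w \<in> Z" for w
    using insert.prems(3)[of w] that insert.hyps(2) Gg[of w] by (auto simp: G'_def)
  have IH: "cmod (G' q) \<le> \<kappa> ^ card Z * M"
    unfolding \<kappa>_def by (rule insert.IH[OF _ hG' zero bd]) (use insert.prems(1) in auto)
  have D: "of_real (R\<^sup>2) - cnj z * q \<noteq> 0"
  proof
    assume "of_real (R\<^sup>2) - cnj z * q = 0"
    then have "cmod (cnj z * q) = R\<^sup>2" by (metis eq_iff_diff_eq_0 norm_of_real abs_of_nonneg zero_le_power2)
    moreover have "cmod z * cmod q \<le> \<rho> * \<rho>" using z(1) q \<rho> by (intro mult_mono) auto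
    moreover have "\<rho> * \<rho> < R * R" using \<rho> R by (intro mult_strict_mono') auto
    ultimately show False by (simp add: norm_mult power2_eq_square)
  qed
  have "cmod (G q) = cmod ((q - z) * of_real R) * cmod (g q) / R" using R by (simp add: Gg norm_mult)
  also have "\<dots> \<le> (\<kappa> * cmod (of_real (R\<^sup>2) - cnj z * q)) * cmod (g q) / R"
    unfolding \<kappa>_def using Blaschke_factor_bound[OF R(1) q z(1) \<rho>(2)] R
    by (intro divide_right_mono mult_right_mono) auto
  also have "\<dots> = \<kappa> * cmod (G' q)" using R by (simp add: G'_def norm_mult norm_divide)
  also have "\<dots> \<le> \<kappa> * (\<kappa> ^ card Z * M)"
  proof (intro mult_left_mono IH)
    have "(R\<^sup>2 - \<rho>\<^sup>2) / (R\<^sup>2 + \<rho>\<^sup>2) \<le> 1" "0 \<le> (R\<^sup>2 - \<rho>\<^sup>2) / (R\<^sup>2 + \<rho>\<^sup>2)"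
      using R \<rho> by (auto simp: divide_simps add_pos_nonneg power_mono)
    then have "((R\<^sup>2 - \<rho>\<^sup>2) / (R\<^sup>2 + \<rho>\<^sup>2))\<^sup>2 \<le> 1" by (rule power_le_one[rotated])
    then show "\<kappa> \<ge> 0" by (simp add: \<kappa>_def)
  qed
  also have "\<dots> = \<kappa> ^ card (insert z Z) * M" using insert.hyps by simp
  finally show ?case unfolding \<kappa>_def .
qed

text \<open>Only finitely many poles lie in the smaller closed disc, so a polynomial with zeros of
  matching orders clears them. That \<open>Q\<close> vanishes at poles only is used later: each zero
  of \<open>Q\<close> has to be a point near which some expansion is large.\<close>

lemma denominator_single:
  assumes f: "f nicely_meromorphic_on ball 0 1" and r: "r < 1"
  shows "\<exists>Q g. Q holomorphic_on UNIV \<and> g holomorphic_on ball 0 r \<and> finite {w. Q w = 0} \<and>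
    (\<forall>w. Q w = 0 \<longrightarrow> w \<in> cball 0 r \<and> is_pole f w) \<and>
    (\<forall>q\<in>ball 0 r. \<not> is_pole f q \<longrightarrow> g q = Q q * f q)"
proof -
  have mero: "f meromorphic_on ball 0 1" using f by (simp add: nicely_meromorphic_on_def)
  define P where "P = {w \<in> cball 0 r. is_pole f w}"
  have "{w. is_pole f w} sparse_in ball 0 1"
    using meromorphic_on_imp_not_pole_cosparse[OF mero] by (simp add: eventually_cosparse)
  then have "{w. is_pole f w} sparse_in cball 0 r"
    by (rule sparse_in_subset) (use r in auto)
  then have "finite (cball 0 r \<inter> {w. is_pole f w})"
    by (intro sparse_in_compact_finite) auto
  then have P: "finite P" by (simp add: P_def Int_def)
  \<comment> \<open>The order of the pole; on \<open>P\<close> the integer \<open>zorder f w\<close>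
    is negative, so \<open>nat\<close> truncates nothing.\<close>
  define e where "e = (\<lambda>w. nat (- zorder f w))"
  define Q where "Q = (\<lambda>q. \<Prod>w\<in>P. (q - w) ^ e w)"
  have Q: "Q holomorphic_on A" for A unfolding Q_def by (intro holomorphic_intros)
  have Q0: "Q w = 0 \<Longrightarrow> w \<in> P" for w using P by (auto simp: Q_def)
  have an: "f analytic_on {q}" if "q \<in> ball 0 1" "\<not> is_pole f q" for q
    using nicely_meromorphic_on_imp_analytic_at[OF f that] .
  have Qan: "Q analytic_on {q}" for q using Q[of UNIV] holomorphic_on_imp_analytic_at by blast
  have lim: "\<exists>c. (\<lambda>q. Q q * f q) \<midarrow>z\<rightarrow> c" if z: "z \<in> ball 0 r" for z
  proof (cases "is_pole f z")
    case False
    have "(\<lambda>q. Q q * f q) analytic_on {z}"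
      using an[of z] z r False by (intro analytic_intros Qan) auto
    then show ?thesis using analytic_at_imp_isCont isContD by blast
  next
    case True
    have zP: "z \<in> P" using True z by (auto simp: P_def)
    obtain S where S: "open S" "z \<in> S" "f holomorphic_on S - {z}"
      using meromorphic_on_isolated_singularity[OF meromorphic_on_subset[OF mero, of "{z}"]] z r
        isolated_singularity_at_iff_analytic_nhd analytic_imp_holomorphic by auto
    obtain s where s: "s > 0" "zor_poly f z holomorphic_on cball z s"
      "\<And>w. w \<in> cball z s - {z} \<Longrightarrow> f w = zor_poly f z w / (w - z) ^ e z"
      using zorder_exist_pole[OF S(3,1,2) True] unfolding e_def by blast
    define k where "k = (\<lambda>q. zor_poly f z q * (\<Prod>w\<in>P - {z}. (q - w) ^ e w))"
    have "isCont k z"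
    proof -
      have "k holomorphic_on ball z s" unfolding k_def
        by (intro holomorphic_intros holomorphic_on_subset[OF s(2)]) auto
      then show ?thesis using s(1)
        by (meson centre_in_ball continuous_on_eq_continuous_at holomorphic_on_imp_continuous_on open_ball)
    qed
    then have "k \<midarrow>z\<rightarrow> k z" by (simp add: isContD)
    moreover have "eventually (\<lambda>q. Q q * f q = k q) (at z)"
    proof -
      have "eventually (\<lambda>q. q \<in> ball z s - {z}) (at z)"
        using s(1) by (intro eventually_at_in_open) auto
      then show ?thesis
      proof eventually_elim
        case (elim q)
        have "Q q = (q - z) ^ e z * (\<Prod>w\<in>P - {z}. (q - w) ^ e w)"
          unfolding Q_def by (rule prod.remove[OF P zP])
        then show ?case using s(3)[of q] elim by (auto simp: k_def)
      qed
    qed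
    ultimately have "(\<lambda>q. Q q * f q) \<midarrow>z\<rightarrow> k z" by (simp add: tendsto_cong)
    then show ?thesis by blast
  qed
  define g where "g = remove_sings (\<lambda>q. Q q * f q)"
  have "g analytic_on {z}" if z: "z \<in> ball 0 r" for z
  proof -
    have "(\<lambda>q. Q q * f q) meromorphic_on {z}"
      by (intro meromorphic_intros analytic_on_imp_meromorphic_on[OF Qan] meromorphic_on_subset[OF mero]) (use z r in auto)
    then have "isolated_singularity_at (\<lambda>q. Q q * f q) z" by (simp add: meromorphic_at_iff)
    then show ?thesis unfolding g_def using lim[OF z] remove_sings_analytic_at by blast
  qed
  then have "g holomorphic_on ball 0 r"
    using analytic_on_analytic_at analytic_imp_holomorphic by blast
  moreover have "g q = Q q * f q" if "q \<in> ball 0 r" "\<not> is_pole f q" for q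
    unfolding g_def by (rule remove_sings_at_analytic) (use an[of q] that r in \<open>auto intro!: analytic_intros Qan\<close>)
  moreover have "finite {w. Q w = 0}" using Q0 by (intro finite_subset[OF _ P]) auto
  ultimately show ?thesis using Q Q0 unfolding P_def by blast
qed

text \<open>The denominators are multiplied, and each numerator picks up the denominators of the
  other functions, so that one \<open>Q\<close> serves all cusps and all three functions at
  once.\<close>

lemma common_denominator:
  assumes "finite I" "\<And>i. i \<in> I \<Longrightarrow> f i nicely_meromorphic_on ball 0 1" "r < 1"
  obtains Q g where "Q holomorphic_on UNIV" "\<And>i. i \<in> I \<Longrightarrow> g i holomorphic_on ball 0 r" "finite {w. Q w = 0}"
    "\<And>w. Q w = 0 \<Longrightarrow> w \<in> cball 0 r \<and> (\<exists>i\<in>I. is_pole (f i) w)"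
    "\<And>i q. i \<in> I \<Longrightarrow> q \<in> ball 0 r \<Longrightarrow> \<not> is_pole (f i) q \<Longrightarrow> g i q = Q q * f i q"
proof -
  define D where "D = (\<lambda>i Q g. Q holomorphic_on UNIV \<and> g holomorphic_on ball 0 r \<and> finite {w. Q w = 0} \<and>
    (\<forall>w. Q w = 0 \<longrightarrow> w \<in> cball 0 r \<and> is_pole (f i) w) \<and>
    (\<forall>q\<in>ball 0 r. \<not> is_pole (f i) q \<longrightarrow> g q = Q q * f i q))"
  have "\<exists>p. D i (fst p) (snd p)" if "i \<in> I" for i
    using denominator_single[OF assms(2)[OF that] assms(3)] unfolding D_def by simp
  then have "\<forall>i\<in>I. \<exists>p. D i (fst p) (snd p)" by simp
  then obtain p where p: "\<And>i. i \<in> I \<Longrightarrow> D i (fst (p i)) (snd (p i))"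
    using bchoice[of I "\<lambda>i p. D i (fst p) (snd p)"] by blast
  define Q where "Q = (\<lambda>i. fst (p i))"
  define g where "g = (\<lambda>i. snd (p i))"
  have Qg: "Q i holomorphic_on UNIV" "g i holomorphic_on ball 0 r"
    "finite {w. Q i w = 0}"
    "\<And>w. Q i w = 0 \<Longrightarrow> w \<in> cball 0 r \<and> is_pole (f i) w"
    "\<And>q. q \<in> ball 0 r \<Longrightarrow> \<not> is_pole (f i) q \<Longrightarrow> g i q = Q i q * f i q" if "i \<in> I" for i
    using p[OF that] unfolding D_def Q_def g_def by simp_all
  show ?thesis
  proof (rule that[of "\<lambda>q. \<Prod>i\<in>I. Q i q" "\<lambda>i q. g i q * (\<Prod>j\<in>I - {i}. Q j q)"])
    show "(\<lambda>q. \<Prod>i\<in>I. Q i q) holomorphic_on UNIV" by (intro holomorphic_intros Qg)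
    show "(\<lambda>q. g i q * (\<Prod>j\<in>I - {i}. Q j q)) holomorphic_on ball 0 r" if "i \<in> I" for i
      using that by (intro holomorphic_intros Qg holomorphic_on_subset[OF Qg(1)]) auto
    have "{w. (\<Prod>i\<in>I. Q i w) = 0} = (\<Union>i\<in>I. {w. Q i w = 0})" using assms(1) by auto
    then show "finite {w. (\<Prod>i\<in>I. Q i w) = 0}" using assms(1) Qg(3) by auto
    show "w \<in> cball 0 r \<and> (\<exists>i\<in>I. is_pole (f i) w)" if w0: "(\<Prod>i\<in>I. Q i w) = 0" for w
    proof -
      obtain i where "i \<in> I" "Q i w = 0" using w0 assms(1) by auto
      then show ?thesis using Qg(4)[of i w] by auto
    qed
    show "g i q * (\<Prod>j\<in>I - {i}. Q j q) = (\<Prod>i\<in>I. Q i q) * f i q"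
      if "i \<in> I" "q \<in> ball 0 r" "\<not> is_pole (f i) q" for i q
      using Qg(5)[OF that] prod.remove[OF assms(1) that(1), of "\<lambda>i. Q i q"] by simp
  qed
qed

text \<open>Supplies the radii of an annulus without zeros of the common denominator.\<close>

lemma interval_avoiding_finite:
  fixes F :: "real set"
  assumes "finite F" "a < b"
  obtains c d where "a < c" "c < d" "d < b" "F \<inter> {c..d} = {}"
proof -
  have "infinite {a<..<b}" using assms(2) by simp
  then obtain x where x: "x \<in> {a<..<b} - F" using assms(1) by (metis finite_Diff2 finite.emptyI equals0I)
  have "open ({a<..<b} - F)" using assms(1) by (intro open_Diff finite_imp_closed) auto
  then obtain e where e: "e > 0" "cball x e \<subseteq> {a<..<b} - F" using x open_contains_cball by blast
  show ?thesis
    by (rule that[of "x - e" "x + e"]) (use e in \<open>auto simp: cball_eq_atLeastAtMost subset_iff\<close>)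
qed

text \<open>The missing degree \<open>3 * n - i - j - k\<close> is filled up with powers of
  \<open>q\<close>, so the same factor \<open>q ^ (3 * n)\<close> clears denominators whatever the
  coefficients are.\<close>

lemma eval3_homogenize:
  "q ^ (3 * n) * eval3 n c u v w =
     (\<Sum>i\<le>n. \<Sum>j\<le>n. \<Sum>k\<le>n. c i j k * (q * u) ^ i * (q * v) ^ j * (q * w) ^ k * q ^ (3 * n - i - j - k))"
proof -
  have *: "q ^ (3 * n) * (c i j k * u ^ i * v ^ j * w ^ k) =
      c i j k * (q * u) ^ i * (q * v) ^ j * (q * w) ^ k * q ^ (3 * n - i - j - k)"
    if "i \<le> n" "j \<le> n" "k \<le> n" for i j k
  proof -
    have "i + j + k + (3 * n - i - j - k) = 3 * n" using that by simp
    then have "q ^ (3 * n) = q ^ i * q ^ j * q ^ k * q ^ (3 * n - i - j - k)"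
      by (simp only: power_add[symmetric])
    then show ?thesis unfolding power_mult_distrib by (simp only: mult_ac)
  qed
  show ?thesis unfolding eval3_def sum_distrib_left
    by (intro sum.cong refl) (use * in \<open>auto simp: mult.assoc\<close>)
qed

text \<open>
  The assumption \<open>T\<close> encodes that every point of the upper half-plane is equivalent to one with
  \<open>\<bar>q\<bar> \<le> \<rho>\<close>, at the cost of permuting the expansions at the cusps. The product of the relation over
  the cusps, cleared of poles by a power of a fixed \<open>Q\<close>, is bounded on a circle of radius \<open>R > \<rho>\<close> by
  \<open>C ^ n\<close> times its maximum on \<open>\<bar>q\<bar> \<le> \<rho>\<close>, whereas each zero gains a fixed factor \<open>\<kappa> < 1\<close>.
\<close>

lemma disc_zero_bound:
  fixes \<Psi> :: "nat \<Rightarrow> 'r \<Rightarrow> complex \<Rightarrow> complex"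
  assumes fin: "finite Rw" and \<rho>: "0 < \<rho>" "\<rho> < 1"
    and mero: "\<And>i r. i < 3 \<Longrightarrow> r \<in> Rw \<Longrightarrow> \<Psi> i r nicely_meromorphic_on ball 0 1"
    and T: "\<And>N0. countable N0 \<Longrightarrow> \<exists>N. countable N \<and> (\<forall>q\<in>ball 0 1 - N. \<exists>q'\<in>cball 0 \<rho> - N0. \<exists>\<pi>.
            bij_betw \<pi> Rw Rw \<and> (\<forall>i<3. \<forall>r\<in>Rw. \<Psi> i r q' = \<Psi> i (\<pi> r) q))"
  shows "\<exists>\<delta>::nat. \<forall>n c r0 Z. r0 \<in> Rw \<longrightarrow> finite Z \<longrightarrow> Z \<subseteq> cball 0 \<rho> \<longrightarrow>
     (\<forall>z\<in>Z. (\<forall>i<3. \<not> is_pole (\<Psi> i r0) z) \<and> eval3 n c (\<Psi> 0 r0 z) (\<Psi> 1 r0 z) (\<Psi> 2 r0 z) = 0) \<longrightarrow>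
     n * \<delta> < card Z \<longrightarrow>
     (\<exists>r\<in>Rw. \<forall>\<^sub>\<approx>q\<in>ball 0 \<rho>. eval3 n c (\<Psi> 0 r q) (\<Psi> 1 r q) (\<Psi> 2 r q) = 0)"
proof -
  \<comment> \<open>Poles may accumulate at the unit circle, but only finitely many lie in the
    closed disc of radius \<open>r1 < 1\<close>.\<close>
  define r1 where "r1 = (1 + \<rho>) / 2"
  have r1: "\<rho> < r1" "r1 < 1" using \<rho> by (auto simp: r1_def)
  define J where "J = {..<3::nat} \<times> Rw"
  have J: "finite J" using fin by (simp add: J_def)
  obtain Q g where Qh: "Q holomorphic_on UNIV" and gh: "\<And>p. p \<in> J \<Longrightarrow> g p holomorphic_on ball 0 r1"
    and Qf: "finite {w. Q w = 0}"
    and Q0: "\<And>w. Q w = 0 \<Longrightarrow> w \<in> cball 0 r1 \<and> (\<exists>p\<in>J. is_pole ((\<lambda>(i, r). \<Psi> i r) p) w)"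
    and gQ: "\<And>p q. p \<in> J \<Longrightarrow> q \<in> ball 0 r1 \<Longrightarrow> \<not> is_pole ((\<lambda>(i, r). \<Psi> i r) p) q \<Longrightarrow> g p q = Q q * (\<lambda>(i, r). \<Psi> i r) p q"
    by (rule common_denominator[OF J, of "\<lambda>(i, r). \<Psi> i r" r1]) (use mero r1 in \<open>auto simp: J_def\<close>)
  obtain a b where ab: "\<rho> < a" "a < b" "b < r1" "cmod ` {w. Q w = 0} \<inter> {a..b} = {}"
    using interval_avoiding_finite[OF finite_imageI[OF Qf, of cmod] r1(1)] by blast
  \<comment> \<open>The comparison circle runs inside an annulus free of zeros of \<open>Q\<close>,
    which leaves room to move off a countable set.\<close>
  define R where "R = (a + b) / 2"
  have R: "\<rho> < R" "a < R" "R < b" "0 < R" "R < r1" using ab \<rho> by (auto simp: R_def)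
  \<comment> \<open>Zeros of \<open>Q\<close> and poles of the expansions; the equivalent point
    \<open>q'\<close> will be chosen off this set.\<close>
  define N0 where "N0 = {w. Q w = 0} \<union> (\<Union>p\<in>J. ball 0 1 \<inter> {w. is_pole ((\<lambda>(i, r). \<Psi> i r) p) w})"
  have N0: "countable N0"
    unfolding N0_def
  proof (intro countable_Un countable_finite[OF Qf] countable_UN countable_finite[OF J])
    fix p assume "p \<in> J"
    then have "(\<lambda>(i, r). \<Psi> i r) p meromorphic_on ball 0 1"
      using mero by (auto simp: J_def nicely_meromorphic_on_def)
    then show "countable (ball 0 1 \<inter> {w. is_pole ((\<lambda>(i, r). \<Psi> i r) p) w})"
      by (intro sparse_imp_countable open_ball) (use meromorphic_on_imp_not_pole_cosparse in \<open>force simp: eventually_cosparse\<close>)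
  qed
  have gQ': "g (i, r) q = Q q * \<Psi> i r q" if "i < 3" "r \<in> Rw" "q \<in> ball 0 r1" "\<not> is_pole (\<Psi> i r) q" for i r q
    using gQ[of "(i, r)" q] that by (simp add: J_def)
  have gQN: "Q q \<noteq> 0 \<and> g (i, r) q = Q q * \<Psi> i r q" if "i < 3" "r \<in> Rw" "q \<in> ball 0 r1" "q \<notin> N0" for i r q
  proof -
    have "\<not> is_pole (\<Psi> i r) q"
    proof
      assume "is_pole (\<Psi> i r) q"
      then have "q \<in> N0" using that r1 unfolding N0_def J_def by (auto intro!: bexI[of _ "(i, r)"])
      with that show False by simp
    qed
    then show ?thesis using gQ'[of i r q] that unfolding N0_def by simp
  qed
  have Qc: "continuous_on A Q" for A
    by (rule holomorphic_on_imp_continuous_on[OF holomorphic_on_subset[OF Qh]]) simp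
  obtain BQ where BQ: "BQ > 0" "\<And>q. q \<in> cball 0 1 \<Longrightarrow> cmod (Q q) \<le> BQ"
  proof -
    have "bounded (Q ` cball 0 1)"
      by (intro compact_imp_bounded compact_continuous_image Qc) simp
    then show ?thesis using that by (auto simp: bounded_pos)
  qed
  define An where "An = {q. a \<le> cmod q \<and> cmod q \<le> b}"
  have An: "compact An"
  proof -
    have "An = cball 0 b - ball 0 a" by (auto simp: An_def)
    then show ?thesis by (simp add: compact_diff)
  qed
  have QAn: "Q q \<noteq> 0" if "q \<in> An" for q using ab(4) that by (auto simp: An_def)
  have "\<exists>A. \<forall>p\<in>J. \<forall>q\<in>An. cmod (g p q / Q q) \<le> A"
  proof -
    have "\<exists>A. \<forall>q\<in>An. cmod (g p q / Q q) \<le> A" if "p \<in> J" for p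
    proof -
      have "continuous_on An (\<lambda>q. g p q / Q q)"
        using QAn ab(3) by (intro continuous_intros Qc holomorphic_on_imp_continuous_on[OF holomorphic_on_subset[OF gh[OF that]]])
          (auto simp: An_def)
      then have "bounded ((\<lambda>q. g p q / Q q) ` An)"
        using compact_continuous_image[OF _ An] compact_imp_bounded by blast
      then show ?thesis by (auto simp: bounded_iff)
    qed
    then obtain A where A: "\<And>p. p \<in> J \<Longrightarrow> \<forall>q\<in>An. cmod (g p q / Q q) \<le> A p" by metis
    have "\<forall>p\<in>J. \<forall>q\<in>An. cmod (g p q / Q q) \<le> Max (A ` J)"
    proof (intro ballI)
      fix p q assume pq: "p \<in> J" "q \<in> An"
      have "A p \<le> Max (A ` J)" using pq J by simp
      then show "cmod (g p q / Q q) \<le> Max (A ` J)" using A[OF pq(1)] pq(2) order_trans by blast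
    qed
    then show ?thesis by blast
  qed
  then obtain A where A: "\<And>p q. p \<in> J \<Longrightarrow> q \<in> An \<Longrightarrow> cmod (g p q / Q q) \<le> A" by blast
  \<comment> \<open>\<open>A\<close> bounds all expansions on the annulus. Each zero
    \<open>w\<close> of \<open>Q\<close> is a pole of some expansion, which therefore exceeds
    \<open>A\<close> near \<open>w\<close>. Hence a point of the small disc that is equivalent to
    one of the annulus stays away from the zeros of \<open>Q\<close>.\<close>
  have "\<exists>\<eta>>0. \<exists>p\<in>J. \<forall>q\<in>ball w \<eta> - {w}. A < cmod ((\<lambda>(i, r). \<Psi> i r) p q)" if w0: "Q w = 0" for w
  proof -
    obtain p where p: "p \<in> J" "is_pole ((\<lambda>(i, r). \<Psi> i r) p) w" using Q0[OF w0] by blast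
    have "eventually (\<lambda>q. A < cmod ((\<lambda>(i, r). \<Psi> i r) p q)) (at w)"
      by (rule filterlim_at_infinity_imp_norm_at_top[OF p(2)[unfolded is_pole_def], unfolded filterlim_at_top_dense, rule_format])
    then obtain \<eta> where "\<eta> > 0" "\<forall>q. q \<noteq> w \<and> dist q w < \<eta> \<longrightarrow> A < cmod ((\<lambda>(i, r). \<Psi> i r) p q)"
      by (auto simp: eventually_at)
    then show ?thesis using p(1) by (intro exI[of _ \<eta>] conjI bexI[of _ p] ballI) (auto simp: dist_commute)
  qed
  then obtain \<eta> where \<eta>: "\<And>w. Q w = 0 \<Longrightarrow> \<eta> w > 0"
      "\<And>w. Q w = 0 \<Longrightarrow> \<exists>p\<in>J. \<forall>q\<in>ball w (\<eta> w) - {w}. A < cmod ((\<lambda>(i, r). \<Psi> i r) p q)"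
    by metis
  \<comment> \<open>What remains of the small disc; by compactness \<open>|Q|\<close> has a positive
    lower bound \<open>\<epsilon>\<close> on it.\<close>
  define K where "K = cball 0 \<rho> - (\<Union>w\<in>{w. Q w = 0}. ball w (\<eta> w))"
  have K: "compact K" unfolding K_def by (intro compact_diff open_UN) auto
  have QK: "Q q \<noteq> 0" if "q \<in> K" for q
  proof
    assume "Q q = 0"
    then have "q \<in> (\<Union>w\<in>{w. Q w = 0}. ball w (\<eta> w))" using \<eta>(1) by (intro UN_I[of q]) simp_all
    then show False using that by (simp add: K_def)
  qed
  obtain \<epsilon> where \<epsilon>: "\<epsilon> > 0" "\<And>q. q \<in> K \<Longrightarrow> \<epsilon> \<le> cmod (Q q)"
  proof (cases "K = {}")
    case True then show ?thesis using that[of 1] by simp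
  next
    case False
    have "continuous_on K (\<lambda>q. cmod (Q q))" by (intro continuous_intros Qc)
    then obtain q0 where "q0 \<in> K" "\<And>q. q \<in> K \<Longrightarrow> cmod (Q q0) \<le> cmod (Q q)"
      using continuous_attains_inf[OF K False] by blast
    then show ?thesis using that[of "cmod (Q q0)"] QK by simp
  qed
  from T[OF N0] obtain N where N': "countable N \<and> (\<forall>q\<in>ball 0 1 - N. \<exists>q'\<in>cball 0 \<rho> - N0. \<exists>\<pi>.
            bij_betw \<pi> Rw Rw \<and> (\<forall>i<3. \<forall>r\<in>Rw. \<Psi> i r q' = \<Psi> i (\<pi> r) q))" by (elim exE)
  note N = N'[THEN conjunct1] and TN = N'[THEN conjunct2, rule_format]
  define \<kappa> where "\<kappa> = sqrt (1 - ((R\<^sup>2 - \<rho>\<^sup>2) / (R\<^sup>2 + \<rho>\<^sup>2))\<^sup>2)"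
  have \<kappa>: "0 \<le> \<kappa>" "\<kappa> < 1"
  proof -
    have sq: "\<rho>\<^sup>2 < R\<^sup>2" using R \<rho> by (simp add: power_strict_mono)
    then have x: "0 < (R\<^sup>2 - \<rho>\<^sup>2) / (R\<^sup>2 + \<rho>\<^sup>2)" "(R\<^sup>2 - \<rho>\<^sup>2) / (R\<^sup>2 + \<rho>\<^sup>2) \<le> 1"
      using \<rho> R by (auto simp: divide_simps add_pos_pos)
    then have "((R\<^sup>2 - \<rho>\<^sup>2) / (R\<^sup>2 + \<rho>\<^sup>2))\<^sup>2 \<le> 1" by (intro power_le_one) auto
    then show "0 \<le> \<kappa>" by (simp add: \<kappa>_def)
    have "((R\<^sup>2 - \<rho>\<^sup>2) / (R\<^sup>2 + \<rho>\<^sup>2))\<^sup>2 > 0" by (rule zero_less_power[OF x(1)])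
    then show "\<kappa> < 1" by (simp add: \<kappa>_def)
  qed
  \<comment> \<open>Passing from \<open>q\<close> to an equivalent \<open>q'\<close> costs the ratio
    \<open>|Q q| / |Q q'| \<le> BQ / \<epsilon>\<close> to the power \<open>3 * n * card Rw\<close>;
    this total cost is \<open>C ^ n\<close>.\<close>
  define C where "C = (BQ / \<epsilon>) ^ (3 * card Rw)"
  have C: "C > 0" using BQ \<epsilon> by (simp add: C_def)
  \<comment> \<open>\<open>\<delta>\<close> depends on \<open>\<kappa>\<close> and \<open>C\<close>
    alone, hence neither on the degree nor on the coefficients of the relation.\<close>
  obtain \<delta> where \<delta>: "\<kappa> ^ \<delta> < 1 / C" using real_arch_pow_inv[of "1 / C" \<kappa>] \<kappa> C by auto
  have main: "\<exists>r\<in>Rw. \<forall>\<^sub>\<approx>q\<in>ball 0 \<rho>. eval3 n c (\<Psi> 0 r q) (\<Psi> 1 r q) (\<Psi> 2 r q) = 0"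
    if r0: "r0 \<in> Rw" and Z: "finite Z" "Z \<subseteq> cball 0 \<rho>"
      and Zp: "\<And>z i. z \<in> Z \<Longrightarrow> i < 3 \<Longrightarrow> \<not> is_pole (\<Psi> i r0) z"
      and Z0: "\<And>z. z \<in> Z \<Longrightarrow> eval3 n c (\<Psi> 0 r0 z) (\<Psi> 1 r0 z) (\<Psi> 2 r0 z) = 0"
      and m: "n * \<delta> < card Z" for n c r0 Z
  proof -
    define H where "H = (\<lambda>r q. \<Sum>i\<le>n. \<Sum>j\<le>n. \<Sum>k\<le>n. c i j k * g (0, r) q ^ i * g (1, r) q ^ j * g (2, r) q ^ k * Q q ^ (3 * n - i - j - k))"
    define P where "P = (\<lambda>r q. eval3 n c (\<Psi> 0 r q) (\<Psi> 1 r q) (\<Psi> 2 r q))"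
    have Hh: "H r holomorphic_on ball 0 r1" if "r \<in> Rw" for r
      unfolding H_def by (intro holomorphic_intros gh holomorphic_on_subset[OF Qh]) (use that in \<open>auto simp: J_def\<close>)
    have HP: "H r q = Q q ^ (3 * n) * P r q"
      if "\<And>i. i < 3 \<Longrightarrow> g (i, r) q = Q q * \<Psi> i r q" for r q
      unfolding H_def P_def eval3_homogenize using that[of 0] that[of 1] that[of 2] by simp
    \<comment> \<open>Up to powers of \<open>Q\<close>, the product over all cosets is unchanged by
      the permutation \<open>\<pi>\<close>, while a zero of the single factor at \<open>r0\<close>
      is still a zero of the product.\<close>
    define G where "G = (\<lambda>q. \<Prod>r\<in>Rw. H r q)"
    have Gh: "G holomorphic_on ball 0 r1" unfolding G_def by (intro holomorphic_intros Hh)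
    have GP: "G q = Q q ^ (3 * n * card Rw) * (\<Prod>r\<in>Rw. P r q)" if "q \<in> ball 0 r1" "q \<notin> N0" for q
    proof -
      have "G q = (\<Prod>r\<in>Rw. Q q ^ (3 * n) * P r q)"
        unfolding G_def using gQN that by (intro prod.cong refl HP) blast
      then show ?thesis by (simp add: prod.distrib power_mult)
    qed
    have GZ: "G z = 0" if "z \<in> Z" for z
    proof -
      have "z \<in> ball 0 r1" using Z(2) that r1 by auto
      then have "H r0 z = Q z ^ (3 * n) * P r0 z"
        using gQ' r0 Zp[OF that] by (intro HP) blast
      then have "H r0 z = 0" using Z0[OF that] by (simp add: P_def)
      then show ?thesis unfolding G_def using r0 fin by auto
    qed
    have Gc: "continuous_on (sphere 0 R) (\<lambda>q. cmod (G q))"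
      using R by (intro continuous_intros holomorphic_on_imp_continuous_on[OF holomorphic_on_subset[OF Gh]]) auto
    obtain q0 where q0: "cmod q0 = R" "\<And>q. cmod q = R \<Longrightarrow> cmod (G q) \<le> cmod (G q0)"
    proof -
      have "sphere 0 R \<noteq> ({} :: complex set)" using R by simp
      from continuous_attains_sup[OF compact_sphere this Gc] show ?thesis
        using that by auto
    qed
    define M where "M = cmod (G q0)"
    have Schw: "cmod (G q) \<le> \<kappa> ^ card Z * M" if "cmod q \<le> \<rho>" for q
      unfolding \<kappa>_def using Schwarz_many_zeros[OF R(4,5) less_imp_le[OF \<rho>(1)] R(1) Z Gh GZ _ that, of M] q0(2)
      unfolding M_def by simp
    \<comment> \<open>The first \<open>\<delta> * n\<close> zeros compensate \<open>C ^ n\<close>;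
      at least one zero is left over, and its factor \<open>\<kappa>\<close> makes the inequality
      strict.\<close>
    have Ck: "C ^ n * \<kappa> ^ card Z < 1"
    proof -
      have "C * \<kappa> ^ \<delta> \<le> 1" using \<delta> C by (simp add: field_simps)
      then have "(C * \<kappa> ^ \<delta>) ^ n \<le> 1" using C \<kappa> by (intro power_le_one) auto
      moreover obtain l where l: "card Z = \<delta> * n + Suc l"
      proof -
        have "card Z = \<delta> * n + Suc (card Z - n * \<delta> - 1)" using m by (simp add: mult.commute)
        then show ?thesis by (rule that)
      qed
      have kZ: "\<kappa> ^ card Z = (\<kappa> ^ \<delta>) ^ n * \<kappa> ^ Suc l"
        unfolding l power_add power_mult ..
      have "\<kappa> ^ l \<le> 1" using \<kappa> by (intro power_le_one) auto
      then have "\<kappa> * \<kappa> ^ l \<le> \<kappa> * 1" using \<kappa> by (intro mult_left_mono) auto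
      then have "\<kappa> ^ Suc l < 1" using \<kappa>(2) by simp
      moreover have "(C * \<kappa> ^ \<delta>) ^ n * \<kappa> ^ Suc l \<le> 1 * \<kappa> ^ Suc l"
        using \<kappa> calculation(1) by (intro mult_right_mono) auto
      ultimately show ?thesis unfolding kZ by (simp add: power_mult_distrib mult.assoc)
    qed
    have est: "cmod (G q) \<le> C ^ n * \<kappa> ^ card Z * M" if q: "q \<in> An" "q \<notin> N \<union> N0" for q
    proof -
      have q1: "q \<in> ball 0 r1" "q \<in> ball 0 1" using q(1) ab r1 by (auto simp: An_def)
      have "q \<in> ball 0 1 - N" using q q1 by simp
      from TN[OF this] obtain q' \<pi> where q': "q' \<in> cball 0 \<rho>" "q' \<notin> N0" "bij_betw \<pi> Rw Rw"
        "\<And>i r. i < 3 \<Longrightarrow> r \<in> Rw \<Longrightarrow> \<Psi> i r q' = \<Psi> i (\<pi> r) q"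
        by (elim bexE exE conjE DiffE) simp
      have q'1: "q' \<in> ball 0 r1" using q'(1) r1 by auto
      have "cmod (\<Psi> i r q') \<le> A" if "i < 3" "r \<in> Rw" for i r
      proof -
        have "\<pi> r \<in> Rw" using q'(3) that(2) bij_betwE by blast
        then have "\<Psi> i (\<pi> r) q = g (i, \<pi> r) q / Q q" "cmod (g (i, \<pi> r) q / Q q) \<le> A"
          using gQN[of i "\<pi> r" q] that q q1 A[of "(i, \<pi> r)" q] by (auto simp: J_def)
        then show ?thesis using q'(4)[OF that] by simp
      qed
      then have le: "cmod ((\<lambda>(i, r). \<Psi> i r) p q') \<le> A" if "p \<in> J" for p using that by (auto simp: J_def)
      have "q' \<in> K"
      proof (rule ccontr)
        assume "q' \<notin> K"
        then obtain w where w: "Q w = 0" "q' \<in> ball w (\<eta> w)" using q'(1) unfolding K_def by blast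
        have "q' \<noteq> w" using w(1) q'(2) unfolding N0_def by auto
        then obtain p where p: "p \<in> J" "A < cmod ((\<lambda>(i, r). \<Psi> i r) p q')" using \<eta>(2)[OF w(1)] w(2) by blast
        show False using le[OF p(1)] p(2) by linarith
      qed
      then have e: "\<epsilon> \<le> cmod (Q q')" by (rule \<epsilon>(2))
      have "(\<Prod>r\<in>Rw. P r q') = (\<Prod>r\<in>Rw. P (\<pi> r) q)"
        by (intro prod.cong refl) (simp add: P_def q'(4))
      also have "\<dots> = (\<Prod>r\<in>Rw. P r q)" by (rule prod.reindex_bij_betw[OF q'(3)])
      finally have PP: "(\<Prod>r\<in>Rw. P r q') = (\<Prod>r\<in>Rw. P r q)" .
      let ?d = "3 * n * card Rw"
      \<comment> \<open>The products of the relations at \<open>q\<close> and \<open>q'\<close>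
        coincide, so \<open>G q * Q q' ^ ?d = Q q ^ ?d * G q'\<close>, and the Schwarz estimate
        applies at \<open>q'\<close>, which lies in the small disc.\<close>
      have "cmod (G q) * \<epsilon> ^ ?d \<le> cmod (G q) * cmod (Q q') ^ ?d"
        using e \<epsilon> by (intro mult_left_mono power_mono) auto
      also have "\<dots> = cmod (Q q) ^ ?d * cmod (G q')"
        using GP[of q] GP[of q'] q q1 q'1 q'(2) PP by (simp add: norm_mult norm_power)
      also have "\<dots> \<le> BQ ^ ?d * (\<kappa> ^ card Z * M)"
        using BQ(2)[of q] q1(2) Schw[of q'] q'(1) BQ(1) by (intro mult_mono power_mono) auto
      finally have "cmod (G q) \<le> BQ ^ ?d * (\<kappa> ^ card Z * M) / \<epsilon> ^ ?d"
        using \<epsilon>(1) by (simp add: pos_le_divide_eq)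
      also have "\<dots> = C ^ n * \<kappa> ^ card Z * M"
        by (simp add: C_def power_mult[symmetric] power_divide mult_ac)
      finally show ?thesis .
    qed
    \<comment> \<open>The maximum point \<open>q0\<close> may be one of the countably many excluded
      points. The contradiction is therefore taken at a nearby point: the strict inequality persists
      on an open, hence uncountable, set.\<close>
    have M0: "M = 0"
    proof (rule ccontr)
      assume "M \<noteq> 0"
      then have "M > 0" by (simp add: M_def)
      then have lt: "C ^ n * \<kappa> ^ card Z * M < M" using Ck by simp
      have "open {q. a < cmod q \<and> cmod q < b}"
        by (intro open_Collect_conj open_Collect_less continuous_intros)
      moreover have "continuous_on {q. a < cmod q \<and> cmod q < b} (\<lambda>q. cmod (G q))"
        using ab by (intro continuous_intros holomorphic_on_imp_continuous_on[OF holomorphic_on_subset[OF Gh]]) auto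
      ultimately have "open ({q. a < cmod q \<and> cmod q < b} \<inter> (\<lambda>q. cmod (G q)) -` {C ^ n * \<kappa> ^ card Z * M <..})"
        by (auto intro!: continuous_open_preimage)
      moreover have "q0 \<in> {q. a < cmod q \<and> cmod q < b} \<inter> (\<lambda>q. cmod (G q)) -` {C ^ n * \<kappa> ^ card Z * M <..}"
        using q0(1) R lt by (simp add: M_def)
      ultimately obtain e where e: "e > 0" "ball q0 e \<subseteq> {q. a < cmod q \<and> cmod q < b} \<inter> (\<lambda>q. cmod (G q)) -` {C ^ n * \<kappa> ^ card Z * M <..}"
        by (meson open_contains_ball)
      have "uncountable (ball q0 e - (N \<union> N0))"
        using N N0 e(1) by (intro uncountable_minus_countable uncountable_ball) auto
      then obtain q where q: "q \<in> ball q0 e" "q \<notin> N \<union> N0" by (metis Diff_iff countable_empty equals0I)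
      have "a < cmod q" "cmod q < b" "C ^ n * \<kappa> ^ card Z * M < cmod (G q)" using e(2) q(1) by auto
      then show False using est[of q] q(2) by (auto simp: An_def)
    qed
    have G0: "G q = 0" if "cmod q \<le> R" for q
      using holomorphic_maximum_disc[OF Gh R(4,5) _ that, of 0] q0(2) M0 by (simp add: M_def)
    \<comment> \<open>If no factor vanished identically, the disc would be a finite union of
      countable zero sets. Which factor vanishes is not known; it need not be the one at
      \<open>r0\<close>.\<close>
    have "\<exists>r\<in>Rw. \<forall>q\<in>ball 0 R. H r q = 0"
    proof (rule ccontr)
      assume neg: "\<not> (\<exists>r\<in>Rw. \<forall>q\<in>ball 0 R. H r q = 0)"
      have "countable {q \<in> ball 0 R. H r q = 0}" if r: "r \<in> Rw" for r
      proof -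
        obtain q where "q \<in> ball 0 R" "H r q \<noteq> 0" using neg r by blast
        then show ?thesis
          by (intro holomorphic_zeros_countable[of _ _ q] holomorphic_on_subset[OF Hh[OF r]]) (use R in auto)
      qed
      then have "countable (\<Union>r\<in>Rw. {q \<in> ball 0 R. H r q = 0})" by (intro countable_UN countable_finite[OF fin])
      moreover have "ball 0 R \<subseteq> (\<Union>r\<in>Rw. {q \<in> ball 0 R. H r q = 0})"
        using G0 fin unfolding G_def by auto
      ultimately have "countable (ball (0::complex) R)" using countable_subset by blast
      then show False using R uncountable_ball by blast
    qed
    then obtain r where r: "r \<in> Rw" "\<And>q. q \<in> ball 0 R \<Longrightarrow> H r q = 0" by blast
    have ev: "\<forall>\<^sub>\<approx>q\<in>ball 0 \<rho>. \<not> is_pole (\<Psi> i r) q" if "i < 3" for i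
    proof (rule meromorphic_on_imp_not_pole_cosparse)
      show "\<Psi> i r meromorphic_on ball 0 \<rho>"
        using mero[OF that r(1)] \<rho> unfolding nicely_meromorphic_on_def
        by (auto elim: meromorphic_on_subset)
    qed
    have e3: "\<forall>\<^sub>\<approx>q\<in>ball 0 \<rho>. \<not> is_pole (\<Psi> 0 r) q" "\<forall>\<^sub>\<approx>q\<in>ball 0 \<rho>. \<not> is_pole (\<Psi> 1 r) q"
      "\<forall>\<^sub>\<approx>q\<in>ball 0 \<rho>. \<not> is_pole (\<Psi> 2 r) q"
      by (rule ev; simp)+
    have "\<forall>\<^sub>\<approx>q\<in>ball 0 \<rho>. Q q \<noteq> 0"
      using Qf by (simp add: eventually_cosparse finite_imp_sparse)
    moreover have "\<forall>\<^sub>\<approx>q\<in>ball 0 \<rho>. q \<in> ball 0 \<rho>" by (rule eventually_in_cosparse) auto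
    ultimately have "\<forall>\<^sub>\<approx>q\<in>ball 0 \<rho>. P r q = 0"
      using e3
    proof eventually_elim
      case (elim q)
      have "H r q = Q q ^ (3 * n) * P r q"
      proof (rule HP)
        fix i :: nat assume i: "i < 3"
        then have "i = 0 \<or> i = 1 \<or> i = 2" by auto
        then have "\<not> is_pole (\<Psi> i r) q" using elim by auto
        then show "g (i, r) q = Q q * \<Psi> i r q" using gQ'[OF i r(1)] elim r1 by auto
      qed
      then show ?case using r(2)[of q] elim R by auto
    qed
    then show ?thesis using r(1) unfolding P_def by blast
  qed
  show ?thesis
  proof (intro exI allI impI)
    fix n c r0 Z
    assume *: "r0 \<in> Rw" "finite Z" "Z \<subseteq> cball 0 \<rho>"
      "\<forall>z\<in>Z. (\<forall>i<3. \<not> is_pole (\<Psi> i r0) z) \<and> eval3 n c (\<Psi> 0 r0 z) (\<Psi> 1 r0 z) (\<Psi> 2 r0 z) = 0"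
      "n * \<delta> < card Z"
    show "\<exists>r\<in>Rw. \<forall>\<^sub>\<approx>q\<in>ball 0 \<rho>. eval3 n c (\<Psi> 0 r q) (\<Psi> 1 r q) (\<Psi> 2 r q) = 0"
      by (rule main[OF *(1-3) _ _ *(5)]) (use *(4) in simp_all)
  qed
qed

section \<open>Matrices acting on the upper half-plane\<close>

\<comment> \<open>The two meanings of \<open>$\<close> make parsing of matrix entries exponential.\<close>
no_notation fps_nth (infixl "$" 75)

definition uhp :: "complex set" where "uhp = {t. Im t > 0}"

lemma open_uhp: "open uhp" unfolding uhp_def by (rule open_halfspace_Im_gt)
lemma convex_uhp: "convex uhp" unfolding uhp_def by (rule convex_halfspace_Im_gt)
lemma connected_uhp: "connected uhp" by (rule convex_connected[OF convex_uhp])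
lemma HH_eq: "HH = uhp \<times> uhp" unfolding HH_def uhp_def by auto

definition mk2 :: "real \<Rightarrow> real \<Rightarrow> real \<Rightarrow> real \<Rightarrow> real^2^2" where
  "mk2 a b c d = vector [vector [a, b], vector [c, d]]"

lemma mk2_nth [simp]: "mk2 a b c d $ 1 $ 1 = a" "mk2 a b c d $ 1 $ 2 = b" "mk2 a b c d $ 2 $ 1 = c" "mk2 a b c d $ 2 $ 2 = d"
  by (simp_all add: mk2_def)

lemma mat2_eq_iff: "(A :: real^2^2) = B \<longleftrightarrow> A$1$1 = B$1$1 \<and> A$1$2 = B$1$2 \<and> A$2$1 = B$2$1 \<and> A$2$2 = B$2$2"
  by (auto simp: vec_eq_iff forall_2)

lemma mat2_mult_nth: "((A :: real^2^2) ** B) $ i $ j = A$i$1 * B$1$j + A$i$2 * B$2$j"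
  by (simp add: matrix_matrix_mult_def sum_2)

lemma mat2_one_nth: "(mat 1 :: real^2^2)$1$1 = 1" "(mat 1 :: real^2^2)$1$2 = 0" "(mat 1 :: real^2^2)$2$1 = 0" "(mat 1 :: real^2^2)$2$2 = 1"
  by (simp_all add: mat_def)

definition minv :: "real^2^2 \<Rightarrow> real^2^2" where
  "minv A = mk2 (A$2$2) (- (A$1$2)) (- (A$2$1)) (A$1$1)"

lemma minv_mult: "det A = 1 \<Longrightarrow> minv A ** A = mat 1" "det A = 1 \<Longrightarrow> A ** minv A = mat 1"
  by (auto simp: mat2_eq_iff mat2_mult_nth mat2_one_nth minv_def det_2 algebra_simps)

lemma det_minv: "det A = 1 \<Longrightarrow> det (minv A) = 1"
  by (simp add: minv_def det_2 algebra_simps)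

lemma autfac_nonzero:
  assumes "det A = 1" "Im t > 0"
  shows "autfac A t \<noteq> 0"
proof
  assume "autfac A t = 0"
  then have "A$2$1 * Im t = 0" "A$2$1 * Re t + A$2$2 = 0" by (simp_all add: autfac_def complex_eq_iff)
  then have "A$2$1 = 0" "A$2$2 = 0" using assms(2) by auto
  then show False using assms(1) by (simp add: det_2)
qed

lemma act_eq: "act A t = (of_real (A$1$1) * t + of_real (A$1$2)) / autfac A t"
  by (simp add: act_def moebius_def autfac_def)

lemma Im_act:
  assumes "det A = 1" "Im t > 0"
  shows "Im (act A t) = Im t / (cmod (autfac A t))\<^sup>2"
proof -
  let ?n = "of_real (A$1$1) * t + of_real (A$1$2)"
  have "Im (act A t) = Im (?n * cnj (autfac A t)) / (cmod (autfac A t))\<^sup>2"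
    unfolding act_eq by (simp add: Im_divide cmod_power2 algebra_simps)
  also have "Im (?n * cnj (autfac A t)) = det A * Im t"
    by (simp add: autfac_def det_2 algebra_simps)
  finally show ?thesis using assms(1) by simp
qed

lemma act_in_uhp: "det A = 1 \<Longrightarrow> t \<in> uhp \<Longrightarrow> act A t \<in> uhp"
  using Im_act autfac_nonzero by (auto simp: uhp_def)

lemma autfac_mult:
  assumes "det B = 1" "t \<in> uhp"
  shows "autfac (A ** B) t = autfac A (act B t) * autfac B t"
proof -
  have nz: "autfac B t \<noteq> 0" using assms autfac_nonzero by (simp add: uhp_def)
  have "autfac A (act B t) * autfac B t = of_real (A$2$1) * (of_real (B$1$1) * t + of_real (B$1$2)) + of_real (A$2$2) * autfac B t"
    using nz by (simp add: autfac_def[of A] act_eq distrib_right)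
  then show ?thesis by (simp add: autfac_def mat2_mult_nth algebra_simps)
qed

lemma act_mult:
  assumes "det B = 1" "t \<in> uhp"
  shows "act (A ** B) t = act A (act B t)"
proof -
  have nz: "autfac B t \<noteq> 0" using assms autfac_nonzero by (simp add: uhp_def)
  let ?nA = "of_real (A$1$1) * act B t + of_real (A$1$2)"
  have n: "?nA * autfac B t = of_real ((A ** B)$1$1) * t + of_real ((A ** B)$1$2)"
    using nz by (simp add: act_eq[of B] distrib_right) (simp add: autfac_def mat2_mult_nth algebra_simps)
  have "act A (act B t) = (?nA * autfac B t) / (autfac A (act B t) * autfac B t)"
    using nz by (simp add: act_eq[of A])
  then show ?thesis unfolding n autfac_mult[OF assms, symmetric] act_eq[of "A ** B"] by simp
qed

lemma act_one [simp]: "act (mat 1) t = t" "autfac (mat 1) t = 1"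
  by (simp_all add: act_eq autfac_def mat2_one_nth)

lemma act_minv: "det A = 1 \<Longrightarrow> t \<in> uhp \<Longrightarrow> act (minv A) (act A t) = t" "det A = 1 \<Longrightarrow> t \<in> uhp \<Longrightarrow> act A (act (minv A) t) = t"
  using act_mult[of A t "minv A"] act_mult[of "minv A" t A] by (simp_all add: minv_mult det_minv)

lemma autfac_has_derivative: "((autfac A) has_field_derivative of_real (A$2$1)) (at t)"
  unfolding autfac_def[abs_def] by (auto intro!: derivative_eq_intros)

lemma act_has_derivative:
  assumes "det A = 1" "t \<in> uhp"
  shows "((act A) has_field_derivative 1 / (autfac A t)\<^sup>2) (at t)"
proof -
  have nz: "autfac A t \<noteq> 0" using assms autfac_nonzero by (simp add: uhp_def)
  have d: "of_real (A$1$1) * of_real (A$2$2) - of_real (A$1$2) * of_real (A$2$1) = (1 :: complex)"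
    using assms(1) unfolding det_2 by (metis of_real_1 of_real_diff of_real_mult)
  have "of_real (A$1$1) * autfac A t - (of_real (A$1$1) * t + of_real (A$1$2)) * of_real (A$2$1) = 1"
    using d by (simp add: autfac_def algebra_simps)
  then have e: "(of_real (A$1$1) * autfac A t - (of_real (A$1$1) * t + of_real (A$1$2)) * of_real (A$2$1)) / (autfac A t * autfac A t)
     = 1 / (autfac A t)\<^sup>2" by (simp add: power2_eq_square)
  have "((\<lambda>t. (of_real (A$1$1) * t + of_real (A$1$2)) / autfac A t) has_field_derivative
     (of_real (A$1$1) * autfac A t - (of_real (A$1$1) * t + of_real (A$1$2)) * of_real (A$2$1)) / (autfac A t * autfac A t)) (at t)"
    by (rule DERIV_divide[OF _ autfac_has_derivative nz]) (auto intro!: derivative_eq_intros)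
  then show ?thesis unfolding e act_eq[abs_def] .
qed

lemma act_analytic: "det A = 1 \<Longrightarrow> act A analytic_on uhp"
  using act_has_derivative by (auto simp: analytic_on_open[OF open_uhp] holomorphic_on_open[OF open_uhp])

lemma act_inj: "det A = 1 \<Longrightarrow> inj_on (act A) uhp"
  by (rule inj_on_inverseI[where g = "act (minv A)"]) (rule act_minv)

text \<open>\<open>\<phi>\<close> avoids the value \<open>\<phi> t\<close> near \<open>t\<close>, so
  it carries punctured neighbourhoods of \<open>t\<close> into punctured neighbourhoods of
  \<open>\<phi> t\<close>. This allows sparse exceptional sets to be pulled back along
  \<open>act A\<close> and \<open>qpar h\<close>.\<close>

lemma cosparse_compose:
  fixes \<phi> :: "complex \<Rightarrow> complex"
  assumes "\<phi> analytic_on A" "open A" "\<phi> ` A \<subseteq> B" "\<And>t. t \<in> A \<Longrightarrow> eventually (\<lambda>s. \<phi> s \<noteq> \<phi> t) (at t)"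
    and "eventually P (cosparse B)"
  shows "eventually (\<lambda>t. P (\<phi> t)) (cosparse A)"
  unfolding eventually_cosparse_open_eq[OF assms(2)]
proof
  fix t assume t: "t \<in> A"
  have "eventually P (at (\<phi> t))" using assms(3,5) t eventually_cosparse_imp_eventually_at by blast
  moreover have "\<phi> \<midarrow>t\<rightarrow> \<phi> t"
    using assms(1) t by (meson analytic_at_imp_isCont analytic_on_analytic_at isContD)
  then have "filterlim \<phi> (at (\<phi> t)) (at t)" using assms(4)[OF t] by (simp add: filterlim_at)
  ultimately show "eventually (\<lambda>t. P (\<phi> t)) (at t)" by (simp add: filterlim_iff)
qed

lemma act_not_eq: "det A = 1 \<Longrightarrow> t \<in> uhp \<Longrightarrow> eventually (\<lambda>s. act A s \<noteq> act A t) (at t)"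
proof -
  assume A: "det A = 1" "t \<in> uhp"
  have "eventually (\<lambda>s. s \<in> uhp - {t}) (at t)" by (rule eventually_at_in_open[OF open_uhp A(2)])
  then show ?thesis by eventually_elim (use act_inj[OF A(1)] A(2) in \<open>auto simp: inj_on_def\<close>)
qed

lemma cosparse_act:
  assumes "det A = 1" "eventually P (cosparse uhp)"
  shows "eventually (\<lambda>t. P (act A t)) (cosparse uhp)"
  by (rule cosparse_compose[OF act_analytic[OF assms(1)] open_uhp _ act_not_eq[OF assms(1)] assms(2)])
     (use act_in_uhp assms(1) in auto)

lemma cosparse_uhp_in: "\<forall>\<^sub>\<approx>t\<in>uhp. t \<in> uhp"
  by (rule eventually_in_cosparse) (auto simp: open_uhp)

lemma cosparse_countable:
  assumes "eventually P (cosparse A)" "open (A :: complex set)"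
  shows "countable {t \<in> A. \<not> P t}"
  using sparse_imp_countable[OF assms(2), of "{t. \<not> P t}"] assms(1) by (simp add: eventually_cosparse Int_def)

section \<open>The local parameter at a cusp\<close>

definition qpar :: "real \<Rightarrow> complex \<Rightarrow> complex" where
  "qpar h t = qexp (t / of_real h)"

lemma qpar_analytic: "h > 0 \<Longrightarrow> qpar h analytic_on A"
  unfolding qpar_def[abs_def] qexp_def[abs_def] by (intro analytic_intros) auto

lemma norm_qexp: "cmod (qexp t) = exp (- 2 * pi * Im t)"
  by (simp add: qexp_def)

lemma norm_qpar: "h > 0 \<Longrightarrow> cmod (qpar h t) = exp (- 2 * pi * Im t / h)"
  by (simp add: qpar_def norm_qexp)

lemma qpar_nonzero: "qpar h t \<noteq> 0"
  by (simp add: qpar_def qexp_def)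

lemma qpar_in_ball: "h > 0 \<Longrightarrow> t \<in> uhp \<Longrightarrow> qpar h t \<in> ball 0 1"
  by (simp add: norm_qpar uhp_def)

lemma qpar_eq_iff:
  assumes "h > 0"
  shows "qpar h s = qpar h t \<longleftrightarrow> (\<exists>n::int. s = t + of_int n * of_real h)"
proof -
  have "qpar h s = qpar h t \<longleftrightarrow> (\<exists>n::int. 2 * of_real pi * \<i> * (s / of_real h) = 2 * of_real pi * \<i> * (t / of_real h) + 2 * of_int n * of_real pi * \<i>)"
    unfolding qpar_def qexp_def exp_eq by (simp add: algebra_simps)
  also have "\<dots> \<longleftrightarrow> (\<exists>n::int. s = t + of_int n * of_real h)"
  proof (rule arg_cong[where f = Ex], rule ext)
    fix n :: int
    have "2 * of_real pi * \<i> * (t / of_real h) + 2 * of_int n * of_real pi * \<i> = 2 * of_real pi * \<i> * ((t + of_int n * of_real h) / of_real h)"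
      using assms by (simp add: field_simps)
    then show "(2 * of_real pi * \<i> * (s / of_real h) = 2 * of_real pi * \<i> * (t / of_real h) + 2 * of_int n * of_real pi * \<i>) = (s = t + of_int n * of_real h)"
      using assms by simp
  qed
  finally show ?thesis .
qed

lemma qpar_not_eq: "h > 0 \<Longrightarrow> eventually (\<lambda>s. qpar h s \<noteq> qpar h t) (at t)"
proof -
  assume h: "h > 0"
  have "eventually (\<lambda>s. s \<in> ball t h - {t}) (at t)" using h by (intro eventually_at_in_open) auto
  then show ?thesis
  proof eventually_elim
    case (elim s)
    show ?case
    proof
      assume "qpar h s = qpar h t"
      then obtain n :: int where n: "s = t + of_int n * of_real h" using qpar_eq_iff[OF h] by blast
      then have "n \<noteq> 0" using elim by auto
      then have "1 \<le> \<bar>real_of_int n\<bar>" by linarith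
      then have "h \<le> \<bar>real_of_int n\<bar> * h" using h by simp
      also have "\<dots> = dist t s" using n h by (simp add: dist_norm norm_mult)
      finally show False using elim by simp
    qed
  qed
qed

lemma cosparse_qpar:
  assumes "h > 0" "eventually P (cosparse (ball 0 1))"
  shows "eventually (\<lambda>t. P (qpar h t)) (cosparse uhp)"
  by (rule cosparse_compose[OF qpar_analytic[OF assms(1)] open_uhp _ qpar_not_eq[OF assms(1)] assms(2)])
     (use qpar_in_ball[OF assms(1)] in auto)

lemma qpar_surj:
  assumes h: "h > 0" and q: "q \<in> ball 0 1" "q \<noteq> 0"
  obtains t where "t \<in> uhp" "qpar h t = q"
proof -
  define t where "t = of_real h * Ln q / (2 * of_real pi * \<i>)"
  have "qpar h t = exp (Ln q)" using h by (simp add: t_def qpar_def qexp_def)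
  then have 1: "qpar h t = q" using q by simp
  have "exp (- 2 * pi * Im t / h) < exp 0" using q(1) 1 norm_qpar[OF h, of t] by simp
  then have "2 * pi * Im t / h > 0" unfolding exp_less_cancel_iff by simp
  then have "t \<in> uhp" using h by (simp add: uhp_def zero_less_divide_iff zero_less_mult_iff)
  then show ?thesis using that 1 by blast
qed

section \<open>Reduction theory for \<open>SL2Z\<close> and cosets of a subgroup of finite
  index\<close>

lemma SL2Z_det: "A \<in> SL2Z \<Longrightarrow> det A = 1" by (simp add: SL2Z_def)

lemma SL2Z_mk2: "A \<in> SL2Z \<longleftrightarrow> (\<exists>a b c d :: int. A = mk2 (of_int a) (of_int b) (of_int c) (of_int d) \<and> a * d - b * c = 1)"
proof
  assume A: "A \<in> SL2Z"
  then have "A$1$1 \<in> \<int>" "A$1$2 \<in> \<int>" "A$2$1 \<in> \<int>" "A$2$2 \<in> \<int>" and det: "det A = 1" by (auto simp: SL2Z_def)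
  then obtain a b c d :: int where abcd: "A$1$1 = of_int a" "A$1$2 = of_int b" "A$2$1 = of_int c" "A$2$2 = of_int d"
    by (auto elim!: Ints_cases)
  have "real_of_int (a * d - b * c) = 1" using det by (simp add: det_2 abcd)
  then have "a * d - b * c = 1" by linarith
  moreover have "A = mk2 (of_int a) (of_int b) (of_int c) (of_int d)" by (simp add: mat2_eq_iff abcd)
  ultimately show "\<exists>a b c d :: int. A = mk2 (of_int a) (of_int b) (of_int c) (of_int d) \<and> a * d - b * c = 1" by blast
next
  assume "\<exists>a b c d :: int. A = mk2 (of_int a) (of_int b) (of_int c) (of_int d) \<and> a * d - b * c = 1"
  then obtain a b c d :: int where A: "A = mk2 (of_int a) (of_int b) (of_int c) (of_int d)" and 1: "a * d - b * c = 1" by blast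
  have "real_of_int (a * d - b * c) = 1" using 1 by simp
  then show "A \<in> SL2Z" by (auto simp: SL2Z_def A det_2 forall_2)
qed

lemma countable_SL2Z: "countable SL2Z"
proof -
  have "SL2Z \<subseteq> (\<lambda>(a, b, c, d). mk2 (real_of_int a) (real_of_int b) (real_of_int c) (real_of_int d)) ` UNIV"
  proof
    fix A assume "A \<in> SL2Z"
    then obtain a b c d :: int where "A = mk2 (of_int a) (of_int b) (of_int c) (of_int d)"
      unfolding SL2Z_mk2 by blast
    then show "A \<in> (\<lambda>(a, b, c, d). mk2 (real_of_int a) (real_of_int b) (real_of_int c) (real_of_int d)) ` UNIV"
      by (intro image_eqI[of _ _ "(a, b, c, d)"]) auto
  qed
  then show ?thesis by (rule countable_subset) (intro countable_image countableI_type)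
qed

lemma SL2Z_one: "mat 1 \<in> SL2Z"
  by (auto simp: SL2Z_def forall_2 mat2_one_nth det_2)

lemma SL2Z_mult: "A \<in> SL2Z \<Longrightarrow> B \<in> SL2Z \<Longrightarrow> A ** B \<in> SL2Z"
  by (auto simp: SL2Z_def mat2_mult_nth det_mul)

lemma SL2Z_minv: "A \<in> SL2Z \<Longrightarrow> minv A \<in> SL2Z"
  by (auto simp: SL2Z_def forall_2 minv_def det_2 algebra_simps)

text \<open>Dirichlet's approximation theorem takes the place of a fundamental domain: it yields a
  bottom row \<open>(c, d)\<close> with \<open>|c * t + d|^2 \<le> 5 * Im t\<close>, and the
  imaginary part of the image is \<open>Im t\<close> divided by this square.\<close>

lemma uhp_reduction:
  assumes t: "t \<in> uhp"
  obtains A where "A \<in> SL2Z" "Im (act A t) \<ge> 1 / 5"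
proof (cases "Im t \<ge> 1 / 5")
  case True
  then show ?thesis using that[of "mat 1"] SL2Z_one by simp
next
  case False
  define y where "y = Im t"
  have y: "0 < y" "y < 1 / 5" using False t by (auto simp: y_def uhp_def)
  define s where "s = sqrt y"
  have s: "0 < s" "s < 1" "s\<^sup>2 = y" using y by (auto simp: s_def)
  \<comment> \<open>With \<open>N\<close> about \<open>1 / sqrt y\<close> the two contributions
    \<open>(1 / N)^2 \<le> y\<close> and \<open>(N * y)^2 \<le> 4 * y\<close> are of the same order;
    their sum is the origin of the constant 5.\<close>
  define N where "N = nat \<lceil>1 / s\<rceil>"
  have N: "1 / s \<le> real N" "real N < 1 / s + 1" using s by (auto simp: N_def) linarith+
  have "real N > 0" using N(1) s(1) by (smt (verit) divide_pos_pos)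
  then have N0: "N > 0" by simp
  have "\<exists>q p. 0 < q \<and> q \<le> int N \<and> \<bar>real_of_int q * Re t - of_int p\<bar> < 1 / N"
  proof (rule Dirichlet_approx_simult[OF N0, where n = 1 and \<theta> = "\<lambda>_. Re t"])
    fix q and p :: "nat \<Rightarrow> int"
    assume "0 < q" "q \<le> int (N ^ 1)" "\<And>i. i < 1 \<Longrightarrow> \<bar>real_of_int q * Re t - of_int (p i)\<bar> < 1 / N"
    then show ?thesis by (intro exI[of _ q] exI[of _ "p 0"]) simp
  qed
  then obtain q p where q: "0 < q" "q \<le> int N" "\<bar>real_of_int q * Re t - of_int p\<bar> < 1 / N" by blast
  \<comment> \<open>Division by the gcd makes the row coprime, hence completable to determinant one,
    and does not increase \<open>|c * t + d|\<close>.\<close>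
  define g where "g = gcd q (- p)"
  have g: "g > 0" using q(1) by (simp add: g_def)
  obtain c d where cd: "q = g * c" "- p = g * d" "coprime c d"
    using gcd_coprime_exists[of q "- p"] g unfolding g_def by (metis mult.commute less_irrefl)
  obtain u v where uv: "u * c + v * d = 1" using bezout_int[of c d] cd(3) by auto
  define A where "A = mk2 (of_int v) (of_int (- u)) (of_int c) (of_int d)"
  have A: "A \<in> SL2Z"
    unfolding SL2Z_mk2 A_def using uv
    by (intro exI[of _ v] exI[of _ "- u"] exI[of _ c] exI[of _ d]) (simp add: algebra_simps)
  have af: "of_int g * autfac A t = of_int q * t - of_int p"
  proof -
    have "of_int g * autfac A t = of_int (g * c) * t + of_int (g * d)"
      by (simp add: autfac_def A_def algebra_simps)
    then show ?thesis unfolding cd(1,2)[symmetric] by simp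
  qed
  have "(cmod (autfac A t))\<^sup>2 \<le> (cmod (of_int g * autfac A t))\<^sup>2"
  proof (rule power_mono)
    have "1 * cmod (autfac A t) \<le> real_of_int g * cmod (autfac A t)" using g by (intro mult_right_mono) auto
    then show "cmod (autfac A t) \<le> cmod (of_int g * autfac A t)" using g by (simp add: norm_mult)
  qed simp
  also have "\<dots> = (of_int q * Re t - of_int p)\<^sup>2 + (of_int q * y)\<^sup>2"
    unfolding af cmod_power2 by (simp add: y_def)
  also have "\<dots> \<le> (1 / N)\<^sup>2 + (N * y)\<^sup>2"
  proof (rule add_mono)
    show "(of_int q * Re t - of_int p)\<^sup>2 \<le> (1 / N)\<^sup>2"
      using q(3) by (simp add: abs_le_square_iff[symmetric])
    have "real_of_int q \<le> real N" using q(2) by simp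
    then show "(of_int q * y)\<^sup>2 \<le> (N * y)\<^sup>2" using q(1) y by (intro power_mono mult_right_mono) auto
  qed
  also have "\<dots> \<le> s\<^sup>2 + (2 * s)\<^sup>2"
  proof (rule add_mono)
    have "1 / real N \<le> s" using N(1) s(1) \<open>real N > 0\<close> by (simp add: field_simps)
    then show "(1 / N)\<^sup>2 \<le> s\<^sup>2" by (intro power_mono) auto
    have "real N * y \<le> (1 / s + 1) * y" using N(2) y by (intro mult_right_mono) auto
    also have "\<dots> = s + s * s" using s by (simp add: field_simps power2_eq_square flip: s(3))
    also have "\<dots> \<le> 2 * s" using s by (simp add: mult_le_cancel_left1)
    finally show "(N * y)\<^sup>2 \<le> (2 * s)\<^sup>2" using y by (intro power_mono) auto
  qed
  also have "\<dots> = 5 * y" using s(3) by (simp add: power_mult_distrib)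
  finally have le: "(cmod (autfac A t))\<^sup>2 \<le> 5 * y" .
  have det: "det A = 1" by (rule SL2Z_det[OF A])
  have nz: "(cmod (autfac A t))\<^sup>2 > 0" using autfac_nonzero[OF det] t by (simp add: uhp_def)
  have "1 / 5 \<le> y / (cmod (autfac A t))\<^sup>2" using le nz by (simp add: field_simps)
  then show ?thesis using that[OF A] Im_act[OF det] t by (simp add: uhp_def y_def)
qed

definition mat_group :: "(real^2^2) set \<Rightarrow> bool" where
  "mat_group G \<longleftrightarrow> mat 1 \<in> G \<and> (\<forall>A\<in>G. det A = 1 \<and> minv A \<in> G) \<and> (\<forall>A\<in>G. \<forall>B\<in>G. A ** B \<in> G)"

lemma mat_group_SL2Z: "mat_group SL2Z"
  by (simp add: mat_group_def SL2Z_one SL2Z_det SL2Z_minv SL2Z_mult)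

lemma mat_group_subgroup:
  assumes "subgroup G SL2R" shows "mat_group G"
proof -
  interpret subgroup G SL2R by fact
  have det: "det A = 1" if "A \<in> G" for A using subset that by (auto simp: SL2R_def)
  have m: "A \<otimes>\<^bsub>SL2R\<^esub> B = A ** B" for A B by (simp add: SL2R_def)
  have "minv A \<in> G" if "A \<in> G" for A
  proof -
    have "m_inv SL2R A = minv A"
      by (rule group.inv_equality[OF group_SL2R])
         (use det[OF that] in \<open>simp_all add: SL2R_def minv_mult det_minv\<close>)
    then show ?thesis using m_inv_closed[OF that] by simp
  qed
  moreover have "mat 1 \<in> G" using one_closed by (simp add: SL2R_def)
  ultimately show ?thesis using det m_closed by (auto simp: mat_group_def m)
qed

text \<open>
  \<open>R\<close> represents the cosets \<open>G r\<close>, and \<open>h\<close> is a common multiple of all cusp widths.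
\<close>

definition coset_data :: "(real^2^2) set \<Rightarrow> (real^2^2) set \<Rightarrow> real \<Rightarrow> bool" where
  "coset_data G R h \<longleftrightarrow> mat_group G \<and> G \<subseteq> SL2Z \<and> finite R \<and> R \<subseteq> SL2Z \<and>
     (\<forall>\<gamma>\<in>SL2Z. \<exists>r\<in>R. \<exists>g\<in>G. \<gamma> = g ** r) \<and> (\<forall>r\<in>R. \<forall>r'\<in>R. \<forall>g\<in>G. r' = g ** r \<longrightarrow> r' = r) \<and>
     1 \<le> h \<and> (\<forall>r\<in>R. \<exists>g\<in>G. r ** mk2 1 h 0 1 = g ** r)"

lemma mk2_shift_mult: "mk2 1 a 0 1 ** mk2 1 b 0 1 = mk2 1 (a + b) 0 1"
  by (simp add: mat2_eq_iff mat2_mult_nth)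

text \<open>Finiteness of the set of cosets gives representatives and, by the pigeonhole principle,
  a positive width for each of them; the product of the widths is a common multiple.\<close>

lemma exists_coset_data:
  assumes "subgroup \<Gamma> SL2R" "commensurable SL2R \<Gamma> SL2Z"
  obtains R h where "coset_data (\<Gamma> \<inter> SL2Z) R h"
proof -
  define G where "G = \<Gamma> \<inter> SL2Z"
  have mg: "mat_group G"
    using mat_group_subgroup[OF assms(1)] mat_group_SL2Z unfolding mat_group_def G_def by blast
  have G1: "mat 1 \<in> G" and Gm: "\<And>A B. A \<in> G \<Longrightarrow> B \<in> G \<Longrightarrow> A ** B \<in> G" and Gi: "\<And>A. A \<in> G \<Longrightarrow> minv A \<in> G"
    and Gd: "\<And>A. A \<in> G \<Longrightarrow> det A = 1"
    using mg by (auto simp: mat_group_def)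
  define cs where "cs = (\<lambda>a :: real^2^2. {g ** a | g. g \<in> G})"
  have "finite (cs ` SL2Z)"
  proof -
    have "rcosets\<^bsub>SL2R\<lparr>carrier := SL2Z\<rparr>\<^esub> (\<Gamma> \<inter> SL2Z) = cs ` SL2Z"
      by (auto simp: RCOSETS_def r_coset_def cs_def G_def SL2R_def)
    then show ?thesis using assms(2) by (simp add: commensurable_def)
  qed
  define rep where "rep = (\<lambda>C. SOME a. a \<in> SL2Z \<and> cs a = C)"
  have rep: "rep (cs a) \<in> SL2Z" "cs (rep (cs a)) = cs a" if "a \<in> SL2Z" for a
    using someI[of "\<lambda>b. b \<in> SL2Z \<and> cs b = cs a" a] that unfolding rep_def by auto
  define R where "R = rep ` cs ` SL2Z"
  have in_cs: "a \<in> cs a" for a unfolding cs_def using G1 by (auto intro!: exI[of _ "mat 1"])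
  have R: "finite R" "R \<subseteq> SL2Z" using \<open>finite (cs ` SL2Z)\<close> rep by (auto simp: R_def)
  have cover: "\<exists>r\<in>R. \<exists>g\<in>G. \<gamma> = g ** r" if "\<gamma> \<in> SL2Z" for \<gamma>
  proof -
    have "\<gamma> \<in> cs (rep (cs \<gamma>))" using rep(2)[OF that] in_cs by simp
    then obtain g where "g \<in> G" "\<gamma> = g ** rep (cs \<gamma>)" by (auto simp: cs_def)
    then show ?thesis using that unfolding R_def by blast
  qed
  have cs_eq: "cs (g ** a) = cs a" if "g \<in> G" for g a
  proof -
    have "h ** (g ** a) \<in> cs a" if "h \<in> G" for h
      unfolding cs_def using Gm[OF that \<open>g \<in> G\<close>] by (auto simp: matrix_mul_assoc)
    moreover have "h ** a \<in> cs (g ** a)" if "h \<in> G" for h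
    proof -
      have "h ** a = (h ** minv g) ** (g ** a)"
        by (metis Gd \<open>g \<in> G\<close> matrix_mul_assoc matrix_mul_rid minv_mult(1))
      then show ?thesis unfolding cs_def using Gm[OF that Gi[OF \<open>g \<in> G\<close>]] by blast
    qed
    ultimately show ?thesis unfolding cs_def by blast
  qed
  have uniq: "r' = r" if "r \<in> R" "r' \<in> R" "g \<in> G" "r' = g ** r" for r r' g
  proof -
    have "cs r' = cs r" using cs_eq that by simp
    moreover have "r = rep (cs r)" "r' = rep (cs r')" using that(1,2) rep by (auto simp: R_def)
    ultimately show ?thesis by metis
  qed
  \<comment> \<open>Among the matrices \<open>r ** mk2 1 k 0 1\<close> two lie in the same coset;
    the difference of their exponents is a period at the cusp of \<open>r\<close>.\<close>
  have shift: "\<exists>m>0. \<exists>g\<in>G. r ** mk2 1 (real m) 0 1 = g ** r" if "r \<in> R" for r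
  proof -
    have TZ: "mk2 1 (real k) 0 1 \<in> SL2Z" for k
      unfolding SL2Z_mk2 by (rule exI[of _ 1], rule exI[of _ "int k"], rule exI[of _ 0], rule exI[of _ 1]) simp
    have rT: "r ** mk2 1 (real k) 0 1 \<in> SL2Z" for k using R(2) that SL2Z_mult TZ by blast
    have "\<not> inj (\<lambda>k. cs (r ** mk2 1 (real k) 0 1))"
    proof
      assume "inj (\<lambda>k. cs (r ** mk2 1 (real k) 0 1))"
      moreover have "range (\<lambda>k. cs (r ** mk2 1 (real k) 0 1)) \<subseteq> cs ` SL2Z" using rT by blast
      ultimately have "finite (UNIV :: nat set)"
        using \<open>finite (cs ` SL2Z)\<close> by (meson finite_subset finite_imageD)
      then show False by simp
    qed
    then obtain k l where kl: "k < l" "cs (r ** mk2 1 (real k) 0 1) = cs (r ** mk2 1 (real l) 0 1)"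
      by (metis (no_types, lifting) injI nat_neq_iff)
    then have "r ** mk2 1 (real l) 0 1 \<in> cs (r ** mk2 1 (real k) 0 1)" using in_cs by simp
    then obtain g where g: "g \<in> G" "r ** mk2 1 (real l) 0 1 = g ** (r ** mk2 1 (real k) 0 1)" unfolding cs_def by blast
    have "mk2 1 (real l) 0 1 ** mk2 1 (- real k) 0 1 = mk2 1 (real (l - k)) 0 1"
      "mk2 1 (real k) 0 1 ** mk2 1 (- real k) 0 1 = mat 1"
      using kl(1) by (simp_all add: mk2_shift_mult of_nat_diff) (simp add: mat2_eq_iff mat2_one_nth)
    then have "r ** mk2 1 (real (l - k)) 0 1 = g ** r"
      using arg_cong[OF g(2), of "\<lambda>M. M ** mk2 1 (- real k) 0 1"] by (simp add: matrix_mul_assoc[symmetric])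
    then show ?thesis using g(1) kl(1) by (intro exI[of _ "l - k"]) auto
  qed
  then obtain m where m: "\<And>r. r \<in> R \<Longrightarrow> m r > 0 \<and> (\<exists>g\<in>G. r ** mk2 1 (real (m r)) 0 1 = g ** r)" by metis
  have mult: "\<exists>g\<in>G. r ** mk2 1 (real (m r * j)) 0 1 = g ** r" if rR: "r \<in> R" for r j
  proof (induction j)
    case 0
    have "mk2 1 0 0 1 = mat 1" by (simp add: mat2_eq_iff mat2_one_nth)
    then show ?case using G1 by (intro bexI[of _ "mat 1"]) auto
  next
    case (Suc j)
    then obtain g where g: "g \<in> G" "r ** mk2 1 (real (m r * j)) 0 1 = g ** r" by blast
    obtain g' where g': "g' \<in> G" "r ** mk2 1 (real (m r)) 0 1 = g' ** r" using m[OF rR] by blast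
    have "mk2 1 (real (m r * Suc j)) 0 1 = mk2 1 (real (m r * j)) 0 1 ** mk2 1 (real (m r)) 0 1"
      by (simp add: mk2_shift_mult algebra_simps)
    then have "r ** mk2 1 (real (m r * Suc j)) 0 1 = (g ** r) ** mk2 1 (real (m r)) 0 1"
      using g(2) by (simp only: matrix_mul_assoc)
    also have "\<dots> = (g ** g') ** r" using g'(2) by (simp only: matrix_mul_assoc[symmetric])
    finally show ?case using Gm[OF g(1) g'(1)] by blast
  qed
  \<comment> \<open>A positive integer, hence at least 1: the parameter \<open>qpar h\<close> will
    have to be injective on a strip of width one.\<close>
  define h where "h = (\<Prod>r\<in>R. m r)"
  have "h > 0" unfolding h_def using m by (intro prod_pos) blast
  moreover have "\<exists>g\<in>G. r ** mk2 1 (real h) 0 1 = g ** r" if "r \<in> R" for r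
  proof -
    have "h = m r * (\<Prod>r\<in>R - {r}. m r)" unfolding h_def using R(1) that by (rule prod.remove)
    then show ?thesis using mult[OF that, of "\<Prod>r\<in>R - {r}. m r"] by simp
  qed
  ultimately have "coset_data G R (real h)"
    unfolding coset_data_def using mg R cover uniq by (auto simp: G_def)
  then show ?thesis using that unfolding G_def by blast
qed

text \<open>Right multiplication by \<open>\<gamma>\<close> permutes the cosets \<open>G r\<close>;
  uniqueness of representatives gives injectivity, and finiteness does the rest.\<close>

lemma coset_permutation:
  assumes cd: "coset_data G R h" and \<gamma>: "\<gamma> \<in> SL2Z"
  obtains \<pi> where "bij_betw \<pi> R R" "\<And>r. r \<in> R \<Longrightarrow> \<exists>g\<in>G. r ** \<gamma> = g ** \<pi> r"
proof -
  have mg: "mat_group G" and R: "finite R" "R \<subseteq> SL2Z" and cover: "\<And>\<gamma>. \<gamma> \<in> SL2Z \<Longrightarrow> \<exists>r\<in>R. \<exists>g\<in>G. \<gamma> = g ** r"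
    and uniq: "\<And>r r' g. r \<in> R \<Longrightarrow> r' \<in> R \<Longrightarrow> g \<in> G \<Longrightarrow> r' = g ** r \<Longrightarrow> r' = r"
    using cd by (auto simp: coset_data_def)
  have "\<exists>r'\<in>R. \<exists>g\<in>G. r ** \<gamma> = g ** r'" if "r \<in> R" for r
    using cover SL2Z_mult \<gamma> R(2) that by blast
  then obtain \<pi> where \<pi>: "\<And>r. r \<in> R \<Longrightarrow> \<pi> r \<in> R" "\<And>r. r \<in> R \<Longrightarrow> \<exists>g\<in>G. r ** \<gamma> = g ** \<pi> r" by metis
  have "inj_on \<pi> R"
  proof (rule inj_onI)
    fix r s assume rs: "r \<in> R" "s \<in> R" "\<pi> r = \<pi> s"
    obtain g where g: "g \<in> G" "r ** \<gamma> = g ** \<pi> r" using \<pi>(2)[OF rs(1)] by blast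
    obtain k where k: "k \<in> G" "s ** \<gamma> = k ** \<pi> s" using \<pi>(2)[OF rs(2)] by blast
    have det: "det g = 1" "det \<gamma> = 1" using mg g(1) SL2Z_det[OF \<gamma>] by (auto simp: mat_group_def)
    have "\<pi> r = minv g ** (r ** \<gamma>)" unfolding g(2) by (simp add: matrix_mul_assoc minv_mult det)
    then have "s ** \<gamma> = k ** (minv g ** (r ** \<gamma>))" using k(2) rs(3) by simp
    then have "(s ** \<gamma>) ** minv \<gamma> = ((k ** minv g) ** r) ** (\<gamma> ** minv \<gamma>)" by (simp add: matrix_mul_assoc)
    then have "s = (k ** minv g) ** r" by (simp add: matrix_mul_assoc[symmetric] minv_mult det)
    moreover have "k ** minv g \<in> G" using mg g(1) k(1) by (auto simp: mat_group_def)
    ultimately show "r = s" using uniq rs by metis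
  qed
  then have "bij_betw \<pi> R R" using \<pi>(1) R(1) by (simp add: bij_betw_def endo_inj_surj image_subsetI)
  then show ?thesis using that \<pi>(2) by blast
qed

section \<open>Periodic functions of moderate growth as meromorphic functions of the
  parameter\<close>

lemma nicely_meromorphic_bounded:
  assumes f: "f meromorphic_on A" "open A" and S: "open S" "S \<subseteq> A" "\<And>t. t \<in> S \<Longrightarrow> cmod (f t) \<le> B t" "continuous_on S B"
    and t: "t \<in> S"
  shows "remove_sings f analytic_on {t} \<and> cmod (remove_sings f t) \<le> B t"
proof -
  let ?F = "remove_sings f"
  have nice: "?F nicely_meromorphic_on A" by (rule remove_sings_nicely_meromorphic[OF f(1)])
  have "eventually (\<lambda>z. ?F z = f z) (at t)"
    using eventually_remove_sings_eq[OF f(1)] S(2) t eventually_cosparse_imp_eventually_at by blast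
  moreover have "eventually (\<lambda>z. z \<in> S) (at t)" by (rule eventually_at_in_open'[OF S(1) t])
  ultimately have ev: "eventually (\<lambda>z. cmod (?F z) \<le> B z) (at t)"
    by eventually_elim (use S(3) in auto)
  have B: "(B \<longlongrightarrow> B t) (at t)"
    using S(1,4) t by (metis continuous_on_eq_continuous_at isContD)
  have np: "\<not> is_pole ?F t"
  proof
    assume "is_pole ?F t"
    then have "filterlim (\<lambda>z. cmod (?F z)) at_top (at t)"
      unfolding is_pole_def by (rule filterlim_at_infinity_imp_norm_at_top)
    then have 1: "eventually (\<lambda>z. B t + 1 < cmod (?F z)) (at t)" unfolding filterlim_at_top_dense by blast
    have 2: "eventually (\<lambda>z. B z < B t + 1) (at t)" using B by (rule order_tendstoD) simp
    have "eventually (\<lambda>z. False) (at t)" using 1 2 ev by eventually_elim linarith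
    then show False by simp
  qed
  have an: "?F analytic_on {t}" using nicely_meromorphic_on_imp_analytic_at[OF nice _ np] S(2) t by blast
  then have "?F \<midarrow>t\<rightarrow> ?F t" by (simp add: analytic_at_imp_isCont isContD)
  then have "((\<lambda>z. cmod (?F z)) \<longlongrightarrow> cmod (?F t)) (at t)" by (rule tendsto_norm)
  then have "cmod (?F t) \<le> B t" using B ev by (intro tendsto_le[of "at t"]) auto
  with an show ?thesis by blast
qed

text \<open>Periodicity makes \<open>f\<close> a function of \<open>q\<close> on the punctured disc,
  and the growth condition is a bound by a power of \<open>1 / |q|\<close>, so the puncture is at
  worst a pole. A bound on a strip is enough, because the principal logarithm places a preimage of
  each \<open>q\<close> in \<open>|Re t| \<le> h / 2\<close>.\<close>

lemma q_expansion:
  assumes f: "f meromorphic_on uhp" and h: "h > 0" and per: "\<forall>\<^sub>\<approx>t\<in>uhp. f (t + of_real h) = f t"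
    and L: "L > h" and gr: "\<And>t. Im t > c0 \<Longrightarrow> \<bar>Re t\<bar> < L \<Longrightarrow> cmod (f t) \<le> C * exp (C * Im t)" and c0: "c0 \<ge> 0"
  obtains \<Psi> where "\<Psi> nicely_meromorphic_on ball 0 1" "\<forall>\<^sub>\<approx>t\<in>uhp. f t = \<Psi> (qpar h t)"
proof -
  define F where "F = remove_sings f"
  have nice: "F nicely_meromorphic_on uhp" unfolding F_def by (rule remove_sings_nicely_meromorphic[OF f])
  have mF: "F meromorphic_on uhp" using nice by (simp add: nicely_meromorphic_on_def)
  have fF: "\<forall>\<^sub>\<approx>t\<in>uhp. F t = f t" unfolding F_def by (rule eventually_remove_sings_eq[OF f])
  define S where "S = {t. Im t > c0 \<and> \<bar>Re t\<bar> < L}"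
  have S: "open S" unfolding S_def by (intro open_Collect_conj open_Collect_less continuous_intros)
  have SF: "F analytic_on {t} \<and> cmod (F t) \<le> C * exp (C * Im t)" if "t \<in> S" for t
    unfolding F_def
    by (rule nicely_meromorphic_bounded[OF f open_uhp S])
       (use that gr c0 in \<open>auto simp: S_def uhp_def intro!: continuous_intros\<close>)
  \<comment> \<open>Removing singularities upgrades periodicity off a sparse set to periodicity
    everywhere.\<close>
  have per1: "F (t + of_real h) = F t" if t: "t \<in> uhp" for t
  proof -
    have "eventually (\<lambda>s. f (s + of_real h) = f s) (at t)"
      using per t eventually_cosparse_imp_eventually_at by blast
    then have ev: "eventually (\<lambda>w. f (t + of_real h + w) = f (t + w)) (at 0)"
      by (simp add: at_to_0' eventually_filtermap algebra_simps)
    have "F (t + of_real h) = remove_sings (\<lambda>w. f (t + of_real h + w)) 0"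
      unfolding F_def by (rule remove_sings_shift_0)
    also have "\<dots> = remove_sings (\<lambda>w. f (t + w)) 0"
      by (rule remove_sings_cong[OF ev refl])
    also have "\<dots> = F t" unfolding F_def by (rule remove_sings_shift_0[symmetric])
    finally show ?thesis .
  qed
  have uhp_shift: "t + of_real x \<in> uhp" if "t \<in> uhp" for t x using that by (simp add: uhp_def)
  have pern: "F (t + of_nat n * of_real h) = F t" if t: "t \<in> uhp" for t n
  proof (induction n)
    case (Suc n)
    have "t + of_nat n * of_real h \<in> uhp" using t by (simp add: uhp_def)
    from per1[OF this] Suc show ?case by (simp add: algebra_simps)
  qed simp
  have perz: "F (t + of_int n * of_real h) = F t" if t: "t \<in> uhp" for t n
  proof (cases "n \<ge> 0")
    case True
    then show ?thesis using pern[OF t, of "nat n"] by simp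
  next
    case False
    have "t + of_int n * of_real h \<in> uhp" using t by (simp add: uhp_def)
    from pern[OF this, of "nat (- n)"] False show ?thesis by simp
  qed
  define l where "l = (\<lambda>q. of_real h * Ln q / (2 * of_real pi * \<i>))"
  have ql: "qpar h (l q) = q" if "q \<noteq> 0" for q using h that by (simp add: l_def qpar_def qexp_def)
  have luhp: "t \<in> uhp" if "qpar h t = q" "q \<in> ball 0 1" for t q
  proof -
    have "exp (- 2 * pi * Im t / h) < exp 0" using that norm_qpar[OF h, of t] by simp
    then have "2 * pi * Im t / h > 0" unfolding exp_less_cancel_iff by simp
    then show "t \<in> uhp" using h by (simp add: uhp_def zero_less_divide_iff zero_less_mult_iff)
  qed
  define \<Psi> where "\<Psi> = (\<lambda>q. F (l q))"
  have PF: "\<Psi> (qpar h t) = F t" if t: "t \<in> uhp" for t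
  proof -
    have "qpar h (l (qpar h t)) = qpar h t" by (rule ql[OF qpar_nonzero])
    then obtain n :: int where "l (qpar h t) = t + of_int n * of_real h" using qpar_eq_iff[OF h] by blast
    then show ?thesis using perz[OF t] by (simp add: \<Psi>_def)
  qed
  \<comment> \<open>The principal branch in \<open>l\<close> has a cut. The branch
    \<open>Ln (w / q) + Ln q\<close> is analytic at \<open>q\<close>, and the two preimages of
    \<open>w\<close> differ by a multiple of the period, which \<open>F\<close> does not
    see.\<close>
  have loc: "\<exists>k. k analytic_on {q} \<and> k q = l q \<and> (\<forall>\<^sub>F w in nhds q. \<Psi> w = F (k w))" if q: "q \<in> ball 0 1" "q \<noteq> 0" for q
  proof -
    define k where "k = (\<lambda>w. of_real h * (Ln (w / q) + Ln q) / (2 * of_real pi * \<i>))"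
    have an: "k analytic_on {q}" unfolding k_def using q(2) by (intro analytic_intros) auto
    have kq: "k q = l q" using q(2) by (simp add: k_def l_def)
    have "eventually (\<lambda>w. w \<in> ball 0 1 - {0}) (nhds q)" using q by (intro eventually_nhds_in_open) auto
    then have "\<forall>\<^sub>F w in nhds q. \<Psi> w = F (k w)"
    proof eventually_elim
      case (elim w)
      have "qpar h (k w) = exp (Ln (w / q) + Ln q)" using h by (simp add: k_def qpar_def qexp_def)
      also have "\<dots> = w" using q(2) elim by (simp add: exp_add)
      finally have qk: "qpar h (k w) = w" .
      then have "k w \<in> uhp" using luhp elim by blast
      from PF[OF this] qk show ?case by simp
    qed
    with an kq show ?thesis by blast
  qed
  have m1: "\<Psi> meromorphic_on {q}" if q: "q \<in> ball 0 1" "q \<noteq> 0" for q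
  proof -
    obtain k where k: "k analytic_on {q}" "k q = l q" "\<forall>\<^sub>F w in nhds q. \<Psi> w = F (k w)" using loc[OF q] by blast
    have lu: "l q \<in> uhp" by (rule luhp[OF ql[OF q(2)] q(1)])
    have "(\<lambda>w. F (k w)) meromorphic_on {q}"
      by (rule meromorphic_on_compose[OF mF k(1)]) (use k(2) lu in auto)
    moreover have "\<forall>\<^sub>F w in at q. \<Psi> w = F (k w)" using k(3) by (simp add: eventually_nhds_conv_at)
    ultimately show ?thesis using meromorphic_on_cong[of "{q}" \<Psi> "\<lambda>w. F (k w)" "{q}"] by simp
  qed
  define e where "e = exp (- 2 * pi * c0 / h)"
  have e: "0 < e" "e \<le> 1" using c0 h by (auto simp: e_def)
  have lS: "l q \<in> S \<and> cmod q = exp (- 2 * pi * Im (l q) / h)" if q: "q \<in> ball 0 e - {0}" for q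
  proof -
    have nq: "cmod q = exp (- 2 * pi * Im (l q) / h)" using norm_qpar[OF h, of "l q"] ql[of q] q by simp
    have "- 2 * pi * Im (l q) / h < - 2 * pi * c0 / h" using q nq unfolding e_def by simp
    then have "Im (l q) > c0" using h by (simp add: divide_less_cancel)
    moreover have "\<bar>Re (l q)\<bar> < L"
    proof -
      have "Re (l q) = h * Im (Ln q) / (2 * pi)" by (simp add: l_def Re_divide power2_eq_square)
      moreover have "\<bar>Im (Ln q)\<bar> \<le> pi" using mpi_less_Im_Ln[of q] Im_Ln_le_pi[of q] q by auto
      then have "h * \<bar>Im (Ln q)\<bar> \<le> h * pi" using h by (intro mult_left_mono) auto
      then have "h * \<bar>Im (Ln q)\<bar> / (2 * pi) \<le> h * pi / (2 * pi)" by (intro divide_right_mono) auto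
      then have "\<bar>h * Im (Ln q) / (2 * pi)\<bar> \<le> h / 2" using h by (simp add: abs_mult)
      ultimately show ?thesis using L h by simp
    qed
    ultimately show ?thesis using nq by (simp add: S_def)
  qed
  have an1: "\<Psi> analytic_on {q}" if q: "q \<in> ball 0 e - {0}" for q
  proof -
    have q1: "q \<in> ball 0 1" "q \<noteq> 0" using q e by auto
    obtain k where k: "k analytic_on {q}" "k q = l q" "\<forall>\<^sub>F w in nhds q. \<Psi> w = F (k w)" using loc[OF q1] by blast
    have "F analytic_on k ` {q}" using SF lS[OF q] k(2) by simp
    then have "(F \<circ> k) analytic_on {q}" by (rule analytic_on_compose[OF k(1)])
    then show ?thesis using analytic_at_cong[OF k(3) refl] by (simp add: o_def)
  qed
  \<comment> \<open>\<open>exp (C * Im t)\<close> is \<open>|q|\<close> to the power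
    \<open>- C * h / (2 * pi)\<close>; the added 1 leaves a spare factor \<open>|q|\<close>, so that
    \<open>q ^ n * \<Psi> q\<close> tends to 0.\<close>
  obtain n :: nat where n: "C * h / (2 * pi) + 1 \<le> real n" using real_arch_simple by blast
  have bd: "cmod (q ^ n * \<Psi> q) \<le> C * cmod q" if q: "q \<in> ball 0 e - {0}" for q
  proof -
    have l: "l q \<in> S" "cmod q = exp (- 2 * pi * Im (l q) / h)" using lS[OF q] by auto
    have Im: "Im (l q) > 0" using l(1) c0 by (simp add: S_def)
    have C0: "0 \<le> C" using SF[OF l(1)] norm_ge_zero order_trans by (metis exp_gt_zero zero_le_mult_iff not_less)
    have "cmod (q ^ n * \<Psi> q) \<le> cmod q ^ n * (C * exp (C * Im (l q)))"
      using SF[OF l(1)] by (auto simp: norm_mult norm_power \<Psi>_def intro!: mult_left_mono)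
    also have "cmod q ^ n = exp (real n * (- 2 * pi * Im (l q) / h))" unfolding l(2) by (rule exp_of_nat_mult[symmetric])
    also have "\<dots> * (C * exp (C * Im (l q))) = C * exp (real n * (- 2 * pi * Im (l q) / h) + C * Im (l q))"
      unfolding exp_add by (simp only: mult_ac)
    also have "\<dots> \<le> C * exp (- 2 * pi * Im (l q) / h)"
    proof (intro mult_left_mono C0, subst exp_le_cancel_iff)
      have "(C * h / (2 * pi) + 1) * (2 * pi * Im (l q) / h) \<le> real n * (2 * pi * Im (l q) / h)"
        using n Im h by (intro mult_right_mono) auto
      moreover have "(C * h / (2 * pi) + 1) * (2 * pi * Im (l q) / h) = C * Im (l q) + 2 * pi * Im (l q) / h"
        using h by (simp add: field_simps)
      ultimately show "real n * (- 2 * pi * Im (l q) / h) + C * Im (l q) \<le> - 2 * pi * Im (l q) / h" by simp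
    qed
    finally show ?thesis using l(2) by simp
  qed
  have m0: "\<Psi> meromorphic_on {0}"
  proof -
    define g where "g = (\<lambda>q. q ^ n * \<Psi> q)"
    have "g analytic_on {q}" if "q \<in> ball 0 e - {0}" for q
      unfolding g_def by (intro analytic_intros an1 that)
    then have "g analytic_on ball 0 e - {0}" using analytic_on_analytic_at by blast
    then have iso: "isolated_singularity_at g 0" using e(1) unfolding isolated_singularity_at_def by blast
    have "g \<midarrow>0\<rightarrow> 0"
    proof (rule Lim_null_comparison)
      have "eventually (\<lambda>q. q \<in> ball 0 e - {0}) (at (0::complex))" using e(1) by (intro eventually_at_in_open) auto
      then show "\<forall>\<^sub>F q in at 0. cmod (g q) \<le> C * cmod q"
        by eventually_elim (use bd in \<open>auto simp: g_def\<close>)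
      show "((\<lambda>q. C * cmod q) \<longlongrightarrow> 0) (at (0::complex))"
        by (rule tendsto_eq_intros | simp)+
    qed
    then have "g meromorphic_on {0}" using iso by (auto simp: meromorphic_at_iff not_essential_def)
    then have "(\<lambda>q. g q / q ^ n) meromorphic_on {0}" by (intro meromorphic_intros)
    moreover have "\<forall>\<^sub>F q in at 0. \<Psi> q = g q / q ^ n"
      by (simp add: eventually_at_filter g_def)
    ultimately show ?thesis using meromorphic_on_cong[of "{0}" \<Psi> "\<lambda>q. g q / q ^ n" "{0}"] by simp
  qed
  have "\<Psi> meromorphic_on {q}" if "q \<in> ball 0 1" for q using m0 m1[OF that] by (cases "q = 0") auto
  then have mP: "\<Psi> meromorphic_on ball 0 1" using meromorphic_on_meromorphic_at by blast
  show ?thesis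
  proof (rule that[of "remove_sings \<Psi>"])
    show "remove_sings \<Psi> nicely_meromorphic_on ball 0 1" by (rule remove_sings_nicely_meromorphic[OF mP])
    have "\<forall>\<^sub>\<approx>t\<in>uhp. remove_sings \<Psi> (qpar h t) = \<Psi> (qpar h t)"
      by (rule cosparse_qpar[OF h eventually_remove_sings_eq[OF mP]])
    then show "\<forall>\<^sub>\<approx>t\<in>uhp. f t = remove_sings \<Psi> (qpar h t)"
      using fF cosparse_uhp_in by eventually_elim (simp add: PF)
  qed
qed

section \<open>Zeros of polynomial relations between modular functions\<close>

text \<open>One expansion is taken for each coset representative, all in the same parameter
  \<open>qpar h\<close>. Reduction theory supplies the equivalence hypothesis of
  \<open>disc_zero_bound\<close>, and the identity theorem carries the vanishing at one coset back
  to the slice itself.\<close>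

lemma slice_zero_bound:
  fixes f :: "nat \<Rightarrow> complex \<Rightarrow> complex"
  assumes cd: "coset_data G R h"
    and mero: "\<And>i. i < 3 \<Longrightarrow> f i meromorphic_on uhp"
    and inv: "\<And>i g. i < 3 \<Longrightarrow> g \<in> G \<Longrightarrow> \<forall>\<^sub>\<approx>t\<in>uhp. f i (act g t) = f i t"
    and qe: "\<And>i r. i < 3 \<Longrightarrow> r \<in> R \<Longrightarrow>
      \<exists>\<Psi>. \<Psi> nicely_meromorphic_on ball 0 1 \<and> (\<forall>\<^sub>\<approx>t\<in>uhp. f i (act r t) = \<Psi> (qpar h t))"
  shows "\<exists>\<delta>::nat. \<forall>n c Z. finite Z \<longrightarrow> Z \<subseteq> {z. 0 < Re z \<and> Re z < 1 \<and> 1 < Im z} \<longrightarrow>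
     (\<forall>z\<in>Z. (\<forall>i<3. f i analytic_on {z}) \<and> eval3 n c (f 0 z) (f 1 z) (f 2 z) = 0) \<longrightarrow>
     n * \<delta> < card Z \<longrightarrow> (\<forall>\<^sub>\<approx>t\<in>uhp. eval3 n c (f 0 t) (f 1 t) (f 2 t) = 0)"
proof -
  have mg: "mat_group G" and GZ: "G \<subseteq> SL2Z" and R: "finite R" "R \<subseteq> SL2Z"
    and cover: "\<And>\<gamma>. \<gamma> \<in> SL2Z \<Longrightarrow> \<exists>r\<in>R. \<exists>g\<in>G. \<gamma> = g ** r" and h1: "1 \<le> h"
    using cd by (auto simp: coset_data_def)
  have h: "h > 0" using h1 by simp
  have Gd: "det g = 1" if "g \<in> G" for g using mg that by (auto simp: mat_group_def)
  have Rd: "det r = 1" if "r \<in> R" for r using R(2) that SL2Z_det by blast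
  define D where "D = (\<lambda>p \<Psi>. \<Psi> nicely_meromorphic_on ball 0 1 \<and> (\<forall>\<^sub>\<approx>t\<in>uhp. f (fst p) (act (snd p) t) = \<Psi> (qpar h t)))"
  define \<Psi> where "\<Psi> = (\<lambda>i r. SOME \<Psi>. D (i, r) \<Psi>)"
  have \<Psi>: "\<Psi> i r nicely_meromorphic_on ball 0 1" "\<forall>\<^sub>\<approx>t\<in>uhp. f i (act r t) = \<Psi> i r (qpar h t)"
    if "i < 3" "r \<in> R" for i r
  proof -
    have "\<exists>\<Psi>. D (i, r) \<Psi>" unfolding D_def fst_conv snd_conv by (rule qe[OF that])
    then have "D (i, r) (\<Psi> i r)" unfolding \<Psi>_def by (rule someI_ex)
    then show "\<Psi> i r nicely_meromorphic_on ball 0 1" "\<forall>\<^sub>\<approx>t\<in>uhp. f i (act r t) = \<Psi> i r (qpar h t)"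
      unfolding D_def by simp_all
  qed
  \<comment> \<open>The radius of the image of the half-plane \<open>Im t \<ge> 1 / 5\<close>, which
    meets every orbit.\<close>
  define \<rho> where "\<rho> = exp (- 2 * pi * (1 / 5) / h)"
  have \<rho>: "0 < \<rho>" "\<rho> < 1" using h by (auto simp: \<rho>_def)
  have in\<rho>: "qpar h t \<in> cball 0 \<rho>" if "Im t \<ge> 1 / 5" for t
  proof -
    have "2 * pi * (1 / 5) / h \<le> 2 * pi * Im t / h"
      using that h by (intro divide_right_mono mult_left_mono) auto
    then show ?thesis by (simp add: norm_qpar[OF h] \<rho>_def)
  qed
  define J where "J = {..<3::nat} \<times> R"
  have J: "countable J" "finite J" using R(1) by (auto simp: J_def intro: countable_finite)
  have T: "\<exists>N. countable N \<and> (\<forall>q\<in>ball 0 1 - N. \<exists>q'\<in>cball 0 \<rho> - N0. \<exists>\<pi>.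
            bij_betw \<pi> R R \<and> (\<forall>i<3. \<forall>r\<in>R. \<Psi> i r q' = \<Psi> i (\<pi> r) q))" if N0: "countable N0" for N0
  proof -
    define E1 where "E1 = (\<Union>(i, r)\<in>J. {t \<in> uhp. \<not> f i (act r t) = \<Psi> i r (qpar h t)})"
    define E2 where "E2 = (\<Union>g\<in>G. \<Union>(i, r)\<in>J. {t \<in> uhp. \<not> f i (act g (act r t)) = f i (act r t)})"
    define E3 where "E3 = (\<Union>z\<in>N0. {t \<in> uhp. \<not> qpar h t \<noteq> z})"
    \<comment> \<open>Expansions and invariance hold only off sparse sets. As \<open>SL2Z\<close> is
      countable, all points that some reducing matrix could send into a bad set can be discarded at
      once.\<close>
    define E where "E = E1 \<union> E2 \<union> (\<Union>\<gamma>\<in>SL2Z. {t \<in> uhp. act \<gamma> t \<in> E1 \<union> E3})"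
    have E1: "countable E1"
      unfolding E1_def
    proof (intro countable_UN J(1))
      fix p assume "p \<in> J"
      then show "countable (case p of (i, r) \<Rightarrow> {t \<in> uhp. \<not> f i (act r t) = \<Psi> i r (qpar h t)})"
        using cosparse_countable[OF \<Psi>(2) open_uhp] by (auto simp: J_def)
    qed
    have E2: "countable E2"
      unfolding E2_def
    proof (intro countable_UN J(1))
      show "countable G" using GZ countable_SL2Z countable_subset by blast
      fix g p assume "g \<in> G" "p \<in> J"
      then show "countable (case p of (i, r) \<Rightarrow> {t \<in> uhp. \<not> f i (act g (act r t)) = f i (act r t)})"
        using cosparse_countable[OF cosparse_act[OF Rd inv] open_uhp] by (auto simp: J_def)
    qed
    have E3: "countable E3"
      unfolding E3_def
    proof (intro countable_UN N0)
      fix z :: complex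
      have "\<forall>\<^sub>\<approx>q\<in>ball 0 1. q \<noteq> z" by (simp add: eventually_cosparse)
      from cosparse_countable[OF cosparse_qpar[OF h this] open_uhp]
      show "countable {t \<in> uhp. \<not> qpar h t \<noteq> z}" .
    qed
    have cE: "countable E"
      unfolding E_def
    proof (intro countable_Un E1 E2 countable_UN countable_SL2Z)
      fix \<gamma> assume \<gamma>: "\<gamma> \<in> SL2Z"
      have "{t \<in> uhp. act \<gamma> t \<in> E1 \<union> E3} \<subseteq> act (minv \<gamma>) ` (E1 \<union> E3)"
      proof
        fix t assume t: "t \<in> {t \<in> uhp. act \<gamma> t \<in> E1 \<union> E3}"
        then show "t \<in> act (minv \<gamma>) ` (E1 \<union> E3)"
          using act_minv(1)[OF SL2Z_det[OF \<gamma>], of t] by (intro image_eqI[of _ _ "act \<gamma> t"]) auto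
      qed
      then show "countable {t \<in> uhp. act \<gamma> t \<in> E1 \<union> E3}"
        by (rule countable_subset) (intro countable_image countable_Un E1 E3)
    qed
    show ?thesis
    proof (intro exI conjI ballI)
      show "countable ({0} \<union> qpar h ` E)" using cE by simp
      fix q assume q: "q \<in> ball 0 1 - ({0} \<union> qpar h ` E)"
      obtain t where t: "t \<in> uhp" "qpar h t = q" by (rule qpar_surj[OF h, of q]) (use q in auto)
      have tE: "t \<notin> E" using t q by blast
      obtain \<gamma> where \<gamma>: "\<gamma> \<in> SL2Z" "Im (act \<gamma> t) \<ge> 1 / 5" by (rule uhp_reduction[OF t(1)])
      have "\<exists>\<pi>. bij_betw \<pi> R R \<and> (\<forall>r\<in>R. \<exists>g\<in>G. r ** \<gamma> = g ** \<pi> r)"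
      proof (rule coset_permutation[OF cd \<gamma>(1)])
        fix \<pi> assume "bij_betw \<pi> R R" "\<And>r. r \<in> R \<Longrightarrow> \<exists>g\<in>G. r ** \<gamma> = g ** \<pi> r"
        then show ?thesis by (intro exI[of _ \<pi>]) simp
      qed
      then obtain \<pi> where \<pi>: "bij_betw \<pi> R R" "\<And>r. r \<in> R \<Longrightarrow> \<exists>g\<in>G. r ** \<gamma> = g ** \<pi> r"
        by (elim exE conjE) simp
      have \<gamma>d: "det \<gamma> = 1" by (rule SL2Z_det[OF \<gamma>(1)])
      have \<gamma>t: "act \<gamma> t \<in> uhp" by (rule act_in_uhp[OF \<gamma>d t(1)])
      have \<gamma>E: "act \<gamma> t \<notin> E1" "act \<gamma> t \<notin> E3" using tE \<gamma>(1) t(1) unfolding E_def by blast+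
      have n0: "qpar h (act \<gamma> t) \<notin> N0" using \<gamma>E(2) \<gamma>t unfolding E3_def by blast
      have eq: "\<Psi> i r (qpar h (act \<gamma> t)) = \<Psi> i (\<pi> r) q" if ir: "i < 3" "r \<in> R" for i r
      proof -
        have \<pi>r: "\<pi> r \<in> R" using \<pi>(1) ir(2) bij_betwE by blast
        obtain g where g: "g \<in> G" "r ** \<gamma> = g ** \<pi> r" using \<pi>(2)[OF ir(2)] by blast
        have J1: "(i, r) \<in> J" "(i, \<pi> r) \<in> J" using ir \<pi>r by (auto simp: J_def)
        have "\<Psi> i r (qpar h (act \<gamma> t)) = f i (act r (act \<gamma> t))"
          using \<gamma>E(1) \<gamma>t J1(1) unfolding E1_def by force
        also have "act r (act \<gamma> t) = act (r ** \<gamma>) t" by (rule act_mult[OF \<gamma>d t(1), symmetric])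
        also have "\<dots> = act g (act (\<pi> r) t)" unfolding g(2) by (rule act_mult[OF Rd[OF \<pi>r] t(1)])
        also have "f i \<dots> = f i (act (\<pi> r) t)"
          using tE t(1) g(1) J1(2) unfolding E_def E2_def by force
        also have "\<dots> = \<Psi> i (\<pi> r) (qpar h t)"
          using tE t(1) J1(2) unfolding E_def E1_def by force
        finally show ?thesis using t(2) by simp
      qed
      show "\<exists>q'\<in>cball 0 \<rho> - N0. \<exists>\<pi>. bij_betw \<pi> R R \<and> (\<forall>i<3. \<forall>r\<in>R. \<Psi> i r q' = \<Psi> i (\<pi> r) q)"
        using in\<rho>[OF \<gamma>(2)] n0 \<pi>(1) eq by (intro bexI[of _ "qpar h (act \<gamma> t)"] exI[of _ \<pi>]) auto
    qed
  qed
  have "\<exists>\<delta>::nat. \<forall>n c r0 Z. r0 \<in> R \<longrightarrow> finite Z \<longrightarrow> Z \<subseteq> cball 0 \<rho> \<longrightarrow>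
     (\<forall>z\<in>Z. (\<forall>i<3. \<not> is_pole (\<Psi> i r0) z) \<and> eval3 n c (\<Psi> 0 r0 z) (\<Psi> 1 r0 z) (\<Psi> 2 r0 z) = 0) \<longrightarrow>
     n * \<delta> < card Z \<longrightarrow>
     (\<exists>r\<in>R. \<forall>\<^sub>\<approx>q\<in>ball 0 \<rho>. eval3 n c (\<Psi> 0 r q) (\<Psi> 1 r q) (\<Psi> 2 r q) = 0)"
    by (rule disc_zero_bound[OF R(1) \<rho> \<Psi>(1) T])
  then obtain \<delta> :: nat where \<delta>: "\<forall>n c r0 Z. r0 \<in> R \<longrightarrow> finite Z \<longrightarrow> Z \<subseteq> cball 0 \<rho> \<longrightarrow>
     (\<forall>z\<in>Z. (\<forall>i<3. \<not> is_pole (\<Psi> i r0) z) \<and> eval3 n c (\<Psi> 0 r0 z) (\<Psi> 1 r0 z) (\<Psi> 2 r0 z) = 0) \<longrightarrow>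
     n * \<delta> < card Z \<longrightarrow>
     (\<exists>r\<in>R. \<forall>\<^sub>\<approx>q\<in>ball 0 \<rho>. eval3 n c (\<Psi> 0 r q) (\<Psi> 1 r q) (\<Psi> 2 r q) = 0)"
    by (elim exE)
  have main: "\<forall>\<^sub>\<approx>t\<in>uhp. eval3 n c (f 0 t) (f 1 t) (f 2 t) = 0"
    if Z: "finite Z" "Z \<subseteq> {z. 0 < Re z \<and> Re z < 1 \<and> 1 < Im z}"
      and Za: "\<And>z i. z \<in> Z \<Longrightarrow> i < 3 \<Longrightarrow> f i analytic_on {z}"
      and Z0: "\<And>z. z \<in> Z \<Longrightarrow> eval3 n c (f 0 z) (f 1 z) (f 2 z) = 0"
      and m: "n * \<delta> < card Z" for n c Z
  proof -
    \<comment> \<open>The coset of the identity. Its expansion is that of \<open>f\<close> itself,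
      since \<open>g0 ** r0\<close> is the identity and \<open>f\<close> is invariant under
      \<open>g0\<close> off a sparse set.\<close>
    obtain r0 g0 where r0: "r0 \<in> R" "g0 \<in> G" "mat 1 = g0 ** r0" using cover[OF SL2Z_one] by blast
    have f0: "\<forall>\<^sub>\<approx>t\<in>uhp. f i t = \<Psi> i r0 (qpar h t)" if i: "i < 3" for i
      using cosparse_act[OF Rd[OF r0(1)] inv[OF i r0(2)]] \<Psi>(2)[OF i r0(1)] cosparse_uhp_in
    proof eventually_elim
      case (elim t)
      have "act g0 (act r0 t) = t" using act_mult[OF Rd[OF r0(1)] elim(3), of g0] by (simp flip: r0(3))
      then show ?case using elim by simp
    qed
    \<comment> \<open>A finite limit of \<open>f i\<close> at \<open>z\<close> excludes a pole of
      the expansion, and comparing limits turns equality off a sparse set into equality at the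
      point.\<close>
    have at: "\<not> is_pole (\<Psi> i r0) (qpar h z) \<and> \<Psi> i r0 (qpar h z) = f i z" if z: "z \<in> Z" and i: "i < 3" for z i
    proof -
      have zu: "z \<in> uhp" using Z(2) z by (auto simp: uhp_def)
      let ?q = "qpar h z"
      have qb: "?q \<in> ball 0 1" by (rule qpar_in_ball[OF h zu])
      have ev: "eventually (\<lambda>t. f i t = \<Psi> i r0 (qpar h t)) (at z)"
        using f0[OF i] zu eventually_cosparse_imp_eventually_at by blast
      have "qpar h \<midarrow>z\<rightarrow> ?q" using qpar_analytic[OF h, of "{z}"] analytic_at_imp_isCont isContD by blast
      then have fl: "filterlim (qpar h) (at ?q) (at z)" using qpar_not_eq[OF h] by (simp add: filterlim_at)
      have fz: "f i \<midarrow>z\<rightarrow> f i z" using Za[OF z i] analytic_at_imp_isCont isContD by blast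
      then have lim: "((\<lambda>t. \<Psi> i r0 (qpar h t)) \<longlongrightarrow> f i z) (at z)" using ev by (simp add: tendsto_cong)
      have np: "\<not> is_pole (\<Psi> i r0) ?q"
      proof
        assume "is_pole (\<Psi> i r0) ?q"
        then have "filterlim (\<lambda>t. \<Psi> i r0 (qpar h t)) at_infinity (at z)"
          unfolding is_pole_def by (rule filterlim_compose[OF _ fl])
        then show False using lim not_tendsto_and_filterlim_at_infinity by (metis trivial_limit_at)
      qed
      have "\<Psi> i r0 analytic_on {?q}" by (rule nicely_meromorphic_on_imp_analytic_at[OF \<Psi>(1)[OF i r0(1)] qb np])
      then have "\<Psi> i r0 \<midarrow>?q\<rightarrow> \<Psi> i r0 ?q" using analytic_at_imp_isCont isContD by blast
      then have "((\<lambda>t. \<Psi> i r0 (qpar h t)) \<longlongrightarrow> \<Psi> i r0 ?q) (at z)" by (rule filterlim_compose[OF _ fl])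
      then have "\<Psi> i r0 ?q = f i z" using lim LIM_unique by blast
      with np show ?thesis by blast
    qed
    \<comment> \<open>Real parts in the box differ by less than 1 and the period is at least 1, so
      distinct zeros have distinct parameters and none is lost in the count.\<close>
    have inj: "inj_on (qpar h) Z"
    proof (rule inj_onI)
      fix z w assume zw: "z \<in> Z" "w \<in> Z" "qpar h z = qpar h w"
      then obtain n :: int where n: "z = w + of_int n * of_real h" using qpar_eq_iff[OF h] by blast
      have "0 < Re z" "Re z < 1" "0 < Re w" "Re w < 1" using Z(2) zw by auto
      then have "\<bar>of_int n * h\<bar> < 1" using n by auto
      then have "\<bar>real_of_int n\<bar> * h < 1" using h by (simp add: abs_mult)
      moreover have "\<bar>real_of_int n\<bar> * 1 \<le> \<bar>real_of_int n\<bar> * h" using h1 by (intro mult_left_mono) auto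
      ultimately have "\<bar>real_of_int n\<bar> < 1" by linarith
      then have "n = 0" by linarith
      then show "z = w" using n by simp
    qed
    have card: "n * \<delta> < card (qpar h ` Z)" using m card_image[OF inj] by simp
    have sub: "qpar h ` Z \<subseteq> cball 0 \<rho>" using in\<rho> Z(2) by fastforce
    have zz: "\<forall>z\<in>qpar h ` Z. (\<forall>i<3. \<not> is_pole (\<Psi> i r0) z) \<and> eval3 n c (\<Psi> 0 r0 z) (\<Psi> 1 r0 z) (\<Psi> 2 r0 z) = 0"
      using at Z0 by auto
    obtain r where r: "r \<in> R" "\<forall>\<^sub>\<approx>q\<in>ball 0 \<rho>. eval3 n c (\<Psi> 0 r q) (\<Psi> 1 r q) (\<Psi> 2 r q) = 0"
      using \<delta>[rule_format, OF r0(1) finite_imageI[OF Z(1)] sub _ card] zz by blast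
    define P where "P = (\<lambda>t. eval3 n c (f 0 t) (f 1 t) (f 2 t))"
    have mP: "P meromorphic_on uhp" unfolding P_def eval3_def by (intro meromorphic_intros mero) auto
    have mPr: "(\<lambda>t. P (act r t)) meromorphic_on uhp"
      by (rule meromorphic_on_compose[OF mP act_analytic[OF Rd[OF r(1)]]]) (use act_in_uhp Rd[OF r(1)] in auto)
    have ev: "\<forall>\<^sub>\<approx>t\<in>uhp. P (act r t) = eval3 n c (\<Psi> 0 r (qpar h t)) (\<Psi> 1 r (qpar h t)) (\<Psi> 2 r (qpar h t))"
      using \<Psi>(2)[of 0, simplified, OF r(1)] \<Psi>(2)[of 1, simplified, OF r(1)] \<Psi>(2)[of 2, simplified, OF r(1)]
      unfolding P_def by eventually_elim simp
    \<comment> \<open>Any point with imaginary part above \<open>1 / 5\<close> would do: its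
      parameter lies in the disc where the relation vanishes, and meromorphy spreads the vanishing
      over the half-plane.\<close>
    have "eventually (\<lambda>t. P (act r t) = 0) (at \<i>)"
    proof -
      have "eventually (\<lambda>t. P (act r t) = eval3 n c (\<Psi> 0 r (qpar h t)) (\<Psi> 1 r (qpar h t)) (\<Psi> 2 r (qpar h t))) (at \<i>)"
        using eventually_cosparse_imp_eventually_at[OF ev, of \<i>] by (simp add: uhp_def)
      moreover have "eventually (\<lambda>t. eval3 n c (\<Psi> 0 r (qpar h t)) (\<Psi> 1 r (qpar h t)) (\<Psi> 2 r (qpar h t)) = 0) (at \<i>)"
      proof -
        have "qpar h \<i> \<in> ball 0 \<rho>" using h by (simp add: norm_qpar[OF h] \<rho>_def field_simps)
        then have e: "eventually (\<lambda>q. eval3 n c (\<Psi> 0 r q) (\<Psi> 1 r q) (\<Psi> 2 r q) = 0) (at (qpar h \<i>))"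
          using r(2) eventually_cosparse_imp_eventually_at by blast
        have "qpar h \<midarrow>\<i>\<rightarrow> qpar h \<i>" using qpar_analytic[OF h, of "{\<i>}"] analytic_at_imp_isCont isContD by blast
        then have fl: "filterlim (qpar h) (at (qpar h \<i>)) (at \<i>)" using qpar_not_eq[OF h] by (simp add: filterlim_at)
        show ?thesis by (rule fl[unfolded filterlim_iff, rule_format, OF e])
      qed
      ultimately show ?thesis by eventually_elim simp
    qed
    then have "\<not> (\<forall>\<^sub>\<approx>t\<in>uhp. P (act r t) \<noteq> 0)"
    proof -
      assume z: "eventually (\<lambda>t. P (act r t) = 0) (at \<i>)"
      show ?thesis
      proof
        assume "\<forall>\<^sub>\<approx>t\<in>uhp. P (act r t) \<noteq> 0"
        then have "eventually (\<lambda>t. P (act r t) \<noteq> 0) (at \<i>)"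
          by (rule eventually_cosparse_imp_eventually_at) (simp add: uhp_def)
        with z have "eventually (\<lambda>t. False) (at \<i>)" by eventually_elim simp
        then show False by simp
      qed
    qed
    then have "\<forall>\<^sub>\<approx>t\<in>uhp. P (act r t) = 0"
      using meromorphic_imp_constant_or_avoid[OF mPr open_uhp connected_uhp, of 0] by blast
    from cosparse_act[OF det_minv[OF Rd[OF r(1)]] this] cosparse_uhp_in
    have "\<forall>\<^sub>\<approx>t\<in>uhp. P t = 0"
      by eventually_elim (simp add: act_minv(2)[OF Rd[OF r(1)]])
    then show ?thesis by (simp add: P_def)
  qed
  show ?thesis
  proof (intro exI allI impI)
    fix n c Z
    assume *: "finite Z" "Z \<subseteq> {z. 0 < Re z \<and> Re z < 1 \<and> 1 < Im z}"
      "\<forall>z\<in>Z. (\<forall>i<3. f i analytic_on {z}) \<and> eval3 n c (f 0 z) (f 1 z) (f 2 z) = 0" "n * \<delta> < card Z"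
    show "\<forall>\<^sub>\<approx>t\<in>uhp. eval3 n c (f 0 t) (f 1 t) (f 2 t) = 0"
      by (rule main[OF *(1,2) _ _ *(4)]) (use *(3) in blast)+
  qed
qed

section \<open>Slices of meromorphic functions of two variables\<close>

lemma holomorphic_zero_ball:
  assumes "f holomorphic_on ball a r" "open U" "U \<noteq> {}" "U \<subseteq> ball a r" "\<And>z. z \<in> U \<Longrightarrow> f z = 0" "w \<in> ball a r"
  shows "f w = 0"
proof -
  obtain z where z: "z \<in> U" using assms(3) by blast
  have "z islimpt U" using assms(2) z by (simp add: interior_limit_point interior_open)
  then show ?thesis
    by (rule analytic_continuation[OF assms(1) open_ball connected_ball assms(4) subsetD[OF assms(4) z] _ assms(5,6)])
qed

lemma holomorphic2_slices:
  assumes "holomorphic2_on f (ball a r \<times> ball b r)"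
  shows "u \<in> ball a r \<Longrightarrow> (\<lambda>v. f (u, v)) holomorphic_on ball b r"
    and "v \<in> ball b r \<Longrightarrow> (\<lambda>u. f (u, v)) holomorphic_on ball a r"
proof -
  have op: "open (ball a r \<times> ball b r)" by (intro open_Times open_ball)
  show "u \<in> ball a r \<Longrightarrow> (\<lambda>v. f (u, v)) holomorphic_on ball b r"
    using holomorphic_slice2[OF assms op, of u] by (auto elim: holomorphic_on_subset)
  show "v \<in> ball b r \<Longrightarrow> (\<lambda>u. f (u, v)) holomorphic_on ball a r"
    using holomorphic_slice1[OF assms op, of v] by (auto elim: holomorphic_on_subset)
qed

lemma holomorphic2_zero_cusp_box:
  assumes f: "holomorphic2_on f (ball a r \<times> ball b r)"
    and U: "open U" "U \<noteq> {}" "U \<subseteq> ball a r \<times> ball b r" "\<And>z. z \<in> U \<Longrightarrow> f z = 0"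
    and z: "z \<in> ball a r \<times> ball b r"
  shows "f z = 0"
proof -
  obtain u v where uv: "(u, v) \<in> U" using U(2) by auto
  obtain A B where AB: "open A" "open B" "u \<in> A" "v \<in> B" "A \<times> B \<subseteq> U"
    using U(1) uv by (rule open_prod_elim) auto
  have sub: "A \<subseteq> ball a r" "B \<subseteq> ball b r" using AB U(3) by blast+
  have 1: "f (p, w) = 0" if "p \<in> A" "w \<in> ball b r" for p w
    by (rule holomorphic_zero_ball[OF holomorphic2_slices(1)[OF f] AB(2) _ sub(2) _ that(2)]) (use AB sub that U(4) in auto)
  have "f (p, w) = 0" if "p \<in> ball a r" "w \<in> ball b r" for p w
    by (rule holomorphic_zero_ball[OF holomorphic2_slices(2)[OF f that(2)] AB(1) _ sub(1) _ that(1)]) (use AB 1 that in auto)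
  then show ?thesis using z by (cases z) auto
qed

text \<open>The interior of the zero set is relatively closed: on a bidisc that meets it, vanishing
  propagates from an open subset in one variable and then in the other.\<close>

lemma holomorphic2_identity:
  assumes f: "holomorphic2_on f V" and V: "open V" "connected V"
    and U: "open U" "U \<noteq> {}" "U \<subseteq> V" "\<And>z. z \<in> U \<Longrightarrow> f z = 0"
    and z: "z \<in> V"
  shows "f z = 0"
proof -
  define Z where "Z = interior {z \<in> V. f z = 0}"
  have Z: "open Z" "Z \<subseteq> V" "\<And>z. z \<in> Z \<Longrightarrow> f z = 0"
    unfolding Z_def using interior_subset by (auto intro: open_interior)
  have "U \<subseteq> Z" unfolding Z_def using U by (intro interior_maximal) auto
  then have ne: "Z \<noteq> {}" using U(2) by blast
  have "V \<subseteq> Z"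
  proof (rule ccontr)
    assume "\<not> V \<subseteq> Z"
    have "open (V - Z)"
      unfolding open_subopen[of "V - Z"]
    proof
      fix x assume x: "x \<in> V - Z"
      obtain a b where ab: "x = (a, b)" by force
      obtain r where r: "r > 0" "cball a r \<times> cball b r \<subseteq> V" using open_prod_ball[OF V(1)] x ab by blast
      let ?W = "ball a r \<times> ball b r"
      have W: "open ?W" "?W \<subseteq> V" using r(2) by (auto intro!: open_Times order_trans[OF Sigma_mono r(2)])
      have "?W \<inter> Z = {}"
      proof (rule ccontr)
        assume "?W \<inter> Z \<noteq> {}"
        then have "f w = 0" if "w \<in> ?W" for w
          by (intro holomorphic2_zero_cusp_box[OF holomorphic2_on_subset[OF f W(2)] _ _ _ _ that, of "?W \<inter> Z"]) (use W Z in auto)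
        then have "?W \<subseteq> Z" unfolding Z_def using W by (intro interior_maximal) auto
        moreover have "(a, b) \<in> ?W" using r(1) by simp
        ultimately show False using x ab by blast
      qed
      then show "\<exists>T. open T \<and> x \<in> T \<and> T \<subseteq> V - Z" using W ab r(1) by (intro exI[of _ ?W]) auto
    qed
    then show False
      using connectedD[OF V(2) Z(1), of "V - Z"] ne Z(2) \<open>\<not> V \<subseteq> Z\<close> by blast
  qed
  then show ?thesis using z Z(3) by blast
qed

text \<open>
  \<open>f (u, v)\<close> is near \<open>u = s\<close>, \<open>\<psi> v = p\<close> a quotient of holomorphic functions in the local parameters
  \<open>u\<close> and \<open>\<psi> v\<close>, and the denominator does not vanish identically on the slice \<open>u = s\<close>. Here \<open>\<psi>\<close> is the
  identity at interior points and \<open>qpar h\<close> with \<open>p = 0\<close> at cusps.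
\<close>

definition local_quotient :: "(complex \<Rightarrow> complex) \<Rightarrow> complex \<Rightarrow> complex \<Rightarrow> (complex \<times> complex \<Rightarrow> complex) \<Rightarrow> bool" where
  "local_quotient \<psi> s p f \<longleftrightarrow> (\<exists>e g h. e > 0 \<and> holomorphic2_on g (ball s e \<times> ball p e) \<and> holomorphic2_on h (ball s e \<times> ball p e) \<and>
     (\<exists>w\<in>ball p e. h (s, w) \<noteq> 0) \<and>
     (\<forall>u v. (u, v) \<in> HH \<longrightarrow> u \<in> ball s e \<longrightarrow> \<psi> v \<in> ball p e \<longrightarrow> h (u, \<psi> v) \<noteq> 0 \<longrightarrow> f (u, v) = g (u, \<psi> v) / h (u, \<psi> v)))"

text \<open>By Lindelof's theorem countably many of the neighbourhoods cover \<open>K\<close>, so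
  the union of their exceptional sets is countable. \<open>K\<close> is left general to allow both
  interior points and the line over a cusp.\<close>

lemma countable_exception:
  fixes K :: "(complex \<times> complex) set"
  assumes "\<And>p. p \<in> K \<Longrightarrow> \<exists>U E. open U \<and> p \<in> U \<and> countable E \<and> (\<forall>s w. (s, w) \<in> U \<inter> K \<longrightarrow> s \<notin> E \<longrightarrow> Q s w)"
  shows "\<exists>E. countable E \<and> (\<forall>s w. (s, w) \<in> K \<longrightarrow> s \<notin> E \<longrightarrow> Q s w)"
proof -
  define P where "P = (\<lambda>U E. open U \<and> countable E \<and> (\<forall>s w. (s, w) \<in> U \<inter> K \<longrightarrow> s \<notin> E \<longrightarrow> Q s w))"
  define F where "F = {U. \<exists>E. P U E}"
  have "open U" if "U \<in> F" for U using that unfolding F_def P_def by auto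
  then obtain F' where F': "F' \<subseteq> F" "countable F'" "\<Union>F' = \<Union>F" by (rule Lindelof)
  have E: "P U (SOME E. P U E)" if "U \<in> F" for U
    using that unfolding F_def by (auto intro: someI)
  define E where "E = (\<Union>U\<in>F'. SOME E. P U E)"
  have "countable E" unfolding E_def
  proof (rule countable_UN[OF F'(2)])
    fix U assume "U \<in> F'"
    then show "countable (SOME E. P U E)" using E[of U] F'(1) unfolding P_def by blast
  qed
  moreover have "Q s w" if sw: "(s, w) \<in> K" "s \<notin> E" for s w
  proof -
    have "(s, w) \<in> \<Union>F"
    proof -
      obtain U E where "open U \<and> (s, w) \<in> U \<and> countable E \<and> (\<forall>s w. (s, w) \<in> U \<inter> K \<longrightarrow> s \<notin> E \<longrightarrow> Q s w)"
        using assms[OF sw(1)] by (elim exE)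
      then have "(s, w) \<in> U" "U \<in> F" unfolding F_def P_def by auto
      then show ?thesis by blast
    qed
    then obtain U where U: "U \<in> F'" "(s, w) \<in> U" using F'(3) by blast
    have "s \<notin> (SOME E. P U E)" using sw(2) U(1) unfolding E_def by blast
    then show ?thesis using E[of U] F'(1) U sw(1) unfolding P_def by blast
  qed
  ultimately show ?thesis by blast
qed

text \<open>Fix one point \<open>(u0, v0)\<close> where the denominator \<open>h\<close> is nonzero.
  If \<open>h\<close> vanishes identically along the slice \<open>u = s\<close>, then
  \<open>h (s, v0) = 0\<close>, which happens for countably many \<open>s\<close> only.\<close>

lemma merom_near_generic:
  assumes "merom_near f (\<lambda>(t1, t2). (t1, \<psi> t2)) (a, b)"
  shows "\<exists>U E. open U \<and> (a, b) \<in> U \<and> countable E \<and> (\<forall>s w. (s, w) \<in> U \<longrightarrow> s \<notin> E \<longrightarrow> local_quotient \<psi> s w f)"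
proof -
  obtain V g h where V: "open V" "connected V" "(a, b) \<in> V" and g: "holomorphic2_on g V" and h: "holomorphic2_on h V"
    and h0: "\<exists>z\<in>V. h z \<noteq> 0"
    and eq: "\<forall>t\<in>HH. (case t of (t1, t2) \<Rightarrow> (t1, \<psi> t2)) \<in> V \<and> h (case t of (t1, t2) \<Rightarrow> (t1, \<psi> t2)) \<noteq> 0 \<longrightarrow>
       f t = g (case t of (t1, t2) \<Rightarrow> (t1, \<psi> t2)) / h (case t of (t1, t2) \<Rightarrow> (t1, \<psi> t2))"
    using assms unfolding merom_near_def by (elim exE conjE) (rule that)
  obtain r where r: "r > 0" "cball a r \<times> cball b r \<subseteq> V" using open_prod_ball[OF V(1,3)] by blast
  let ?W = "ball a r \<times> ball b r"
  have W: "open ?W" "?W \<subseteq> V" using r(2) by (auto intro!: open_Times order_trans[OF Sigma_mono r(2)])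
  have hW: "holomorphic2_on h ?W" by (rule holomorphic2_on_subset[OF h W(2)])
  have gW: "holomorphic2_on g ?W" by (rule holomorphic2_on_subset[OF g W(2)])
  have "\<exists>z\<in>?W. h z \<noteq> 0"
  proof (rule ccontr)
    assume "\<not> (\<exists>z\<in>?W. h z \<noteq> 0)"
    then have "h z = 0" if "z \<in> V" for z
      by (intro holomorphic2_identity[OF h V(1,2) W(1) _ W(2) _ that]) (use r(1) in auto)
    then show False using h0 by blast
  qed
  then obtain u0 v0 where uv: "u0 \<in> ball a r" "v0 \<in> ball b r" "h (u0, v0) \<noteq> 0" by auto
  define E where "E = {u \<in> ball a r. h (u, v0) = 0}"
  have "countable E" unfolding E_def
    by (rule holomorphic_zeros_countable[OF holomorphic2_slices(2)[OF hW uv(2)] open_ball connected_ball uv(1,3)])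
  moreover have "local_quotient \<psi> s w f" if sw: "(s, w) \<in> ?W" "s \<notin> E" for s w
  proof -
    obtain e where e: "e > 0" "cball s e \<times> cball w e \<subseteq> ?W" using open_prod_ball[OF W(1) sw(1)] by blast
    have sub: "ball s e \<times> ball w e \<subseteq> ?W" by (rule order_trans[OF Sigma_mono e(2)]) auto
    have "\<exists>v\<in>ball w e. h (s, v) \<noteq> 0"
    proof (rule ccontr)
      assume n: "\<not> (\<exists>v\<in>ball w e. h (s, v) \<noteq> 0)"
      have sb: "ball w e \<subseteq> ball b r"
      proof
        fix v assume "v \<in> ball w e"
        then have "(s, v) \<in> ball s e \<times> ball w e" using e(1) by simp
        then show "v \<in> ball b r" using sub by blast
      qed
      have "h (s, v0) = 0"
        by (rule holomorphic_zero_ball[OF holomorphic2_slices(1)[OF hW] open_ball _ sb _ uv(2)]) (use n e(1) sw(1) in auto)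
      then show False using sw uv(2) unfolding E_def by auto
    qed
    moreover have "f (u, v) = g (u, \<psi> v) / h (u, \<psi> v)"
      if "(u, v) \<in> HH" "u \<in> ball s e" "\<psi> v \<in> ball w e" "h (u, \<psi> v) \<noteq> 0" for u v
    proof -
      have "(u, \<psi> v) \<in> V" using that(2,3) sub W(2) by blast
      then show ?thesis using bspec[OF eq that(1)] that by simp
    qed
    ultimately show ?thesis
      unfolding local_quotient_def using e(1) holomorphic2_on_subset[OF gW sub] holomorphic2_on_subset[OF hW sub] by blast
  qed
  ultimately show ?thesis using W(1) r(1) by (intro exI[of _ ?W] exI[of _ E]) auto
qed

text \<open>The local parameter has derivative \<open>m (\<psi> v)\<close>, with
  \<open>m = 1\<close> for the identity and \<open>m\<close> a multiple of the identity function for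
  \<open>qpar h\<close>; hence differentiation does not leave the class of quotients in
  \<open>u\<close> and \<open>\<psi> v\<close>.\<close>

lemma quotient_pullback:
  assumes g: "holomorphic2_on g (ball s e \<times> ball p e)" and h: "holomorphic2_on h (ball s e \<times> ball p e)"
    and eq: "\<And>u v. (u, v) \<in> HH \<Longrightarrow> u \<in> ball s e \<Longrightarrow> \<psi> v \<in> ball p e \<Longrightarrow> h (u, \<psi> v) \<noteq> 0 \<Longrightarrow> f (u, v) = g (u, \<psi> v) / h (u, \<psi> v)"
    and \<psi>: "\<And>v. v \<in> uhp \<Longrightarrow> (\<psi> has_field_derivative m (\<psi> v)) (at v)"
    and uv0: "(u0, v0) \<in> HH" "u0 \<in> ball s e" "\<psi> v0 \<in> ball p e" "h (u0, \<psi> v0) \<noteq> 0"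
  shows "Dq1 f (u0, v0) = 1 / (2 * of_real pi * \<i>) * (pd1 g (u0, \<psi> v0) * h (u0, \<psi> v0) - g (u0, \<psi> v0) * pd1 h (u0, \<psi> v0)) / (h (u0, \<psi> v0))\<^sup>2"
    and "Dq2 f (u0, v0) = 1 / (2 * of_real pi * \<i>) * (pd2 g (u0, \<psi> v0) * h (u0, \<psi> v0) - g (u0, \<psi> v0) * pd2 h (u0, \<psi> v0)) * m (\<psi> v0) / (h (u0, \<psi> v0))\<^sup>2"
    and "\<exists>U. open U \<and> (u0, v0) \<in> U \<and> U \<subseteq> HH \<and> holomorphic2_on f U"
proof -
  let ?W = "ball s e \<times> ball p e"
  have W: "open ?W" by (intro open_Times open_ball)
  define V where "V = {z \<in> ?W. h z \<noteq> 0}"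
  have V: "open V"
  proof -
    have "open (?W \<inter> h -` (- {0}))" by (intro continuous_open_preimage holomorphic2_on_imp_continuous_on h W) auto
    moreover have "?W \<inter> h -` (- {0}) = V" by (auto simp: V_def)
    ultimately show ?thesis by simp
  qed
  have VW: "V \<subseteq> ?W" by (auto simp: V_def)
  define k where "k = (\<lambda>z. g z / h z)"
  have k: "holomorphic2_on k V" unfolding k_def
    by (rule holomorphic2_on_divide(1)[OF holomorphic2_on_subset[OF g VW] holomorphic2_on_subset[OF h VW] V]) (simp add: V_def)
  have kd: "pd1 k (u, v) = (pd1 g (u, v) * h (u, v) - g (u, v) * pd1 h (u, v)) / (h (u, v))\<^sup>2"
    "pd2 k (u, v) = (pd2 g (u, v) * h (u, v) - g (u, v) * pd2 h (u, v)) / (h (u, v))\<^sup>2" if "(u, v) \<in> V" for u v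
    unfolding k_def
    by (rule holomorphic2_on_divide(2,3)[OF holomorphic2_on_subset[OF g VW] holomorphic2_on_subset[OF h VW] V _ that]; simp add: V_def)+
  have \<psi>h: "\<psi> holomorphic_on uhp" using \<psi> by (auto simp: holomorphic_on_open[OF open_uhp])
  have \<psi>s: "holomorphic2_on (\<lambda>t. \<psi> (snd t)) HH" and \<psi>1: "\<And>u v. (u, v) \<in> HH \<Longrightarrow> pd1 (\<lambda>t. \<psi> (snd t)) (u, v) = 0"
    and \<psi>2: "\<And>u v. (u, v) \<in> HH \<Longrightarrow> pd2 (\<lambda>t. \<psi> (snd t)) (u, v) = m (\<psi> v)"
  proof -
    have HH: "open HH" unfolding HH_eq by (intro open_Times open_uhp)
    show "holomorphic2_on (\<lambda>t. \<psi> (snd t)) HH"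
      by (rule holomorphic2_on_compose1(1)[OF holomorphic2_on_snd \<psi>h HH open_uhp]) (auto simp: HH_eq)
    show "pd1 (\<lambda>t. \<psi> (snd t)) (u, v) = 0" if "(u, v) \<in> HH" for u v by (simp add: pd1_def)
    show "pd2 (\<lambda>t. \<psi> (snd t)) (u, v) = m (\<psi> v)" if "(u, v) \<in> HH" for u v
      using \<psi>[of v] that by (simp add: pd2_def HH_eq DERIV_imp_deriv)
  qed
  have HH: "open HH" unfolding HH_eq by (intro open_Times open_uhp)
  define O' where "O' = {t \<in> HH. (fst t, \<psi> (snd t)) \<in> V}"
  have O': "open O'"
  proof -
    have "open (HH \<inter> (\<lambda>t. (fst t, \<psi> (snd t))) -` V)"
      by (intro continuous_open_preimage continuous_intros holomorphic2_on_imp_continuous_on \<psi>s HH V)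
    moreover have "HH \<inter> (\<lambda>t. (fst t, \<psi> (snd t))) -` V = O'" by (auto simp: O'_def)
    ultimately show ?thesis by simp
  qed
  have O'H: "O' \<subseteq> HH" by (auto simp: O'_def)
  have fk: "f t = k (fst t, \<psi> (snd t))" if "t \<in> O'" for t
    using eq[of "fst t" "snd t"] that by (auto simp: O'_def V_def k_def)
  have D: "pd1 f (u, v) = pd1 k (u, \<psi> v)" "pd2 f (u, v) = pd2 k (u, \<psi> v) * m (\<psi> v)" if uv: "(u, v) \<in> O'" for u v
  proof -
    have fst: "pd1 fst (u, v) = (1::complex)" "pd2 fst (u, v) = (0::complex)" by (simp_all add: pd1_def pd2_def)
    have uvH: "(u, v) \<in> HH" using uv O'H by blast
    have inV: "(fst z, \<psi> (snd z)) \<in> V" if "z \<in> O'" for z using that by (simp add: O'_def)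
    note c = holomorphic2_on_compose2(2,3)[OF holomorphic2_on_fst holomorphic2_on_subset[OF \<psi>s O'H] k O' V inV uv]
    have c1: "pd1 (\<lambda>t. k (fst t, \<psi> (snd t))) (u, v) = pd1 k (u, \<psi> v)"
      using c(1) fst \<psi>1[OF uvH] by simp
    have c2: "pd2 (\<lambda>t. k (fst t, \<psi> (snd t))) (u, v) = pd2 k (u, \<psi> v) * m (\<psi> v)"
      using c(2) fst \<psi>2[OF uvH] by simp
    show "pd1 f (u, v) = pd1 k (u, \<psi> v)" "pd2 f (u, v) = pd2 k (u, \<psi> v) * m (\<psi> v)"
      using pd_cong[OF O' uv, of f "\<lambda>t. k (fst t, \<psi> (snd t))", OF fk] c1 c2 by simp_all
  qed
  have in0: "(u0, v0) \<in> O'" "(u0, \<psi> v0) \<in> V" using uv0 by (simp_all add: O'_def V_def)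
  show "Dq1 f (u0, v0) = 1 / (2 * of_real pi * \<i>) * (pd1 g (u0, \<psi> v0) * h (u0, \<psi> v0) - g (u0, \<psi> v0) * pd1 h (u0, \<psi> v0)) / (h (u0, \<psi> v0))\<^sup>2"
    using D(1)[OF in0(1)] kd(1)[OF in0(2)] by (simp add: Dq1_eq)
  show "Dq2 f (u0, v0) = 1 / (2 * of_real pi * \<i>) * (pd2 g (u0, \<psi> v0) * h (u0, \<psi> v0) - g (u0, \<psi> v0) * pd2 h (u0, \<psi> v0)) * m (\<psi> v0) / (h (u0, \<psi> v0))\<^sup>2"
    using D(2)[OF in0(1)] kd(2)[OF in0(2)] by (simp add: Dq2_eq)
  have "holomorphic2_on (\<lambda>t. k (fst t, \<psi> (snd t))) O'"
    by (rule holomorphic2_on_compose2(1)[OF holomorphic2_on_fst holomorphic2_on_subset[OF \<psi>s O'H] k O' V]) (simp add: O'_def)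
  then have "holomorphic2_on f O'" by (rule holomorphic2_on_cong[OF _ O']) (simp add: fk)
  then show "\<exists>U. open U \<and> (u0, v0) \<in> U \<and> U \<subseteq> HH \<and> holomorphic2_on f U"
    using O' in0(1) O'H by blast
qed

text \<open>The quotient rule produces the denominator \<open>h^2\<close>, which has the same zeros
  as \<open>h\<close>, so the genericity of a slice is inherited by derivatives.\<close>

lemma local_quotient_derivative:
  assumes f: "local_quotient \<psi> s p f" and \<psi>: "\<And>v. v \<in> uhp \<Longrightarrow> (\<psi> has_field_derivative m (\<psi> v)) (at v)" and m: "m holomorphic_on UNIV"
  shows "local_quotient \<psi> s p (Dq1 f)" "local_quotient \<psi> s p (Dq2 f)"
proof -
  obtain e g h where e: "e > 0" and g: "holomorphic2_on g (ball s e \<times> ball p e)" and h: "holomorphic2_on h (ball s e \<times> ball p e)"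
    and h0: "\<exists>w\<in>ball p e. h (s, w) \<noteq> 0"
    and eq: "\<And>u v. (u, v) \<in> HH \<Longrightarrow> u \<in> ball s e \<Longrightarrow> \<psi> v \<in> ball p e \<Longrightarrow> h (u, \<psi> v) \<noteq> 0 \<Longrightarrow> f (u, v) = g (u, \<psi> v) / h (u, \<psi> v)"
    using f unfolding local_quotient_def by (elim exE conjE) simp
  let ?W = "ball s e \<times> ball p e"
  have W: "open ?W" by (intro open_Times open_ball)
  let ?c = "1 / (2 * of_real pi * \<i>) :: complex"
  have h2: "holomorphic2_on (\<lambda>z. (h z)\<^sup>2) ?W" by (rule holomorphic2_on_power[OF h W])
  have h20: "\<exists>w\<in>ball p e. (h (s, w))\<^sup>2 \<noteq> 0" using h0 by simp
  have ms: "holomorphic2_on (\<lambda>z. m (snd z)) ?W"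
    by (rule holomorphic2_on_compose1(1)[OF holomorphic2_on_snd m W open_UNIV]) simp
  have g1: "holomorphic2_on (\<lambda>z. ?c * (pd1 g z * h z - g z * pd1 h z)) ?W"
    by (intro holomorphic2_on_mult(1) holomorphic2_on_diff holomorphic2_on_pd1 holomorphic2_on_const g h W)
  have g2: "holomorphic2_on (\<lambda>z. ?c * (pd2 g z * h z - g z * pd2 h z) * m (snd z)) ?W"
    by (intro holomorphic2_on_mult(1) holomorphic2_on_diff holomorphic2_on_pd2 holomorphic2_on_const g h W ms)
  show "local_quotient \<psi> s p (Dq1 f)"
    unfolding local_quotient_def
  proof (intro exI conjI allI impI)
    fix u v assume a: "(u, v) \<in> HH" "u \<in> ball s e" "\<psi> v \<in> ball p e" "(h (u, \<psi> v))\<^sup>2 \<noteq> 0"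
    have "h (u, \<psi> v) \<noteq> 0" using a(4) by simp
    have "Dq1 f (u, v) = 1 / (2 * of_real pi * \<i>) * (pd1 g (u, \<psi> v) * h (u, \<psi> v) - g (u, \<psi> v) * pd1 h (u, \<psi> v)) / (h (u, \<psi> v))\<^sup>2"
      by (rule quotient_pullback(1)[OF g h eq \<psi> a(1-3) \<open>h (u, \<psi> v) \<noteq> 0\<close>])
    then show "Dq1 f (u, v) = ?c * (pd1 g (u, \<psi> v) * h (u, \<psi> v) - g (u, \<psi> v) * pd1 h (u, \<psi> v)) / (h (u, \<psi> v))\<^sup>2" by simp
  qed (fact e g1 h2 h20)+
  show "local_quotient \<psi> s p (Dq2 f)"
    unfolding local_quotient_def
  proof (intro exI conjI allI impI)
    fix u v assume a: "(u, v) \<in> HH" "u \<in> ball s e" "\<psi> v \<in> ball p e" "(h (u, \<psi> v))\<^sup>2 \<noteq> 0"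
    have "h (u, \<psi> v) \<noteq> 0" using a(4) by simp
    have "Dq2 f (u, v) = 1 / (2 * of_real pi * \<i>) * (pd2 g (u, \<psi> v) * h (u, \<psi> v) - g (u, \<psi> v) * pd2 h (u, \<psi> v)) * m (\<psi> v) / (h (u, \<psi> v))\<^sup>2"
      by (rule quotient_pullback(2)[OF g h eq \<psi> a(1-3) \<open>h (u, \<psi> v) \<noteq> 0\<close>])
    then show "Dq2 f (u, v) = ?c * (pd2 g (u, \<psi> v) * h (u, \<psi> v) - g (u, \<psi> v) * pd2 h (u, \<psi> v)) * m (snd (u, \<psi> v)) / (h (u, \<psi> v))\<^sup>2" by simp
  qed (fact e g2 h2 h20)+
qed

lemma holomorphic_eventually_nonzero:
  assumes k: "k holomorphic_on ball p e" and w: "w \<in> ball p e" "k w \<noteq> 0" and e: "e > 0"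
  shows "eventually (\<lambda>w. k w \<noteq> 0) (at p)"
proof -
  have "\<not> (\<forall>\<^sub>\<approx>w\<in>ball p e. k w = 0)"
  proof
    assume z: "\<forall>\<^sub>\<approx>w\<in>ball p e. k w = 0"
    have "countable {w \<in> ball p e. k w = 0}"
      by (rule holomorphic_zeros_countable[OF k open_ball connected_ball w])
    moreover have "countable {w \<in> ball p e. \<not> k w = 0}" by (rule cosparse_countable[OF z open_ball])
    ultimately have "countable ({w \<in> ball p e. k w = 0} \<union> {w \<in> ball p e. \<not> k w = 0})"
      by (rule countable_Un)
    moreover have "ball p e \<subseteq> {w \<in> ball p e. k w = 0} \<union> {w \<in> ball p e. \<not> k w = 0}" by blast
    ultimately have "countable (ball p e)" by (rule countable_subset[rotated])
    then show False using uncountable_ball[OF e, of p] by contradiction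
  qed
  moreover have "k meromorphic_on ball p e"
    using k by (simp add: analytic_on_open analytic_on_imp_meromorphic_on)
  ultimately have "\<forall>\<^sub>\<approx>w\<in>ball p e. k w \<noteq> 0"
    using meromorphic_imp_constant_or_avoid[OF _ open_ball connected_ball] by blast
  then show ?thesis by (rule eventually_cosparse_imp_eventually_at) (use e in simp)
qed

lemma local_quotient_slice_germ:
  assumes "local_quotient \<psi> s p f" "s \<in> uhp"
  obtains e k where "e > 0" "k meromorphic_on {p}" "\<forall>v\<in>uhp. \<psi> v \<in> ball p e \<longrightarrow> \<psi> v \<noteq> p \<longrightarrow> f (s, v) = k (\<psi> v)"
proof -
  obtain e g h where e: "e > 0" and g: "holomorphic2_on g (ball s e \<times> ball p e)" and h: "holomorphic2_on h (ball s e \<times> ball p e)"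
    and h0: "\<exists>w\<in>ball p e. h (s, w) \<noteq> 0"
    and eq: "\<And>u v. (u, v) \<in> HH \<Longrightarrow> u \<in> ball s e \<Longrightarrow> \<psi> v \<in> ball p e \<Longrightarrow> h (u, \<psi> v) \<noteq> 0 \<Longrightarrow> f (u, v) = g (u, \<psi> v) / h (u, \<psi> v)"
    using assms(1) unfolding local_quotient_def by (elim exE conjE) simp
  have ss: "s \<in> ball s e" using e by simp
  have hs: "(\<lambda>w. h (s, w)) holomorphic_on ball p e" and gs: "(\<lambda>w. g (s, w)) holomorphic_on ball p e"
    by (rule holomorphic2_slices(1)[OF h ss] holomorphic2_slices(1)[OF g ss])+
  have "eventually (\<lambda>w. h (s, w) \<noteq> 0) (at p)"
    using h0 e by (auto intro: holomorphic_eventually_nonzero[OF hs])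
  then obtain d where d: "d > 0" "\<And>w. w \<noteq> p \<Longrightarrow> dist w p < d \<Longrightarrow> h (s, w) \<noteq> 0" by (auto simp: eventually_at)
  show ?thesis
  proof (rule that[of "min d e" "\<lambda>w. g (s, w) / h (s, w)"])
    show "min d e > 0" using d e by simp
    have "(\<lambda>w. g (s, w)) meromorphic_on ball p e" "(\<lambda>w. h (s, w)) meromorphic_on ball p e"
      using gs hs by (simp_all add: analytic_on_open analytic_on_imp_meromorphic_on)
    then have "(\<lambda>w. g (s, w) / h (s, w)) meromorphic_on ball p e" by (rule meromorphic_on_divide)
    then show "(\<lambda>w. g (s, w) / h (s, w)) meromorphic_on {p}" by (rule meromorphic_on_subset) (use e in simp)
    have "f (s, v) = g (s, \<psi> v) / h (s, \<psi> v)" if "v \<in> uhp" "\<psi> v \<in> ball p (min d e)" "\<psi> v \<noteq> p" for v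
      by (rule eq) (use that d(2)[of "\<psi> v"] e assms(2) in \<open>auto simp: HH_eq dist_commute\<close>)
    then show "\<forall>v\<in>uhp. \<psi> v \<in> ball p (min d e) \<longrightarrow> \<psi> v \<noteq> p \<longrightarrow> f (s, v) = g (s, \<psi> v) / h (s, \<psi> v)" by simp
  qed
qed

lemma local_quotient_slice_meromorphic:
  assumes "\<And>p. p \<in> uhp \<Longrightarrow> local_quotient (\<lambda>v. v) s p f" "s \<in> uhp"
  shows "(\<lambda>v. f (s, v)) meromorphic_on uhp"
proof -
  have "(\<lambda>v. f (s, v)) meromorphic_on {p}" if p: "p \<in> uhp" for p
  proof -
    obtain e k where ek: "e > 0" "k meromorphic_on {p}"
        "\<forall>v\<in>uhp. v \<in> ball p e \<longrightarrow> v \<noteq> p \<longrightarrow> f (s, v) = k v"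
      by (rule local_quotient_slice_germ[OF assms(1)[OF p] assms(2)])
    have "eventually (\<lambda>v. v \<in> uhp \<inter> ball p e - {p}) (at p)"
      using p ek(1) open_uhp by (intro eventually_at_in_open open_Int) auto
    then have "eventually (\<lambda>v. f (s, v) = k v) (at p)" by eventually_elim (use ek(3) in auto)
    then show ?thesis using meromorphic_on_cong[of "{p}" "\<lambda>v. f (s, v)" k "{p}"] ek(2) by simp
  qed
  then show ?thesis using meromorphic_on_meromorphic_at by blast
qed

lemma meromorphic_at_zero_growth:
  assumes "k meromorphic_on {0}"
  obtains e C n where "e > 0" "C \<ge> 0" "\<forall>q. q \<noteq> 0 \<longrightarrow> cmod q < e \<longrightarrow> cmod (k q) \<le> C / cmod q ^ n"
proof -
  obtain F where F: "(\<lambda>w. k (0 + w)) has_laurent_expansion F" using assms unfolding meromorphic_on_def by blast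
  define n where "n = nat (- fls_subdegree F)"
  have kF: "k has_laurent_expansion F" using F by simp
  have "(\<lambda>q. q ^ n * k q) has_laurent_expansion fls_X ^ n * F"
    by (intro laurent_expansion_intros kF)
  moreover have "fls_subdegree (fls_X ^ n * F) \<ge> 0"
  proof (cases "F = 0")
    case False
    then show ?thesis by (simp add: n_def fls_subdegree_pow)
  qed simp
  ultimately have "(\<lambda>q. q ^ n * k q) \<midarrow>0\<rightarrow> fls_nth (fls_X ^ n * F) 0"
    by (rule has_laurent_expansion_imp_tendsto_0)
  then have "((\<lambda>q. cmod (q ^ n * k q)) \<longlongrightarrow> cmod (fls_nth (fls_X ^ n * F) 0)) (at 0)" by (rule tendsto_norm)
  then have "eventually (\<lambda>q. cmod (q ^ n * k q) < cmod (fls_nth (fls_X ^ n * F) 0) + 1) (at 0)"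
    by (rule order_tendstoD) simp
  then obtain e where e: "e > 0" "\<And>q. q \<noteq> 0 \<Longrightarrow> dist q 0 < e \<Longrightarrow> cmod (q ^ n * k q) < cmod (fls_nth (fls_X ^ n * F) 0) + 1"
    by (auto simp: eventually_at)
  show ?thesis
  proof (rule that[OF e(1)])
    show "cmod (fls_nth (fls_X ^ n * F) 0) + 1 \<ge> 0" by simp
    have "cmod (k q) \<le> (cmod (fls_nth (fls_X ^ n * F) 0) + 1) / cmod q ^ n" if "q \<noteq> 0" "cmod q < e" for q
    proof -
      have "cmod q ^ n * cmod (k q) \<le> cmod (fls_nth (fls_X ^ n * F) 0) + 1"
        using e(2)[of q] that by (simp add: norm_mult norm_power)
      then show ?thesis using that(1) by (simp add: pos_le_divide_eq mult.commute)
    qed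
    then show "\<forall>q. q \<noteq> 0 \<longrightarrow> cmod q < e \<longrightarrow> cmod (k q) \<le> (cmod (fls_nth (fls_X ^ n * F) 0) + 1) / cmod q ^ n" by simp
  qed
qed

text \<open>Meromorphy in the parameter bounds the quotient by a power of \<open>1 / |q|\<close>,
  which is exponential in \<open>Im v\<close>. The factor \<open>qexp (r * v)\<close> with complex
  \<open>r\<close> may grow with \<open>|Re v|\<close> too, which is why the bound is restricted to
  a strip.\<close>

lemma local_quotient_slice_growth:
  assumes f: "local_quotient (qpar h) s 0 f" and s: "s \<in> uhp" and h: "h > 0" and L: "L > 0"
    and F: "\<And>v. v \<in> uhp \<Longrightarrow> F v = qexp (r * v) * f (s, v)"
  obtains C c0 where "c0 \<ge> 0" "\<forall>v. Im v > c0 \<longrightarrow> \<bar>Re v\<bar> < L \<longrightarrow> cmod (F v) \<le> C * exp (C * Im v)"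
proof -
  obtain e k where ek: "e > 0" "k meromorphic_on {0}"
      "\<forall>v\<in>uhp. qpar h v \<in> ball 0 e \<longrightarrow> qpar h v \<noteq> 0 \<longrightarrow> f (s, v) = k (qpar h v)"
    by (rule local_quotient_slice_germ[OF f s])
  obtain d C n where d: "d > 0" "C \<ge> 0" "\<forall>q. q \<noteq> 0 \<longrightarrow> cmod q < d \<longrightarrow> cmod (k q) \<le> C / cmod q ^ n"
    by (rule meromorphic_at_zero_growth[OF ek(2)])
  define m where "m = min d e"
  have m: "m > 0" using d(1) ek(1) by (simp add: m_def)
  define c0 where "c0 = max 0 (- h * ln m / (2 * pi))"
  define A where "A = 2 * pi * cmod r"
  define B where "B = real n * (2 * pi / h) + A"
  define C' where "C' = max B (C * exp (A * L))"
  show ?thesis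
  proof (rule that[of c0 C'])
    show "c0 \<ge> 0" by (simp add: c0_def)
    show "\<forall>v. Im v > c0 \<longrightarrow> \<bar>Re v\<bar> < L \<longrightarrow> cmod (F v) \<le> C' * exp (C' * Im v)"
    proof (intro allI impI)
    fix v assume v: "Im v > c0" "\<bar>Re v\<bar> < L"
    have Im: "Im v > 0" using v(1) by (simp add: c0_def)
    then have vu: "v \<in> uhp" by (simp add: uhp_def)
    have "- h * ln m / (2 * pi) < Im v" using v(1) by (simp add: c0_def)
    then have "- 2 * pi * Im v / h < ln m" using h by (simp add: field_simps)
    then have "exp (- 2 * pi * Im v / h) < m" using m by (metis exp_less_cancel_iff exp_ln)
    then have q: "cmod (qpar h v) < m" by (simp only: norm_qpar[OF h])
    have "cmod (f (s, v)) \<le> C / cmod (qpar h v) ^ n"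
      using ek(3)[rule_format, OF vu] d(3)[rule_format, of "qpar h v"] q qpar_nonzero[of h v] by (simp add: m_def)
    also have "\<dots> = C * exp (real n * (2 * pi / h) * Im v)"
    proof -
      have "cmod (qpar h v) ^ n = exp (- (real n * (2 * pi / h) * Im v))"
        unfolding norm_qpar[OF h] exp_of_nat_mult[symmetric] by (simp add: mult_ac)
      then show ?thesis by (simp only: exp_minus divide_inverse inverse_inverse_eq)
    qed
    finally have 1: "cmod (f (s, v)) \<le> C * exp (real n * (2 * pi / h) * Im v)" .
    have "- Im (r * v) \<le> cmod (r * v)" using abs_Im_le_cmod[of "r * v"] by linarith
    also have "\<dots> \<le> cmod r * (L + Im v)"
      unfolding norm_mult using cmod_le[of v] v Im by (intro mult_left_mono) auto
    finally have "- 2 * pi * Im (r * v) \<le> A * L + A * Im v"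
      using mult_left_mono[of "- Im (r * v)" "cmod r * (L + Im v)" "2 * pi"] by (simp add: A_def algebra_simps)
    then have 2: "cmod (qexp (r * v)) \<le> exp (A * L + A * Im v)" unfolding norm_qexp by simp
    have "cmod (F v) \<le> exp (A * L + A * Im v) * (C * exp (real n * (2 * pi / h) * Im v))"
      unfolding F[OF vu] norm_mult by (intro mult_mono 1 2) auto
    also have "\<dots> = (C * exp (A * L)) * exp (B * Im v)"
      unfolding B_def distrib_right exp_add by (simp only: mult_ac)
    also have "\<dots> \<le> C' * exp (C' * Im v)"
    proof (rule mult_mono)
      show "exp (B * Im v) \<le> exp (C' * Im v)" using Im by (simp add: C'_def mult_right_mono)
      have "0 \<le> C * exp (A * L)" using d(2) by simp
      then show "0 \<le> C'" by (simp add: C'_def)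
    qed (simp_all add: C'_def)
    finally show "cmod (F v) \<le> C' * exp (C' * Im v)" .
    qed
  qed
qed

text \<open>The exponential factor in \<open>F\<close> adds the constant \<open>r\<close> to
  \<open>G2\<close> and nothing to \<open>G1\<close>, so logarithmic derivatives are plain quotients
  in the parameter. Their denominator is \<open>g * h\<close>; the assumption \<open>nz\<close>
  ensures that the slice does not lie in the zero set of \<open>g\<close>.\<close>

lemma local_quotient_log_derivatives:
  assumes f: "local_quotient \<psi> s p f" and \<psi>: "\<And>v. v \<in> uhp \<Longrightarrow> (\<psi> has_field_derivative m (\<psi> v)) (at v)" and m: "m holomorphic_on UNIV"
    and F: "\<And>u v. (u, v) \<in> HH \<Longrightarrow> F (u, v) = qexp (r * v) * f (u, v)"
    and nz: "\<And>d. d > 0 \<Longrightarrow> \<exists>v\<in>uhp. \<psi> v \<in> ball p d \<and> \<psi> v \<noteq> p \<and> f (s, v) \<noteq> 0" and s: "s \<in> uhp"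
  shows "local_quotient \<psi> s p (G1 F)" "local_quotient \<psi> s p (G2 F)"
proof -
  obtain e g h where e: "e > 0" and g: "holomorphic2_on g (ball s e \<times> ball p e)" and h: "holomorphic2_on h (ball s e \<times> ball p e)"
    and h0: "\<exists>w\<in>ball p e. h (s, w) \<noteq> 0"
    and eq: "\<And>u v. (u, v) \<in> HH \<Longrightarrow> u \<in> ball s e \<Longrightarrow> \<psi> v \<in> ball p e \<Longrightarrow> h (u, \<psi> v) \<noteq> 0 \<Longrightarrow> f (u, v) = g (u, \<psi> v) / h (u, \<psi> v)"
    using f unfolding local_quotient_def by (elim exE conjE) simp
  let ?W = "ball s e \<times> ball p e"
  have W: "open ?W" by (intro open_Times open_ball)
  let ?c = "1 / (2 * of_real pi * \<i>) :: complex"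
  have ss: "s \<in> ball s e" using e by simp
  have "eventually (\<lambda>w. h (s, w) \<noteq> 0) (at p)"
    using h0 e by (auto intro: holomorphic_eventually_nonzero[OF holomorphic2_slices(1)[OF h ss]])
  then obtain d where d: "d > 0" "\<And>w. w \<noteq> p \<Longrightarrow> dist w p < d \<Longrightarrow> h (s, w) \<noteq> 0" by (auto simp: eventually_at)
  have "min d e > 0" using d e by simp
  from nz[OF this] obtain v0 where v0: "v0 \<in> uhp" "\<psi> v0 \<in> ball p (min d e)" "\<psi> v0 \<noteq> p" "f (s, v0) \<noteq> 0" by blast
  have hv0: "h (s, \<psi> v0) \<noteq> 0" using d(2)[of "\<psi> v0"] v0 by (simp add: dist_commute)
  have "g (s, \<psi> v0) \<noteq> 0" using eq[of s v0] v0 hv0 s ss by (auto simp: HH_eq)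
  then have gh0: "\<exists>w\<in>ball p e. g (s, w) * h (s, w) \<noteq> 0" using hv0 v0(2) by auto
  have gh: "holomorphic2_on (\<lambda>z. g z * h z) ?W" by (rule holomorphic2_on_mult(1)[OF g h W])
  have ms: "holomorphic2_on (\<lambda>z. m (snd z)) ?W"
    by (rule holomorphic2_on_compose1(1)[OF holomorphic2_on_snd m W open_UNIV]) simp
  have g1: "holomorphic2_on (\<lambda>z. ?c * (pd1 g z * h z - g z * pd1 h z)) ?W"
    by (intro holomorphic2_on_mult(1) holomorphic2_on_diff holomorphic2_on_pd1 holomorphic2_on_const g h W)
  have g2: "holomorphic2_on (\<lambda>z. ?c * (pd2 g z * h z - g z * pd2 h z) * m (snd z) + r * (g z * h z)) ?W"
    by (intro holomorphic2_on_add(1) holomorphic2_on_mult(1) holomorphic2_on_diff holomorphic2_on_pd2 holomorphic2_on_const g h W ms)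
  have E: "holomorphic2_on (\<lambda>t. qexp (r * snd t)) U" if "open U" for U
    unfolding qexp_def
    by (rule holomorphic2_on_compose1(1)[OF holomorphic2_on_snd _ that open_UNIV, of "\<lambda>z. exp (2 * of_real pi * \<i> * (r * z))"])
       (auto intro!: holomorphic_intros)
  have E1: "Dq1 (\<lambda>t. qexp (r * snd t)) (u, v) = 0" for u v by (simp add: Dq1_eq pd1_def)
  have E2: "Dq2 (\<lambda>t. qexp (r * snd t)) (u, v) = r * qexp (r * v)" for u v
  proof -
    have "((\<lambda>v. qexp (r * v)) has_field_derivative 2 * of_real pi * \<i> * r * qexp (r * v)) (at v)"
      unfolding qexp_def by (auto intro!: derivative_eq_intros)
    from DERIV_imp_deriv[OF this] show ?thesis by (simp add: Dq2_eq pd2_def)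
  qed
  have key: "G1 F (u, v) = Dq1 f (u, v) / f (u, v)" "G2 F (u, v) = r + Dq2 f (u, v) / f (u, v)"
    "f (u, v) = g (u, \<psi> v) / h (u, \<psi> v)"
    if a: "(u, v) \<in> HH" "u \<in> ball s e" "\<psi> v \<in> ball p e" "g (u, \<psi> v) * h (u, \<psi> v) \<noteq> 0" for u v
  proof -
    have h1: "h (u, \<psi> v) \<noteq> 0" using a(4) by simp
    have "\<exists>U. open U \<and> (u, v) \<in> U \<and> U \<subseteq> HH \<and> holomorphic2_on f U"
      by (rule quotient_pullback(3)[OF g h eq \<psi> a(1-3) h1])
    then obtain U where U: "open U" "(u, v) \<in> U" "U \<subseteq> HH" "holomorphic2_on f U" by (elim exE conjE)
    have FU: "F z = qexp (r * snd z) * f z" if "z \<in> U" for z using F[of "fst z" "snd z"] that U(3) by auto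
    show fg: "f (u, v) = g (u, \<psi> v) / h (u, \<psi> v)" by (rule eq[OF a(1-3) h1])
    have f0: "f (u, v) \<noteq> 0" using fg a(4) by simp
    have q0: "qexp (r * v) \<noteq> 0" by (simp add: qexp_def)
    have d1: "Dq1 F (u, v) = qexp (r * v) * Dq1 f (u, v)"
      using Dq_cong(1)[OF U(1,2) FU] Dq_mult(1)[OF E[OF U(1)] U(4,1,2)] E1 by simp
    have d2: "Dq2 F (u, v) = qexp (r * v) * Dq2 f (u, v) + r * qexp (r * v) * f (u, v)"
      using Dq_cong(2)[OF U(1,2) FU] Dq_mult(2)[OF E[OF U(1)] U(4,1,2)] E2 by simp
    show "G1 F (u, v) = Dq1 f (u, v) / f (u, v)"
      unfolding G1_def d1 F[OF a(1)] using q0 by simp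
    show "G2 F (u, v) = r + Dq2 f (u, v) / f (u, v)"
      unfolding G2_def d2 F[OF a(1)] using q0 f0 by (simp add: field_simps)
  qed
  show "local_quotient \<psi> s p (G1 F)"
    unfolding local_quotient_def
  proof (intro exI conjI allI impI)
    fix u v assume a: "(u, v) \<in> HH" "u \<in> ball s e" "\<psi> v \<in> ball p e" "g (u, \<psi> v) * h (u, \<psi> v) \<noteq> 0"
    have nz: "h (u, \<psi> v) \<noteq> 0" "g (u, \<psi> v) \<noteq> 0" using a(4) by auto
    have qp: "Dq1 f (u, v) = 1 / (2 * of_real pi * \<i>) * (pd1 g (u, \<psi> v) * h (u, \<psi> v) - g (u, \<psi> v) * pd1 h (u, \<psi> v)) / (h (u, \<psi> v))\<^sup>2"
      by (rule quotient_pullback(1)[OF g h eq \<psi> a(1-3) nz(1)])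
    show "G1 F (u, v) = ?c * (pd1 g (u, \<psi> v) * h (u, \<psi> v) - g (u, \<psi> v) * pd1 h (u, \<psi> v)) / (g (u, \<psi> v) * h (u, \<psi> v))"
      unfolding key(1)[OF a] key(3)[OF a] qp
      using nz by (simp add: divide_simps power2_eq_square)
  qed (fact e g1 gh gh0)+
  show "local_quotient \<psi> s p (G2 F)"
    unfolding local_quotient_def
  proof (intro exI conjI allI impI)
    fix u v assume a: "(u, v) \<in> HH" "u \<in> ball s e" "\<psi> v \<in> ball p e" "g (u, \<psi> v) * h (u, \<psi> v) \<noteq> 0"
    have nz: "h (u, \<psi> v) \<noteq> 0" "g (u, \<psi> v) \<noteq> 0" using a(4) by auto
    have qp: "Dq2 f (u, v) = 1 / (2 * of_real pi * \<i>) * (pd2 g (u, \<psi> v) * h (u, \<psi> v) - g (u, \<psi> v) * pd2 h (u, \<psi> v)) * m (\<psi> v) / (h (u, \<psi> v))\<^sup>2"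
      by (rule quotient_pullback(2)[OF g h eq \<psi> a(1-3) nz(1)])
    show "G2 F (u, v) = (?c * (pd2 g (u, \<psi> v) * h (u, \<psi> v) - g (u, \<psi> v) * pd2 h (u, \<psi> v)) * m (snd (u, \<psi> v))
         + r * (g (u, \<psi> v) * h (u, \<psi> v))) / (g (u, \<psi> v) * h (u, \<psi> v))"
      unfolding key(2)[OF a] key(3)[OF a] qp snd_conv
      using nz by (simp add: divide_simps power2_eq_square)
  qed (fact e g2 gh gh0)+
qed

section \<open>Generic slices of a modular form\<close>

lemma slash_second:
  "slash k1 k2 (mat 1) B f (u, v) = autfac B v powi (- k2) * f (u, act B v)"
  by (simp add: slash_def)

text \<open>Near each point the condition fails on countably many slices only;
  \<open>countable_exception\<close> globalises this over \<open>HH\<close> and, for each of the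
  finitely many matrices in \<open>R\<close>, over the line \<open>uhp \<times> {0}\<close>.\<close>

lemma modular_generic_local_quotient:
  assumes m: "meromorphic_HH_star k1 k2 f" and R: "finite R" "R \<subseteq> SL2Z"
  obtains E where "countable E" "\<forall>s\<in>uhp. s \<notin> E \<longrightarrow> (\<forall>p\<in>uhp. local_quotient (\<lambda>v. v) s p f)"
    "\<forall>s\<in>uhp. s \<notin> E \<longrightarrow> (\<forall>B\<in>R. \<exists>h>0. \<exists>r. local_quotient (qpar h) s 0 (\<lambda>(t1, t2). qexp (- r * t2) * slash k1 k2 (mat 1) B f (t1, t2)))"
proof -
  have HHp: "\<exists>U E. open U \<and> p \<in> U \<and> countable E \<and> (\<forall>s w. (s, w) \<in> U \<inter> HH \<longrightarrow> s \<notin> E \<longrightarrow> local_quotient (\<lambda>v. v) s w f)" if p: "p \<in> HH" for p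
  proof -
    have "merom_near f (\<lambda>t. t) p" using m p unfolding meromorphic_HH_star_def by blast
    moreover have "(\<lambda>(t1, t2). (t1, (\<lambda>v. v) t2)) = (\<lambda>t :: complex \<times> complex. t)" by auto
    ultimately have "merom_near f (\<lambda>(t1, t2). (t1, (\<lambda>v. v) t2)) (fst p, snd p)" by (simp only: prod.collapse)
    from merom_near_generic[OF this] obtain U E
      where "open U \<and> (fst p, snd p) \<in> U \<and> countable E \<and> (\<forall>s w. (s, w) \<in> U \<longrightarrow> s \<notin> E \<longrightarrow> local_quotient (\<lambda>v. v) s w f)"
      by (elim exE)
    then show ?thesis by (intro exI[of _ U] exI[of _ E]) simp
  qed
  have "\<exists>E. countable E \<and> (\<forall>s w. (s, w) \<in> HH \<longrightarrow> s \<notin> E \<longrightarrow> local_quotient (\<lambda>v. v) s w f)"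
    by (rule countable_exception, rule HHp)
  then obtain E0 where
    E0: "countable E0" "\<forall>s w. (s, w) \<in> HH \<longrightarrow> s \<notin> E0 \<longrightarrow> local_quotient (\<lambda>v. v) s w f" by (elim exE conjE)
  define Q where "Q = (\<lambda>B s (w::complex). \<exists>h>0. \<exists>r. local_quotient (qpar h) s 0 (\<lambda>(t1, t2). qexp (- r * t2) * slash k1 k2 (mat 1) B f (t1, t2)))"
  have "\<exists>E. countable E \<and> (\<forall>s w. (s, w) \<in> uhp \<times> {0} \<longrightarrow> s \<notin> E \<longrightarrow> Q B s w)" if B: "B \<in> R" for B
  proof (rule countable_exception)
    fix p :: "complex \<times> complex" assume p: "p \<in> uhp \<times> {0}"
    then obtain s0 where s0: "p = (s0, 0)" "Im s0 > 0" by (auto simp: uhp_def)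
    have "\<exists>(h::real) r. h > 0 \<and>
        merom_near (\<lambda>(t1, t2). qexp (- r * t2) * slash k1 k2 (mat 1) B f (t1, t2))
          (\<lambda>(t1, t2). (t1, qexp (t2 / of_real h))) (s0, 0)"
      using m s0(2) B R(2) unfolding meromorphic_HH_star_def by blast
    then obtain h :: real and r where h: "h > 0" and
      mn: "merom_near (\<lambda>(t1, t2). qexp (- r * t2) * slash k1 k2 (mat 1) B f (t1, t2))
          (\<lambda>(t1, t2). (t1, qpar h t2)) (s0, 0)" unfolding qpar_def by (elim exE conjE)
    from merom_near_generic[OF mn] obtain U E where
      U: "open U" "(s0, 0) \<in> U" "countable E" and
      local_quotient: "\<forall>s w. (s, w) \<in> U \<longrightarrow> s \<notin> E \<longrightarrow> local_quotient (qpar h) s w (\<lambda>(t1, t2). qexp (- r * t2) * slash k1 k2 (mat 1) B f (t1, t2))"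
      by (elim exE conjE)
    have "Q B s w" if "(s, w) \<in> U \<inter> uhp \<times> {0}" "s \<notin> E" for s w
      unfolding Q_def by (rule exI[of _ h], rule conjI[OF h], rule exI[of _ r]) (use local_quotient that in auto)
    then show "\<exists>U E. open U \<and> p \<in> U \<and> countable E \<and> (\<forall>s w. (s, w) \<in> U \<inter> uhp \<times> {0} \<longrightarrow> s \<notin> E \<longrightarrow> Q B s w)"
      using U s0(1) by (intro exI[of _ U] exI[of _ E]) simp
  qed
  then have "\<forall>B\<in>R. \<exists>E. countable E \<and> (\<forall>s w. (s, w) \<in> uhp \<times> {0} \<longrightarrow> s \<notin> E \<longrightarrow> Q B s w)" by blast
  from bchoice[OF this] obtain E1 where
    E1: "\<forall>B\<in>R. countable (E1 B) \<and> (\<forall>s w. (s, w) \<in> uhp \<times> {0} \<longrightarrow> s \<notin> E1 B \<longrightarrow> Q B s w)" by (elim exE)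
  show ?thesis
  proof (rule that[of "E0 \<union> (\<Union>B\<in>R. E1 B)"])
    show "countable (E0 \<union> (\<Union>B\<in>R. E1 B))" using E0(1) E1 R(1) by (simp add: countable_finite)
    show "\<forall>s\<in>uhp. s \<notin> E0 \<union> (\<Union>B\<in>R. E1 B) \<longrightarrow> (\<forall>p\<in>uhp. local_quotient (\<lambda>v. v) s p f)"
      using E0(2) by (simp add: HH_eq)
    show "\<forall>s\<in>uhp. s \<notin> E0 \<union> (\<Union>B\<in>R. E1 B) \<longrightarrow> (\<forall>B\<in>R. \<exists>h>0. \<exists>r. local_quotient (qpar h) s 0 (\<lambda>(t1, t2). qexp (- r * t2) * slash k1 k2 (mat 1) B f (t1, t2)))"
    proof (intro ballI impI)
      fix s B assume "s \<in> uhp" "s \<notin> E0 \<union> (\<Union>B\<in>R. E1 B)" "B \<in> R"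
      then have "Q B s 0" using E1 by auto
      then show "\<exists>h>0. \<exists>r. local_quotient (qpar h) s 0 (\<lambda>(t1, t2). qexp (- r * t2) * slash k1 k2 (mat 1) B f (t1, t2))"
        unfolding Q_def .
    qed
  qed
qed

lemma local_quotient_hol_points:
  assumes f: "local_quotient (\<lambda>v. v) s p f" and s: "s \<in> uhp" "p \<in> uhp"
  shows "eventually (\<lambda>v. (s, v) \<in> hol_points f) (at p)"
proof -
  obtain e g h where e: "e > 0" and g: "holomorphic2_on g (ball s e \<times> ball p e)" and h: "holomorphic2_on h (ball s e \<times> ball p e)"
    and h0: "\<exists>w\<in>ball p e. h (s, w) \<noteq> 0"
    and eq: "\<And>u v. (u, v) \<in> HH \<Longrightarrow> u \<in> ball s e \<Longrightarrow> v \<in> ball p e \<Longrightarrow> h (u, v) \<noteq> 0 \<Longrightarrow> f (u, v) = g (u, v) / h (u, v)"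
    using f unfolding local_quotient_def by (elim exE conjE) simp
  have ss: "s \<in> ball s e" using e by simp
  have "eventually (\<lambda>w. h (s, w) \<noteq> 0) (at p)"
    using h0 e by (auto intro: holomorphic_eventually_nonzero[OF holomorphic2_slices(1)[OF h ss]])
  moreover have "eventually (\<lambda>v. v \<in> uhp \<inter> ball p e) (at p)"
    using s e open_uhp by (intro eventually_at_in_open' open_Int) auto
  ultimately show ?thesis
  proof eventually_elim
    case (elim v)
    have a: "(s, v) \<in> HH" "v \<in> ball p e" using elim s by (auto simp: HH_eq)
    have "\<exists>U. open U \<and> (s, v) \<in> U \<and> U \<subseteq> HH \<and> holomorphic2_on f U"
      by (rule quotient_pullback(3)[where \<psi> = "\<lambda>v. v" and m = "\<lambda>_. 1", OF g h eq]) (use a ss elim in auto)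
    then show ?case unfolding hol_points_def by blast
  qed
qed

text \<open>If \<open>f\<close> vanished on the slice at \<open>s\<close> off a sparse set, it would
  vanish at all but finitely many points of a compact disc. So with a countably infinite test set
  \<open>V\<close> in that disc, a bad \<open>s\<close> satisfies \<open>f (s, v) = 0\<close> for
  some \<open>v\<close> in \<open>V\<close>, and each of these equations has countably many
  solutions.\<close>

lemma generic_nonzero:
  assumes E2: "countable E2" "\<And>v. v \<in> uhp \<Longrightarrow> v \<notin> E2 \<Longrightarrow> (\<lambda>u. f (u, v)) meromorphic_on uhp"
    and W: "open W" "W \<noteq> {}" "W \<subseteq> HH" "\<And>t. t \<in> W \<Longrightarrow> f t \<noteq> 0"
  obtains E where "countable E" "\<forall>s\<in>uhp. s \<notin> E \<longrightarrow> \<not> (\<forall>\<^sub>\<approx>v\<in>uhp. f (s, v) = 0)"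
proof -
  obtain u0 v0 where uv: "(u0, v0) \<in> W" using W(2) by auto
  obtain r where r: "r > 0" "cball u0 r \<times> cball v0 r \<subseteq> W" by (rule open_prod_ball[OF W(1) uv])
  have "uncountable (ball v0 r - E2)" using r(1) E2(1) by (intro uncountable_minus_countable uncountable_ball)
  then have "infinite (ball v0 r - E2)" using countable_finite by blast
  then obtain V where V: "V \<subseteq> ball v0 r - E2" "countable V" "infinite V"
    using infinite_countable_subset' by blast
  have Vu: "v \<in> uhp" "v \<notin> E2" if "v \<in> V" for v
  proof -
    have "(u0, v) \<in> cball u0 r \<times> cball v0 r" using subsetD[OF V(1) that] r(1) by simp
    then have "(u0, v) \<in> W" using r(2) by blast
    then show "v \<in> uhp" "v \<notin> E2" using W(3) V(1) that by (auto simp: HH_eq)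
  qed
  define E where "E = (\<Union>v\<in>V. {u \<in> uhp. f (u, v) = 0})"
  have "countable E"
    unfolding E_def
  proof (rule countable_UN[OF V(2)])
    fix v assume v: "v \<in> V"
    show "countable {u \<in> uhp. f (u, v) = 0}"
    proof (rule meromorphic_zeros_countable[OF E2(2)[OF Vu[OF v]] open_uhp connected_uhp])
      show "\<not> (\<forall>\<^sub>\<approx>z\<in>uhp. f (z, v) = 0)"
      proof
        assume z: "\<forall>\<^sub>\<approx>z\<in>uhp. f (z, v) = 0"
        have "ball u0 r \<subseteq> {u \<in> uhp. \<not> f (u, v) = 0}"
        proof
          fix u assume "u \<in> ball u0 r"
          then have "(u, v) \<in> cball u0 r \<times> cball v0 r" using subsetD[OF V(1) v] by simp
          then have "(u, v) \<in> W" using r(2) by blast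
          then show "u \<in> {u \<in> uhp. \<not> f (u, v) = 0}" using W(3,4) by (auto simp: HH_eq)
        qed
        then have "countable (ball u0 r)" by (rule countable_subset[OF _ cosparse_countable[OF z open_uhp]])
        then show False using uncountable_ball[OF r(1), of u0] by contradiction
      qed
    qed
  qed
  moreover have "\<not> (\<forall>\<^sub>\<approx>v\<in>uhp. f (s, v) = 0)" if s: "s \<in> uhp" "s \<notin> E" for s
  proof
    assume "\<forall>\<^sub>\<approx>v\<in>uhp. f (s, v) = 0"
    then have sp: "{v. f (s, v) \<noteq> 0} sparse_in uhp" by (simp add: eventually_cosparse)
    have K: "cball v0 r \<subseteq> uhp"
    proof
      fix v assume "v \<in> cball v0 r"
      then have "(u0, v) \<in> cball u0 r \<times> cball v0 r" using r(1) by simp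
      then have "(u0, v) \<in> W" using r(2) by blast
      then show "v \<in> uhp" using W(3) by (auto simp: HH_eq)
    qed
    have "finite (cball v0 r \<inter> {v. f (s, v) \<noteq> 0})"
      by (rule sparse_in_compact_finite[OF sparse_in_subset[OF sp K] compact_cball])
    moreover have "V \<subseteq> cball v0 r \<inter> {v. f (s, v) \<noteq> 0}"
    proof
      fix v assume v: "v \<in> V"
      then have "f (s, v) \<noteq> 0" using s unfolding E_def by blast
      then show "v \<in> cball v0 r \<inter> {v. f (s, v) \<noteq> 0}" using V(1) v by auto
    qed
    ultimately show False using V(3) finite_subset by blast
  qed
  ultimately show ?thesis using that[of E] by blast
qed

section \<open>Logarithmic derivatives under the weighted action\<close>

definition logd :: "(complex \<Rightarrow> complex) \<Rightarrow> complex \<Rightarrow> complex" where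
  "logd \<phi> z = 1 / (2 * of_real pi * \<i>) * deriv \<phi> z / \<phi> z"

lemma G_logd: "G1 f (u, v) = logd (\<lambda>s. f (s, v)) u" "G2 f (u, v) = logd (\<lambda>s. f (u, s)) v"
  by (simp_all add: G1_def G2_def Dq1_def Dq2_def logd_def)

lemma logd_slash:
  assumes \<phi>: "(\<phi> has_field_derivative d) (at (act B t))" and nz: "\<phi> (act B t) \<noteq> 0" and B: "det B = 1" and t: "t \<in> uhp"
  shows "logd (\<lambda>s. autfac B s powi (- k) * \<phi> (act B s)) t =
     logd \<phi> (act B t) / (autfac B t)\<^sup>2 - of_int k * (of_real (B$2$1) / (2 * of_real pi * \<i>)) / autfac B t"
proof -
  let ?J = "autfac B t" and ?c = "of_real (B$2$1) :: complex"
  have J: "?J \<noteq> 0" using autfac_nonzero[OF B] t by (simp add: uhp_def)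
  have p: "((\<lambda>s. autfac B s powi (- k)) has_field_derivative of_int (- k) * ?J powi (- k - 1) * ?c) (at t)"
    by (rule DERIV_power_int[OF autfac_has_derivative disjI2[OF J]])
  have c: "((\<lambda>s. \<phi> (act B s)) has_field_derivative d * (1 / ?J\<^sup>2)) (at t)"
    by (rule DERIV_chain2[OF \<phi> act_has_derivative[OF B t]])
  have D: "((\<lambda>s. autfac B s powi (- k) * \<phi> (act B s)) has_field_derivative
     of_int (- k) * ?J powi (- k - 1) * ?c * \<phi> (act B t) + d * (1 / ?J\<^sup>2) * ?J powi (- k)) (at t)"
    by (rule DERIV_mult[OF p c])
  have pw: "?J powi (- k - 1) = ?J powi (- k) / ?J" using J by (simp add: power_int_diff)
  have pk: "?J powi (- k) \<noteq> 0" using J by simp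
  have "logd (\<lambda>s. autfac B s powi (- k) * \<phi> (act B s)) t = 1 / (2 * of_real pi * \<i>) *
     (of_int (- k) * (?J powi (- k) / ?J) * ?c * \<phi> (act B t) + d * (1 / ?J\<^sup>2) * ?J powi (- k)) / (?J powi (- k) * \<phi> (act B t))"
    unfolding logd_def DERIV_imp_deriv[OF D] pw ..
  also have "\<dots> = 1 / (2 * of_real pi * \<i>) * d / \<phi> (act B t) / ?J\<^sup>2 - of_int k * (?c / (2 * of_real pi * \<i>)) / ?J"
    using J pk nz by (simp add: divide_simps) (simp add: algebra_simps)
  finally show ?thesis by (simp add: logd_def DERIV_imp_deriv[OF \<phi>])
qed

text \<open>The weighted action on the second variable alone; the first variable stays a parameter,
  and its weight does not occur.\<close>

definition slash_snd :: "int \<Rightarrow> real^2^2 \<Rightarrow> (complex \<times> complex \<Rightarrow> complex) \<Rightarrow> complex \<times> complex \<Rightarrow> complex" where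
  "slash_snd k B f = (\<lambda>(u, v). autfac B v powi (- k) * f (u, act B v))"

lemma open_act_preimage:
  assumes "open W" "det B = 1"
  shows "open {t \<in> HH. (fst t, act B (snd t)) \<in> W}"
proof -
  have "continuous_on HH (\<lambda>t. (fst t, act B (snd t)))"
    by (intro continuous_intros continuous_on_compose2[OF holomorphic_on_imp_continuous_on[OF analytic_imp_holomorphic[OF act_analytic[OF assms(2)]]]])
       (auto simp: HH_eq)
  moreover have "open HH" unfolding HH_eq by (intro open_Times open_uhp)
  ultimately have "open (HH \<inter> (\<lambda>t. (fst t, act B (snd t))) -` W)" using assms(1) by (intro continuous_open_preimage)
  moreover have "HH \<inter> (\<lambda>t. (fst t, act B (snd t))) -` W = {t \<in> HH. (fst t, act B (snd t)) \<in> W}" by auto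
  ultimately show ?thesis by simp
qed

lemma holomorphic2_nonzero_open:
  assumes "holomorphic2_on f S" "open S"
  shows "open {t \<in> S. f t \<noteq> 0}"
proof -
  have "open (S \<inter> f -` (- {0}))" by (intro continuous_open_preimage holomorphic2_on_imp_continuous_on assms) auto
  moreover have "S \<inter> f -` (- {0}) = {t \<in> S. f t \<noteq> 0}" by auto
  ultimately show ?thesis by simp
qed

text \<open>With \<open>J = autfac B v\<close> and \<open>e\<close> the value of
  \<open>Dq2 J\<close>, the terms in \<open>k\<close> come from the logarithmic derivative of
  \<open>J powi (- k)\<close>, and the term \<open>2 * e * G2 f / J^3\<close> from differentiating
  \<open>J^2\<close> in the denominator. These are the nonmodular terms that have to cancel in the
  coefficients.\<close>

lemma G_slash:
  assumes B: "det B = 1" and uv: "(u, v) \<in> HH" "(u, act B v) \<in> hol_points f" "f (u, act B v) \<noteq> 0"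
  shows "G1 (slash_snd k B f) (u, v) = G1 f (u, act B v)"
    and "Dq1 (G1 (slash_snd k B f)) (u, v) = Dq1 (G1 f) (u, act B v)"
    and "G2 (slash_snd k B f) (u, v) = G2 f (u, act B v) / (autfac B v)\<^sup>2
           - of_int k * (of_real (B$2$1) / (2 * of_real pi * \<i>)) / autfac B v"
    and "Dq2 (G2 (slash_snd k B f)) (u, v) = Dq2 (G2 f) (u, act B v) / (autfac B v)^4
           - 2 * (of_real (B$2$1) / (2 * of_real pi * \<i>)) * G2 f (u, act B v) / (autfac B v)^3
           + of_int k * (of_real (B$2$1) / (2 * of_real pi * \<i>))\<^sup>2 / (autfac B v)\<^sup>2"
proof -
  define W where "W = {t \<in> hol_points f. f t \<noteq> 0}"
  have W: "open W" unfolding W_def by (rule holomorphic2_nonzero_open[OF holomorphic2_on_hol_points open_hol_points])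
  define U where "U = {t \<in> HH. (fst t, act B (snd t)) \<in> W}"
  have U: "open U" unfolding U_def by (rule open_act_preimage[OF W B])
  have uvU: "(u, v) \<in> U" using uv by (simp add: U_def W_def)
  have fW: "holomorphic2_on f W" by (rule holomorphic2_on_subset[OF holomorphic2_on_hol_points]) (auto simp: W_def)
  have J: "autfac B q \<noteq> 0" if "(p, q) \<in> U" for p q
    using that autfac_nonzero[OF B] by (auto simp: U_def HH_def)
  let ?e = "of_real (B$2$1) / (2 * of_real pi * \<i>) :: complex"
  have g1: "G1 (slash_snd k B f) (p, q) = G1 f (p, act B q)" if pq: "(p, q) \<in> U" for p q
  proof -
    have "((\<lambda>s. f (s, act B q)) has_field_derivative pd1 f (p, act B q)) (at p)"
      by (rule holomorphic2_on_partials(2)[OF fW W]) (use pq in \<open>simp add: U_def\<close>)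
    then have "((\<lambda>s. autfac B q powi (- k) * f (s, act B q)) has_field_derivative autfac B q powi (- k) * pd1 f (p, act B q)) (at p)"
      by (rule DERIV_cmult)
    from DERIV_imp_deriv[OF this] show ?thesis using J[OF pq]
      by (simp add: G1_def Dq1_def slash_snd_def pd1_def)
  qed
  have g2: "G2 (slash_snd k B f) (p, q) = G2 f (p, act B q) / (autfac B q)\<^sup>2 - of_int k * ?e / autfac B q" if pq: "(p, q) \<in> U" for p q
  proof -
    have "((\<lambda>s. f (p, s)) has_field_derivative pd2 f (p, act B q)) (at (act B q))"
      by (rule holomorphic2_on_partials(3)[OF fW W]) (use pq in \<open>simp add: U_def\<close>)
    then show ?thesis unfolding G_logd slash_snd_def prod.case
      by (rule logd_slash) (use pq B in \<open>auto simp: U_def W_def HH_eq\<close>)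
  qed
  show "G1 (slash_snd k B f) (u, v) = G1 f (u, act B v)" by (rule g1[OF uvU])
  show "G2 (slash_snd k B f) (u, v) = G2 f (u, act B v) / (autfac B v)\<^sup>2 - of_int k * ?e / autfac B v" by (rule g2[OF uvU])
  have "Dq1 (G1 (slash_snd k B f)) (u, v) = Dq1 (\<lambda>t. G1 f (fst t, act B (snd t))) (u, v)"
    by (rule Dq_cong(1)[OF U uvU]) (use g1 in auto)
  then show "Dq1 (G1 (slash_snd k B f)) (u, v) = Dq1 (G1 f) (u, act B v)" by (simp add: Dq1_def)
  let ?J = "autfac B v"
  have G2W: "holomorphic2_on (G2 f) W" by (rule holomorphic2_on_G(2)[OF fW W]) (simp add: W_def)
  have "((\<lambda>s. G2 f (u, s)) has_field_derivative pd2 (G2 f) (u, act B v)) (at (act B v))"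
    by (rule holomorphic2_on_partials(3)[OF G2W W]) (use uvU in \<open>simp add: U_def\<close>)
  then have c: "((\<lambda>s. G2 f (u, act B s)) has_field_derivative pd2 (G2 f) (u, act B v) * (1 / ?J\<^sup>2)) (at v)"
    by (rule DERIV_chain2[OF _ act_has_derivative[OF B]]) (use uv in \<open>simp add: HH_eq\<close>)
  have "((\<lambda>s. G2 f (u, act B s) / (autfac B s)\<^sup>2 - of_int k * ?e / autfac B s) has_field_derivative
     (pd2 (G2 f) (u, act B v) * (1 / ?J\<^sup>2) * ?J\<^sup>2 - G2 f (u, act B v) * (2 * ?J * of_real (B$2$1))) / (?J\<^sup>2 * ?J\<^sup>2)
     - (0 * ?J - of_int k * ?e * of_real (B$2$1)) / (?J * ?J)) (at v)"
    using J[OF uvU]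
    by (intro DERIV_diff DERIV_divide c DERIV_const autfac_has_derivative)
       (auto intro!: derivative_eq_intros autfac_has_derivative)
  note d = DERIV_imp_deriv[OF this]
  have "Dq2 (G2 (slash_snd k B f)) (u, v) = Dq2 (\<lambda>t. G2 f (fst t, act B (snd t)) / (autfac B (snd t))\<^sup>2 - of_int k * ?e / autfac B (snd t)) (u, v)"
    by (rule Dq_cong(2)[OF U uvU]) (use g2 in auto)
  also have "\<dots> = 1 / (2 * of_real pi * \<i>) * ((pd2 (G2 f) (u, act B v) * (1 / ?J\<^sup>2) * ?J\<^sup>2 - G2 f (u, act B v) * (2 * ?J * of_real (B$2$1))) / (?J\<^sup>2 * ?J\<^sup>2)
     - (0 * ?J - of_int k * ?e * of_real (B$2$1)) / (?J * ?J))"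
    unfolding Dq2_def prod.case fst_conv snd_conv d ..
  also have "\<dots> = Dq2 (G2 f) (u, act B v) / ?J^4 - 2 * ?e * G2 f (u, act B v) / ?J^3 + of_int k * ?e\<^sup>2 / ?J\<^sup>2"
  proof -
    have alg: "K * ((D * (1 / j\<^sup>2) * j\<^sup>2 - G * (2 * j * b)) / (j\<^sup>2 * j\<^sup>2) - (0 * j - kk * (b / P) * b) / (j * j))
       = D / P / j^4 - 2 * (b / P) * G / j^3 + kk * (b / P)\<^sup>2 / j\<^sup>2"
      if "j \<noteq> 0" "P \<noteq> 0" "K = 1 / P" for j D G b kk P K :: complex
      using that(1,2) unfolding that(3)
      by (simp add: divide_simps) (simp add: algebra_simps power2_eq_square power3_eq_cube power4_eq_xxxx)
    show ?thesis unfolding Dq2_eq by (rule alg[OF J[OF uvU] _ refl]) simp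
  qed
  finally show "Dq2 (G2 (slash_snd k B f)) (u, v) = Dq2 (G2 f) (u, act B v) / ?J^4 - 2 * ?e * G2 f (u, act B v) / ?J^3 + of_int k * ?e\<^sup>2 / ?J\<^sup>2" .
qed

text \<open>A constant factor, in the applications a value of the character, drops out of
  logarithmic derivatives.\<close>

lemma G_const_mult:
  assumes W: "open W" "t \<in> W" "holomorphic2_on f W" "c \<noteq> 0" "\<And>z. z \<in> W \<Longrightarrow> f' z = c * f z"
  shows "G1 f' t = G1 f t" "G2 f' t = G2 f t" "Dq1 (G1 f') t = Dq1 (G1 f) t" "Dq2 (G2 f') t = Dq2 (G2 f) t"
proof -
  have pd: "Dq1 f' z = c * Dq1 f z" "Dq2 f' z = c * Dq2 f z" if "z \<in> W" for z
  proof -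
    have "Dq1 (\<lambda>t. c) z = 0" "Dq2 (\<lambda>t. c) z = 0" by (simp_all add: Dq1_def Dq2_def split: prod.splits)
    then show "Dq1 f' z = c * Dq1 f z" "Dq2 f' z = c * Dq2 f z"
      using Dq_cong[OF W(1) that W(5)] Dq_mult[OF holomorphic2_on_const[of c] W(3,1) that] by simp_all
  qed
  have G: "G1 f' z = G1 f z" "G2 f' z = G2 f z" if "z \<in> W" for z
    using pd[OF that] W(4) W(5)[OF that] by (simp_all add: G1_def G2_def)
  show "G1 f' t = G1 f t" "G2 f' t = G2 f t" by (rule G[OF W(2)])+
  show "Dq1 (G1 f') t = Dq1 (G1 f) t" by (rule Dq_cong(1)[OF W(1,2) G(1)])
  show "Dq2 (G2 f') t = Dq2 (G2 f) t" by (rule Dq_cong(2)[OF W(1,2) G(2)])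
qed

section \<open>Covariance of the coefficients\<close>

text \<open>
  The index enumerates \<open>a0, b0, a1, b1, a2, b2, a3, b3\<close>; the arguments \<open>p, q, r, s\<close> are \<open>G1 x, G2 x, G1 y, G2 y\<close>,
  and \<open>X, Y, Z\<close> are the second order expressions in \<open>x, y, F\<close>.
\<close>

definition coeff_formula :: "nat \<Rightarrow> complex \<Rightarrow> complex \<Rightarrow> complex \<Rightarrow> complex \<Rightarrow> complex \<Rightarrow> complex \<Rightarrow> complex \<Rightarrow> complex \<Rightarrow> complex \<Rightarrow> complex \<Rightarrow> complex" where
  "coeff_formula i p q r s X1 X2 Y1 Y2 Z1 Z2 =
    [2 * r * s / (p * s + r * q), 2 * p * q / (p * s + r * q),
     (s^2 * X1 - r^2 * X2) / (p^2 * s^2 - r^2 * q^2), (- (q^2) * X1 + p^2 * X2) / (p^2 * s^2 - r^2 * q^2),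
     (s^2 * Y1 - r^2 * Y2) / (p^2 * s^2 - r^2 * q^2), (- (q^2) * Y1 + p^2 * Y2) / (p^2 * s^2 - r^2 * q^2),
     - ((s^2 * Z1 - r^2 * Z2) / (p^2 * s^2 - r^2 * q^2)), - ((- (q^2) * Z1 + p^2 * Z2) / (p^2 * s^2 - r^2 * q^2))] ! i"

definition coeff_value :: "nat \<Rightarrow> (nat \<Rightarrow> complex) \<Rightarrow> complex" where
  "coeff_value i w = coeff_formula i (w 0) (w 1) (w 2) (w 3) (w 6 - 2 * w 4 * w 0) (w 7 - 2 * w 5 * w 1)
      (w 8 - 2 * w 4 * w 2) (w 9 - 2 * w 5 * w 3) (w 10 - (w 4)^2) (w 11 - (w 5)^2)"

text \<open>Even positions belong to the first variable and odd ones to the second. Numbering the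
  twelve functions lets meromorphy and expansions be passed through the coefficient formulas for all
  entries together.\<close>

definition log_derivs :: "(complex \<times> complex \<Rightarrow> complex) \<Rightarrow> (complex \<times> complex \<Rightarrow> complex) \<Rightarrow> (complex \<times> complex \<Rightarrow> complex) \<Rightarrow>
    complex \<times> complex \<Rightarrow> nat \<Rightarrow> complex" where
  "log_derivs F x y t n = [G1 x t, G2 x t, G1 y t, G2 y t, G1 F t, G2 F t, Dq1 (G1 x) t, Dq2 (G2 x) t,
     Dq1 (G1 y) t, Dq2 (G2 y) t, Dq1 (G1 F) t, Dq2 (G2 F) t] ! n"

lemma log_derivs_simps [simp]:
  "log_derivs F x y t 0 = G1 x t" "log_derivs F x y t (Suc 0) = G2 x t" "log_derivs F x y t 1 = G2 x t" "log_derivs F x y t 2 = G1 y t" "log_derivs F x y t 3 = G2 y t"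
  "log_derivs F x y t 4 = G1 F t" "log_derivs F x y t 5 = G2 F t" "log_derivs F x y t 6 = Dq1 (G1 x) t" "log_derivs F x y t 7 = Dq2 (G2 x) t"
  "log_derivs F x y t 8 = Dq1 (G1 y) t" "log_derivs F x y t 9 = Dq2 (G2 y) t" "log_derivs F x y t 10 = Dq1 (G1 F) t" "log_derivs F x y t 11 = Dq2 (G2 F) t"
  by (simp_all add: log_derivs_def eval_nat_numeral)

lemma less_8_cases: "i < (8::nat) \<longleftrightarrow> i = 0 \<or> i = 1 \<or> i = 2 \<or> i = 3 \<or> i = 4 \<or> i = 5 \<or> i = 6 \<or> i = 7" by auto

lemma coeff_formula_simps:
  "coeff_formula 0 p q r s X1 X2 Y1 Y2 Z1 Z2 = 2 * r * s / (p * s + r * q)"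
  "coeff_formula 1 p q r s X1 X2 Y1 Y2 Z1 Z2 = 2 * p * q / (p * s + r * q)"
  "coeff_formula 2 p q r s X1 X2 Y1 Y2 Z1 Z2 = (s^2 * X1 - r^2 * X2) / (p^2 * s^2 - r^2 * q^2)"
  "coeff_formula 3 p q r s X1 X2 Y1 Y2 Z1 Z2 = (- (q^2) * X1 + p^2 * X2) / (p^2 * s^2 - r^2 * q^2)"
  "coeff_formula 4 p q r s X1 X2 Y1 Y2 Z1 Z2 = (s^2 * Y1 - r^2 * Y2) / (p^2 * s^2 - r^2 * q^2)"
  "coeff_formula 5 p q r s X1 X2 Y1 Y2 Z1 Z2 = (- (q^2) * Y1 + p^2 * Y2) / (p^2 * s^2 - r^2 * q^2)"
  "coeff_formula 6 p q r s X1 X2 Y1 Y2 Z1 Z2 = - ((s^2 * Z1 - r^2 * Z2) / (p^2 * s^2 - r^2 * q^2))"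
  "coeff_formula 7 p q r s X1 X2 Y1 Y2 Z1 Z2 = - ((- (q^2) * Z1 + p^2 * Z2) / (p^2 * s^2 - r^2 * q^2))"
  by (simp_all add: coeff_formula_def eval_nat_numeral)

lemma coefficients_eq_coeff_value:
  "coeff_a0 x y = (\<lambda>t. coeff_value 0 (log_derivs F x y t))" "coeff_b0 x y = (\<lambda>t. coeff_value 1 (log_derivs F x y t))"
  "coeff_a1 F x y = (\<lambda>t. coeff_value 2 (log_derivs F x y t))" "coeff_b1 F x y = (\<lambda>t. coeff_value 3 (log_derivs F x y t))"
  "coeff_a2 F x y = (\<lambda>t. coeff_value 4 (log_derivs F x y t))" "coeff_b2 F x y = (\<lambda>t. coeff_value 5 (log_derivs F x y t))"
  "coeff_a3 F x y = (\<lambda>t. coeff_value 6 (log_derivs F x y t))" "coeff_b3 F x y = (\<lambda>t. coeff_value 7 (log_derivs F x y t))"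
  unfolding coeff_a0_def[abs_def] coeff_a1_def[abs_def] coeff_a2_def[abs_def] coeff_a3_def[abs_def]
    coeff_b0_def[abs_def] coeff_b1_def[abs_def] coeff_b2_def[abs_def] coeff_b3_def[abs_def] coeff_value_def coeff_formula_simps coeff_N_def log_derivs_simps
  by (rule refl)+

text \<open>Each coefficient has degree zero when the data of the second variable are scaled,
  first-order entries by \<open>m\<close> and second-order ones by \<open>m^2\<close>. A matrix acts
  in this way, with \<open>m\<close> the inverse square of the automorphy factor.\<close>

lemma coeff_formula_scale:
  assumes "m \<noteq> 0" "i < 8"
  shows "coeff_formula i p (m * q) r (m * s) X1 (m^2 * X2) Y1 (m^2 * Y2) Z1 (m^2 * Z2) = coeff_formula i p q r s X1 X2 Y1 Y2 Z1 Z2"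
proof -
  have c: "(m * A) / (m * B) = A / B" for A B :: complex using assms(1) by simp
  have c2: "(m^2 * A) / (m^2 * B) = A / B" for A B :: complex using assms(1) by simp
  have N: "p^2 * (m * s)^2 - r^2 * (m * q)^2 = m^2 * (p^2 * s^2 - r^2 * q^2)"
    and D: "p * (m * s) + r * (m * q) = m * (p * s + r * q)"
    and e0: "2 * r * (m * s) = m * (2 * r * s)" "2 * p * (m * q) = m * (2 * p * q)"
    and e1: "(m * s)^2 * X - r^2 * (m^2 * Y) = m^2 * (s^2 * X - r^2 * Y)"
      "- ((m * q)^2) * X + p^2 * (m^2 * Y) = m^2 * (- (q^2) * X + p^2 * Y)" for X Y
    by (simp_all add: algebra_simps power_mult_distrib)
  show ?thesis
    using assms(2) unfolding less_8_cases
    by (elim disjE) (simp_all only: coeff_formula_simps N D e0 e1 c c2)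
qed

text \<open>Exchanging the variables changes the sign of numerator and determinant alike and leaves
  the first two formulas symmetric; so results on slices in one direction transfer to the
  other.\<close>

lemma coeff_formula_swap:
  assumes "i < 8"
  shows "coeff_formula i q p s r X2 X1 Y2 Y1 Z2 Z1 = coeff_formula i p q r s X1 X2 Y1 Y2 Z1 Z2"
proof -
  have m: "(- A) / (- B) = A / B" for A B :: complex by simp
  have N: "q^2 * r^2 - s^2 * p^2 = - (p^2 * s^2 - r^2 * q^2)"
    and D: "q * r + s * p = p * s + r * q" and e0: "2 * s * r = 2 * r * s" "2 * q * p = 2 * p * q"
    and e1: "r^2 * Y - s^2 * X = - (s^2 * X - r^2 * Y)" "- (p^2) * Y + q^2 * X = - (- (q^2) * X + p^2 * Y)" for X Y
    by (simp_all add: algebra_simps)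
  show ?thesis
    using assms unfolding less_8_cases
    by (elim disjE) (simp_all only: coeff_formula_simps N D e0 e1 m)
qed

lemma coeff_value_meromorphic:
  assumes "\<And>n. n < 12 \<Longrightarrow> (\<lambda>q. \<Psi> n q) meromorphic_on A" "i < 8"
  shows "(\<lambda>q. coeff_value i (\<lambda>n. \<Psi> n q)) meromorphic_on A"
  using assms(2) unfolding less_8_cases coeff_value_def
  by (elim disjE; simp only: coeff_formula_simps; intro meromorphic_intros assms(1); simp)

lemma coeff_value_cong: "(\<And>n. n < 12 \<Longrightarrow> w n = w' n) \<Longrightarrow> coeff_value i w = coeff_value i w'"
  unfolding coeff_value_def by simp

text \<open>If \<open>F\<close> had weight \<open>k\<close>, the second-order expressions would keep
  terms with a factor \<open>k - 1\<close>; they vanish for \<open>k = 1\<close>. What remains is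
  pure scaling by powers of \<open>j^2\<close>.\<close>

lemma coeff_value_slash:
  assumes B: "det B = 1" and uv: "(u, v) \<in> HH" and r: "(u, act B v) \<in> regular_domain F x y" and i: "i < 8"
  shows "coeff_value i (log_derivs (slash_snd 1 B F) (slash_snd 0 B x) (slash_snd 0 B y) (u, v)) = coeff_value i (log_derivs F x y (u, act B v))"
proof -
  have J: "autfac B v \<noteq> 0" using uv autfac_nonzero[OF B] by (simp add: HH_def)
  define j where "j = inverse (autfac B v)"
  have j: "j \<noteq> 0" using J by (simp add: j_def)
  define e where "e = of_real (B$2$1) / (2 * of_real pi * \<i>)"
  have hp: "(u, act B v) \<in> hol_points F" "(u, act B v) \<in> hol_points x" "(u, act B v) \<in> hol_points y"
    using r regular_domain_subset by blast+
  note gF = G_slash[OF B uv hp(1) regular_domainD(1)[OF r], of 1, folded e_def]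
  note gx = G_slash[OF B uv hp(2) regular_domainD(2)[OF r], of 0, folded e_def]
  note gy = G_slash[OF B uv hp(3) regular_domainD(3)[OF r], of 0, folded e_def]
  have dj: "a / autfac B v = a * j" "a / (autfac B v)^n = a * j^n" for a n
    by (simp_all add: j_def divide_inverse power_inverse)
  let ?w = "log_derivs F x y (u, act B v)" and ?w' = "log_derivs (slash_snd 1 B F) (slash_snd 0 B x) (slash_snd 0 B y) (u, v)"
  have "?w' 0 = ?w 0" "?w' 2 = ?w 2" "?w' 4 = ?w 4" "?w' 6 = ?w 6" "?w' 8 = ?w 8" "?w' 10 = ?w 10"
    unfolding log_derivs_simps gF gx gy by (rule refl)+
  moreover have 1: "?w' 1 = j^2 * ?w 1" "?w' 3 = j^2 * ?w 3"
    unfolding log_derivs_simps gx gy dj by simp_all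
  moreover have "?w' 7 - 2 * ?w' 5 * ?w' 1 = (j^2)^2 * (?w 7 - 2 * ?w 5 * ?w 1)"
    "?w' 9 - 2 * ?w' 5 * ?w' 3 = (j^2)^2 * (?w 9 - 2 * ?w 5 * ?w 3)"
    "?w' 11 - (?w' 5)^2 = (j^2)^2 * (?w 11 - (?w 5)^2)"
    unfolding log_derivs_simps gF gx gy dj by (simp_all add: algebra_simps power2_eq_square power3_eq_cube power4_eq_xxxx)
  ultimately have W: "?w' 0 = ?w 0" "?w' 2 = ?w 2" "?w' 4 = ?w 4" "?w' 6 = ?w 6" "?w' 8 = ?w 8" "?w' 10 = ?w 10"
    "?w' 7 - 2 * ?w' 5 * ?w' 1 = (j^2)^2 * (?w 7 - 2 * ?w 5 * ?w 1)"
    "?w' 9 - 2 * ?w' 5 * ?w' 3 = (j^2)^2 * (?w 9 - 2 * ?w 5 * ?w 3)"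
    "?w' 11 - (?w' 5)^2 = (j^2)^2 * (?w 11 - (?w 5)^2)" "?w' 1 = j^2 * ?w 1" "?w' 3 = j^2 * ?w 3" by blast+
  have "coeff_value i ?w' = coeff_formula i (?w 0) (j^2 * ?w 1) (?w 2) (j^2 * ?w 3) (?w 6 - 2 * ?w 4 * ?w 0) ((j^2)^2 * (?w 7 - 2 * ?w 5 * ?w 1))
      (?w 8 - 2 * ?w 4 * ?w 2) ((j^2)^2 * (?w 9 - 2 * ?w 5 * ?w 3)) (?w 10 - (?w 4)^2) ((j^2)^2 * (?w 11 - (?w 5)^2))"
    unfolding coeff_value_def W(1-9) unfolding W(10,11) ..
  also have "\<dots> = coeff_value i ?w" unfolding coeff_value_def using j by (intro coeff_formula_scale i) simp
  finally show ?thesis .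
qed

section \<open>Translations at a cusp\<close>

definition shift2 :: "complex \<Rightarrow> (complex \<times> complex \<Rightarrow> complex) \<Rightarrow> complex \<times> complex \<Rightarrow> complex" where
  "shift2 h f = (\<lambda>(u, v). f (u, v + h))"

lemma Dq_shift2: "Dq1 (shift2 h f) = shift2 h (Dq1 f)" "Dq2 (shift2 h f) = shift2 h (Dq2 f)"
proof -
  have "deriv (\<lambda>s. g (s + h)) v = deriv g (v + h)" for g v
    unfolding deriv_def DERIV_shift ..
  then show "Dq1 (shift2 h f) = shift2 h (Dq1 f)" "Dq2 (shift2 h f) = shift2 h (Dq2 f)"
    by (auto simp: fun_eq_iff Dq1_def Dq2_def shift2_def)
qed

lemma G_shift2: "G1 (shift2 h f) = shift2 h (G1 f)" "G2 (shift2 h f) = shift2 h (G2 f)"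
  by (auto simp: fun_eq_iff G1_def G2_def Dq_shift2) (auto simp: shift2_def G1_def G2_def)

lemma holomorphic2_slash_snd:
  assumes B: "det B = 1"
  shows "holomorphic2_on (slash_snd k B f) {t \<in> HH. (fst t, act B (snd t)) \<in> hol_points f}" (is "holomorphic2_on _ ?U")
proof -
  have U: "open ?U" by (rule open_act_preimage[OF open_hol_points B])
  have an: "act B holomorphic_on uhp" by (rule analytic_imp_holomorphic[OF act_analytic[OF B]])
  have J: "(\<lambda>z. autfac B z powi (- k)) holomorphic_on uhp"
  proof -
    have "autfac B holomorphic_on uhp" using autfac_has_derivative by (auto simp: holomorphic_on_open[OF open_uhp])
    then show ?thesis by (intro holomorphic_intros) (use autfac_nonzero[OF B] in \<open>auto simp: uhp_def\<close>)
  qed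
  have 1: "holomorphic2_on (\<lambda>t. autfac B (snd t) powi (- k)) ?U"
    by (rule holomorphic2_on_compose1(1)[OF holomorphic2_on_snd J U open_uhp]) (auto simp: HH_eq)
  have 2: "holomorphic2_on (\<lambda>t. act B (snd t)) ?U"
    by (rule holomorphic2_on_compose1(1)[OF holomorphic2_on_snd an U open_uhp]) (auto simp: HH_eq)
  have 3: "holomorphic2_on (\<lambda>t. f (fst t, act B (snd t))) ?U"
    by (rule holomorphic2_on_compose2(1)[OF holomorphic2_on_fst 2 holomorphic2_on_hol_points U open_hol_points]) simp
  have "slash_snd k B f = (\<lambda>t. autfac B (snd t) powi (- k) * f (fst t, act B (snd t)))" by (auto simp: slash_snd_def)
  then show ?thesis using holomorphic2_on_mult(1)[OF 1 3 U] by simp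
qed

lemma act_shift: "act (mk2 1 h 0 1) v = v + of_real h" "autfac (mk2 1 h 0 1) v = 1"
  by (simp_all add: act_eq autfac_def)

text \<open>By \<open>r ** mk2 1 h 0 1 = g ** r\<close>, translating by \<open>h\<close> amounts to
  acting by \<open>g\<close>. The cocycle rule cancels the automorphy factors, and only the
  character value is left: the slashed form is periodic up to a constant.\<close>

lemma slash_snd_shift:
  assumes m: "modular_form2 \<Gamma>1 \<Gamma>2 k1 k2 ch f" and one: "mat 1 \<in> \<Gamma>1" and g: "g \<in> \<Gamma>2" "det g = 1" and r: "det r = 1"
    and rT: "r ** mk2 1 h 0 1 = g ** r" and uv: "(u, v) \<in> HH" "(u, act r v) \<in> hol_points f" "(u, act (g ** r) v) \<in> hol_points f"
  shows "slash_snd k2 r f (u, v + of_real h) = ch (mat 1) g * slash_snd k2 r f (u, v)"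
proof -
  have vu: "v \<in> uhp" using uv by (simp add: HH_eq)
  have ru: "act r v \<in> uhp" by (rule act_in_uhp[OF r vu])
  have dT: "det (mk2 1 h 0 1) = 1" by (simp add: det_2)
  have a1: "act r (v + of_real h) = act g (act r v)"
    using act_mult[OF dT vu, of r] act_mult[OF r vu, of g] by (simp add: act_shift rT)
  have a2: "autfac r (v + of_real h) = autfac g (act r v) * autfac r v"
    using autfac_mult[OF dT vu, of r] autfac_mult[OF r vu, of g] by (simp add: act_shift rT)
  have nz: "autfac g (act r v) \<noteq> 0" using autfac_nonzero[OF g(2)] ru by (simp add: uhp_def)
  have mm: "f (act A t1, act B t2) = ch A B * autfac A t1 powi k1 * autfac B t2 powi k2 * f (t1, t2)"
    if "A \<in> \<Gamma>1" "B \<in> \<Gamma>2" "(t1, t2) \<in> hol_points f" "(act A t1, act B t2) \<in> hol_points f" for A B t1 t2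
    using m that unfolding modular_form2_def by blast
  have "f (act (mat 1) u, act g (act r v)) = ch (mat 1) g * autfac (mat 1) u powi k1 * autfac g (act r v) powi k2 * f (u, act r v)"
    by (rule mm[OF one g(1) uv(2)]) (use uv(3) act_mult[OF r vu, of g] in simp)
  then have "f (u, act g (act r v)) = ch (mat 1) g * autfac g (act r v) powi k2 * f (u, act r v)" by simp
  moreover have "autfac g (act r v) powi (- k2) * autfac g (act r v) powi k2 = 1"
    using nz by (simp add: power_int_minus)
  ultimately show ?thesis
    unfolding slash_snd_def prod.case a1 a2 power_int_mult_distrib by (simp add: mult_ac)
qed

lemma G_slash_periodic:
  assumes m: "modular_form2 \<Gamma>1 \<Gamma>2 k1 k2 ch f" and one: "mat 1 \<in> \<Gamma>1" and g: "g \<in> \<Gamma>2" "det g = 1" and r: "det r = 1"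
    and rT: "r ** mk2 1 h 0 1 = g ** r" and uv: "(u, v) \<in> HH" "(u, act r v) \<in> hol_points f" "(u, act (g ** r) v) \<in> hol_points f"
  shows "G1 (slash_snd k2 r f) (u, v + of_real h) = G1 (slash_snd k2 r f) (u, v)"
    "G2 (slash_snd k2 r f) (u, v + of_real h) = G2 (slash_snd k2 r f) (u, v)"
    "Dq1 (G1 (slash_snd k2 r f)) (u, v + of_real h) = Dq1 (G1 (slash_snd k2 r f)) (u, v)"
    "Dq2 (G2 (slash_snd k2 r f)) (u, v + of_real h) = Dq2 (G2 (slash_snd k2 r f)) (u, v)"
proof -
  define U where "U = {t \<in> HH. (fst t, act r (snd t)) \<in> hol_points f} \<inter> {t \<in> HH. (fst t, act (g ** r) (snd t)) \<in> hol_points f}"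
  have U: "open U" unfolding U_def
    by (intro open_Int open_act_preimage open_hol_points) (simp_all add: r g(2) det_mul)
  have uvU: "(u, v) \<in> U" using uv by (simp add: U_def)
  have hol: "holomorphic2_on (slash_snd k2 r f) U" by (rule holomorphic2_on_subset[OF holomorphic2_slash_snd[OF r]]) (auto simp: U_def)
  have ch: "ch (mat 1) g \<noteq> 0" using m one g(1) unfolding modular_form2_def character_on_def by blast
  have eq: "shift2 (of_real h) (slash_snd k2 r f) z = ch (mat 1) g * slash_snd k2 r f z" if z: "z \<in> U" for z
  proof -
    obtain p q where z': "z = (p, q)" by force
    have *: "(p, q) \<in> HH" "(p, act r q) \<in> hol_points f" "(p, act (g ** r) q) \<in> hol_points f"
      using z by (simp_all add: U_def z')
    show ?thesis unfolding z' shift2_def prod.case by (rule slash_snd_shift[OF m one g r rT *])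
  qed
  note c = G_const_mult[OF U uvU hol ch eq, unfolded G_shift2 Dq_shift2]
  show "G1 (slash_snd k2 r f) (u, v + of_real h) = G1 (slash_snd k2 r f) (u, v)"
    "G2 (slash_snd k2 r f) (u, v + of_real h) = G2 (slash_snd k2 r f) (u, v)"
    "Dq1 (G1 (slash_snd k2 r f)) (u, v + of_real h) = Dq1 (G1 (slash_snd k2 r f)) (u, v)"
    "Dq2 (G2 (slash_snd k2 r f)) (u, v + of_real h) = Dq2 (G2 (slash_snd k2 r f)) (u, v)"
    using c by (simp_all add: shift2_def)
qed

section \<open>Slices with good behaviour at interior points and at the cusps\<close>

definition good_slice :: "(real^2^2) set \<Rightarrow> int \<Rightarrow> int \<Rightarrow> (complex \<times> complex \<Rightarrow> complex) \<Rightarrow> complex \<Rightarrow> bool" where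
  "good_slice R k1 k2 f s \<longleftrightarrow> s \<in> uhp \<and> (\<forall>p\<in>uhp. local_quotient (\<lambda>v. v) s p f) \<and>
     (\<forall>B\<in>R. \<exists>h>0. \<exists>r. local_quotient (qpar h) s 0 (\<lambda>(t1, t2). qexp (- r * t2) * slash k1 k2 (mat 1) B f (t1, t2))) \<and>
     \<not> (\<forall>\<^sub>\<approx>v\<in>uhp. f (s, v) = 0)"

lemma good_slice_nonzero:
  assumes "good_slice R k1 k2 f s"
  shows "\<forall>\<^sub>\<approx>v\<in>uhp. f (s, v) \<noteq> 0" "(\<lambda>v. f (s, v)) meromorphic_on uhp" "\<forall>\<^sub>\<approx>v\<in>uhp. (s, v) \<in> hol_points f"
proof -
  have s: "s \<in> uhp" and local_quotient: "\<And>p. p \<in> uhp \<Longrightarrow> local_quotient (\<lambda>v. v) s p f" and nz: "\<not> (\<forall>\<^sub>\<approx>v\<in>uhp. f (s, v) = 0)"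
    using assms by (auto simp: good_slice_def)
  show m: "(\<lambda>v. f (s, v)) meromorphic_on uhp" by (rule local_quotient_slice_meromorphic[OF local_quotient s])
  show "\<forall>\<^sub>\<approx>v\<in>uhp. f (s, v) \<noteq> 0"
    using meromorphic_imp_constant_or_avoid[OF m open_uhp connected_uhp, of 0] nz by blast
  show "\<forall>\<^sub>\<approx>v\<in>uhp. (s, v) \<in> hol_points f"
    unfolding eventually_cosparse_open_eq[OF open_uhp] using local_quotient_hol_points[OF local_quotient s] by blast
qed

lemma good_slice_G_meromorphic:
  assumes gs: "good_slice R k1 k2 f s"
  shows "(\<lambda>v. G1 f (s, v)) meromorphic_on uhp" "(\<lambda>v. G2 f (s, v)) meromorphic_on uhp"
    "(\<lambda>v. Dq1 (G1 f) (s, v)) meromorphic_on uhp" "(\<lambda>v. Dq2 (G2 f) (s, v)) meromorphic_on uhp"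
proof -
  have s: "s \<in> uhp" and local_quotient: "\<And>p. p \<in> uhp \<Longrightarrow> local_quotient (\<lambda>v. v) s p f" using gs by (auto simp: good_slice_def)
  have d: "((\<lambda>v. v) has_field_derivative (\<lambda>_. 1) v) (at v)" for v :: complex by simp
  have m: "(\<lambda>_. 1 :: complex) holomorphic_on UNIV" by simp
  have nz: "\<exists>v\<in>uhp. v \<in> ball p e \<and> v \<noteq> p \<and> f (s, v) \<noteq> 0" if p: "p \<in> uhp" and e: "e > 0" for p e
  proof -
    have "eventually (\<lambda>v. f (s, v) \<noteq> 0) (at p)"
      using good_slice_nonzero(1)[OF gs] p eventually_cosparse_imp_eventually_at by blast
    moreover have "eventually (\<lambda>v. v \<in> uhp \<inter> ball p e - {p}) (at p)"
      using p e open_uhp by (intro eventually_at_in_open open_Int) auto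
    ultimately have "eventually (\<lambda>v. v \<in> uhp \<inter> ball p e - {p} \<and> f (s, v) \<noteq> 0) (at p)"
      by eventually_elim blast
    then obtain v where "v \<in> uhp \<inter> ball p e - {p} \<and> f (s, v) \<noteq> 0"
      using eventually_happens trivial_limit_at by blast
    then show ?thesis by blast
  qed
  have G: "local_quotient (\<lambda>v. v) s p (G1 f)" "local_quotient (\<lambda>v. v) s p (G2 f)" if p: "p \<in> uhp" for p
    by (rule local_quotient_log_derivatives[OF local_quotient[OF p] d m, of f 0]; (use nz[OF p] s in \<open>simp add: qexp_def\<close>))+
  show "(\<lambda>v. G1 f (s, v)) meromorphic_on uhp" by (rule local_quotient_slice_meromorphic[OF G(1) s])
  show "(\<lambda>v. G2 f (s, v)) meromorphic_on uhp" by (rule local_quotient_slice_meromorphic[OF G(2) s])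
  show "(\<lambda>v. Dq1 (G1 f) (s, v)) meromorphic_on uhp"
    by (rule local_quotient_slice_meromorphic[OF local_quotient_derivative(1)[OF G(1) d m] s])
  show "(\<lambda>v. Dq2 (G2 f) (s, v)) meromorphic_on uhp"
    by (rule local_quotient_slice_meromorphic[OF local_quotient_derivative(2)[OF G(2) d m] s])
qed

text \<open>Two widths meet here: \<open>h\<close> comes with the meromorphy at the cusp and yields
  the growth bound, while \<open>h0\<close> is the common period in which the expansion is wanted.
  The strip of half-width \<open>h0 + 1\<close> is what \<open>q_expansion\<close> asks for.\<close>

lemma slice_q_expansion:
  assumes m: "(\<lambda>v. H (s, v)) meromorphic_on uhp" and h0: "h0 > 0"
    and per: "\<forall>\<^sub>\<approx>v\<in>uhp. H (s, v + of_real h0) = H (s, v)"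
    and local_quotient: "local_quotient (qpar h) s 0 u" "h > 0" "s \<in> uhp" and H: "\<And>v. v \<in> uhp \<Longrightarrow> H (s, v) = qexp (r * v) * u (s, v)"
  shows "\<exists>\<Psi>. \<Psi> nicely_meromorphic_on ball 0 1 \<and> (\<forall>\<^sub>\<approx>v\<in>uhp. H (s, v) = \<Psi> (qpar h0 v))"
proof -
  have L: "h0 + 1 > 0" using h0 by simp
  obtain C c0 where C: "c0 \<ge> 0" "\<forall>v. Im v > c0 \<longrightarrow> \<bar>Re v\<bar> < h0 + 1 \<longrightarrow> cmod (H (s, v)) \<le> C * exp (C * Im v)"
    by (rule local_quotient_slice_growth[OF local_quotient(1,3,2) L H])
  obtain \<Psi> where "\<Psi> nicely_meromorphic_on ball 0 1" "\<forall>\<^sub>\<approx>t\<in>uhp. H (s, t) = \<Psi> (qpar h0 t)"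
    by (rule q_expansion[OF m h0 per, of "h0 + 1" c0 C]) (use C in auto)
  then show ?thesis by blast
qed

section \<open>Exchanging the two variables\<close>

lemma coset_dataD:
  assumes "coset_data (\<Gamma>2 \<inter> SL2Z) R h"
  shows "h > 0" "finite R" "R \<subseteq> SL2Z" "\<And>r. r \<in> R \<Longrightarrow> det r = 1"
    "\<And>r. r \<in> R \<Longrightarrow> \<exists>g\<in>\<Gamma>2. det g = 1 \<and> r ** mk2 1 h 0 1 = g ** r"
proof -
  show 1: "h > 0" "finite R" "R \<subseteq> SL2Z" using assms by (auto simp: coset_data_def)
  show "det r = 1" if "r \<in> R" for r using 1(3) that SL2Z_det by blast
  show "\<exists>g\<in>\<Gamma>2. det g = 1 \<and> r ** mk2 1 h 0 1 = g ** r" if r: "r \<in> R" for r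
  proof -
    obtain g where "g \<in> \<Gamma>2 \<inter> SL2Z" "r ** mk2 1 h 0 1 = g ** r" using assms r unfolding coset_data_def by blast
    then show ?thesis using SL2Z_det by blast
  qed
qed

lemma qpar_derivative: "h > 0 \<Longrightarrow> (qpar h has_field_derivative (2 * of_real pi * \<i> / of_real h) * qpar h v) (at v)"
  unfolding qpar_def[abs_def] qexp_def by (auto intro!: derivative_eq_intros)

lemma slash_snd_eq_slash: "slash_snd k2 r f (u, v) = qexp (\<rho> * v) * (\<lambda>(t1, t2). qexp (- \<rho> * t2) * slash k1 k2 (mat 1) r f (t1, t2)) (u, v)"
  by (simp add: slash_second slash_snd_def qexp_def mult.assoc[symmetric] exp_add[symmetric])

text \<open>Ensures that the numerator at the cusp is not identically zero on the slice: points high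
  in the half-plane have small parameter, and \<open>f\<close> vanishes there only on a sparse
  set.\<close>

lemma good_slice_cusp_nonzero:
  assumes gs: "good_slice R k1 k2 f s" and r: "det r = 1" and h: "h > 0" and d: "d > 0"
  shows "\<exists>v\<in>uhp. qpar h v \<in> ball 0 d \<and> qpar h v \<noteq> 0 \<and>
      (\<lambda>(t1, t2). qexp (- \<rho> * t2) * slash k1 k2 (mat 1) r f (t1, t2)) (s, v) \<noteq> 0"
proof -
  have ev: "\<forall>\<^sub>\<approx>v\<in>uhp. f (s, act r v) \<noteq> 0" by (rule cosparse_act[OF r good_slice_nonzero(1)[OF gs]])
  define Y where "Y = max 0 (- h * ln d / (2 * pi))"
  define p where "p = \<i> * of_real (Y + 1)"
  have p: "p \<in> uhp" "Im p > Y" by (simp_all add: p_def uhp_def Y_def)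
  have "eventually (\<lambda>v. f (s, act r v) \<noteq> 0) (at p)" using ev p(1) eventually_cosparse_imp_eventually_at by blast
  moreover have "eventually (\<lambda>v. v \<in> {v. Im v > Y}) (at p)"
    using p by (intro eventually_at_in_open' open_halfspace_Im_gt) simp
  ultimately have "eventually (\<lambda>v. Im v > Y \<and> f (s, act r v) \<noteq> 0) (at p)" by eventually_elim simp
  then obtain v where v: "Im v > Y" "f (s, act r v) \<noteq> 0" using eventually_happens trivial_limit_at by blast
  have vu: "v \<in> uhp" using v(1) by (simp add: uhp_def Y_def)
  have "- h * ln d / (2 * pi) < Im v" using v(1) by (simp add: Y_def)
  then have "- 2 * pi * Im v / h < ln d" using h by (simp add: field_simps)
  then have "exp (- 2 * pi * Im v / h) < d" using d by (metis exp_less_cancel_iff exp_ln)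
  then have "cmod (qpar h v) < d" by (simp only: norm_qpar[OF h])
  moreover have "autfac r v \<noteq> 0" using autfac_nonzero[OF r] vu by (simp add: uhp_def)
  then have "(\<lambda>(t1, t2). qexp (- \<rho> * t2) * slash k1 k2 (mat 1) r f (t1, t2)) (s, v) \<noteq> 0"
    using v(2) by (simp add: slash_second qexp_def)
  ultimately show ?thesis using vu qpar_nonzero[of h v] by (intro bexI[of _ v]) auto
qed

text \<open>Interior meromorphy comes from \<open>G_slash\<close>, periodicity from
  \<open>G_slash_periodic\<close>, growth from the local quotient at the cusp. The slashed form is
  periodic only up to a character value, but its logarithmic derivatives are periodic.\<close>

lemma good_slice_G_expansions:
  assumes m: "modular_form2 \<Gamma>1 \<Gamma>2 k1 k2 ch f" and one: "mat 1 \<in> \<Gamma>1" and cd: "coset_data (\<Gamma>2 \<inter> SL2Z) R h0"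
    and gs: "good_slice R k1 k2 f s" and r: "r \<in> R"
    and H: "H \<in> {G1 (slash_snd k2 r f), G2 (slash_snd k2 r f), Dq1 (G1 (slash_snd k2 r f)), Dq2 (G2 (slash_snd k2 r f))}"
  shows "\<exists>\<Psi>. \<Psi> nicely_meromorphic_on ball 0 1 \<and> (\<forall>\<^sub>\<approx>v\<in>uhp. H (s, v) = \<Psi> (qpar h0 v))"
proof -
  note cdD = coset_dataD[OF cd]
  have rd: "det r = 1" by (rule cdD(4)[OF r])
  obtain g where g: "g \<in> \<Gamma>2" "det g = 1" "r ** mk2 1 h0 0 1 = g ** r" using cdD(5)[OF r] by blast
  have s: "s \<in> uhp" using gs by (simp add: good_slice_def)
  have "\<exists>h>0. \<exists>\<rho>. local_quotient (qpar h) s 0 (\<lambda>(t1, t2). qexp (- \<rho> * t2) * slash k1 k2 (mat 1) r f (t1, t2))"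
    using gs r unfolding good_slice_def by blast
  then obtain h \<rho> where h: "h > 0" and LQ0: "local_quotient (qpar h) s 0 (\<lambda>(t1, t2). qexp (- \<rho> * t2) * slash k1 k2 (mat 1) r f (t1, t2))"
    by (elim exE conjE) (rule that)
  have qd: "(qpar h has_field_derivative (\<lambda>z. (2 * of_real pi * \<i> / of_real h) * z) (qpar h v)) (at v)" for v
    by (rule qpar_derivative[OF h])
  have mh: "(\<lambda>z. (2 * of_real pi * \<i> / of_real h) * z) holomorphic_on UNIV" by (intro holomorphic_intros)
  have LQG: "local_quotient (qpar h) s 0 (G1 (slash_snd k2 r f))" "local_quotient (qpar h) s 0 (G2 (slash_snd k2 r f))"
    by (rule local_quotient_log_derivatives[OF LQ0 qd mh slash_snd_eq_slash good_slice_cusp_nonzero[OF gs rd h] s]; assumption)+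
  have local_quotient: "local_quotient (qpar h) s 0 H"
    using H LQG local_quotient_derivative(1)[OF LQG(1) qd mh] local_quotient_derivative(2)[OF LQG(2) qd mh] by auto
  have e1: "\<forall>\<^sub>\<approx>v\<in>uhp. (s, act r v) \<in> hol_points f" by (rule cosparse_act[OF rd good_slice_nonzero(3)[OF gs]])
  have e2: "\<forall>\<^sub>\<approx>v\<in>uhp. (s, act (g ** r) v) \<in> hol_points f"
    by (rule cosparse_act[OF _ good_slice_nonzero(3)[OF gs]]) (simp add: det_mul rd g(2))
  have e3: "\<forall>\<^sub>\<approx>v\<in>uhp. f (s, act r v) \<noteq> 0" by (rule cosparse_act[OF rd good_slice_nonzero(1)[OF gs]])
  have per: "\<forall>\<^sub>\<approx>v\<in>uhp. H (s, v + of_real h0) = H (s, v)"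
    using e1 e2 cosparse_uhp_in
  proof eventually_elim
    case (elim v)
    have "(s, v) \<in> HH" using elim s by (simp add: HH_eq)
    from G_slash_periodic[OF m one g(1,2) rd g(3) this elim(1,2)] H show ?case by auto
  qed
  have J: "autfac r meromorphic_on uhp"
    using autfac_has_derivative
    by (intro analytic_on_imp_meromorphic_on) (auto simp: analytic_on_open[OF open_uhp] holomorphic_on_open[OF open_uhp])
  have comp: "(\<lambda>v. K (s, act r v)) meromorphic_on uhp" if "(\<lambda>v. K (s, v)) meromorphic_on uhp" for K :: "complex \<times> complex \<Rightarrow> complex"
    by (rule meromorphic_on_compose[OF that act_analytic[OF rd]]) (use act_in_uhp[OF rd] in auto)
  note GM = good_slice_G_meromorphic[OF gs]
  let ?e = "of_real (r$2$1) / (2 * of_real pi * \<i>) :: complex"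
  have ev: "\<forall>\<^sub>\<approx>v\<in>uhp. G1 (slash_snd k2 r f) (s, v) = G1 f (s, act r v) \<and> Dq1 (G1 (slash_snd k2 r f)) (s, v) = Dq1 (G1 f) (s, act r v) \<and>
     G2 (slash_snd k2 r f) (s, v) = G2 f (s, act r v) / (autfac r v)\<^sup>2 - of_int k2 * ?e / autfac r v \<and>
     Dq2 (G2 (slash_snd k2 r f)) (s, v) = Dq2 (G2 f) (s, act r v) / (autfac r v)^4 - 2 * ?e * G2 f (s, act r v) / (autfac r v)^3
       + of_int k2 * ?e\<^sup>2 / (autfac r v)\<^sup>2"
    using e1 e3 cosparse_uhp_in
  proof eventually_elim
    case (elim v)
    have "(s, v) \<in> HH" using elim s by (simp add: HH_eq)
    from G_slash[OF rd this elim(1,2), of k2] show ?case by blast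
  qed
  have "(\<lambda>v. G1 (slash_snd k2 r f) (s, v)) meromorphic_on uhp \<longleftrightarrow> (\<lambda>v. G1 f (s, act r v)) meromorphic_on uhp"
    by (rule meromorphic_on_cong'[OF eventually_mono[OF ev] refl]) blast
  moreover have "(\<lambda>v. Dq1 (G1 (slash_snd k2 r f)) (s, v)) meromorphic_on uhp \<longleftrightarrow> (\<lambda>v. Dq1 (G1 f) (s, act r v)) meromorphic_on uhp"
    by (rule meromorphic_on_cong'[OF eventually_mono[OF ev] refl]) blast
  moreover have "(\<lambda>v. G2 (slash_snd k2 r f) (s, v)) meromorphic_on uhp \<longleftrightarrow>
      (\<lambda>v. G2 f (s, act r v) / (autfac r v)\<^sup>2 - of_int k2 * ?e / autfac r v) meromorphic_on uhp"
    by (rule meromorphic_on_cong'[OF eventually_mono[OF ev] refl]) blast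
  moreover have "(\<lambda>v. Dq2 (G2 (slash_snd k2 r f)) (s, v)) meromorphic_on uhp \<longleftrightarrow>
      (\<lambda>v. Dq2 (G2 f) (s, act r v) / (autfac r v)^4 - 2 * ?e * G2 f (s, act r v) / (autfac r v)^3
       + of_int k2 * ?e\<^sup>2 / (autfac r v)\<^sup>2) meromorphic_on uhp"
    by (rule meromorphic_on_cong'[OF eventually_mono[OF ev] refl]) blast
  moreover have "(\<lambda>v. G2 f (s, act r v) / (autfac r v)\<^sup>2 - of_int k2 * ?e / autfac r v) meromorphic_on uhp"
    by (intro meromorphic_intros J comp GM)
  moreover have "(\<lambda>v. Dq2 (G2 f) (s, act r v) / (autfac r v)^4 - 2 * ?e * G2 f (s, act r v) / (autfac r v)^3
       + of_int k2 * ?e\<^sup>2 / (autfac r v)\<^sup>2) meromorphic_on uhp"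
    by (intro meromorphic_intros J comp GM)
  ultimately have mero: "(\<lambda>v. H (s, v)) meromorphic_on uhp"
    using H comp[OF GM(1)] comp[OF GM(3)] by auto
  show ?thesis
    by (rule slice_q_expansion[where u = H and r = 0, OF mero cdD(1) per local_quotient h s]) (simp add: qexp_def)
qed

lemma good_slice_function_expansion:
  assumes m: "modular_function2 \<Gamma>1 \<Gamma>2 f" and one: "mat 1 \<in> \<Gamma>1" and cd: "coset_data (\<Gamma>2 \<inter> SL2Z) R h0"
    and gs: "good_slice R 0 0 f s" and r: "r \<in> R"
  shows "\<exists>\<Psi>. \<Psi> nicely_meromorphic_on ball 0 1 \<and> (\<forall>\<^sub>\<approx>v\<in>uhp. f (s, act r v) = \<Psi> (qpar h0 v))"
proof -
  note cdD = coset_dataD[OF cd]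
  have mf: "modular_form2 \<Gamma>1 \<Gamma>2 0 0 (\<lambda>_ _. 1) f" using m by (simp add: modular_function2_def)
  have rd: "det r = 1" by (rule cdD(4)[OF r])
  obtain g where g: "g \<in> \<Gamma>2" "det g = 1" "r ** mk2 1 h0 0 1 = g ** r" using cdD(5)[OF r] by blast
  have s: "s \<in> uhp" using gs by (simp add: good_slice_def)
  have "\<exists>h>0. \<exists>\<rho>. local_quotient (qpar h) s 0 (\<lambda>(t1, t2). qexp (- \<rho> * t2) * slash 0 0 (mat 1) r f (t1, t2))"
    using gs r unfolding good_slice_def by blast
  then obtain h \<rho> where h: "h > 0" and LQ0: "local_quotient (qpar h) s 0 (\<lambda>(t1, t2). qexp (- \<rho> * t2) * slash 0 0 (mat 1) r f (t1, t2))"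
    by (elim exE conjE) (rule that)
  have slash_snd: "slash_snd 0 r f (u, v) = f (u, act r v)" for u v by (simp add: slash_snd_def)
  have mero: "(\<lambda>v. slash_snd 0 r f (s, v)) meromorphic_on uhp" unfolding slash_snd
    by (rule meromorphic_on_compose[OF good_slice_nonzero(2)[OF gs] act_analytic[OF rd]]) (use act_in_uhp[OF rd] in auto)
  have e1: "\<forall>\<^sub>\<approx>v\<in>uhp. (s, act r v) \<in> hol_points f" by (rule cosparse_act[OF rd good_slice_nonzero(3)[OF gs]])
  have e2: "\<forall>\<^sub>\<approx>v\<in>uhp. (s, act (g ** r) v) \<in> hol_points f"
    by (rule cosparse_act[OF _ good_slice_nonzero(3)[OF gs]]) (simp add: det_mul rd g(2))
  have per: "\<forall>\<^sub>\<approx>v\<in>uhp. slash_snd 0 r f (s, v + of_real h0) = slash_snd 0 r f (s, v)"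
    using e1 e2 cosparse_uhp_in
  proof eventually_elim
    case (elim v)
    have "(s, v) \<in> HH" using elim s by (simp add: HH_eq)
    from slash_snd_shift[OF mf one g(1,2) rd g(3) this elim(1,2)] show ?case by simp
  qed
  show ?thesis
    using slice_q_expansion[OF mero cdD(1) per LQ0 h s slash_snd_eq_slash] unfolding slash_snd .
qed

lemma merom_near_swap:
  assumes "merom_near f \<phi> p"
  shows "merom_near (f \<circ> prod.swap) (prod.swap \<circ> \<phi> \<circ> prod.swap) (prod.swap p)"
proof -
  obtain V g h where V: "open V" "connected V" "p \<in> V" and g: "holomorphic2_on g V" and h: "holomorphic2_on h V"
    and h0: "\<exists>z\<in>V. h z \<noteq> 0" and eq: "\<forall>t\<in>HH. \<phi> t \<in> V \<and> h (\<phi> t) \<noteq> 0 \<longrightarrow> f t = g (\<phi> t) / h (\<phi> t)"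
    using assms unfolding merom_near_def by (elim exE conjE) (rule that)
  show ?thesis
    unfolding merom_near_def
  proof (intro exI conjI)
    show "open (prod.swap ` V)" by (rule open_swap[OF V(1)])
    show "connected (prod.swap ` V)" by (rule connected_continuous_image[OF continuous_on_swap V(2)])
    show "prod.swap p \<in> prod.swap ` V" using V(3) by blast
    show "holomorphic2_on (g \<circ> prod.swap) (prod.swap ` V)" by (rule holomorphic2_on_swap[OF g V(1)])
    show "holomorphic2_on (h \<circ> prod.swap) (prod.swap ` V)" by (rule holomorphic2_on_swap[OF h V(1)])
    show "\<exists>z\<in>prod.swap ` V. (h \<circ> prod.swap) z \<noteq> 0" using h0 by auto
    show "\<forall>t\<in>HH. (prod.swap \<circ> \<phi> \<circ> prod.swap) t \<in> prod.swap ` V \<and> (h \<circ> prod.swap) ((prod.swap \<circ> \<phi> \<circ> prod.swap) t) \<noteq> 0 \<longrightarrow>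
       (f \<circ> prod.swap) t = (g \<circ> prod.swap) ((prod.swap \<circ> \<phi> \<circ> prod.swap) t) / (h \<circ> prod.swap) ((prod.swap \<circ> \<phi> \<circ> prod.swap) t)"
    proof (intro ballI impI)
      fix t assume t: "t \<in> HH" and *: "(prod.swap \<circ> \<phi> \<circ> prod.swap) t \<in> prod.swap ` V \<and> (h \<circ> prod.swap) ((prod.swap \<circ> \<phi> \<circ> prod.swap) t) \<noteq> 0"
      have "prod.swap t \<in> HH" using t by (auto simp: HH_def)
      moreover have "\<phi> (prod.swap t) \<in> V"
      proof -
        obtain w where "w \<in> V" "prod.swap (\<phi> (prod.swap t)) = prod.swap w" using * by auto
        then show ?thesis using arg_cong[of _ _ prod.swap] by (metis swap_swap)
      qed
      moreover have "h (\<phi> (prod.swap t)) \<noteq> 0" using * by simp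
      ultimately show "(f \<circ> prod.swap) t = (g \<circ> prod.swap) ((prod.swap \<circ> \<phi> \<circ> prod.swap) t) / (h \<circ> prod.swap) ((prod.swap \<circ> \<phi> \<circ> prod.swap) t)"
        using eq by simp
    qed
  qed
qed

lemma merom_near_swap':
  assumes "merom_near f \<phi> p" "f \<circ> prod.swap = f'" "prod.swap \<circ> \<phi> \<circ> prod.swap = \<phi>'" "prod.swap p = p'"
  shows "merom_near f' \<phi>' p'"
  using merom_near_swap[OF assms(1)] unfolding assms(2-4) .

lemma slash_swap: "slash k1 k2 A B (f \<circ> prod.swap) (u, v) = slash k2 k1 B A f (v, u)"
  by (simp add: slash_def)

lemma meromorphic_HH_star_swap:
  assumes m: "meromorphic_HH_star k1 k2 f"
  shows "meromorphic_HH_star k2 k1 (f \<circ> prod.swap)"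
  unfolding meromorphic_HH_star_def
proof (intro conjI ballI allI impI)
  fix p :: "complex \<times> complex" assume p: "p \<in> HH"
  then have "prod.swap p \<in> HH" by (auto simp: HH_def)
  then have "merom_near f (\<lambda>t. t) (prod.swap p)" using m unfolding meromorphic_HH_star_def by blast
  then show "merom_near (f \<circ> prod.swap) (\<lambda>t. t) p"
    by (rule merom_near_swap') (auto simp: fun_eq_iff)
next
  fix s :: complex and B assume s: "Im s > 0" "B \<in> SL2Z"
  then have "\<exists>(h::real) r. h > 0 \<and> merom_near (\<lambda>(t1, t2). qexp (- r * t1) * slash k1 k2 B (mat 1) f (t1, t2))
          (\<lambda>(t1, t2). (qexp (t1 / of_real h), t2)) (0, s)"
    using m unfolding meromorphic_HH_star_def by blast
  then obtain h :: real and r where h: "h > 0" and mn: "merom_near (\<lambda>(t1, t2). qexp (- r * t1) * slash k1 k2 B (mat 1) f (t1, t2))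
          (\<lambda>(t1, t2). (qexp (t1 / of_real h), t2)) (0, s)" by (elim exE conjE) (rule that)
  have "merom_near (\<lambda>(t1, t2). qexp (- r * t2) * slash k2 k1 (mat 1) B (f \<circ> prod.swap) (t1, t2))
          (\<lambda>(t1, t2). (t1, qexp (t2 / of_real h))) (s, 0)"
    by (rule merom_near_swap'[OF mn]) (auto simp: fun_eq_iff slash_swap)
  with h show "\<exists>(h::real) r. h > 0 \<and> merom_near (\<lambda>(t1, t2). qexp (- r * t2) * slash k2 k1 (mat 1) B (f \<circ> prod.swap) (t1, t2))
          (\<lambda>(t1, t2). (t1, qexp (t2 / of_real h))) (s, 0)" by (intro exI[of _ h] exI[of _ r] conjI)
next
  fix s :: complex and A assume s: "Im s > 0" "A \<in> SL2Z"
  then have "\<exists>(h::real) r. h > 0 \<and> merom_near (\<lambda>(t1, t2). qexp (- r * t2) * slash k1 k2 (mat 1) A f (t1, t2))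
          (\<lambda>(t1, t2). (t1, qexp (t2 / of_real h))) (s, 0)"
    using m unfolding meromorphic_HH_star_def by blast
  then obtain h :: real and r where h: "h > 0" and mn: "merom_near (\<lambda>(t1, t2). qexp (- r * t2) * slash k1 k2 (mat 1) A f (t1, t2))
          (\<lambda>(t1, t2). (t1, qexp (t2 / of_real h))) (s, 0)" by (elim exE conjE) (rule that)
  have "merom_near (\<lambda>(t1, t2). qexp (- r * t1) * slash k2 k1 A (mat 1) (f \<circ> prod.swap) (t1, t2))
          (\<lambda>(t1, t2). (qexp (t1 / of_real h), t2)) (0, s)"
    by (rule merom_near_swap'[OF mn]) (auto simp: fun_eq_iff slash_swap)
  with h show "\<exists>(h::real) r. h > 0 \<and> merom_near (\<lambda>(t1, t2). qexp (- r * t1) * slash k2 k1 A (mat 1) (f \<circ> prod.swap) (t1, t2))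
          (\<lambda>(t1, t2). (qexp (t1 / of_real h), t2)) (0, s)" by (intro exI[of _ h] exI[of _ r] conjI)
next
  fix A B :: "real^2^2" assume AB: "A \<in> SL2Z" "B \<in> SL2Z"
  then have "\<exists>(h1::real) (h2::real) r1 r2. h1 > 0 \<and> h2 > 0 \<and>
        merom_near (\<lambda>(t1, t2). qexp (- r1 * t1 - r2 * t2) * slash k1 k2 B A f (t1, t2))
          (\<lambda>(t1, t2). (qexp (t1 / of_real h1), qexp (t2 / of_real h2))) (0, 0)"
    using m unfolding meromorphic_HH_star_def by blast
  then obtain h1 h2 :: real and r1 r2 where h: "h1 > 0" "h2 > 0" and
    mn: "merom_near (\<lambda>(t1, t2). qexp (- r1 * t1 - r2 * t2) * slash k1 k2 B A f (t1, t2))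
          (\<lambda>(t1, t2). (qexp (t1 / of_real h1), qexp (t2 / of_real h2))) (0, 0)" by (elim exE conjE) (rule that)
  have "merom_near (\<lambda>(t1, t2). qexp (- r2 * t1 - r1 * t2) * slash k2 k1 A B (f \<circ> prod.swap) (t1, t2))
          (\<lambda>(t1, t2). (qexp (t1 / of_real h2), qexp (t2 / of_real h1))) (0, 0)"
  proof (rule merom_near_swap'[OF mn])
    have "qexp (- (r1 * b) - r2 * a) = qexp (- (r2 * a) - r1 * b)" for a b
      by (rule arg_cong[where f = qexp]) algebra
    then show "(\<lambda>(t1, t2). qexp (- r1 * t1 - r2 * t2) * slash k1 k2 B A f (t1, t2)) \<circ> prod.swap =
        (\<lambda>(t1, t2). qexp (- r2 * t1 - r1 * t2) * slash k2 k1 A B (f \<circ> prod.swap) (t1, t2))"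
      by (simp add: fun_eq_iff slash_swap)
  qed (auto simp: fun_eq_iff)
  with h show "\<exists>(h1::real) (h2::real) r1 r2. h1 > 0 \<and> h2 > 0 \<and>
        merom_near (\<lambda>(t1, t2). qexp (- r1 * t1 - r2 * t2) * slash k2 k1 A B (f \<circ> prod.swap) (t1, t2))
          (\<lambda>(t1, t2). (qexp (t1 / of_real h1), qexp (t2 / of_real h2))) (0, 0)"
    by (intro exI[of _ h2] exI[of _ h1] exI[of _ r2] exI[of _ r1] conjI)
qed

lemma hol_points_swap: "(a, b) \<in> hol_points (f \<circ> prod.swap) \<longleftrightarrow> (b, a) \<in> hol_points f"
proof -
  have *: "(b, a) \<in> hol_points (g \<circ> prod.swap)" if ab: "(a, b) \<in> hol_points g" for a b g
  proof -
    obtain U where U: "open U" "(a, b) \<in> U" "U \<subseteq> HH" "holomorphic2_on g U" using ab by (auto simp: hol_points_def)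
    have "open (prod.swap ` U)" "(b, a) \<in> prod.swap ` U" "prod.swap ` U \<subseteq> HH" "holomorphic2_on (g \<circ> prod.swap) (prod.swap ` U)"
      using open_swap[OF U(1)] imageI[OF U(2), of prod.swap] U(3) holomorphic2_on_swap[OF U(4,1)]
      by (auto simp: HH_def subset_iff)
    then show ?thesis unfolding hol_points_def by (intro CollectI exI[of _ "prod.swap ` U"] conjI)
  qed
  have "(f \<circ> prod.swap) \<circ> prod.swap = f" by (simp add: fun_eq_iff)
  then show ?thesis using *[of a b "f \<circ> prod.swap"] *[of b a f] by auto
qed

lemma modular_form2_swap:
  assumes m: "modular_form2 \<Gamma>1 \<Gamma>2 k1 k2 ch f"
  shows "modular_form2 \<Gamma>2 \<Gamma>1 k2 k1 (\<lambda>A B. ch B A) (f \<circ> prod.swap)"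
  unfolding modular_form2_def
proof (intro conjI ballI allI impI)
  show "character_on \<Gamma>2 \<Gamma>1 (\<lambda>A B. ch B A)"
    using m unfolding modular_form2_def character_on_def by blast
  show "meromorphic_HH_star k2 k1 (f \<circ> prod.swap)"
    using m meromorphic_HH_star_swap unfolding modular_form2_def by blast
  fix A B t1 t2 assume *: "A \<in> \<Gamma>2" "B \<in> \<Gamma>1" "(t1, t2) \<in> hol_points (f \<circ> prod.swap)" "(act A t1, act B t2) \<in> hol_points (f \<circ> prod.swap)"
  have "f (act B t2, act A t1) = ch B A * autfac B t2 powi k1 * autfac A t1 powi k2 * f (t2, t1)"
    using m * unfolding modular_form2_def hol_points_swap by blast
  then show "(f \<circ> prod.swap) (act A t1, act B t2) = ch B A * autfac A t1 powi k2 * autfac B t2 powi k1 * (f \<circ> prod.swap) (t1, t2)"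
    by (simp add: mult_ac)
qed

lemma modular_function2_swap: "modular_function2 \<Gamma>1 \<Gamma>2 f \<Longrightarrow> modular_function2 \<Gamma>2 \<Gamma>1 (f \<circ> prod.swap)"
  unfolding modular_function2_def by (drule modular_form2_swap)

lemma Dq_swap: "Dq1 (f \<circ> prod.swap) = Dq2 f \<circ> prod.swap" "Dq2 (f \<circ> prod.swap) = Dq1 f \<circ> prod.swap"
  by (auto simp: fun_eq_iff Dq1_def Dq2_def)

lemma G_swap: "G1 (f \<circ> prod.swap) = G2 f \<circ> prod.swap" "G2 (f \<circ> prod.swap) = G1 f \<circ> prod.swap"
  by (auto simp: fun_eq_iff G1_def G2_def Dq_swap)

lemma coeff_value_log_derivs_swap:
  assumes "i < 8"
  shows "coeff_value i (log_derivs (F \<circ> prod.swap) (x \<circ> prod.swap) (y \<circ> prod.swap) t) = coeff_value i (log_derivs F x y (prod.swap t))"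
  unfolding coeff_value_def log_derivs_simps G_swap Dq_swap o_apply by (rule coeff_formula_swap[OF assms])

lemma coeff_N_swap: "coeff_N (x \<circ> prod.swap) (y \<circ> prod.swap) t = - coeff_N x y (prod.swap t)"
  by (simp add: coeff_N_def G_swap)

lemma regular_domain_swap:
  "(a, b) \<in> regular_domain (F \<circ> prod.swap) (x \<circ> prod.swap) (y \<circ> prod.swap) \<longleftrightarrow> (b, a) \<in> regular_domain F x y"
  by (simp add: regular_domain_def hol_points_swap coeff_N_swap)

section \<open>Relations on generic slices\<close>

text \<open>Nonvanishing on generic slices needs meromorphy in the other variable too. It is read
  off from the function with exchanged variables, where an empty \<open>R\<close> suffices because
  no cusp is involved.\<close>

lemma generic_good:
  assumes m: "meromorphic_HH_star k1 k2 f" and R: "finite R" "R \<subseteq> SL2Z" and t0: "t0 \<in> hol_points f" "f t0 \<noteq> 0"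
  obtains E where "countable E" "\<forall>s\<in>uhp. s \<notin> E \<longrightarrow> good_slice R k1 k2 f s"
proof -
  obtain E1 where E1: "countable E1" "\<forall>s\<in>uhp. s \<notin> E1 \<longrightarrow> (\<forall>p\<in>uhp. local_quotient (\<lambda>v. v) s p f)"
    "\<forall>s\<in>uhp. s \<notin> E1 \<longrightarrow> (\<forall>B\<in>R. \<exists>h>0. \<exists>r. local_quotient (qpar h) s 0 (\<lambda>(t1, t2). qexp (- r * t2) * slash k1 k2 (mat 1) B f (t1, t2)))"
    by (rule modular_generic_local_quotient[OF m R])
  obtain E2 where E2: "countable E2" "\<forall>s\<in>uhp. s \<notin> E2 \<longrightarrow> (\<forall>p\<in>uhp. local_quotient (\<lambda>v. v) s p (f \<circ> prod.swap))"
    by (rule modular_generic_local_quotient[OF meromorphic_HH_star_swap[OF m] finite.emptyI empty_subsetI])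
  have sw: "(\<lambda>u. f (u, v)) meromorphic_on uhp" if v: "v \<in> uhp" "v \<notin> E2" for v
  proof -
    have "(\<lambda>u. (f \<circ> prod.swap) (v, u)) meromorphic_on uhp"
      by (rule local_quotient_slice_meromorphic[OF _ v(1)]) (use E2(2) v in blast)
    then show ?thesis by simp
  qed
  define W where "W = {t \<in> hol_points f. f t \<noteq> 0}"
  have "t0 \<in> W" using t0 by (simp add: W_def)
  then have W0: "W \<noteq> {}" by blast
  have W: "open W" "W \<subseteq> HH" "\<And>t. t \<in> W \<Longrightarrow> f t \<noteq> 0"
    using holomorphic2_nonzero_open[OF holomorphic2_on_hol_points open_hol_points, of f] hol_points_subset[of f]
    by (auto simp: W_def)
  obtain E3 where E3: "countable E3" "\<forall>s\<in>uhp. s \<notin> E3 \<longrightarrow> \<not> (\<forall>\<^sub>\<approx>v\<in>uhp. f (s, v) = 0)"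
    by (rule generic_nonzero[OF E2(1) sw W(1) W0 W(2,3)])
  show ?thesis
  proof (rule that)
    show "countable (E1 \<union> E3)" using E1(1) E3(1) by simp
    show "\<forall>s\<in>uhp. s \<notin> E1 \<union> E3 \<longrightarrow> good_slice R k1 k2 f s"
      unfolding good_slice_def using E1(2,3) E3(2) by blast
  qed
qed

lemma coeff_N_slice_meromorphic:
  assumes "good_slice R 0 0 x s" "good_slice R 0 0 y s"
  shows "(\<lambda>v. coeff_N x y (s, v)) meromorphic_on uhp"
  unfolding coeff_N_def by (intro meromorphic_intros good_slice_G_meromorphic[OF assms(1)] good_slice_G_meromorphic[OF assms(2)])

definition regular_slice where
  "regular_slice R F x y s \<longleftrightarrow> good_slice R 1 1 F s \<and> good_slice R 0 0 x s \<and> good_slice R 0 0 y s \<and>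
     (\<forall>\<^sub>\<approx>v\<in>uhp. (s, v) \<in> regular_domain F x y)"

text \<open>One regular point is enough: \<open>coeff_N\<close> is nonzero near it and meromorphic
  along generic slices in both directions, hence nonzero off a sparse set on all but countably many
  slices.\<close>

lemma generic_regular:
  assumes m: "meromorphic_HH_star 1 1 F" "meromorphic_HH_star 0 0 x" "meromorphic_HH_star 0 0 y"
    and R: "finite R" "R \<subseteq> SL2Z" and t0: "t0 \<in> regular_domain F x y"
  obtains E where "countable E" "\<forall>s\<in>uhp. s \<notin> E \<longrightarrow> regular_slice R F x y s"
proof -
  have hp: "t0 \<in> hol_points F" "t0 \<in> hol_points x" "t0 \<in> hol_points y" using t0 regular_domain_subset by blast+
  note nz = regular_domainD[OF t0]
  have swp: "prod.swap t0 \<in> hol_points (f \<circ> prod.swap)" if "t0 \<in> hol_points f" for f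
    using that hol_points_swap[of "snd t0" "fst t0" f] by (simp add: prod.swap_def)
  obtain E1 where E1: "countable E1" "\<forall>s\<in>uhp. s \<notin> E1 \<longrightarrow> good_slice R 1 1 F s"
    by (rule generic_good[OF m(1) R hp(1) nz(1)])
  obtain E2 where E2: "countable E2" "\<forall>s\<in>uhp. s \<notin> E2 \<longrightarrow> good_slice R 0 0 x s"
    by (rule generic_good[OF m(2) R hp(2) nz(2)])
  obtain E3 where E3: "countable E3" "\<forall>s\<in>uhp. s \<notin> E3 \<longrightarrow> good_slice R 0 0 y s"
    by (rule generic_good[OF m(3) R hp(3) nz(3)])
  obtain E4 where E4: "countable E4" "\<forall>s\<in>uhp. s \<notin> E4 \<longrightarrow> good_slice {} 0 0 (x \<circ> prod.swap) s"
    by (rule generic_good[OF meromorphic_HH_star_swap[OF m(2)] finite.emptyI empty_subsetI swp[OF hp(2)]]) (simp add: nz)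
  obtain E5 where E5: "countable E5" "\<forall>s\<in>uhp. s \<notin> E5 \<longrightarrow> good_slice {} 0 0 (y \<circ> prod.swap) s"
    by (rule generic_good[OF meromorphic_HH_star_swap[OF m(3)] finite.emptyI empty_subsetI swp[OF hp(3)]]) (simp add: nz)
  have cN: "(\<lambda>u. coeff_N x y (u, v)) meromorphic_on uhp" if v: "v \<in> uhp" "v \<notin> E4 \<union> E5" for v
  proof -
    have "(\<lambda>u. coeff_N (x \<circ> prod.swap) (y \<circ> prod.swap) (v, u)) meromorphic_on uhp"
      by (rule coeff_N_slice_meromorphic[of "{}"]) (use E4(2) E5(2) v in blast)+
    then have "(\<lambda>u. - (- coeff_N x y (u, v))) meromorphic_on uhp"
      unfolding coeff_N_swap swap_simp by (rule meromorphic_on_uminus)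
    then show ?thesis by simp
  qed
  have cE: "countable (E4 \<union> E5)" using E4(1) E5(1) by simp
  obtain E6 where E6: "countable E6" "\<forall>s\<in>uhp. s \<notin> E6 \<longrightarrow> \<not> (\<forall>\<^sub>\<approx>v\<in>uhp. coeff_N x y (s, v) = 0)"
    by (rule generic_nonzero[OF cE cN open_regular_domain[of F x y] _ regular_domain_subset(4) regular_domainD(4)])
      (use t0 in blast)+
  show ?thesis
  proof (rule that)
    show "countable (E1 \<union> E2 \<union> E3 \<union> E6)" using E1(1) E2(1) E3(1) E6(1) by simp
    show "\<forall>s\<in>uhp. s \<notin> E1 \<union> E2 \<union> E3 \<union> E6 \<longrightarrow> regular_slice R F x y s"
    proof (intro ballI impI)
      fix s assume s: "s \<in> uhp" "s \<notin> E1 \<union> E2 \<union> E3 \<union> E6"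
      have g: "good_slice R 1 1 F s" "good_slice R 0 0 x s" "good_slice R 0 0 y s"
        using s E1(2) E2(2) E3(2) by auto
      have "\<not> (\<forall>\<^sub>\<approx>v\<in>uhp. coeff_N x y (s, v) = 0)" using s E6(2) by auto
      then have "\<forall>\<^sub>\<approx>v\<in>uhp. coeff_N x y (s, v) \<noteq> 0"
        using meromorphic_imp_constant_or_avoid[OF coeff_N_slice_meromorphic[OF g(2,3)] open_uhp connected_uhp, of 0] by blast
      then have "\<forall>\<^sub>\<approx>v\<in>uhp. (s, v) \<in> regular_domain F x y"
        using good_slice_nonzero(1,3)[OF g(1)] good_slice_nonzero(1,3)[OF g(2)] good_slice_nonzero(1,3)[OF g(3)]
        by eventually_elim (simp add: regular_domain_def)
      then show "regular_slice R F x y s" using g by (simp add: regular_slice_def)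
    qed
  qed
qed

lemma holomorphic2_coeff_value:
  assumes i: "i < 8"
  shows "holomorphic2_on (\<lambda>t. coeff_value i (log_derivs F x y t)) (regular_domain F x y)"
proof -
  let ?S = "regular_domain F x y"
  note S = open_regular_domain[of F x y]
  have nz: "F t \<noteq> 0" "x t \<noteq> 0" "y t \<noteq> 0" "coeff_N x y t \<noteq> 0" if "t \<in> ?S" for t by (rule regular_domainD[OF that])+
  have N: "(G1 x t)^2 * (G2 y t)^2 - (G1 y t)^2 * (G2 x t)^2 \<noteq> 0" if "t \<in> ?S" for t
    using nz(4)[OF that] by (simp add: coeff_N_def)
  have D: "G1 x t * G2 y t + G1 y t * G2 x t \<noteq> 0" if "t \<in> ?S" for t
  proof
    assume "G1 x t * G2 y t + G1 y t * G2 x t = 0"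
    then have "(G1 x t * G2 y t + G1 y t * G2 x t) * (G1 x t * G2 y t - G1 y t * G2 x t) = 0" by simp
    with N[OF that] show False by (simp add: algebra_simps power2_eq_square)
  qed
  have G: "holomorphic2_on (G1 F) ?S" "holomorphic2_on (G2 F) ?S" "holomorphic2_on (G1 x) ?S" "holomorphic2_on (G2 x) ?S"
    "holomorphic2_on (G1 y) ?S" "holomorphic2_on (G2 y) ?S"
    by (intro holomorphic2_on_G regular_domain_holomorphic S nz; assumption)+
  note DG = G[THEN holomorphic2_on_Dq(1)[OF _ S]] G[THEN holomorphic2_on_Dq(2)[OF _ S]]
  show ?thesis
    using i unfolding less_8_cases coeff_value_def log_derivs_simps
    apply (elim disjE; simp only: coeff_formula_simps)
    apply (((intro holomorphic2_on_divide(1) holomorphic2_on_add(1) holomorphic2_on_diff holomorphic2_on_mult(1)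
          holomorphic2_on_uminus holomorphic2_on_power holomorphic2_on_const G DG S)[1], (rule D | rule N)[1], assumption)+)
    done
qed

lemma slice_analytic:
  assumes "holomorphic2_on f S" "open S" "(s, z) \<in> S"
  shows "(\<lambda>v. f (s, v)) analytic_on {z}"
  using holomorphic_slice2[OF assms(1,2), of s] open_slice2[OF assms(2), of s] assms(3)
  by (auto simp: analytic_at)

lemma slash_snd_invariant:
  assumes m: "modular_form2 \<Gamma>1 \<Gamma>2 k1 k2 ch f" and one: "mat 1 \<in> \<Gamma>1" and g: "g \<in> \<Gamma>2" "det g = 1"
    and uv: "(u, v) \<in> hol_points f" "(u, act g v) \<in> hol_points f"
  shows "slash_snd k2 g f (u, v) = ch (mat 1) g * f (u, v)"
proof -
  have "v \<in> uhp" using uv(1) hol_points_subset[of f] by (auto simp: HH_eq)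
  then have nz: "autfac g v \<noteq> 0" using autfac_nonzero[OF g(2)] by (simp add: uhp_def)
  have mm: "f (act A t1, act B t2) = ch A B * autfac A t1 powi k1 * autfac B t2 powi k2 * f (t1, t2)"
    if "A \<in> \<Gamma>1" "B \<in> \<Gamma>2" "(t1, t2) \<in> hol_points f" "(act A t1, act B t2) \<in> hol_points f" for A B t1 t2
    using m that unfolding modular_form2_def by blast
  have "f (act (mat 1) u, act g v) = ch (mat 1) g * autfac (mat 1) u powi k1 * autfac g v powi k2 * f (u, v)"
    by (rule mm[OF one g(1) uv(1)]) (use uv(2) in simp)
  then have "f (u, act g v) = ch (mat 1) g * autfac g v powi k2 * f (u, v)" by simp
  moreover have "autfac g v powi (- k2) * autfac g v powi k2 = 1" using nz by (simp add: power_int_minus)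
  ultimately show ?thesis unfolding slash_snd_def by (simp add: mult_ac)
qed

text \<open>Slashing by \<open>g\<close> multiplies each form by a constant, which logarithmic
  derivatives ignore; by covariance the coefficients of the slashed forms at \<open>v\<close> are
  those of the original forms at \<open>act g v\<close>.\<close>

lemma coeff_value_invariant:
  assumes F: "modular_form2 \<Gamma>1 \<Gamma>2 1 1 ch F" and x: "modular_function2 \<Gamma>1 \<Gamma>2 x" and y: "modular_function2 \<Gamma>1 \<Gamma>2 y"
    and one: "mat 1 \<in> \<Gamma>1" and g: "g \<in> \<Gamma>2" "det g = 1" and i: "i < 8"
    and uv: "(u, v) \<in> regular_domain F x y" "(u, act g v) \<in> regular_domain F x y"
  shows "coeff_value i (log_derivs F x y (u, act g v)) = coeff_value i (log_derivs F x y (u, v))"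
proof -
  let ?S = "regular_domain F x y"
  define W where "W = ?S \<inter> {t \<in> HH. (fst t, act g (snd t)) \<in> ?S}"
  have W: "open W" unfolding W_def by (intro open_Int open_act_preimage open_regular_domain g(2))
  have uvH: "(u, v) \<in> HH" using uv(1) regular_domain_subset(4) by blast
  have uvW: "(u, v) \<in> W" using uv uvH by (simp add: W_def)
  have WS: "W \<subseteq> ?S" by (simp add: W_def)
  have hp: "z \<in> hol_points f \<and> (fst z, act g (snd z)) \<in> hol_points f" if "z \<in> W" "?S \<subseteq> hol_points f" for z f
    using that by (auto simp: W_def)
  have inv: "slash_snd k2 g f z = ch' (mat 1) g * f z"
    if "modular_form2 \<Gamma>1 \<Gamma>2 k1 k2 ch' f" "z \<in> W" "?S \<subseteq> hol_points f" for k1 k2 ch' f z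
    using slash_snd_invariant[OF that(1) one g, of "fst z" "snd z"] hp[OF that(2,3)] by simp
  have c: "G1 (slash_snd k2 g f) (u, v) = G1 f (u, v) \<and> G2 (slash_snd k2 g f) (u, v) = G2 f (u, v) \<and>
      Dq1 (G1 (slash_snd k2 g f)) (u, v) = Dq1 (G1 f) (u, v) \<and> Dq2 (G2 (slash_snd k2 g f)) (u, v) = Dq2 (G2 f) (u, v)"
    if mf: "modular_form2 \<Gamma>1 \<Gamma>2 k1 k2 ch' f" "?S \<subseteq> hol_points f" for k1 k2 ch' f
  proof -
    have nz: "ch' (mat 1) g \<noteq> 0" using mf(1) one g(1) unfolding modular_form2_def character_on_def by blast
    have hol: "holomorphic2_on f W"
      by (rule holomorphic2_on_subset[OF holomorphic2_on_hol_points order_trans[OF WS mf(2)]])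
    show ?thesis using G_const_mult[OF W uvW hol nz inv[OF mf(1) _ mf(2)]] by blast
  qed
  note cF = c[OF F regular_domain_subset(1)]
  note cx = c[OF x[unfolded modular_function2_def] regular_domain_subset(2)]
  note cy = c[OF y[unfolded modular_function2_def] regular_domain_subset(3)]
  have "coeff_value i (log_derivs F x y (u, act g v)) = coeff_value i (log_derivs (slash_snd 1 g F) (slash_snd 0 g x) (slash_snd 0 g y) (u, v))"
    by (rule coeff_value_slash[OF g(2) uvH uv(2) i, symmetric])
  also have "\<dots> = coeff_value i (log_derivs F x y (u, v))"
    unfolding coeff_value_def log_derivs_simps using cF cx cy by simp
  finally show ?thesis .
qed

text \<open>Logarithmic derivatives composed with \<open>r\<close> need not be periodic, but those
  of the slashed forms are. The coefficient is a rational expression in the latter, and covariance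
  identifies its value with the one at \<open>act r v\<close>.\<close>

lemma coeff_value_expansion:
  assumes F: "modular_form2 \<Gamma>1 \<Gamma>2 1 1 ch F" and x: "modular_function2 \<Gamma>1 \<Gamma>2 x" and y: "modular_function2 \<Gamma>1 \<Gamma>2 y"
    and one: "mat 1 \<in> \<Gamma>1" and cd: "coset_data (\<Gamma>2 \<inter> SL2Z) R h0"
    and rs: "regular_slice R F x y s" and r: "r \<in> R" and i: "i < 8"
  shows "\<exists>\<Psi>. \<Psi> nicely_meromorphic_on ball 0 1 \<and> (\<forall>\<^sub>\<approx>v\<in>uhp. coeff_value i (log_derivs F x y (s, act r v)) = \<Psi> (qpar h0 v))"
proof -
  note cdD = coset_dataD[OF cd]
  have rd: "det r = 1" by (rule cdD(4)[OF r])
  have gs: "good_slice R 1 1 F s" "good_slice R 0 0 x s" "good_slice R 0 0 y s"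
    and ev: "\<forall>\<^sub>\<approx>v\<in>uhp. (s, v) \<in> regular_domain F x y" using rs by (auto simp: regular_slice_def)
  have s: "s \<in> uhp" using gs(1) by (simp add: good_slice_def)
  note xF = good_slice_G_expansions[OF F one cd gs(1) r]
  note xx = good_slice_G_expansions[OF x[unfolded modular_function2_def] one cd gs(2) r]
  note xy = good_slice_G_expansions[OF y[unfolded modular_function2_def] one cd gs(3) r]
  have lt12: "n = 0 \<or> n = 1 \<or> n = 2 \<or> n = 3 \<or> n = 4 \<or> n = 5 \<or> n = 6 \<or> n = 7 \<or> n = 8 \<or> n = 9 \<or> n = 10 \<or> n = 11"
    if "n < 12" for n :: nat using that by presburger
  let ?w = "\<lambda>v. log_derivs (slash_snd 1 r F) (slash_snd 0 r x) (slash_snd 0 r y) (s, v)"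
  define X where "X = (\<lambda>H. \<exists>\<Psi>. \<Psi> nicely_meromorphic_on ball 0 1 \<and> (\<forall>\<^sub>\<approx>v\<in>uhp. H (s, v) = \<Psi> (qpar h0 v)))"
  have XF: "X (G1 (slash_snd 1 r F))" "X (G2 (slash_snd 1 r F))" "X (Dq1 (G1 (slash_snd 1 r F)))" "X (Dq2 (G2 (slash_snd 1 r F)))"
    unfolding X_def by (rule xF; simp)+
  have Xx: "X (G1 (slash_snd 0 r x))" "X (G2 (slash_snd 0 r x))" "X (Dq1 (G1 (slash_snd 0 r x)))" "X (Dq2 (G2 (slash_snd 0 r x)))"
    unfolding X_def by (rule xx; simp)+
  have Xy: "X (G1 (slash_snd 0 r y))" "X (G2 (slash_snd 0 r y))" "X (Dq1 (G1 (slash_snd 0 r y)))" "X (Dq2 (G2 (slash_snd 0 r y)))"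
    unfolding X_def by (rule xy; simp)+
  have "\<exists>\<Psi>. \<Psi> nicely_meromorphic_on ball 0 1 \<and> (\<forall>\<^sub>\<approx>v\<in>uhp. ?w v n = \<Psi> (qpar h0 v))" if "n < 12" for n
    using lt12[OF that] by (elim disjE; hypsubst; unfold log_derivs_simps; intro XF[unfolded X_def] Xx[unfolded X_def] Xy[unfolded X_def])
  then have ex: "\<forall>n\<in>{..<12}. \<exists>\<Psi>. \<Psi> nicely_meromorphic_on ball 0 1 \<and> (\<forall>\<^sub>\<approx>v\<in>uhp. ?w v n = \<Psi> (qpar h0 v))" by simp
  obtain \<Psi> where "\<forall>n\<in>{..<12}. \<Psi> n nicely_meromorphic_on ball 0 1 \<and> (\<forall>\<^sub>\<approx>v\<in>uhp. ?w v n = \<Psi> n (qpar h0 v))"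
    using bchoice[OF ex] by (rule exE)
  then have \<Psi>: "\<And>n. n < 12 \<Longrightarrow> \<Psi> n nicely_meromorphic_on ball 0 1"
      "\<And>n. n < 12 \<Longrightarrow> \<forall>\<^sub>\<approx>v\<in>uhp. ?w v n = \<Psi> n (qpar h0 v)" by simp_all
  define \<Psi>0 where "\<Psi>0 = (\<lambda>q. coeff_value i (\<lambda>n. \<Psi> n q))"
  have m0: "\<Psi>0 meromorphic_on ball 0 1" unfolding \<Psi>0_def
    by (rule coeff_value_meromorphic[OF _ i]) (use \<Psi>(1) in \<open>simp add: nicely_meromorphic_on_def\<close>)
  have "\<forall>\<^sub>\<approx>q\<in>ball 0 1. remove_sings \<Psi>0 q = \<Psi>0 q" by (rule eventually_remove_sings_eq[OF m0])
  then have e0: "\<forall>\<^sub>\<approx>v\<in>uhp. remove_sings \<Psi>0 (qpar h0 v) = \<Psi>0 (qpar h0 v)" by (rule cosparse_qpar[OF cdD(1)])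
  have "\<forall>\<^sub>\<approx>v\<in>uhp. \<forall>n\<in>{..<12}. ?w v n = \<Psi> n (qpar h0 v)"
    by (intro eventually_ball_finite) (use \<Psi>(2) in auto)
  then have "\<forall>\<^sub>\<approx>v\<in>uhp. coeff_value i (log_derivs F x y (s, act r v)) = remove_sings \<Psi>0 (qpar h0 v)"
    using e0 cosparse_act[OF rd ev] cosparse_uhp_in
  proof eventually_elim
    case (elim v)
    have "(s, v) \<in> HH" using elim s by (simp add: HH_eq)
    then have "coeff_value i (log_derivs F x y (s, act r v)) = coeff_value i (?w v)" by (rule coeff_value_slash[OF rd _ elim(3) i, symmetric])
    also have "\<dots> = \<Psi>0 (qpar h0 v)" unfolding \<Psi>0_def by (rule coeff_value_cong) (use elim(1) in simp)
    finally show ?case using elim(2) by simp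
  qed
  moreover have "remove_sings \<Psi>0 nicely_meromorphic_on ball 0 1" by (rule remove_sings_nicely_meromorphic[OF m0])
  ultimately show ?thesis by blast
qed

text \<open>One box for all slices, so that grids can be formed. Real parts in an interval of length
  1 make \<open>qpar h\<close> injective for every \<open>h \<ge> 1\<close>, and
  \<open>Im z > 1\<close> places the parameter inside the disc reached by reduction.\<close>

definition cusp_box :: "complex set" where "cusp_box = {z. 0 < Re z \<and> Re z < 1 \<and> 1 < Im z}"

text \<open>On a regular slice the coefficient, like \<open>x\<close> and \<open>y\<close>, is an
  invariant function of one variable with expansions at all cusps, so the zero count applies to the
  three together.\<close>

lemma slice_dependence:
  assumes F: "modular_form2 \<Gamma>1 \<Gamma>2 1 1 ch F" and x: "modular_function2 \<Gamma>1 \<Gamma>2 x" and y: "modular_function2 \<Gamma>1 \<Gamma>2 y"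
    and one: "mat 1 \<in> \<Gamma>1" and cd: "coset_data (\<Gamma>2 \<inter> SL2Z) R h0"
    and rs: "regular_slice R F x y s" and i: "i < 8"
  shows "\<exists>\<delta>::nat. \<forall>n c Z. finite Z \<longrightarrow> Z \<subseteq> cusp_box \<longrightarrow>
     (\<forall>z\<in>Z. (s, z) \<in> regular_domain F x y \<and> eval3 n c (x (s, z)) (y (s, z)) (coeff_value i (log_derivs F x y (s, z))) = 0) \<longrightarrow>
     n * \<delta> < card Z \<longrightarrow> (\<forall>\<^sub>\<approx>v\<in>uhp. eval3 n c (x (s, v)) (y (s, v)) (coeff_value i (log_derivs F x y (s, v))) = 0)"
proof -
  note cdD = coset_dataD[OF cd]
  let ?S = "regular_domain F x y"
  have gs: "good_slice R 1 1 F s" "good_slice R 0 0 x s" "good_slice R 0 0 y s"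
    and ev: "\<forall>\<^sub>\<approx>v\<in>uhp. (s, v) \<in> ?S" using rs by (auto simp: regular_slice_def)
  define f where "f = (\<lambda>(j::nat) v. if j = 0 then x (s, v) else if j = 1 then y (s, v) else coeff_value i (log_derivs F x y (s, v)))"
  have f: "f 0 = (\<lambda>v. x (s, v))" "f 1 = (\<lambda>v. y (s, v))" "f 2 = (\<lambda>v. coeff_value i (log_derivs F x y (s, v)))"
    "f (Suc 0) = (\<lambda>v. y (s, v))" by (simp_all add: f_def)
  have lt3: "j = 0 \<or> j = 1 \<or> j = 2" if "j < 3" for j :: nat using that by auto
  have mero: "f j meromorphic_on uhp" if "j < 3" for j
  proof -
    have "(\<lambda>v. coeff_value i (\<lambda>n. log_derivs F x y (s, v) n)) meromorphic_on uhp"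
    proof (rule coeff_value_meromorphic[OF _ i])
      fix n :: nat assume "n < 12"
      then have "n = 0 \<or> n = 1 \<or> n = 2 \<or> n = 3 \<or> n = 4 \<or> n = 5 \<or> n = 6 \<or> n = 7 \<or> n = 8 \<or> n = 9 \<or> n = 10 \<or> n = 11" by presburger
      then show "(\<lambda>v. log_derivs F x y (s, v) n) meromorphic_on uhp"
        by (elim disjE; hypsubst; unfold log_derivs_simps; intro good_slice_G_meromorphic[OF gs(1)]
          good_slice_G_meromorphic[OF gs(2)] good_slice_G_meromorphic[OF gs(3)])
    qed
    then show ?thesis
      using lt3[OF that] good_slice_nonzero(2)[OF gs(2)] good_slice_nonzero(2)[OF gs(3)] by (auto simp: f)
  qed
  have inv: "\<forall>\<^sub>\<approx>v\<in>uhp. f j (act g v) = f j v" if j: "j < 3" and g: "g \<in> \<Gamma>2 \<inter> SL2Z" for j g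
  proof -
    have g': "g \<in> \<Gamma>2" "det g = 1" using g SL2Z_det by auto
    show ?thesis using ev cosparse_act[OF g'(2) ev]
    proof eventually_elim
      case (elim v)
      have hp: "(s, v) \<in> hol_points x" "(s, act g v) \<in> hol_points x" "(s, v) \<in> hol_points y" "(s, act g v) \<in> hol_points y"
        using elim regular_domain_subset by blast+
      have "x (s, act g v) = x (s, v)" "y (s, act g v) = y (s, v)"
        using slash_snd_invariant[OF x[unfolded modular_function2_def] one g' hp(1,2)]
          slash_snd_invariant[OF y[unfolded modular_function2_def] one g' hp(3,4)] by (simp_all add: slash_snd_def)
      then show ?case using lt3[OF j] coeff_value_invariant[OF F x y one g' i elim] by (auto simp: f)
    qed
  qed
  have qe: "\<exists>\<Psi>. \<Psi> nicely_meromorphic_on ball 0 1 \<and> (\<forall>\<^sub>\<approx>v\<in>uhp. f j (act r v) = \<Psi> (qpar h0 v))"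
    if j: "j < 3" and r: "r \<in> R" for j r
    using lt3[OF j]
  proof (elim disjE)
    show ?thesis if "j = 0" unfolding that f by (rule good_slice_function_expansion[OF x one cd gs(2) r])
    show ?thesis if "j = 1" unfolding that f by (rule good_slice_function_expansion[OF y one cd gs(3) r])
    show ?thesis if "j = 2" unfolding that f by (rule coeff_value_expansion[OF F x y one cd rs r i])
  qed
  have an: "f j analytic_on {z}" if "j < 3" "(s, z) \<in> ?S" for j z
    using lt3[OF that(1)] slice_analytic[OF regular_domain_holomorphic(2) open_regular_domain that(2)]
      slice_analytic[OF regular_domain_holomorphic(3) open_regular_domain that(2)]
      slice_analytic[OF holomorphic2_coeff_value[OF i] open_regular_domain that(2)]
    by (auto simp: f)
  obtain \<delta> :: nat where \<delta>: "\<forall>n c Z. finite Z \<longrightarrow> Z \<subseteq> {z. 0 < Re z \<and> Re z < 1 \<and> 1 < Im z} \<longrightarrow>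
     (\<forall>z\<in>Z. (\<forall>i<3. f i analytic_on {z}) \<and> eval3 n c (f 0 z) (f 1 z) (f 2 z) = 0) \<longrightarrow>
     n * \<delta> < card Z \<longrightarrow> (\<forall>\<^sub>\<approx>t\<in>uhp. eval3 n c (f 0 t) (f 1 t) (f 2 t) = 0)"
    using slice_zero_bound[OF cd mero inv qe] by (rule exE)
  show ?thesis
  proof (intro exI[of _ \<delta>] allI impI)
    fix n c Z
    assume Z: "finite Z" "Z \<subseteq> cusp_box"
      "\<forall>z\<in>Z. (s, z) \<in> ?S \<and> eval3 n c (x (s, z)) (y (s, z)) (coeff_value i (log_derivs F x y (s, z))) = 0" "n * \<delta> < card Z"
    have 0: "\<forall>z\<in>Z. (\<forall>i<3. f i analytic_on {z}) \<and> eval3 n c (f 0 z) (f 1 z) (f 2 z) = 0"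
      using Z(3) an by (simp add: f)
    have "\<forall>\<^sub>\<approx>t\<in>uhp. eval3 n c (f 0 t) (f 1 t) (f 2 t) = 0"
      by (rule \<delta>[THEN spec, THEN spec, THEN spec, THEN mp, OF Z(1), THEN mp, OF Z(2)[unfolded cusp_box_def], THEN mp, OF 0, THEN mp, OF Z(4)])
    then show "\<forall>\<^sub>\<approx>v\<in>uhp. eval3 n c (x (s, v)) (y (s, v)) (coeff_value i (log_derivs F x y (s, v))) = 0" by (simp add: f)
  qed
qed

section \<open>Algebraic dependence\<close>

text \<open>Gaussian elimination: the new equation is solved for a pivot unknown \<open>u0\<close>,
  and substitution costs one equation and one unknown.\<close>

lemma homogeneous_system:
  fixes A :: "'e \<Rightarrow> 'u \<Rightarrow> 'a::field"
  assumes "finite E" "finite U" "card E < card U"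
  shows "\<exists>c. (\<exists>u\<in>U. c u \<noteq> 0) \<and> (\<forall>e\<in>E. (\<Sum>u\<in>U. c u * A e u) = 0)"
  using assms
proof (induction E arbitrary: U A rule: finite_induct)
  case empty
  then have "U \<noteq> {}" by auto
  then show ?case by (intro exI[of _ "\<lambda>_. 1"]) auto
next
  case (insert e E)
  show ?case
  proof (cases "\<forall>u\<in>U. A e u = 0")
    case True
    have "card E < card U" using insert by simp
    from insert.IH[OF insert.prems(1) this, of A] obtain c where
      c: "\<exists>u\<in>U. c u \<noteq> 0" "\<forall>e\<in>E. (\<Sum>u\<in>U. c u * A e u) = 0" by blast
    have "(\<Sum>u\<in>U. c u * A e u) = 0" using True by simp
    with c show ?thesis by (intro exI[of _ c]) simp
  next
    case False
    then obtain u0 where u0: "u0 \<in> U" "A e u0 \<noteq> 0" by blast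
    define A' where "A' = (\<lambda>e' u. A e' u - A e u / A e u0 * A e' u0)"
    let ?U = "U - {u0}"
    have fU: "finite ?U" and "card E < card ?U" using insert u0 by simp_all
    from insert.IH[OF this, of A'] obtain c' where
      c': "\<exists>u\<in>?U. c' u \<noteq> 0" "\<And>e'. e' \<in> E \<Longrightarrow> (\<Sum>u\<in>?U. c' u * A' e' u) = 0" by blast
    define c where "c = c'(u0 := - (\<Sum>u\<in>?U. c' u * A e u) / A e u0)"
    have s: "(\<Sum>u\<in>U. c u * A e' u) = c u0 * A e' u0 + (\<Sum>u\<in>?U. c' u * A e' u)" for e'
    proof -
      have "(\<Sum>u\<in>?U. c u * A e' u) = (\<Sum>u\<in>?U. c' u * A e' u)" by (rule sum.cong) (auto simp: c_def)
      then show ?thesis using sum.remove[OF insert.prems(1) u0(1), of "\<lambda>u. c u * A e' u"] by simp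
    qed
    have "(\<Sum>u\<in>U. c u * A e u) = 0" unfolding s using u0(2) by (simp add: c_def)
    moreover have "(\<Sum>u\<in>U. c u * A e' u) = 0" if "e' \<in> E" for e'
    proof -
      have "c' u * A' e' u = c' u * A e' u - c' u * A e u * (A e' u0 / A e u0)" for u
        by (simp add: A'_def algebra_simps)
      then have "(\<Sum>u\<in>?U. c' u * A' e' u) = (\<Sum>u\<in>?U. c' u * A e' u) - (\<Sum>u\<in>?U. c' u * A e u) * (A e' u0 / A e u0)"
        by (simp only: sum_subtractf sum_distrib_right)
      then have "(\<Sum>u\<in>?U. c' u * A e' u) = (\<Sum>u\<in>?U. c' u * A e u) * (A e' u0 / A e u0)"
        using c'(2)[OF that] by simp
      then show ?thesis unfolding s by (simp add: c_def)
    qed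
    moreover have "\<exists>u\<in>U. c u \<noteq> 0" using c'(1) by (auto simp: c_def)
    ultimately show ?thesis by (intro exI[of _ c]) simp
  qed
qed

text \<open>An uncountable set is not a countable union of countable sets, so a single natural
  number serves uncountably many \<open>p\<close>.\<close>

lemma uncountable_uniform_bound:
  assumes "uncountable P" "\<And>p. p \<in> P \<Longrightarrow> \<exists>\<delta>::nat. Q p \<delta>"
  obtains \<delta> where "uncountable {p \<in> P. Q p \<delta>}"
proof -
  have "\<exists>\<delta>. uncountable {p \<in> P. Q p \<delta>}"
  proof (rule ccontr)
    assume "\<nexists>\<delta>. uncountable {p \<in> P. Q p \<delta>}"
    then have "countable (\<Union>\<delta>. {p \<in> P. Q p \<delta>})" by (intro countable_UN) auto
    moreover have "P \<subseteq> (\<Union>\<delta>. {p \<in> P. Q p \<delta>})" using assms(2) by blast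
    ultimately show False using assms(1) countable_subset by blast
  qed
  then show ?thesis using that by blast
qed

lemma uncountable_finite_subset:
  assumes "uncountable (A - B)"
  obtains Z where "Z \<subseteq> A - B" "finite Z" "card Z = k"
proof -
  have "infinite (A - B)" using assms countable_finite by blast
  then show ?thesis using infinite_arbitrarily_large[of "A - B" k] that by blast
qed

lemma uncountable_cusp_box: "uncountable cusp_box" and cusp_box_subset_uhp: "cusp_box \<subseteq> uhp"
proof -
  have "ball (Complex (1/2) 2) (1/4) \<subseteq> cusp_box"
  proof
    fix z assume "z \<in> ball (Complex (1/2) 2) (1/4)"
    then have "cmod (Complex (1/2) 2 - z) < 1/4" by (simp add: dist_norm)
    moreover note abs_Re_le_cmod[of "Complex (1/2) 2 - z"] abs_Im_le_cmod[of "Complex (1/2) 2 - z"]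
    ultimately have "\<bar>1/2 - Re z\<bar> < 1/4" "\<bar>2 - Im z\<bar> < 1/4" by simp_all
    then show "z \<in> cusp_box" unfolding cusp_box_def mem_Collect_eq abs_less_iff by linarith
  qed
  moreover have "uncountable (ball (Complex (1/2) 2) (1/4))" by (rule uncountable_ball) simp
  ultimately show "uncountable cusp_box" using countable_subset by blast
  show "cusp_box \<subseteq> uhp" by (auto simp: cusp_box_def uhp_def)
qed

text \<open>\<open>\<Phi>\<close> is abstract so that the same notion covers the relation with
  exchanged variables.\<close>

definition slice_bound where
  "slice_bound S \<Phi> \<delta> s \<longleftrightarrow> (\<forall>n c Z. finite Z \<longrightarrow> Z \<subseteq> cusp_box \<longrightarrow>
     (\<forall>z\<in>Z. (s, z) \<in> S \<and> \<Phi> n c (s, z) = (0::complex)) \<longrightarrow> n * \<delta> < card Z \<longrightarrow> (\<forall>\<^sub>\<approx>v\<in>uhp. \<Phi> n c (s, v) = 0))"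

lemma slice_boundD:
  fixes n \<delta> :: nat
  assumes "slice_bound S \<Phi> \<delta> s" "finite Z" "Z \<subseteq> cusp_box" "\<And>z. z \<in> Z \<Longrightarrow> (s, z) \<in> S" "\<And>z. z \<in> Z \<Longrightarrow> \<Phi> n c (s, z) = 0" "card Z = Suc (n * \<delta>)"
  shows "\<forall>\<^sub>\<approx>v\<in>uhp. \<Phi> n c (s, v) = 0"
  using assms unfolding slice_bound_def by simp

lemma countable_exceptions:
  assumes "finite D" "\<And>p. p \<in> D \<Longrightarrow> \<forall>\<^sub>\<approx>v\<in>uhp. P p v"
  shows "countable {v \<in> uhp. \<exists>p\<in>D. \<not> P p v}"
proof -
  have "\<forall>\<^sub>\<approx>v\<in>uhp. \<forall>p\<in>D. P p v" using assms by (intro eventually_ball_finite) auto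
  from cosparse_countable[OF this open_uhp] show ?thesis by (simp only: Bex_def Ball_def not_all not_imp)
qed

text \<open>
  Vanishing of a relation on a grid of \<open>(n * \<delta>1 + 1) * (n * \<delta>2 + 1)\<close> points imposes fewer conditions than
  its \<open>(n + 1) ^ 3\<close> coefficients for large \<open>n\<close>, and it propagates from the grid to slices and then to \<open>S\<close>.
\<close>

lemma grid_dependence:
  fixes S :: "(complex \<times> complex) set" and x y a :: "complex \<times> complex \<Rightarrow> complex"
  defines "\<Phi> \<equiv> \<lambda>n c t. eval3 n c (x t) (y t) (a t)"
  assumes S: "open S" "S \<subseteq> HH" and cont: "continuous_on S x" "continuous_on S y" "continuous_on S a"
    and E1: "countable E1" "\<And>s. s \<in> uhp \<Longrightarrow> s \<notin> E1 \<Longrightarrow> \<exists>\<delta>. slice_bound S \<Phi> \<delta> s"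
      "\<And>s. s \<in> uhp \<Longrightarrow> s \<notin> E1 \<Longrightarrow> \<forall>\<^sub>\<approx>v\<in>uhp. (s, v) \<in> S"
    and E2: "countable E2" "\<And>v. v \<in> uhp \<Longrightarrow> v \<notin> E2 \<Longrightarrow> \<exists>\<delta>. slice_bound (prod.swap ` S) (\<lambda>n c. \<Phi> n c \<circ> prod.swap) \<delta> v"
      "\<And>v. v \<in> uhp \<Longrightarrow> v \<notin> E2 \<Longrightarrow> \<forall>\<^sub>\<approx>s\<in>uhp. (s, v) \<in> S"
  shows "\<exists>n c. (\<exists>i\<le>n. \<exists>j\<le>n. \<exists>k\<le>n. c i j k \<noteq> 0) \<and> (\<forall>t\<in>S. \<Phi> n c t = 0)"
proof -
  have "uncountable (cusp_box - E1)" by (rule uncountable_minus_countable[OF uncountable_cusp_box E1(1)])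
  then obtain \<delta>1 where "uncountable {s \<in> cusp_box - E1. slice_bound S \<Phi> \<delta>1 s}"
    by (rule uncountable_uniform_bound[where Q = "\<lambda>s \<delta>. slice_bound S \<Phi> \<delta> s"]) (use E1(2) cusp_box_subset_uhp in blast)
  then obtain P where P: "uncountable P" "P \<subseteq> cusp_box - E1" "\<And>s. s \<in> P \<Longrightarrow> slice_bound S \<Phi> \<delta>1 s" by blast
  have "uncountable (cusp_box - E2)" by (rule uncountable_minus_countable[OF uncountable_cusp_box E2(1)])
  then obtain \<delta>2 where "uncountable {v \<in> cusp_box - E2. slice_bound (prod.swap ` S) (\<lambda>n c. \<Phi> n c \<circ> prod.swap) \<delta>2 v}"
    by (rule uncountable_uniform_bound[where Q = "\<lambda>v \<delta>. slice_bound (prod.swap ` S) (\<lambda>n c. \<Phi> n c \<circ> prod.swap) \<delta> v"]) (use E2(2) cusp_box_subset_uhp in blast)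
  then obtain Q where Q: "uncountable Q" "Q \<subseteq> cusp_box - E2" "\<And>v. v \<in> Q \<Longrightarrow> slice_bound (prod.swap ` S) (\<lambda>n c. \<Phi> n c \<circ> prod.swap) \<delta>2 v"
    by blast
  have Pu: "p \<in> uhp" "p \<notin> E1" "p \<in> cusp_box" if "p \<in> P" for p using that P(2) cusp_box_subset_uhp by auto
  have Qu: "q \<in> uhp" "q \<notin> E2" "q \<in> cusp_box" if "q \<in> Q" for q using that Q(2) cusp_box_subset_uhp by auto
  \<comment> \<open>Chosen so that \<open>(n * \<delta>2 + 1) * (n * \<delta>1 + 1) \<le> (n + 1)^2
    * (\<delta>1 + 1) * (\<delta>2 + 1) = (n + 1)^2 * n\<close>, which is below the number
    \<open>(n + 1)^3\<close> of unknowns.\<close>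
  define n where "n = Suc \<delta>1 * Suc \<delta>2"
  obtain A where A: "A \<subseteq> Q - {}" "finite A" "card A = Suc (n * \<delta>1)"
    by (rule uncountable_finite_subset[of Q "{}"]) (use Q(1) in simp)
  have AQ: "z \<in> Q" if "z \<in> A" for z using that A(1) by auto
  define C1 where "C1 = {s \<in> uhp. \<exists>v\<in>A. \<not> (s, v) \<in> S}"
  have C1: "countable C1" unfolding C1_def by (rule countable_exceptions[OF A(2) E2(3)]) (use AQ Qu in blast)+
  \<comment> \<open>The second coordinates \<open>A\<close> are fixed first; the first coordinates
    \<open>D\<close> then avoid the countable set \<open>C1\<close>, so that the whole grid lies in
    \<open>S\<close>.\<close>
  obtain D where D: "D \<subseteq> P - C1" "finite D" "card D = Suc (n * \<delta>2)"
    by (rule uncountable_finite_subset[OF uncountable_minus_countable[OF P(1) C1]])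
  have DP: "p \<in> P" if "p \<in> D" for p using that D(1) by auto
  have DS: "(p, z) \<in> S" if "p \<in> D" "z \<in> A" for p z
    using that D(1) Pu(1)[OF DP[OF that(1)]] by (auto simp: C1_def)
  let ?U = "{..n} \<times> {..n} \<times> {..n}"
  have "card (D \<times> A) < card ?U"
  proof -
    have "card (D \<times> A) = Suc (n * \<delta>2) * Suc (n * \<delta>1)" by (simp add: card_cartesian_product A(3) D(3))
    also have "\<dots> \<le> (Suc n * Suc \<delta>2) * (Suc n * Suc \<delta>1)" by (intro mult_le_mono) simp_all
    also have "\<dots> = Suc n * Suc n * n" unfolding n_def by (simp only: mult_ac)
    also have "\<dots> < Suc n * Suc n * Suc n" by simp
    also have "\<dots> = card ?U" by (simp add: card_cartesian_product)
    finally show ?thesis .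
  qed
  with D(2) A(2) have "\<exists>c'. (\<exists>u\<in>?U. c' u \<noteq> 0) \<and>
      (\<forall>t\<in>D \<times> A. (\<Sum>u\<in>?U. c' u * (x t ^ fst u * y t ^ fst (snd u) * a t ^ snd (snd u))) = 0)"
    by (intro homogeneous_system) simp_all
  then obtain c' where c': "\<exists>u\<in>?U. c' u \<noteq> 0"
    "\<And>t. t \<in> D \<times> A \<Longrightarrow> (\<Sum>u\<in>?U. c' u * (x t ^ fst u * y t ^ fst (snd u) * a t ^ snd (snd u))) = 0" by blast
  define c where "c = (\<lambda>i j k. c' (i, j, k))"
  have \<Phi>c: "\<Phi> n c t = (\<Sum>u\<in>?U. c' u * (x t ^ fst u * y t ^ fst (snd u) * a t ^ snd (snd u)))" for t
    unfolding \<Phi>_def eval3_def c_def sum.cartesian_product by (intro sum.cong refl) (auto simp: mult.assoc)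
  have c0: "\<exists>i\<le>n. \<exists>j\<le>n. \<exists>k\<le>n. c i j k \<noteq> 0" using c'(1) by (auto simp: c_def)
  \<comment> \<open>The slice at \<open>p\<close> carries \<open>n * \<delta>1 + 1\<close> grid
    points, one more than the number of zeros its bound tolerates.\<close>
  have row: "\<forall>\<^sub>\<approx>v\<in>uhp. \<Phi> n c (p, v) = 0" if p: "p \<in> D" for p
    by (rule slice_boundD[OF P(3)[OF DP[OF p]] A(2) _ DS[OF p] _ A(3)]) (use AQ Qu(3) c'(2) p in \<open>auto simp: \<Phi>c\<close>)
  define C2 where "C2 = {v \<in> uhp. \<exists>p\<in>D. \<not> ((p, v) \<in> S \<and> \<Phi> n c (p, v) = 0)}"
  have C2: "countable C2" unfolding C2_def
    by (rule countable_exceptions[OF D(2)]) (intro eventually_conj row E1(3); use DP Pu in blast)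
  \<comment> \<open>Off the countable set \<open>C2\<close> the relation vanishes at
    \<open>(p, v)\<close> for all \<open>p\<close> in \<open>D\<close>, that is at
    \<open>n * \<delta>2 + 1\<close> points of the slice in the other direction.\<close>
  have column: "\<forall>\<^sub>\<approx>s\<in>uhp. \<Phi> n c (s, v) = 0" if v: "v \<in> Q" "v \<notin> C2" for v
  proof -
    have *: "(p, v) \<in> S" "\<Phi> n c (p, v) = 0" if "p \<in> D" for p using v Qu(1)[OF v(1)] that by (auto simp: C2_def)
    have "\<forall>\<^sub>\<approx>s\<in>uhp. (\<lambda>n c. \<Phi> n c \<circ> prod.swap) n c (v, s) = 0"
    proof (rule slice_boundD[OF Q(3)[OF v(1)] D(2) _ _ _ D(3)])
      show "D \<subseteq> cusp_box" using DP Pu(3) by blast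
      show "(v, p) \<in> prod.swap ` S" if "p \<in> D" for p using imageI[OF *(1)[OF that], of prod.swap] by simp
      show "(\<Phi> n c \<circ> prod.swap) (v, p) = 0" if "p \<in> D" for p using *(2)[OF that] by simp
    qed
    then show ?thesis by simp
  qed
  have "uncountable (Q - C2)" by (rule uncountable_minus_countable[OF Q(1) C2])
  then have "infinite (Q - C2)" using countable_finite by blast
  then obtain V where V: "V \<subseteq> Q - C2" "countable V" "infinite V" using infinite_countable_subset' by blast
  have VQ: "v \<in> Q" "v \<notin> C2" if "v \<in> V" for v using that V(1) by auto
  define C3 where "C3 = E1 \<union> (\<Union>v\<in>V. {s \<in> uhp. \<not> ((s, v) \<in> S \<and> \<Phi> n c (s, v) = 0)})"
  have C3: "countable C3" unfolding C3_def
  proof (intro countable_Un E1(1) countable_UN V(2))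
    fix v assume v: "v \<in> V"
    have "\<forall>\<^sub>\<approx>s\<in>uhp. (s, v) \<in> S \<and> \<Phi> n c (s, v) = 0"
      by (intro eventually_conj column E2(3) Qu VQ v)
    from cosparse_countable[OF this open_uhp] show "countable {s \<in> uhp. \<not> ((s, v) \<in> S \<and> \<Phi> n c (s, v) = 0)}" .
  qed
  have generic: "\<forall>\<^sub>\<approx>v\<in>uhp. \<Phi> n c (s, v) = 0" if s: "s \<in> uhp" "s \<notin> C3" for s
  proof -
    have sE: "s \<notin> E1" using s by (simp add: C3_def)
    obtain \<delta> where \<delta>: "slice_bound S \<Phi> \<delta> s" using E1(2)[OF s(1) sE] by blast
    obtain Z where Z: "Z \<subseteq> V" "finite Z" "card Z = Suc (n * \<delta>)"
      using infinite_arbitrarily_large[OF V(3)] by blast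
    have *: "(s, z) \<in> S \<and> \<Phi> n c (s, z) = 0" if "z \<in> Z" for z using s Z(1) that by (auto simp: C3_def)
    show ?thesis
      by (rule slice_boundD[OF \<delta> Z(2) _ _ _ Z(3)]) (use * Z(1) VQ(1) Qu(3) in blast)+
  qed
  have cont\<Phi>: "continuous_on S (\<Phi> n c)" unfolding \<Phi>_def eval3_def by (intro continuous_intros cont)
  \<comment> \<open>By continuity a nonzero value would spread to a bidisc, which contains part of a
    generic slice; there the relation vanishes off a countable set.\<close>
  have "\<Phi> n c t = 0" if t: "t \<in> S" for t
  proof (rule ccontr)
    assume nz: "\<Phi> n c t \<noteq> 0"
    define W where "W = S \<inter> \<Phi> n c -` (- {0})"
    have W: "open W" unfolding W_def by (intro continuous_open_preimage cont\<Phi> S(1)) auto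
    have "(fst t, snd t) \<in> W" using t nz by (simp add: W_def)
    then obtain r where r: "r > 0" "cball (fst t) r \<times> cball (snd t) r \<subseteq> W" by (rule open_prod_ball[OF W])
    have rW: "(u, v) \<in> S \<and> \<Phi> n c (u, v) \<noteq> 0" if "u \<in> ball (fst t) r" "v \<in> ball (snd t) r" for u v
    proof -
      have "(u, v) \<in> cball (fst t) r \<times> cball (snd t) r" using that by simp
      then have "(u, v) \<in> W" using r(2) by blast
      then show ?thesis by (simp add: W_def)
    qed
    have uh: "u \<in> uhp \<and> v \<in> uhp" if "(u, v) \<in> S" for u v using that S(2) by (auto simp: HH_eq)
    have "uncountable (ball (fst t) r - C3)" using r(1) C3 by (intro uncountable_minus_countable uncountable_ball)
    then obtain s where s: "s \<in> ball (fst t) r" "s \<notin> C3" by (metis Diff_iff countable_empty equals0I)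
    have "(s, snd t) \<in> S" using rW[OF s(1)] r(1) by simp
    then have "\<forall>\<^sub>\<approx>v\<in>uhp. \<Phi> n c (s, v) = 0" using uh s(2) by (intro generic) blast+
    from cosparse_countable[OF this open_uhp] have "countable {v \<in> uhp. \<Phi> n c (s, v) \<noteq> 0}" .
    moreover have "ball (snd t) r \<subseteq> {v \<in> uhp. \<Phi> n c (s, v) \<noteq> 0}" using rW[OF s(1)] uh by blast
    ultimately have "countable (ball (snd t) r)" by (rule countable_subset[rotated])
    then show False using uncountable_ball r(1) by blast
  qed
  then show ?thesis using c0 by blast
qed

section \<open>Relations as nested polynomials, nonzero on a dense set\<close>

definition poly3 :: "nat \<Rightarrow> (nat \<Rightarrow> nat \<Rightarrow> nat \<Rightarrow> complex) \<Rightarrow> complex poly poly poly" where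
  "poly3 n c = (\<Sum>k\<le>n. monom (\<Sum>j\<le>n. monom (\<Sum>i\<le>n. monom (c i j k) i) j) k)"

lemma coeff_sum_monom: "coeff (\<Sum>k\<le>n. monom (g k) k) m = (if m \<le> n then g m else 0)" for n :: nat
  unfolding coeff_sum coeff_monom by (simp only: sum.delta[OF finite_atMost] atMost_iff)

lemma specialise_poly3:
  "specialise u v (poly3 n c) = (\<Sum>k\<le>n. monom (\<Sum>j\<le>n. \<Sum>i\<le>n. c i j k * u ^ i * v ^ j) k)"
proof (rule poly_eqI)
  fix m
  have "poly (poly (\<Sum>j\<le>n. monom (\<Sum>i\<le>n. monom (c i j m) i) j) [:v:]) u = (\<Sum>j\<le>n. \<Sum>i\<le>n. c i j m * u ^ i * v ^ j)"
    by (simp add: poly_sum poly_monom poly_power sum_distrib_right)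
  then show "coeff (specialise u v (poly3 n c)) m = coeff (\<Sum>k\<le>n. monom (\<Sum>j\<le>n. \<Sum>i\<le>n. c i j k * u ^ i * v ^ j) k) m"
    unfolding specialise_def poly3_def by (simp add: coeff_map_poly coeff_sum_monom)
qed

lemma poly_specialise_poly3: "poly (specialise u v (poly3 n c)) w = eval3 n c u v w"
proof -
  have "poly (specialise u v (poly3 n c)) w = (\<Sum>k\<le>n. \<Sum>j\<le>n. \<Sum>i\<le>n. c i j k * u ^ i * v ^ j * w ^ k)"
    by (simp add: specialise_poly3 poly_sum poly_monom sum_distrib_right)
  also have "\<dots> = (\<Sum>k\<le>n. \<Sum>i\<le>n. \<Sum>j\<le>n. c i j k * u ^ i * v ^ j * w ^ k)"
    by (rule sum.cong[OF refl]) (rule sum.swap)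
  also have "\<dots> = (\<Sum>i\<le>n. \<Sum>k\<le>n. \<Sum>j\<le>n. c i j k * u ^ i * v ^ j * w ^ k)" by (rule sum.swap)
  also have "\<dots> = eval3 n c u v w" unfolding eval3_def by (rule sum.cong[OF refl]) (rule sum.swap)
  finally show ?thesis .
qed

text \<open>The root bound is applied twice to the coefficient of \<open>T ^ k0\<close>. For fixed
  \<open>v\<close> it is a polynomial in \<open>u\<close> with infinitely many zeros, so its
  coefficient at \<open>i0\<close> vanishes for every \<open>v\<close> in a ball; this in turn is a
  polynomial in \<open>v\<close> with infinitely many zeros.\<close>

lemma specialise_poly3_nonzero:
  assumes c: "i0 \<le> n" "j0 \<le> n" "k0 \<le> n" "c i0 j0 k0 \<noteq> 0" and V: "open V" "V \<noteq> {}"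
  shows "\<exists>(u, v)\<in>V. specialise u v (poly3 n c) \<noteq> 0"
proof (rule ccontr)
  assume H: "\<not> ?thesis"
  obtain u0 v0 where uv: "(u0, v0) \<in> V" using V(2) by auto
  obtain r where r: "r > 0" "cball u0 r \<times> cball v0 r \<subseteq> V" by (rule open_prod_ball[OF V(1) uv])
  have inf: "infinite (ball z r)" for z :: complex using uncountable_ball[of r z] r(1) countable_finite by blast
  have z: "(\<Sum>j\<le>n. \<Sum>i\<le>n. c i j k0 * u ^ i * v ^ j) = 0" if "u \<in> ball u0 r" "v \<in> ball v0 r" for u v
  proof -
    have "(u, v) \<in> cball u0 r \<times> cball v0 r" using that by simp
    then have "(u, v) \<in> V" using r(2) by blast
    then have "specialise u v (poly3 n c) = 0" using H by blast
    then have "coeff (specialise u v (poly3 n c)) k0 = 0" by simp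
    then show ?thesis unfolding specialise_poly3 coeff_sum_monom using c(3) by simp
  qed
  have 1: "(\<Sum>j\<le>n. c i0 j k0 * v ^ j) = 0" if v: "v \<in> ball v0 r" for v
  proof (rule ccontr)
    assume nz: "(\<Sum>j\<le>n. c i0 j k0 * v ^ j) \<noteq> 0"
    have "(\<Sum>i\<le>n. (\<Sum>j\<le>n. c i j k0 * v ^ j) * u ^ i) = 0" if u: "u \<in> ball u0 r" for u
    proof -
      have "(\<Sum>i\<le>n. (\<Sum>j\<le>n. c i j k0 * v ^ j) * u ^ i) = (\<Sum>i\<le>n. \<Sum>j\<le>n. c i j k0 * u ^ i * v ^ j)"
        by (simp add: sum_distrib_left sum_distrib_right mult_ac)
      also have "\<dots> = 0" using z[OF u v] by (subst sum.swap)
      finally show ?thesis .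
    qed
    then have "ball u0 r \<subseteq> {u. (\<Sum>i\<le>n. (\<Sum>j\<le>n. c i j k0 * v ^ j) * u ^ i) = 0}" by blast
    moreover have "finite {u. (\<Sum>i\<le>n. (\<Sum>j\<le>n. c i j k0 * v ^ j) * u ^ i) = 0}"
      unfolding polyfun_finite_roots using c(1) nz by blast
    ultimately show False using inf finite_subset by blast
  qed
  then have "ball v0 r \<subseteq> {v. (\<Sum>j\<le>n. c i0 j k0 * v ^ j) = 0}" by blast
  moreover have "finite {v. (\<Sum>j\<le>n. c i0 j k0 * v ^ j) = 0}"
    unfolding polyfun_finite_roots using c(2,4) by blast
  ultimately show False using inf finite_subset by blast
qed

text \<open>The Jacobian makes \<open>(x, y)\<close> locally open, and a polynomial with a nonzero
  coefficient cannot vanish on an open set of values. This is algebraic independence of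
  \<open>x\<close> and \<open>y\<close> on every part of the domain.\<close>

lemma regular_domain_dense_image:
  assumes c: "i0 \<le> n" "j0 \<le> n" "k0 \<le> n" "c i0 j0 k0 \<noteq> 0"
  shows "regular_domain F x y \<subseteq> closure {t \<in> regular_domain F x y. specialise (x t) (y t) (poly3 n c) \<noteq> 0}" (is "?S \<subseteq> closure ?A")
proof
  fix t assume t: "t \<in> ?S"
  show "t \<in> closure ?A"
  proof (rule ccontr)
    assume nt: "t \<notin> closure ?A"
    define W where "W = ?S - closure ?A"
    have W: "open W" "t \<in> W" "W \<subseteq> ?S" using t nt open_regular_domain by (auto simp: W_def)
    have J: "pd1 x t' * pd2 y t' - pd2 x t' * pd1 y t' \<noteq> 0" if "t' \<in> W" for t'
      using regular_domain_Jacobian that W(3) by blast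
    obtain U V g where U: "open U" "t \<in> U" "U \<subseteq> W" and V: "open V" and h: "homeomorphism U V (\<lambda>t. (x t, y t)) g"
      by (rule holomorphic2_local_inverse[OF holomorphic2_on_subset[OF regular_domain_holomorphic(2) W(3)]
          holomorphic2_on_subset[OF regular_domain_holomorphic(3) W(3)] W(1,2) J])
    have im: "(\<lambda>t. (x t, y t)) ` U = V" using h by (rule homeomorphism_image1)
    then have "V \<noteq> {}" using U(2) by blast
    then obtain u v where uv: "(u, v) \<in> V" "specialise u v (poly3 n c) \<noteq> 0"
      using specialise_poly3_nonzero[of i0 n j0 k0 c, OF c V] by blast
    then obtain t' where t': "t' \<in> U" "u = x t'" "v = y t'" using im by blast
    have "t' \<in> W" using t'(1) U(3) by blast
    then have "t' \<in> ?A" and nc: "t' \<notin> closure ?A" using uv(2) t' by (auto simp: W_def)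
    from subsetD[OF closure_subset this(1)] nc show False by contradiction
  qed
qed

text \<open>Slices with the first variable fixed use cosets of \<open>\<Gamma>2\<close>; those with
  the second variable fixed use cosets of \<open>\<Gamma>1\<close>, after exchanging the variables.
  Both families feed the grid argument.\<close>

lemma coefficient_algebraic:
  assumes \<Gamma>1: "subgroup \<Gamma>1 SL2R" "commensurable SL2R \<Gamma>1 SL2Z" and \<Gamma>2: "subgroup \<Gamma>2 SL2R" "commensurable SL2R \<Gamma>2 SL2Z"
    and F: "modular_form2 \<Gamma>1 \<Gamma>2 1 1 ch F" and x: "modular_function2 \<Gamma>1 \<Gamma>2 x" and y: "modular_function2 \<Gamma>1 \<Gamma>2 y"
    and i: "i < 8"
  shows "algebraic_function_of (regular_domain F x y) x y (\<lambda>t. coeff_value i (log_derivs F x y t))"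
proof (cases "regular_domain F x y = {}")
  case True
  then show ?thesis unfolding algebraic_function_of_def by simp
next
  case False
  let ?S = "regular_domain F x y"
  define \<Phi> where "\<Phi> = (\<lambda>n c t. eval3 n c (x t) (y t) (coeff_value i (log_derivs F x y t)))"
  obtain a b where ab: "(a, b) \<in> ?S" using False by auto
  have one: "mat 1 \<in> \<Gamma>1" "mat 1 \<in> \<Gamma>2"
    using mat_group_subgroup[OF \<Gamma>1(1)] mat_group_subgroup[OF \<Gamma>2(1)] by (simp_all add: mat_group_def)
  have m: "meromorphic_HH_star 1 1 F" "meromorphic_HH_star 0 0 x" "meromorphic_HH_star 0 0 y"
    using F x y by (auto simp: modular_function2_def modular_form2_def)
  let ?F = "F \<circ> prod.swap" and ?x = "x \<circ> prod.swap" and ?y = "y \<circ> prod.swap"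
  obtain R1 h1 where cd1: "coset_data (\<Gamma>1 \<inter> SL2Z) R1 h1" by (rule exists_coset_data[OF \<Gamma>1])
  obtain R2 h2 where cd2: "coset_data (\<Gamma>2 \<inter> SL2Z) R2 h2" by (rule exists_coset_data[OF \<Gamma>2])
  obtain E1 where E1: "countable E1" "\<forall>s\<in>uhp. s \<notin> E1 \<longrightarrow> regular_slice R2 F x y s"
    by (rule generic_regular[OF m coset_dataD(2,3)[OF cd2] ab])
  have ba: "(b, a) \<in> regular_domain ?F ?x ?y" using ab by (simp only: regular_domain_swap)
  obtain E2 where E2: "countable E2" "\<forall>s\<in>uhp. s \<notin> E2 \<longrightarrow> regular_slice R1 ?F ?x ?y s"
    by (rule generic_regular[OF m[THEN meromorphic_HH_star_swap] coset_dataD(2,3)[OF cd1] ba])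
  have b1: "\<exists>\<delta>. slice_bound ?S \<Phi> \<delta> s" if "s \<in> uhp" "s \<notin> E1" for s
    unfolding slice_bound_def \<Phi>_def
    by (rule slice_dependence[OF F x y one(1) cd2 _ i]) (use E1(2) that in blast)
  have b2: "\<exists>\<delta>. slice_bound (prod.swap ` ?S) (\<lambda>n c. \<Phi> n c \<circ> prod.swap) \<delta> v" if v: "v \<in> uhp" "v \<notin> E2" for v
  proof -
    have rs: "regular_slice R1 ?F ?x ?y v" using E2(2) v by blast
    have e: "(v, z) \<in> regular_domain ?F ?x ?y \<longleftrightarrow> (v, z) \<in> prod.swap ` ?S" for z
      unfolding regular_domain_swap using image_iff[of "(v, z)" prod.swap ?S] by auto
    have e2: "eval3 n c (?x (v, z)) (?y (v, z)) (coeff_value i (log_derivs ?F ?x ?y (v, z))) = (\<Phi> n c \<circ> prod.swap) (v, z)" for n c z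
      unfolding coeff_value_log_derivs_swap[OF i] \<Phi>_def by simp
    show ?thesis
      using slice_dependence[OF modular_form2_swap[OF F] modular_function2_swap[OF x] modular_function2_swap[OF y] one(2) cd1 rs i]
      unfolding e e2 slice_bound_def .
  qed
  have s1: "\<forall>\<^sub>\<approx>v\<in>uhp. (s, v) \<in> ?S" if "s \<in> uhp" "s \<notin> E1" for s
    using E1(2) that by (auto simp: regular_slice_def)
  have s2: "\<forall>\<^sub>\<approx>s\<in>uhp. (s, v) \<in> ?S" if "v \<in> uhp" "v \<notin> E2" for v
    using E2(2) that unfolding regular_slice_def regular_domain_swap by blast
  have cont: "continuous_on ?S x" "continuous_on ?S y" "continuous_on ?S (\<lambda>t. coeff_value i (log_derivs F x y t))"
    by (intro holomorphic2_on_imp_continuous_on regular_domain_holomorphic holomorphic2_coeff_value i)+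
  have "\<exists>n c. (\<exists>i\<le>n. \<exists>j\<le>n. \<exists>k\<le>n. c i j k \<noteq> 0) \<and> (\<forall>t\<in>?S. eval3 n c (x t) (y t) (coeff_value i (log_derivs F x y t)) = 0)"
    by (rule grid_dependence[OF open_regular_domain regular_domain_subset(4) cont E1(1) b1[unfolded \<Phi>_def] s1 E2(1) b2[unfolded \<Phi>_def] s2])
  then obtain n c i0 j0 k0 where c: "i0 \<le> n" "j0 \<le> n" "k0 \<le> n" "c i0 j0 k0 \<noteq> 0"
    and z: "\<forall>t\<in>?S. eval3 n c (x t) (y t) (coeff_value i (log_derivs F x y t)) = 0" by blast
  show ?thesis
    unfolding algebraic_function_of_def
  proof (intro exI[of _ "poly3 n c"] conjI)
    show "\<forall>t\<in>?S. poly (specialise (x t) (y t) (poly3 n c)) (coeff_value i (log_derivs F x y t)) = 0"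
      unfolding poly_specialise_poly3 by (rule z)
    show "?S \<subseteq> closure {t \<in> ?S. specialise (x t) (y t) (poly3 n c) \<noteq> 0}"
      by (rule regular_domain_dense_image[of i0 n j0 k0 c, OF c])
  qed
qed

theorem theorem2p1:
  fixes \<Gamma>1 \<Gamma>2 :: "(real^2^2) set"
    and ch :: "real^2^2 \<Rightarrow> real^2^2 \<Rightarrow> complex"
    and F x y :: "complex \<times> complex \<Rightarrow> complex"
  assumes "subgroup \<Gamma>1 SL2R" and "commensurable SL2R \<Gamma>1 SL2Z"
    and "subgroup \<Gamma>2 SL2R" and "commensurable SL2R \<Gamma>2 SL2Z"
    and "modular_form2 \<Gamma>1 \<Gamma>2 1 1 ch F"
    and "modular_function2 \<Gamma>1 \<Gamma>2 x" and "nonconstant x"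
    and "modular_function2 \<Gamma>1 \<Gamma>2 y" and "nonconstant y"
  shows "(\<forall>a \<in> {coeff_a0 x y, coeff_b0 x y, coeff_a1 F x y, coeff_b1 F x y,
                 coeff_a2 F x y, coeff_b2 F x y, coeff_a3 F x y, coeff_b3 F x y}.
            algebraic_function_of (regular_domain F x y) x y a) \<and>
         (\<forall>t0 \<in> regular_domain F x y. \<exists>U \<Phi>.
            open U \<and> t0 \<in> U \<and> U \<subseteq> regular_domain F x y \<and>
            inj_on (\<lambda>t. (x t, y t)) U \<and> open ((\<lambda>t. (x t, y t)) ` U) \<and>
            holomorphic2_on \<Phi> ((\<lambda>t. (x t, y t)) ` U) \<and>
            (\<forall>t\<in>U. F t = \<Phi> (x t, y t)) \<and>
            (\<forall>t\<in>U.
               Dx (Dx \<Phi>) (x t, y t) + coeff_a0 x y t * Dx (Dy \<Phi>) (x t, y t)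
                 + coeff_a1 F x y t * Dx \<Phi> (x t, y t) + coeff_a2 F x y t * Dy \<Phi> (x t, y t)
                 + coeff_a3 F x y t * \<Phi> (x t, y t) = 0 \<and>
               Dy (Dy \<Phi>) (x t, y t) + coeff_b0 x y t * Dx (Dy \<Phi>) (x t, y t)
                 + coeff_b1 F x y t * Dx \<Phi> (x t, y t) + coeff_b2 F x y t * Dy \<Phi> (x t, y t)
                 + coeff_b3 F x y t * \<Phi> (x t, y t) = 0))"
proof (intro conjI ballI)
  fix a assume "a \<in> {coeff_a0 x y, coeff_b0 x y, coeff_a1 F x y, coeff_b1 F x y,
                 coeff_a2 F x y, coeff_b2 F x y, coeff_a3 F x y, coeff_b3 F x y}"
  then obtain i where i: "i < 8" "a = (\<lambda>t. coeff_value i (log_derivs F x y t))"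
    unfolding insert_iff empty_iff coefficients_eq_coeff_value[where F = F and x = x and y = y]
    by (elim disjE FalseE) (rule that[rotated], assumption, simp)+
  show "algebraic_function_of (regular_domain F x y) x y a"
    unfolding i(2) by (rule coefficient_algebraic[OF assms(1-6,8) i(1)])
next
  fix t0 assume "t0 \<in> regular_domain F x y"
  then show "\<exists>U \<Phi>.
            open U \<and> t0 \<in> U \<and> U \<subseteq> regular_domain F x y \<and>
            inj_on (\<lambda>t. (x t, y t)) U \<and> open ((\<lambda>t. (x t, y t)) ` U) \<and>
            holomorphic2_on \<Phi> ((\<lambda>t. (x t, y t)) ` U) \<and>
            (\<forall>t\<in>U. F t = \<Phi> (x t, y t)) \<and>
            (\<forall>t\<in>U.
               Dx (Dx \<Phi>) (x t, y t) + coeff_a0 x y t * Dx (Dy \<Phi>) (x t, y t)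
                 + coeff_a1 F x y t * Dx \<Phi> (x t, y t) + coeff_a2 F x y t * Dy \<Phi> (x t, y t)
                 + coeff_a3 F x y t * \<Phi> (x t, y t) = 0 \<and>
               Dy (Dy \<Phi>) (x t, y t) + coeff_b0 x y t * Dx (Dy \<Phi>) (x t, y t)
                 + coeff_b1 F x y t * Dx \<Phi> (x t, y t) + coeff_b2 F x y t * Dy \<Phi> (x t, y t)
                 + coeff_b3 F x y t * \<Phi> (x t, y t) = 0)"
    by (rule local_differential_system)
qed

end
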